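(* Let $\varphi$ be a left-invariant strong $\mathrm{G}_2T$-structure on a $7$-dimensional unimodular Lie group $G$. Then $g_\varphi$ has non-negative scalar curvature. Moreover, $g_\varphi$ is flat whenever $G$ is solvable or $\mathrm{Scal}(g_\varphi)=0$. When this happens, the $\mathrm{G}_2$-structure $\varphi$ is parallel.
   Context: Write $e^{ij\cdots}=e^i\wedge e^j\wedge\cdots$. A $\mathrm{G}_2$-structure on a $7$-manifold $M$ is a definite $3$-form $\varphi$: at each point there is a coframe $(e^1,\dots,e^7)$ with $\varphi=e^{123}+e^1\wedge(e^{45}+e^{67})+e^2\wedge(e^{46}-e^{57})-e^3\wedge(e^{47}+e^{56})$. It induces the metric $g_\varphi$ for which this coframe is orthonormal, the orientation $e^{1234567}$, and a Hodge operator $\star$. It is a $\mathrm{G}_2T$-structure if $d\star\varphi=\theta\wedge\star\varphi$ for some $1$-form $\theta$ (the Lee form; necessarily $\theta=-\frac13\star(\star d\varphi\wedge\varphi)$). Its torsion $3$-form is $T=\frac16\star(d\varphi\wedge\varphi)\,\varphi-\star d\varphi+\star(\theta\wedge\varphi)$. A $\mathrm{G}_2T$-structure is strong if $dT=0$, and it is parallel if $d\varphi=0$ and $d\star\varphi=0$. *)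

theory Defs
  imports
    "HOL-Analysis.Analysis"
    "HOL-Algebra.Solvable_Groups"
    "HOL-Combinatorics.Permutations"
begin

section \<open>Smooth manifolds and Lie groups\<close>

text \<open>\<open>Ck k f S\<close> is meant for open \<open>S\<close> in a Euclidean space, where \<open>differentiable_on\<close> is
  differentiability at each point of \<open>S\<close>.\<close>

primrec Ck :: "nat \<Rightarrow> ('a::euclidean_space \<Rightarrow> 'b::real_normed_vector) \<Rightarrow> 'a set \<Rightarrow> bool" where
  "Ck 0 f S \<longleftrightarrow> continuous_on S f"
| "Ck (Suc k) f S \<longleftrightarrow>
     f differentiable_on S \<and> (\<forall>v. Ck k (\<lambda>x. frechet_derivative f (at x) v) S)"

definition smooth_on :: "'a set \<Rightarrow> ('a::euclidean_space \<Rightarrow> 'b::real_normed_vector) \<Rightarrow> bool" where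
  "smooth_on S f \<longleftrightarrow> (\<forall>k. Ck k f S)"

text \<open>The underlying point set of a manifold is a whole type; an atlas is a set of charts \<open>(U, c)\<close>
  with domain \<open>U\<close>. It need not be maximal.\<close>

type_synonym ('g, 'n) atlas = "('g set \<times> ('g \<Rightarrow> real ^ 'n)) set"

definition smooth_atlas ::
  "('g::{t2_space,second_countable_topology}, 'n::finite) atlas \<Rightarrow> bool" where
  "smooth_atlas A \<longleftrightarrow>
     (\<forall>(U, c)\<in>A. open U \<and> open (c ` U) \<and> homeomorphism U (c ` U) c (inv_into U c)) \<and>
     (\<Union>(U, c)\<in>A. U) = UNIV \<and>
     (\<forall>(U, c)\<in>A. \<forall>(V, d)\<in>A. smooth_on (c ` (U \<inter> V)) (d \<circ> inv_into U c))"

definition lie_group ::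
  "'g::{t2_space,second_countable_topology} monoid \<Rightarrow> ('g, 'n::finite) atlas \<Rightarrow> bool" where
  "lie_group G A \<longleftrightarrow>
     group G \<and> carrier G = UNIV \<and> smooth_atlas A \<and>
     continuous_on UNIV (\<lambda>(x, y). x \<otimes>\<^bsub>G\<^esub> y) \<and> continuous_on UNIV (\<lambda>x. inv\<^bsub>G\<^esub> x) \<and>
     (\<forall>(U, c)\<in>A. \<forall>(V, d)\<in>A. \<forall>(W, e)\<in>A.
        smooth_on {(x, y). x \<in> c ` U \<and> y \<in> d ` V \<and> inv_into U c x \<otimes>\<^bsub>G\<^esub> inv_into V d y \<in> W}
          (\<lambda>(x, y). e (inv_into U c x \<otimes>\<^bsub>G\<^esub> inv_into V d y))) \<and>
     (\<forall>(U, c)\<in>A. \<forall>(V, d)\<in>A.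
        smooth_on {x \<in> c ` U. inv\<^bsub>G\<^esub> (inv_into U c x) \<in> V} (\<lambda>x. d (inv\<^bsub>G\<^esub> (inv_into U c x))))"

definition smooth_fun :: "('g::topological_space, 'n::finite) atlas \<Rightarrow> 'g set \<Rightarrow> ('g \<Rightarrow> real) \<Rightarrow> bool" where
  "smooth_fun A W f \<longleftrightarrow> (\<forall>(U, c)\<in>A. smooth_on (c ` (U \<inter> W)) (f \<circ> inv_into U c))"

definition smooth_at :: "('g::topological_space, 'n::finite) atlas \<Rightarrow> 'g \<Rightarrow> ('g \<Rightarrow> real) \<Rightarrow> bool" where
  "smooth_at A p f \<longleftrightarrow> (\<exists>W. open W \<and> p \<in> W \<and> smooth_fun A W f)"

text \<open>A tangent vector at \<open>p\<close> is a directional derivative acting on the functions that are smooth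
  near \<open>p\<close>. It is set to 0 on all other functions, so that equality of tangent vectors is equality
  of functions.\<close>

type_synonym 'g tvec = "('g \<Rightarrow> real) \<Rightarrow> real"

definition lincomb :: "real \<Rightarrow> 'g tvec \<Rightarrow> real \<Rightarrow> 'g tvec \<Rightarrow> 'g tvec" where
  "lincomb a u b v = (\<lambda>f. a * u f + b * v f)"

definition tangent_space :: "('g::topological_space, 'n::finite) atlas \<Rightarrow> 'g \<Rightarrow> 'g tvec set" where
  "tangent_space A p =
     {(\<lambda>f. if smooth_at A p f then frechet_derivative (f \<circ> inv_into U c) (at (c p)) u else 0)
       | U c u. (U, c) \<in> A \<and> p \<in> U}"

text \<open>Differential of a diffeomorphism \<open>F\<close> of the manifold.\<close>

definition push :: "('g \<Rightarrow> 'g) \<Rightarrow> 'g tvec \<Rightarrow> 'g tvec" where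
  "push F v = (\<lambda>f. v (f \<circ> F))"

type_synonym 'g vfield = "'g \<Rightarrow> 'g tvec"

definition vector_field :: "('g::topological_space, 'n::finite) atlas \<Rightarrow> 'g vfield \<Rightarrow> bool" where
  "vector_field A X \<longleftrightarrow>
     (\<forall>p. X p \<in> tangent_space A p) \<and>
     (\<forall>W f. open W \<and> smooth_fun A W f \<longrightarrow> smooth_fun A W (\<lambda>p. X p f))"

definition extend :: "('g::topological_space, 'n::finite) atlas \<Rightarrow> 'g \<Rightarrow> 'g tvec \<Rightarrow> 'g vfield" where
  "extend A p v = (SOME X. vector_field A X \<and> X p = v)"

definition bracket ::
  "('g::topological_space, 'n::finite) atlas \<Rightarrow> 'g vfield \<Rightarrow> 'g vfield \<Rightarrow> 'g vfield" where
  "bracket A X Y = (\<lambda>p f. if smooth_at A p f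
     then X p (\<lambda>q. Y q f) - Y p (\<lambda>q. X q f) else 0)"

text \<open>Unimodularity: the modular function \<open>x \<mapsto> \<bar>det (Ad x)\<bar>\<close> is trivial, where \<open>Ad x\<close> is the
  differential at the identity of conjugation by \<open>x\<close>.\<close>

definition Ad :: "'g monoid \<Rightarrow> 'g \<Rightarrow> 'g tvec \<Rightarrow> 'g tvec" where
  "Ad G x = push (\<lambda>y. x \<otimes>\<^bsub>G\<^esub> y \<otimes>\<^bsub>G\<^esub> inv\<^bsub>G\<^esub> x)"

definition tangent_basis ::
  "('g::topological_space, 'n::finite) atlas \<Rightarrow> 'g \<Rightarrow> ('n \<Rightarrow> 'g tvec) \<Rightarrow> bool" where
  "tangent_basis A p b \<longleftrightarrow>
     bij_betw (\<lambda>x :: real ^ 'n. (\<lambda>f. \<Sum>i\<in>UNIV. x $ i * b i f)) UNIV (tangent_space A p)"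

definition unimodular_group ::
  "'g::topological_space monoid \<Rightarrow> ('g, 'n::finite) atlas \<Rightarrow> bool" where
  "unimodular_group G A \<longleftrightarrow>
     (\<forall>x b. \<forall>M :: real ^ 'n ^ 'n.
        tangent_basis A \<one>\<^bsub>G\<^esub> b \<and> (\<forall>j. Ad G x (b j) = (\<lambda>f. \<Sum>i\<in>UNIV. M $ i $ j * b i f))
        \<longrightarrow> \<bar>det M\<bar> = 1)"

section \<open>Differential forms\<close>

text \<open>The value of a \<open>k\<close>-form at a point takes a list of \<open>k\<close> tangent vectors; values on other
  arguments are irrelevant, so forms are compared with \<open>form_eq\<close>.\<close>

type_synonym 'g form = "'g \<Rightarrow> 'g tvec list \<Rightarrow> real"

definition tuples :: "nat \<Rightarrow> 'a set \<Rightarrow> 'a list set" where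
  "tuples k V = {vs. length vs = k \<and> set vs \<subseteq> V}"

definition alternating_on :: "'g tvec set \<Rightarrow> nat \<Rightarrow> ('g tvec list \<Rightarrow> real) \<Rightarrow> bool" where
  "alternating_on V k \<omega> \<longleftrightarrow>
     (\<forall>vs\<in>tuples k V.
        (\<forall>i<k. \<forall>u\<in>V. \<forall>w\<in>V. \<forall>a b.
           \<omega> (vs[i := lincomb a u b w]) = a * \<omega> (vs[i := u]) + b * \<omega> (vs[i := w])) \<and>
        (\<forall>i<k. \<forall>j<k. i \<noteq> j \<and> vs ! i = vs ! j \<longrightarrow> \<omega> vs = 0))"

definition diff_form :: "('g::topological_space, 'n::finite) atlas \<Rightarrow> nat \<Rightarrow> 'g form \<Rightarrow> bool" where
  "diff_form A k \<omega> \<longleftrightarrow>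
     (\<forall>p. alternating_on (tangent_space A p) k (\<omega> p)) \<and>
     (\<forall>Xs\<in>tuples k {X. vector_field A X}. smooth_fun A UNIV (\<lambda>p. \<omega> p (map (\<lambda>X. X p) Xs)))"

definition form_eq ::
  "('g::topological_space, 'n::finite) atlas \<Rightarrow> nat \<Rightarrow> 'g form \<Rightarrow> 'g form \<Rightarrow> bool" where
  "form_eq A k \<alpha> \<beta> \<longleftrightarrow> (\<forall>p. \<forall>vs\<in>tuples k (tangent_space A p). \<alpha> p vs = \<beta> p vs)"

text \<open>Normalised so that wedge products of 1-forms are determinants:
  \<open>(\<alpha> \<and> \<beta>)(u, v) = \<alpha> u * \<beta> v - \<alpha> v * \<beta> u\<close>.\<close>

definition wedge :: "nat \<Rightarrow> nat \<Rightarrow> 'g form \<Rightarrow> 'g form \<Rightarrow> 'g form" where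
  "wedge k l \<alpha> \<beta> = (\<lambda>p vs.
     (\<Sum>\<sigma> | \<sigma> permutes {..<k + l}. of_int (sign \<sigma>) *
        \<alpha> p (map (\<lambda>i. vs ! \<sigma> i) [0..<k]) * \<beta> p (map (\<lambda>i. vs ! \<sigma> i) [k..<k + l]))
     / (fact k * fact l))"

text \<open>Exterior derivative, by the invariant formula
  \<open>d\<omega>(X\<^sub>0,\<dots>,X\<^sub>k) = \<Sum>\<^sub>i (-1)\<^sup>i X\<^sub>i(\<omega>(\<dots>omit i\<dots>)) + \<Sum>\<^bsub>i<j\<^esub> (-1)\<^bsup>i+j\<^esup> \<omega>([X\<^sub>i,X\<^sub>j],\<dots>omit i,j\<dots>)\<close>.
  The value at \<open>p\<close> depends only on the values of the fields at \<open>p\<close>.\<close>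

definition ext_deriv_fields ::
  "('g::topological_space, 'n::finite) atlas \<Rightarrow> 'g form \<Rightarrow> 'g vfield list \<Rightarrow> 'g \<Rightarrow> real" where
  "ext_deriv_fields A \<omega> Xs p =
     (\<Sum>i<length Xs. (-1) ^ i * (Xs ! i) p (\<lambda>q. \<omega> q (map (\<lambda>X. X q) (nths Xs (- {i}))))) +
     (\<Sum>j<length Xs. \<Sum>i<j. (-1) ^ (i + j) *
        \<omega> p (bracket A (Xs ! i) (Xs ! j) p # map (\<lambda>X. X p) (nths Xs (- {i, j}))))"

definition ext_deriv :: "('g::topological_space, 'n::finite) atlas \<Rightarrow> 'g form \<Rightarrow> 'g form" where
  "ext_deriv A \<omega> = (\<lambda>p vs. ext_deriv_fields A \<omega> (map (extend A p) vs) p)"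

definition left_invariant ::
  "'g::topological_space monoid \<Rightarrow> ('g, 'n::finite) atlas \<Rightarrow> nat \<Rightarrow> 'g form \<Rightarrow> bool" where
  "left_invariant G A k \<omega> \<longleftrightarrow>
     (\<forall>x. form_eq A k (\<lambda>p vs. \<omega> (x \<otimes>\<^bsub>G\<^esub> p) (map (push (\<lambda>y. x \<otimes>\<^bsub>G\<^esub> y)) vs)) \<omega>)"

section \<open>Riemannian geometry\<close>

type_synonym 'g metric = "'g \<Rightarrow> 'g tvec \<Rightarrow> 'g tvec \<Rightarrow> real"

definition orthonormal_frame ::
  "('g::topological_space, 'n::finite) atlas \<Rightarrow> 'g metric \<Rightarrow> 'g \<Rightarrow> ('n \<Rightarrow> 'g tvec) \<Rightarrow> bool" where
  "orthonormal_frame A g p E \<longleftrightarrow>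
     (\<forall>i. E i \<in> tangent_space A p) \<and> (\<forall>i j. g p (E i) (E j) = (if i = j then 1 else 0))"

definition some_frame ::
  "('g::topological_space, 'n::finite) atlas \<Rightarrow> 'g metric \<Rightarrow> 'g \<Rightarrow> 'n \<Rightarrow> 'g tvec" where
  "some_frame A g p = (SOME E. orthonormal_frame A g p E)"

text \<open>Hodge operator on \<open>k\<close>-forms for a metric \<open>g\<close> and a volume form \<open>vol\<close>: with \<open>E\<close> orthonormal,
  \<open>(\<star>\<omega>)(v) = (1/k!) \<Sum> \<omega>(E\<^bsub>i1\<^esub>,\<dots>,E\<^bsub>ik\<^esub>) vol(E\<^bsub>i1\<^esub>,\<dots>,E\<^bsub>ik\<^esub>,v)\<close>, which is the convention
  \<open>\<alpha> \<and> \<star>\<beta> = g(\<alpha>,\<beta>) vol\<close>.\<close>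

definition hodge ::
  "('g::topological_space, 'n::finite) atlas \<Rightarrow> 'g metric \<Rightarrow> 'g form \<Rightarrow> nat \<Rightarrow> 'g form \<Rightarrow> 'g form" where
  "hodge A g vol k \<omega> = (\<lambda>p vs.
     (\<Sum>is\<in>tuples k UNIV. \<omega> p (map (some_frame A g p) is) * vol p (map (some_frame A g p) is @ vs))
     / fact k)"

definition is_levi_civita ::
  "('g::topological_space, 'n::finite) atlas \<Rightarrow> 'g metric \<Rightarrow>
     ('g vfield \<Rightarrow> 'g vfield \<Rightarrow> 'g vfield) \<Rightarrow> bool" where
  "is_levi_civita A g D \<longleftrightarrow>
     (\<forall>X Y. vector_field A X \<and> vector_field A Y \<longrightarrow> vector_field A (D X Y)) \<and>
     (\<forall>X Y Z f h. vector_field A X \<and> vector_field A Y \<and> vector_field A Z \<and>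
        smooth_fun A UNIV f \<and> smooth_fun A UNIV h \<longrightarrow>
        D (\<lambda>p. lincomb (f p) (X p) (h p) (Y p)) Z
          = (\<lambda>p. lincomb (f p) (D X Z p) (h p) (D Y Z p))) \<and>
     (\<forall>X Y Z. vector_field A X \<and> vector_field A Y \<and> vector_field A Z \<longrightarrow>
        D X (\<lambda>p. lincomb 1 (Y p) 1 (Z p)) = (\<lambda>p. lincomb 1 (D X Y p) 1 (D X Z p))) \<and>
     (\<forall>X Y f. vector_field A X \<and> vector_field A Y \<and> smooth_fun A UNIV f \<longrightarrow>
        D X (\<lambda>p. lincomb (f p) (Y p) 0 (Y p))
          = (\<lambda>p. lincomb (X p f) (Y p) (f p) (D X Y p))) \<and>
     (\<forall>X Y Z p. vector_field A X \<and> vector_field A Y \<and> vector_field A Z \<longrightarrow>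
        X p (\<lambda>q. g q (Y q) (Z q)) = g p (D X Y p) (Z p) + g p (Y p) (D X Z p)) \<and>
     (\<forall>X Y. vector_field A X \<and> vector_field A Y \<longrightarrow>
        (\<lambda>p. lincomb 1 (D X Y p) (-1) (D Y X p)) = bracket A X Y)"

definition levi_civita ::
  "('g::topological_space, 'n::finite) atlas \<Rightarrow> 'g metric \<Rightarrow>
     'g vfield \<Rightarrow> 'g vfield \<Rightarrow> 'g vfield" where
  "levi_civita A g = (SOME D. is_levi_civita A g D)"

definition curvature ::
  "('g::topological_space, 'n::finite) atlas \<Rightarrow> 'g metric \<Rightarrow>
     'g vfield \<Rightarrow> 'g vfield \<Rightarrow> 'g vfield \<Rightarrow> 'g vfield" where
  "curvature A g X Y Z = (let D = levi_civita A g in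
     (\<lambda>p f. D X (D Y Z) p f - D Y (D X Z) p f - D (bracket A X Y) Z p f))"

definition flat :: "('g::topological_space, 'n::finite) atlas \<Rightarrow> 'g metric \<Rightarrow> bool" where
  "flat A g \<longleftrightarrow> (\<forall>X Y Z p. vector_field A X \<and> vector_field A Y \<and> vector_field A Z \<longrightarrow>
     curvature A g X Y Z p = (\<lambda>f. 0))"

definition scalar_curvature ::
  "('g::topological_space, 'n::finite) atlas \<Rightarrow> 'g metric \<Rightarrow> 'g \<Rightarrow> real" where
  "scalar_curvature A g p =
     (let E = (\<lambda>i. extend A p (some_frame A g p i)) in
      \<Sum>i\<in>UNIV. \<Sum>j\<in>UNIV. g p (curvature A g (E i) (E j) (E j) p) (E i p))"

section \<open>$G_2$-structures\<close>

text \<open>Coframes are indexed by the seven-element type \<open>7\<close>, in which the numeral \<open>7\<close> equals \<open>0\<close>;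
  the numerals \<open>1\<close> to \<open>7\<close> are pairwise distinct and exhaust the type.\<close>

definition coframe :: "('g::topological_space, 7) atlas \<Rightarrow> 'g \<Rightarrow> (7 \<Rightarrow> 'g tvec \<Rightarrow> real) \<Rightarrow> bool" where
  "coframe A p e \<longleftrightarrow>
     (\<forall>i. \<forall>u\<in>tangent_space A p. \<forall>v\<in>tangent_space A p. \<forall>a b.
        e i (lincomb a u b v) = a * e i u + b * e i v) \<and>
     bij_betw (\<lambda>v. \<chi> i. e i v) (tangent_space A p) (UNIV :: (real ^ 7) set)"

text \<open>\<open>ewedge e [i1, \<dots>, ik]\<close> is \<open>e\<^bsup>i1\<^esup> \<and> \<dots> \<and> e\<^bsup>ik\<^esup>\<close>, i.e. the determinant of the values.\<close>

definition ewedge :: "(7 \<Rightarrow> 'g tvec \<Rightarrow> real) \<Rightarrow> 7 list \<Rightarrow> 'g tvec list \<Rightarrow> real" where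
  "ewedge e is vs = (\<Sum>\<sigma> | \<sigma> permutes {..<length is}.
     of_int (sign \<sigma>) * (\<Prod>a<length is. e (is ! a) (vs ! \<sigma> a)))"

definition g2_coframe ::
  "('g::topological_space, 7) atlas \<Rightarrow> 'g form \<Rightarrow> 'g \<Rightarrow> (7 \<Rightarrow> 'g tvec \<Rightarrow> real) \<Rightarrow> bool" where
  "g2_coframe A \<phi> p e \<longleftrightarrow> coframe A p e \<and>
     (\<forall>vs\<in>tuples 3 (tangent_space A p).
        \<phi> p vs = ewedge e [1,2,3] vs + ewedge e [1,4,5] vs + ewedge e [1,6,7] vs
               + ewedge e [2,4,6] vs - ewedge e [2,5,7] vs
               - ewedge e [3,4,7] vs - ewedge e [3,5,6] vs)"

definition g2_structure :: "('g::topological_space, 7) atlas \<Rightarrow> 'g form \<Rightarrow> bool" where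
  "g2_structure A \<phi> \<longleftrightarrow> diff_form A 3 \<phi> \<and> (\<forall>p. \<exists>e. g2_coframe A \<phi> p e)"

text \<open>Metric and volume form do not depend on the adapted coframe chosen at each point.\<close>

definition some_g2_coframe ::
  "('g::topological_space, 7) atlas \<Rightarrow> 'g form \<Rightarrow> 'g \<Rightarrow> 7 \<Rightarrow> 'g tvec \<Rightarrow> real" where
  "some_g2_coframe A \<phi> p = (SOME e. g2_coframe A \<phi> p e)"

definition g2_metric :: "('g::topological_space, 7) atlas \<Rightarrow> 'g form \<Rightarrow> 'g metric" where
  "g2_metric A \<phi> = (\<lambda>p u v. \<Sum>i\<in>UNIV. some_g2_coframe A \<phi> p i u * some_g2_coframe A \<phi> p i v)"

definition g2_vol :: "('g::topological_space, 7) atlas \<Rightarrow> 'g form \<Rightarrow> 'g form" where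
  "g2_vol A \<phi> = (\<lambda>p. ewedge (some_g2_coframe A \<phi> p) [1,2,3,4,5,6,7])"

definition g2_star :: "('g::topological_space, 7) atlas \<Rightarrow> 'g form \<Rightarrow> nat \<Rightarrow> 'g form \<Rightarrow> 'g form" where
  "g2_star A \<phi> = hodge A (g2_metric A \<phi>) (g2_vol A \<phi>)"

definition lee_form :: "('g::topological_space, 7) atlas \<Rightarrow> 'g form \<Rightarrow> 'g form \<Rightarrow> bool" where
  "lee_form A \<phi> \<theta> \<longleftrightarrow> diff_form A 1 \<theta> \<and>
     form_eq A 5 (ext_deriv A (g2_star A \<phi> 3 \<phi>)) (wedge 1 4 \<theta> (g2_star A \<phi> 3 \<phi>))"

definition g2t_structure :: "('g::topological_space, 7) atlas \<Rightarrow> 'g form \<Rightarrow> bool" where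
  "g2t_structure A \<phi> \<longleftrightarrow> g2_structure A \<phi> \<and> (\<exists>\<theta>. lee_form A \<phi> \<theta>)"

definition torsion_form :: "('g::topological_space, 7) atlas \<Rightarrow> 'g form \<Rightarrow> 'g form \<Rightarrow> 'g form" where
  "torsion_form A \<phi> \<theta> = (\<lambda>p vs.
     1 / 6 * g2_star A \<phi> 7 (wedge 4 3 (ext_deriv A \<phi>) \<phi>) p [] * \<phi> p vs
     - g2_star A \<phi> 4 (ext_deriv A \<phi>) p vs
     + g2_star A \<phi> 4 (wedge 1 3 \<theta> \<phi>) p vs)"

definition strong_g2t_structure :: "('g::topological_space, 7) atlas \<Rightarrow> 'g form \<Rightarrow> bool" where
  "strong_g2t_structure A \<phi> \<longleftrightarrow> g2t_structure A \<phi> \<and>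
     (\<forall>\<theta>. lee_form A \<phi> \<theta> \<longrightarrow> form_eq A 4 (ext_deriv A (torsion_form A \<phi> \<theta>)) (\<lambda>p vs. 0))"

definition parallel_g2 :: "('g::topological_space, 7) atlas \<Rightarrow> 'g form \<Rightarrow> bool" where
  "parallel_g2 A \<phi> \<longleftrightarrow>
     form_eq A 4 (ext_deriv A \<phi>) (\<lambda>p vs. 0) \<and>
     form_eq A 5 (ext_deriv A (g2_star A \<phi> 3 \<phi>)) (\<lambda>p vs. 0)"

end

theory Submission
  imports Defs "HOL-Combinatorics.Multiset_Permutations"
begin

text \<open>In a left-invariant coframe adapted to \<open>\<phi>\<close> everything is expressed by the structure constants
  \<open>c\<close>; the Lee form has constant components because they are components of \<open>d\<star>\<phi>\<close>.
  Let \<open>A\<close> be the Levi-Civita connection plus \<open>T/2\<close>. It preserves \<open>\<phi>\<close>, so each matrix \<open>A\<^sub>i\<close> lies in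
  \<open>g\<^sub>2\<close>, the eigenspace of contraction with \<open>\<star>\<phi>\<close> on 2-forms for the eigenvalue \<open>-2\<close>. Contracting
  \<open>dT = 0\<close> and the Jacobi identity with \<open>\<star>\<phi>\<close> gives, by unimodularity,
  \<open>\<Sum> A\<^sub>i\<^sub>j\<^sub>k A\<^sub>j\<^sub>i\<^sub>k + \<Sum> A\<^sub>i\<^sub>j\<^sub>k T\<^sub>i\<^sub>j\<^sub>k = 0\<close>, which turns the formula for the scalar curvature into
  \<open>Scal = \<Sum> T\<^sub>i\<^sub>j\<^sub>k\<^sup>2 / 4\<close>. If \<open>G\<close> is solvable, an orthonormal basis adapted to the derived series shows
  \<open>Scal \<le> 0\<close>. So in both cases \<open>T = 0\<close>, and \<open>A\<close> is the Levi-Civita connection with curvature \<open>R\<close> in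
  \<open>S\<^sup>2(g\<^sub>2)\<close>. The 4-form \<open>tr(R \<and> R)\<close> has a left-invariant Chern-Simons primitive and \<open>\<star>\<phi>\<close> is
  parallel, hence \<open>\<Sum> (\<star>\<phi>)\<^sub>i\<^sub>j\<^sub>k\<^sub>l tr(R\<^sub>i\<^sub>j R\<^sub>k\<^sub>l) = 0\<close>; as \<open>R\<close> takes values in \<open>g\<^sub>2\<close>, this sum is a nonzero
  multiple of \<open>|R|\<^sup>2\<close>, and so \<open>R = 0\<close>.\<close>

section \<open>Index calculus for the $G_2$ three-form\<close>

text \<open>The vanishing statements have one source. The invariance of \<star>\<phi> under each A_i
  is summed over i with one slot of \<star>\<phi> set to i; unimodularity removes the divergence
  term. For T = 0 this says that an invariant exact 4-form d\<beta> is orthogonal to \<star>\<phi>: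
  d\<beta> \<and> \<phi> = d(\<beta> \<and> \<phi>), and invariant 6-forms on a unimodular group are
  closed. It replaces integration over a compact quotient, which need not exist. Two obstacles shape
  the rest. Solvability is that of the abstract group, whose derived subgroups need not be closed;
  the filtration of the Lie algebra is therefore built from tangent cones of plain subsets. And the
  metric, the volume form, the orthonormal frame, the connection and the extension of tangent
  vectors are all picked by choice, so each formula has to be shown independent of the choice. For
  metric and volume this means that a linear map preserving \<phi> is an isometry of determinant 1,
  which is deduced from an expression of the metric through \<phi>.\<close>

lemma exhaust_7: "x = 0 \<or> x = 1 \<or> x = 2 \<or> x = 3 \<or> x = 4 \<or> x = 5 \<or> x = 6" for x :: 7
proof (induct x)
  case (of_int z)
  then have "z = 0 \<or> z = 1 \<or> z = 2 \<or> z = 3 \<or> z = 4 \<or> z = 5 \<or> z = 6" by auto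
  then show ?case by auto
qed

lemma UNIV_7: "UNIV = {0, 1, 2, 3, 4, 5, 6 :: 7}"
  using exhaust_7 by auto

lemma forall_7: "(\<forall>i::7. P i) \<longleftrightarrow> P 0 \<and> P 1 \<and> P 2 \<and> P 3 \<and> P 4 \<and> P 5 \<and> P 6"
  by (metis exhaust_7)

lemma sum_7: "(\<Sum>i\<in>UNIV. f i) = f 0 + f 1 + f 2 + f 3 + f 4 + f 5 + f (6::7)"
  unfolding UNIV_7 by (simp add: add.assoc)

text \<open>The components of the 3-form e^a \<and> e^b \<and> e^c for distinct a, b, c; see
  \<open>ew_tri\<close>.\<close>

definition tri :: "7 \<Rightarrow> 7 \<Rightarrow> 7 \<Rightarrow> 7 \<Rightarrow> 7 \<Rightarrow> 7 \<Rightarrow> real" where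
  "tri a b c i j k =
    (if i = a \<and> j = b \<and> k = c \<or> i = b \<and> j = c \<and> k = a \<or> i = c \<and> j = a \<and> k = b then 1
     else if i = b \<and> j = a \<and> k = c \<or> i = a \<and> j = c \<and> k = b \<or> i = c \<and> j = b \<and> k = a then -1 else 0)"

text \<open>The components of \<phi> in an adapted coframe. As the numeral 7 is 0, the seven index
  triples are the lines of a Fano plane with the points 0 to 6.\<close>

definition ph :: "7 \<Rightarrow> 7 \<Rightarrow> 7 \<Rightarrow> real" where
  "ph i j k = tri 1 2 3 i j k + tri 1 4 5 i j k + tri 1 6 7 i j k + tri 2 4 6 i j k
     - tri 2 5 7 i j k - tri 3 4 7 i j k - tri 3 5 6 i j k"

text \<open>The components of \<star>\<phi>, introduced by the contraction identity for two copies
  of \<phi> instead of the Hodge operator, so that eigenvalues and invariance can be derived from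
  those of \<open>ph\<close>. Agreement with the Hodge dual is \<open>star_phi0\<close>.\<close>

definition ps :: "7 \<Rightarrow> 7 \<Rightarrow> 7 \<Rightarrow> 7 \<Rightarrow> real" where
  "ps i j k l = (\<Sum>m\<in>UNIV. ph i j m * ph m k l) - of_bool (i = k \<and> j = l) + of_bool (i = l \<and> j = k)"

text \<open>Two points of the Fano plane lie on exactly one line, so two distinct indices leave one
  possible third index. Written as a delta in the last index, the rule also collapses sums over that
  index.\<close>

lemma ph_rows:
  "ph 0 0 k = 0" "ph 0 1 k = (if k = 6 then 1 else 0)" "ph 0 2 k = (if k = 5 then -1 else 0)"
  "ph 0 3 k = (if k = 4 then -1 else 0)" "ph 0 4 k = (if k = 3 then 1 else 0)" "ph 0 5 k = (if k = 2 then 1 else 0)"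
  "ph 0 6 k = (if k = 1 then -1 else 0)" "ph 1 0 k = (if k = 6 then -1 else 0)" "ph 1 1 k = 0"
  "ph 1 2 k = (if k = 3 then 1 else 0)" "ph 1 3 k = (if k = 2 then -1 else 0)" "ph 1 4 k = (if k = 5 then 1 else 0)"
  "ph 1 5 k = (if k = 4 then -1 else 0)" "ph 1 6 k = (if k = 0 then 1 else 0)" "ph 2 0 k = (if k = 5 then 1 else 0)"
  "ph 2 1 k = (if k = 3 then -1 else 0)" "ph 2 2 k = 0" "ph 2 3 k = (if k = 1 then 1 else 0)"
  "ph 2 4 k = (if k = 6 then 1 else 0)" "ph 2 5 k = (if k = 0 then -1 else 0)" "ph 2 6 k = (if k = 4 then -1 else 0)"
  "ph 3 0 k = (if k = 4 then 1 else 0)" "ph 3 1 k = (if k = 2 then 1 else 0)" "ph 3 2 k = (if k = 1 then -1 else 0)"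
  "ph 3 3 k = 0" "ph 3 4 k = (if k = 0 then -1 else 0)" "ph 3 5 k = (if k = 6 then -1 else 0)"
  "ph 3 6 k = (if k = 5 then 1 else 0)" "ph 4 0 k = (if k = 3 then -1 else 0)" "ph 4 1 k = (if k = 5 then -1 else 0)"
  "ph 4 2 k = (if k = 6 then -1 else 0)" "ph 4 3 k = (if k = 0 then 1 else 0)" "ph 4 4 k = 0"
  "ph 4 5 k = (if k = 1 then 1 else 0)" "ph 4 6 k = (if k = 2 then 1 else 0)" "ph 5 0 k = (if k = 2 then -1 else 0)"
  "ph 5 1 k = (if k = 4 then 1 else 0)" "ph 5 2 k = (if k = 0 then 1 else 0)" "ph 5 3 k = (if k = 6 then 1 else 0)"
  "ph 5 4 k = (if k = 1 then -1 else 0)" "ph 5 5 k = 0" "ph 5 6 k = (if k = 3 then -1 else 0)"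
  "ph 6 0 k = (if k = 1 then 1 else 0)" "ph 6 1 k = (if k = 0 then -1 else 0)" "ph 6 2 k = (if k = 4 then 1 else 0)"
  "ph 6 3 k = (if k = 5 then -1 else 0)" "ph 6 4 k = (if k = 2 then -1 else 0)" "ph 6 5 k = (if k = 3 then 1 else 0)"
  "ph 6 6 k = 0"
  by (simp_all add: ph_def tri_def)

lemma tri_cyc: "tri a b c j k i = tri a b c i j k"
  by (simp only: tri_def conj_ac disj_ac)

lemma ph_cyc: "ph j k i = ph i j k"
  by (simp only: ph_def tri_cyc[of _ _ _ j k i])

lemma ph_swap12: "ph j i k = - ph i j k"
  using exhaust_7[of i] exhaust_7[of j] by (elim disjE) (simp_all add: ph_rows)

lemma ph_swap23: "ph i k j = - ph i j k"
  using ph_cyc[of i k j] ph_cyc[of i j k] ph_swap12[of k j i] ph_cyc[of j k i] ph_cyc[of k j i] by simp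

lemma ps_swap12: "ps j i k l = - ps i j k l"
proof -
  have "(\<Sum>m\<in>UNIV. ph j i m * ph m k l) = - (\<Sum>m\<in>UNIV. ph i j m * ph m k l)"
    unfolding sum_negf[symmetric] by (intro sum.cong refl) (metis ph_swap12 mult_minus_left)
  then show ?thesis by (simp only: ps_def conj_commute)
qed

lemma ps_swap34: "ps i j l k = - ps i j k l"
proof -
  have "(\<Sum>m\<in>UNIV. ph i j m * ph m l k) = - (\<Sum>m\<in>UNIV. ph i j m * ph m k l)"
    unfolding sum_negf[symmetric] by (intro sum.cong refl) (metis ph_swap23 mult_minus_right)
  then show ?thesis by (simp add: ps_def)
qed

text \<open>The swaps inside the first and the last pair are inherited from \<open>ph\<close>. This
  one mixes the two factors of the contraction and is checked for all values of the middle
  indices.\<close>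

lemma ps_swap23: "ps i k j l = - ps i j k l"
proof -
  have "\<forall>i l. ps i k j l = - ps i j k l"
    using exhaust_7[of j] exhaust_7[of k] unfolding forall_7 ps_def
    by (elim disjE) (simp_all add: ph_rows mult_delta_left)
  then show ?thesis by blast
qed

text \<open>The 2-forms whose contraction with \<phi> is zero: seven linear conditions on 21
  entries, the 14-dimensional Lie algebra of the stabiliser of \<phi>. These equations are easier to
  verify for an explicit connection than invariance, which follows in
  \<open>is_g2_ph\<close>.\<close>

definition is_g2 :: "(7 \<Rightarrow> 7 \<Rightarrow> real) \<Rightarrow> bool" where
  "is_g2 B \<longleftrightarrow> (\<forall>i j. B j i = - B i j) \<and> (\<forall>l. (\<Sum>j\<in>UNIV. \<Sum>k\<in>UNIV. B j k * ph j k l) = 0)"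

lemma is_g2_skew: "is_g2 B \<Longrightarrow> B j i = - B i j"
  unfolding is_g2_def by blast

lemma is_g2_phD: "is_g2 B \<Longrightarrow> (\<Sum>j\<in>UNIV. \<Sum>k\<in>UNIV. B j k * ph j k l) = 0"
  unfolding is_g2_def by blast

text \<open>The product of two \<open>ph\<close> in the definition of \<open>ps\<close> gives zero
  on B, and the two delta terms leave - B_ij + B_ji.\<close>

lemma is_g2_ps:
  assumes "is_g2 B"
  shows "(\<Sum>k\<in>UNIV. \<Sum>l\<in>UNIV. ps i j k l * B k l) = - 2 * B i j"
proof -
  have 0: "(\<Sum>k\<in>UNIV. \<Sum>l\<in>UNIV. ph m k l * B k l) = 0" for m
  proof -
    have "(\<Sum>k\<in>UNIV. \<Sum>l\<in>UNIV. ph m k l * B k l) = (\<Sum>k\<in>UNIV. \<Sum>l\<in>UNIV. B k l * ph k l m)"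
      by (intro sum.cong refl) (simp add: mult.commute ph_cyc[of _ _ m])
    then show ?thesis by (simp add: is_g2_phD[OF assms])
  qed
  have "(\<Sum>k\<in>UNIV. \<Sum>l\<in>UNIV. (\<Sum>m\<in>UNIV. ph i j m * ph m k l) * B k l)
    = (\<Sum>k\<in>UNIV. \<Sum>l\<in>UNIV. \<Sum>m\<in>UNIV. ph i j m * (ph m k l * B k l))"
    unfolding sum_distrib_right mult.assoc ..
  also have "\<dots> = (\<Sum>k\<in>UNIV. \<Sum>m\<in>UNIV. \<Sum>l\<in>UNIV. ph i j m * (ph m k l * B k l))"
    by (intro sum.cong refl sum.swap)
  also have "\<dots> = (\<Sum>m\<in>UNIV. \<Sum>k\<in>UNIV. \<Sum>l\<in>UNIV. ph i j m * (ph m k l * B k l))"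
    by (rule sum.swap)
  also have "\<dots> = (\<Sum>m\<in>UNIV. ph i j m * (\<Sum>k\<in>UNIV. \<Sum>l\<in>UNIV. ph m k l * B k l))"
    by (simp add: sum_distrib_left)
  finally have 1: "(\<Sum>k\<in>UNIV. \<Sum>l\<in>UNIV. (\<Sum>m\<in>UNIV. ph i j m * ph m k l) * B k l) = 0"
    by (simp add: 0)
  have 2: "(\<Sum>k\<in>UNIV. \<Sum>l\<in>UNIV. of_bool (i = k \<and> j = l) * B k l) = B i j" for i j
  proof -
    have "of_bool (i = k \<and> j = l) * B k l = (if l = j then (if k = i then B k l else 0) else 0)" for k l by auto
    then show ?thesis by simp
  qed
  have "(\<Sum>k\<in>UNIV. \<Sum>l\<in>UNIV. of_bool (i = l \<and> j = k) * B k l) = B j i"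
    unfolding conj_commute[of "i = _"] by (rule 2)
  then have "(\<Sum>k\<in>UNIV. \<Sum>l\<in>UNIV. ps i j k l * B k l) = 0 - B i j + B j i"
    unfolding ps_def using 1 2[of i j] by (simp add: algebra_simps sum.distrib sum_subtractf)
  moreover have "B j i = - B i j" by (rule is_g2_skew[OF assms])
  ultimately show ?thesis by simp
qed

text \<open>Each of the seven equations of \<open>is_g2\<close> is solved for one entry of B. After
  this substitution the action of B on \<phi> as a derivation vanishes component by
  component.\<close>

lemma is_g2_ph:
  assumes "is_g2 B"
  shows "(\<Sum>m\<in>UNIV. B i m * ph m j k + B j m * ph i m k + B k m * ph i j m) = 0"
proof -
  have s: "B 0 0 = 0" "B 1 1 = 0" "B 2 2 = 0" "B 3 3 = 0" "B 4 4 = 0" "B 5 5 = 0" "B 6 6 = 0"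
    "B 1 0 = - B 0 1" "B 2 0 = - B 0 2" "B 3 0 = - B 0 3" "B 4 0 = - B 0 4" "B 5 0 = - B 0 5" "B 6 0 = - B 0 6"
    "B 2 1 = - B 1 2" "B 3 1 = - B 1 3" "B 4 1 = - B 1 4" "B 5 1 = - B 1 5" "B 6 1 = - B 1 6"
    "B 3 2 = - B 2 3" "B 4 2 = - B 2 4" "B 5 2 = - B 2 5" "B 6 2 = - B 2 6"
    "B 4 3 = - B 3 4" "B 5 3 = - B 3 5" "B 6 3 = - B 3 6"
    "B 5 4 = - B 4 5" "B 6 4 = - B 4 6" "B 6 5 = - B 5 6"
    using is_g2_skew[OF assms] by (metis equal_neg_zero)+
  have c: "(\<Sum>j\<in>UNIV. \<Sum>k\<in>UNIV. B j k * ph l j k) = 0" for l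
  proof -
    have "(\<Sum>j\<in>UNIV. \<Sum>k\<in>UNIV. B j k * ph l j k) = (\<Sum>j\<in>UNIV. \<Sum>k\<in>UNIV. B j k * ph j k l)"
      by (intro sum.cong refl arg_cong2[of _ _ _ _ "(*)"] ph_cyc[symmetric])
    then show ?thesis by (simp add: is_g2_phD[OF assms])
  qed
  have h0: "B 1 6 = B 2 5 + B 3 4" using c[of 0] by (simp add: sum_7 ph_rows s)
  have h1: "B 0 6 = B 2 3 + B 4 5" using c[of 1] by (simp add: sum_7 ph_rows s)
  have h2: "B 0 5 = B 1 3 - B 4 6" using c[of 2] by (simp add: sum_7 ph_rows s)
  have h3: "B 0 4 = - B 1 2 + B 5 6" using c[of 3] by (simp add: sum_7 ph_rows s)
  have h4: "B 0 3 = - B 1 5 - B 2 6" using c[of 4] by (simp add: sum_7 ph_rows s)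
  have h5: "B 0 2 = B 1 4 + B 3 6" using c[of 5] by (simp add: sum_7 ph_rows s)
  have h6: "B 0 1 = - B 2 4 + B 3 5" using c[of 6] by (simp add: sum_7 ph_rows s)
  have "(\<Sum>m\<in>UNIV. B i m * ph j k m + B j m * ph k i m + B k m * ph i j m) = 0"
    using exhaust_7[of i] exhaust_7[of j] exhaust_7[of k]
    by (elim disjE) (simp_all add: ph_rows s h0 h1 h2 h3 h4 h5 h6 mult_delta_right sum.distrib)
  moreover have "ph m j k = ph j k m" "ph i m k = ph k i m" for m
    using ph_cyc by metis+
  ultimately show ?thesis by simp
qed

text \<open>\<open>ps\<close> is built from two copies of \<open>ph\<close> and the metric, and B
  annihilates both as a derivation. Invariance of each copy of \<open>ph\<close> trades the action
  on its outer slots for one on the contracted index; the two resulting terms cancel because B is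
  skew.\<close>

lemma is_g2_ps_inv:
  assumes "is_g2 B"
  shows "(\<Sum>m\<in>UNIV. B i m * ps m j k l + B j m * ps i m k l + B k m * ps i j m l + B l m * ps i j k m) = 0"
proof -
  have skew: "B j i = - B i j" for i j by (rule is_g2_skew[OF assms])
  have p1: "(\<Sum>m\<in>UNIV. B i m * ph m j k) + (\<Sum>m\<in>UNIV. B j m * ph i m k) = - (\<Sum>m\<in>UNIV. B k m * ph i j m)" for i j k
    using is_g2_ph[OF assms, of i j k] by (simp add: sum.distrib)
  have p2: "(\<Sum>m\<in>UNIV. B j m * ph i m k) + (\<Sum>m\<in>UNIV. B k m * ph i j m) = - (\<Sum>m\<in>UNIV. B i m * ph m j k)" for i j k
    using is_g2_ph[OF assms, of i j k] by (simp add: sum.distrib)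
  let ?f = "\<lambda>i j k l. \<Sum>n\<in>UNIV. ph i j n * ph n k l"
  have a: "(\<Sum>m\<in>UNIV. B i m * ?f m j k l + B j m * ?f i m k l)
     = (\<Sum>n\<in>UNIV. ((\<Sum>m\<in>UNIV. B i m * ph m j n) + (\<Sum>m\<in>UNIV. B j m * ph i m n)) * ph n k l)"
    unfolding sum_distrib_left sum_distrib_right sum.distrib distrib_right mult.assoc[symmetric]
    by (intro arg_cong2[of _ _ _ _ "(+)"] sum.swap)
  have b: "(\<Sum>m\<in>UNIV. B k m * ?f i j m l + B l m * ?f i j k m)
     = (\<Sum>n\<in>UNIV. ph i j n * ((\<Sum>m\<in>UNIV. B k m * ph n m l) + (\<Sum>m\<in>UNIV. B l m * ph n k m)))"
    unfolding sum_distrib_left sum_distrib_right sum.distrib distrib_left mult.left_commute[of "B _ _"]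
    by (intro arg_cong2[of _ _ _ _ "(+)"] sum.swap)
  have c: "(\<Sum>n\<in>UNIV. (\<Sum>m\<in>UNIV. B n m * ph i j m) * ph n k l)
     = - (\<Sum>n\<in>UNIV. ph i j n * (\<Sum>m\<in>UNIV. B n m * ph m k l))"
  proof -
    have pt: "B n m * x * y = - (x * (B m n * y))" for n m x y by (simp add: skew[of n m])
    have "(\<Sum>n\<in>UNIV. (\<Sum>m\<in>UNIV. B n m * ph i j m) * ph n k l)
      = (\<Sum>m\<in>UNIV. \<Sum>n\<in>UNIV. B n m * ph i j m * ph n k l)"
      unfolding sum_distrib_right by (rule sum.swap)
    also have "\<dots> = (\<Sum>m\<in>UNIV. \<Sum>n\<in>UNIV. - (ph i j m * (B m n * ph n k l)))"
      by (intro sum.cong refl pt)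
    finally show ?thesis by (simp add: sum_negf sum_distrib_left)
  qed
  have d: "(\<Sum>m\<in>UNIV. B a m * of_bool (m = b \<and> P)) = B a b * of_bool P"
     "(\<Sum>m\<in>UNIV. B a m * of_bool (P \<and> m = b)) = B a b * of_bool P"
     "(\<Sum>m\<in>UNIV. B a m * of_bool (b = m \<and> P)) = B a b * of_bool P"
     "(\<Sum>m\<in>UNIV. B a m * of_bool (P \<and> b = m)) = B a b * of_bool P" for a b P
    by (cases P; simp add: of_bool_def mult_delta_right)+
  have "(\<Sum>m\<in>UNIV. B i m * ?f m j k l + B j m * ?f i m k l) + (\<Sum>m\<in>UNIV. B k m * ?f i j m l + B l m * ?f i j k m) = 0"
    unfolding a b p1 p2 using c by (simp add: sum_negf)
  then show ?thesis
    unfolding ps_def using skew[of k i] skew[of l i] skew[of k j] skew[of l j]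
    by (simp add: distrib_left right_diff_distrib sum.distrib sum_subtractf d)
qed

section \<open>Contractions of a connection preserving the three-form with the dual
  four-form\<close>

lemma nested5:
  "(\<Sum>(i,j,k,l,m)\<in>UNIV. f i j k l m) = (\<Sum>i\<in>UNIV. \<Sum>j\<in>UNIV. \<Sum>k\<in>UNIV. \<Sum>l\<in>UNIV. \<Sum>m\<in>UNIV. f i j k l m)"
  by (simp add: UNIV_Times_UNIV[symmetric] sum.cartesian_product del: UNIV_Times_UNIV)

lemma nested3:
  "(\<Sum>(i,j,k)\<in>UNIV. f i j k) = (\<Sum>i\<in>UNIV. \<Sum>j\<in>UNIV. \<Sum>k\<in>UNIV. f i j k)"
  by (simp add: UNIV_Times_UNIV[symmetric] sum.cartesian_product del: UNIV_Times_UNIV)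

text \<open>\<open>A i j k\<close> stands for the e_k-component of the derivative of e_j along e_i,
  for a metric connection that preserves \<phi>. The trace condition is the form in which
  unimodularity enters.\<close>

locale g2_skew =
  fixes A :: "7 \<Rightarrow> 7 \<Rightarrow> 7 \<Rightarrow> real"
  assumes g2: "is_g2 (A i)" and tr: "(\<Sum>i\<in>UNIV. A i i j) = 0"
begin

lemma A_skew: "A i k j = - A i j k"
  by (rule is_g2_skew[OF g2])

lemma inv_A: "(\<Sum>m\<in>UNIV. A i a m * ps m b c d + A i b m * ps a m c d + A i c m * ps a b m d + A i d m * ps a b c m) = 0"
  by (rule is_g2_ps_inv[OF g2])

definition QQ :: "(7 \<Rightarrow> 7 \<Rightarrow> 7 \<Rightarrow> real) \<Rightarrow> real" where
  "QQ \<beta> = (\<Sum>(i,j,k,l,m)\<in>UNIV. A i j m * \<beta> m k l * ps i j k l)"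

lemma ps_cyc3: "ps k i j l = ps i j k l" "ps l i k j = ps i j k l"
  by (metis ps_swap12 ps_swap23 ps_swap34 minus_minus)+

text \<open>The invariance of \<star>\<phi> under A_i is taken with the second slot of \<star>\<phi>
  equal to i, contracted with \<beta> and summed over i. Four slots give four terms; the one for the
  slot i contains the trace A_iij and vanishes.\<close>

lemma contract:
  "(\<Sum>(i,j,k,l,m)\<in>UNIV. A i j m * \<beta> m k l * ps i j k l)
    + (\<Sum>(i,j,k,l,m)\<in>UNIV. A i k j * \<beta> m k l * ps m i j l)
    + (\<Sum>(i,j,k,l,m)\<in>UNIV. A i l j * \<beta> m k l * ps m i k j) = 0"
proof -
  have pt0: "A i m j * ps j i k l * x = A i j m * x * ps i j k l" for i j k l m x
    by (simp add: A_skew[of i m j] ps_swap12[of i j])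
  have "(\<Sum>j\<in>UNIV. A i m j * ps j i k l + A i i j * ps m j k l + A i k j * ps m i j l + A i l j * ps m i k j) * \<beta> m k l = 0" for i k l m
    using inv_A[of i m i k l] by simp
  then have "(\<Sum>(i,k,l,m,j)\<in>UNIV. (A i m j * ps j i k l + A i i j * ps m j k l + A i k j * ps m i j l + A i l j * ps m i k j) * \<beta> m k l) = 0"
    unfolding nested5 by (simp add: sum_distrib_right)
  also have "(\<Sum>(i,k,l,m,j)\<in>UNIV. (A i m j * ps j i k l + A i i j * ps m j k l + A i k j * ps m i j l + A i l j * ps m i k j) * \<beta> m k l)
    = (\<Sum>(i,j,k,l,m)\<in>UNIV. (A i m j * ps j i k l + A i i j * ps m j k l + A i k j * ps m i j l + A i l j * ps m i k j) * \<beta> m k l)"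
    by (rule sum.reindex_bij_witness[of _ "\<lambda>(i,j,k,l,m). (i,k,l,m,j)" "\<lambda>(i,k,l,m,j). (i,j,k,l,m)"]) auto
  also have "\<dots> = (\<Sum>(i,j,k,l,m)\<in>UNIV. A i m j * ps j i k l * \<beta> m k l) + (\<Sum>(i,j,k,l,m)\<in>UNIV. A i i j * ps m j k l * \<beta> m k l)
     + (\<Sum>(i,j,k,l,m)\<in>UNIV. A i k j * \<beta> m k l * ps m i j l)
    + (\<Sum>(i,j,k,l,m)\<in>UNIV. A i l j * \<beta> m k l * ps m i k j)"
    by (simp add: case_prod_beta sum.distrib algebra_simps)
  also have "(\<Sum>(i,j,k,l,m)\<in>UNIV. A i i j * ps m j k l * \<beta> m k l) = (\<Sum>(j,k,l,m,i)\<in>UNIV. A i i j * ps m j k l * \<beta> m k l)"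
    by (rule sum.reindex_bij_witness[of _ "\<lambda>(j,k,l,m,i). (i,j,k,l,m)" "\<lambda>(i,j,k,l,m). (j,k,l,m,i)"]) auto
  also have "\<dots> = 0"
    unfolding nested5 by (simp add: sum_distrib_right[symmetric] tr)
  also have "(\<Sum>(i,j,k,l,m)\<in>UNIV. A i m j * ps j i k l * \<beta> m k l) = (\<Sum>(i,j,k,l,m)\<in>UNIV. A i j m * \<beta> m k l * ps i j k l)"
    by (intro sum.cong refl) (auto simp: pt0)
  finally show ?thesis by simp
qed

text \<open>For alternating \<beta> the three terms of \<open>contract\<close> coincide.\<close>

lemma QQ_zero:
  assumes sk1: "\<And>i j k. \<beta> j i k = - \<beta> i j k" and sk2: "\<And>i j k. \<beta> i k j = - \<beta> i j k"
  shows "QQ \<beta> = 0"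
proof -
  have pt1: "A i m j * \<beta> k m l * ps k i j l = A i j m * \<beta> m k l * ps i j k l" for i j k l m
    using A_skew[of i m j] sk1[of m k l] ps_cyc3(1)[of k i j l] by simp
  have "(\<Sum>(i,j,k,l,m)\<in>UNIV. A i k j * \<beta> m k l * ps m i j l) = QQ \<beta>"
    unfolding QQ_def
    by (rule sum.reindex_bij_witness[of _ "\<lambda>(i,j,k,l,m). (i,j,m,l,k)" "\<lambda>(i,j,k,l,m). (i,j,m,l,k)"])
      (auto intro: pt1[symmetric])
  moreover have pt2: "A i m j * \<beta> l k m * ps l i k j = A i j m * \<beta> m k l * ps i j k l" for i j k l m
    using A_skew[of i m j] sk1[of l k m] sk2[of k l m] sk1[of m k l] ps_cyc3(2)[of l i k j] by simp
  then have "(\<Sum>(i,j,k,l,m)\<in>UNIV. A i l j * \<beta> m k l * ps m i k j) = QQ \<beta>"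
    unfolding QQ_def
    by (intro sum.reindex_bij_witness[of _ "\<lambda>(i,j,k,l,m). (i,j,k,m,l)" "\<lambda>(i,j,k,l,m). (i,j,k,m,l)"])
      (auto intro: pt2[symmetric])
  ultimately show ?thesis using contract[of \<beta>] by (simp add: QQ_def)
qed

definition UU :: real where "UU = (\<Sum>(i,j,k)\<in>UNIV. A i j k * A j i k)"

lemma eigA: "(\<Sum>l\<in>UNIV. \<Sum>m\<in>UNIV. A k l m * ps a b l m) = - 2 * A k a b"
  using is_g2_ps[OF g2, of a b k] by (simp add: mult.commute)

text \<open>This is \<open>contract\<close> for a \<beta> that is not alternating. The second term
  meets the eigenvalue equation \<open>eigA\<close> and becomes 2 UU, while the third repeats the
  first.\<close>

lemma SS: "(\<Sum>(i,j,k,l,m)\<in>UNIV. A i j m * A k l m * ps i j k l) = - UU"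
proof -
  let ?S = "\<Sum>(i,j,k,l,m)\<in>UNIV. A i j m * A k l m * ps i j k l"
  have "(\<Sum>(i,j,k,l,m)\<in>UNIV. A i k j * A k l m * ps m i j l)
     = (\<Sum>(i,j,k,l,m)\<in>UNIV. - (A i k j * (A k l m * ps i j l m)))"
  proof (intro sum.cong refl, clarify)
    fix i j k l m
    have "ps m i j l = - ps i j l m" by (metis ps_swap12 ps_swap23 ps_swap34)
    then show "A i k j * A k l m * ps m i j l = - (A i k j * (A k l m * ps i j l m))" by simp
  qed
  also have "\<dots> = - (\<Sum>(i,j,k)\<in>UNIV. A i k j * (- 2 * A k i j))"
    unfolding nested5 nested3 by (simp only: sum_negf sum_distrib_left[symmetric] eigA)
  also have "\<dots> = 2 * (\<Sum>(i,j,k)\<in>UNIV. A i k j * A k i j)"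
    unfolding sum_distrib_left sum_negf[symmetric] by (intro sum.cong refl) auto
  also have "(\<Sum>(i,j,k)\<in>UNIV. A i k j * A k i j) = UU"
    unfolding UU_def
    by (rule sum.reindex_bij_witness[of _ "\<lambda>(i,j,k). (i,k,j)" "\<lambda>(i,j,k). (i,k,j)"]) auto
  finally have 1: "(\<Sum>(i,j,k,l,m)\<in>UNIV. A i k j * A k l m * ps m i j l) = 2 * UU" .
  have pt2: "A i m j * A k m l * ps l i k j = A i j m * A k l m * ps i j k l" for i j k l m
    using A_skew[of i m j] A_skew[of k m l] ps_cyc3(2)[of l i k j] by simp
  then have 2: "(\<Sum>(i,j,k,l,m)\<in>UNIV. A i l j * A k l m * ps m i k j) = ?S"
    by (intro sum.reindex_bij_witness[of _ "\<lambda>(i,j,k,l,m). (i,j,k,m,l)" "\<lambda>(i,j,k,l,m). (i,j,k,m,l)"])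
      (auto intro: pt2[symmetric])
  show ?thesis using contract[of "\<lambda>m k l. A k l m"] 1 2 by simp
qed

text \<open>Let F X Y contract X_ijm Y_mkl with \<star>\<phi>, and let A' be A with its first two
  indices swapped, so that c = A - A' - T. The two closing assumptions are F c T = 0 and F c c = 0.
  The first yields F T T = 0. In the second, F A A = 2 UU, F A A' = UU, F T A = -2 VV, and F A T, F
  T A' and F T T vanish, so that F c c = 2 (UU + VV), where VV is the sum of A_ijk T_ijk.\<close>

lemma jac_contract:
  assumes sk1: "\<And>i j k. T j i k = - T i j k" and sk2: "\<And>i j k. T i k j = - T i j k"
    and c: "\<And>i j k. c i j k = A i j k - A j i k - T i j k"
    and dT: "(\<Sum>(i,j,k,l,m)\<in>UNIV. c i j m * T m k l * ps i j k l) = 0"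
    and jac: "(\<Sum>(i,j,k,l,m)\<in>UNIV. c i j m * c m k l * ps i j k l) = 0"
  shows "UU + (\<Sum>(i,j,k)\<in>UNIV. A i j k * T i j k) = 0"
proof -
  define F :: "(7 \<Rightarrow> 7 \<Rightarrow> 7 \<Rightarrow> real) \<Rightarrow> (7 \<Rightarrow> 7 \<Rightarrow> 7 \<Rightarrow> real) \<Rightarrow> real" where "F = (\<lambda>X Y. \<Sum>(i,j,k,l,m)\<in>UNIV. X i j m * Y m k l * ps i j k l)"
  let ?VV = "\<Sum>(i,j,k)\<in>UNIV. A i j k * T i j k"
  have sw: "F (\<lambda>i j. X j i) Y = - F X Y" for X Y
  proof -
    have "F (\<lambda>i j. X j i) Y = (\<Sum>(i,j,k,l,m)\<in>UNIV. X i j m * Y m k l * ps j i k l)"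
      unfolding F_def
      by (rule sum.reindex_bij_witness[of _ "\<lambda>(i,j,k,l,m). (j,i,k,l,m)" "\<lambda>(i,j,k,l,m). (j,i,k,l,m)"]) auto
    also have "\<dots> = (\<Sum>(i,j,k,l,m)\<in>UNIV. - (X i j m * Y m k l * ps i j k l))"
    proof (intro sum.cong refl, clarify)
      show "X i j m * Y m k l * ps j i k l = - (X i j m * Y m k l * ps i j k l)" for i j k l m
        using ps_swap12[of j i k l] by simp
    qed
    finally show ?thesis by (simp add: F_def sum_negf case_prod_beta)
  qed
  have lin1: "F (\<lambda>i j k. X i j k - X' i j k) Y = F X Y - F X' Y" for X X' Y
    by (simp add: F_def case_prod_beta left_diff_distrib sum_subtractf)
  have lin2: "F X (\<lambda>i j k. Y i j k - Y' i j k) = F X Y - F X Y'" for X Y Y'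
    by (simp add: F_def case_prod_beta left_diff_distrib right_diff_distrib sum_subtractf)
  have ceq: "c = (\<lambda>i j k. A i j k - A j i k - T i j k)" by (simp add: fun_eq_iff c)
  have FAT: "F A T = 0" using QQ_zero[of T, OF sk1 sk2] by (simp add: F_def QQ_def)
  have "F c T = 0" using dT by (simp add: F_def)
  \<comment> \<open>F c T equals 2 F A T - F T T, since c contains A once as it is and once with
    swapped indices and opposite sign.\<close>
  then have FTT: "F T T = 0" unfolding ceq lin1 sw[of A] by (simp add: FAT)
  have UU': "(\<Sum>(i,j,m)\<in>UNIV. A i j m * A m i j) = - UU"
  proof -
    have "(\<Sum>(i,j,m)\<in>UNIV. A i j m * A m i j) = (\<Sum>(i,j,m)\<in>UNIV. - (A i m j * A m i j))"
    proof (intro sum.cong refl, clarify)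
      show "A i j m * A m i j = - (A i m j * A m i j)" for i j m using A_skew[of i j m] by simp
    qed
    also have "\<dots> = - (\<Sum>(i,j,m)\<in>UNIV. A i m j * A m i j)" by (simp add: sum_negf case_prod_beta)
    also have "(\<Sum>(i,j,m)\<in>UNIV. A i m j * A m i j) = UU" unfolding UU_def
      by (rule sum.reindex_bij_witness[of _ "\<lambda>(i,j,k). (i,k,j)" "\<lambda>(i,j,k). (i,k,j)"]) auto
    finally show ?thesis .
  qed
  have FXA: "F X A = - 2 * (\<Sum>(i,j,m)\<in>UNIV. X i j m * A m i j)" for X
  proof -
    have "F X A = (\<Sum>(i,j,m,k,l)\<in>UNIV. X i j m * (A m k l * ps i j k l))"
      unfolding F_def
      by (rule sum.reindex_bij_witness[of _ "\<lambda>(i,j,m,k,l). (i,j,k,l,m)" "\<lambda>(i,j,k,l,m). (i,j,m,k,l)"]) auto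
    also have "\<dots> = (\<Sum>i\<in>UNIV. \<Sum>j\<in>UNIV. \<Sum>m\<in>UNIV. X i j m * (- 2 * A m i j))"
      unfolding nested5 by (simp only: sum_distrib_left[symmetric] eigA)
    finally show ?thesis by (simp add: nested3 sum_distrib_left mult.left_commute)
  qed
  have FAA: "F A A = 2 * UU" using FXA[of A] UU' by simp
  have FTA: "F T A = - 2 * ?VV"
  proof -
    have "(\<Sum>(i,j,m)\<in>UNIV. T i j m * A m i j) = ?VV"
    proof (rule sum.reindex_bij_witness[of _ "\<lambda>(m,i,j). (i,j,m)" "\<lambda>(i,j,m). (m,i,j)"])
      fix x :: "7 \<times> 7 \<times> 7"
      obtain i j m where x: "x = (i,j,m)" by (cases x)
      have "T m i j = T i j m" using sk1[of m i j] sk2[of i m j] by simp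
      then show "(case case x of (i, j, m) \<Rightarrow> (m, i, j) of (i, j, k) \<Rightarrow> A i j k * T i j k) = (case x of (i, j, m) \<Rightarrow> T i j m * A m i j)"
        by (simp add: x)
    qed auto
    then show ?thesis using FXA[of T] by simp
  qed
  have neg: "F X (\<lambda>m k l. A k m l) = - (\<Sum>(i,j,k,l,m)\<in>UNIV. X i j m * A k l m * ps i j k l)" for X
  proof -
    have "F X (\<lambda>m k l. A k m l) = (\<Sum>(i,j,k,l,m)\<in>UNIV. - (X i j m * A k l m * ps i j k l))"
      unfolding F_def
    proof (intro sum.cong refl, clarify)
      show "X i j m * A k m l * ps i j k l = - (X i j m * A k l m * ps i j k l)" for i j k l m
        using A_skew[of k m l] by simp
    qed
    then show ?thesis by (simp add: sum_negf case_prod_beta)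
  qed
  have FAA2: "F A (\<lambda>m k l. A k m l) = UU" using SS neg by simp
  have FTA2: "F T (\<lambda>m k l. A k m l) = 0"
  proof -
    have "(\<Sum>(i,j,k,l,m)\<in>UNIV. T i j m * A k l m * ps i j k l) = F A T"
      unfolding F_def
    proof (rule sum.reindex_bij_witness[of _ "\<lambda>(i,j,k,l,m). (k,l,i,j,m)" "\<lambda>(i,j,k,l,m). (k,l,i,j,m)"])
      fix x :: "7 \<times> 7 \<times> 7 \<times> 7 \<times> 7"
      obtain i j k l m where x: "x = (i,j,k,l,m)" by (cases x)
      have "T m i j = T i j m" using sk1[of m i j] sk2[of i m j] by simp
      moreover have "ps k l i j = ps i j k l" by (metis ps_swap12 ps_swap23 ps_swap34 minus_minus)
      ultimately show "(case case x of (i,j,k,l,m) \<Rightarrow> (k,l,i,j,m) of (i,j,k,l,m) \<Rightarrow> A i j m * T m k l * ps i j k l)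
        = (case x of (i,j,k,l,m) \<Rightarrow> T i j m * A k l m * ps i j k l)"
        by (simp add: x)
    qed auto
    then show ?thesis using neg[of T] FAT by simp
  qed
  have "F c c = 0" using jac by (simp add: F_def)
  then show ?thesis unfolding ceq lin1 lin2 sw[of A] by (simp add: FAT FTT FAA FTA FAA2 FTA2)
qed

end

text \<open>The left side is the scalar curvature of a unimodular group with Levi-Civita
  coefficients G; see \<open>scal_Gc\<close>. Renaming summation indices reduces every product to
  one of the three sums of A_ijk A_jik, of A_ijk T_ijk and of T_ijk^2.\<close>

lemma scal_formula:
  fixes A T c G :: "7 \<Rightarrow> 7 \<Rightarrow> 7 \<Rightarrow> real"
  assumes sk: "\<And>i j k. A i k j = - A i j k"
    and sk1: "\<And>i j k. T j i k = - T i j k" and sk2: "\<And>i j k. T i k j = - T i j k"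
    and c: "\<And>i j k. c i j k = A i j k - A j i k - T i j k"
    and G: "\<And>i j k. G i j k = A i j k - T i j k / 2"
  shows "(\<Sum>(i,j,k)\<in>UNIV. G i j k * G j i k) - (\<Sum>(i,j,k)\<in>UNIV. c i j k * G k j i)
     = - (\<Sum>(i,j,k)\<in>UNIV. A i j k * A j i k) - (\<Sum>(i,j,k)\<in>UNIV. A i j k * T i j k) + (\<Sum>(i,j,k)\<in>UNIV. (T i j k)\<^sup>2) / 4"
proof -
  define S where "S = (\<lambda>f::7 \<Rightarrow> 7 \<Rightarrow> 7 \<Rightarrow> real. \<Sum>(i,j,k)\<in>UNIV. f i j k)"
  have swap: "S (\<lambda>i j k. f j i k) = S f" for f unfolding S_def
    by (rule sum.reindex_bij_witness[of _ "\<lambda>(i,j,k). (j,i,k)" "\<lambda>(i,j,k). (j,i,k)"]) auto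
  have rot: "S (\<lambda>i j k. f k i j) = S f" for f unfolding S_def
    by (rule sum.reindex_bij_witness[of _ "\<lambda>(k,i,j). (i,j,k)" "\<lambda>(i,j,k). (k,i,j)"]) auto
  have add: "S (\<lambda>i j k. f i j k + g i j k) = S f + S g" "S (\<lambda>i j k. f i j k - g i j k) = S f - S g"
     "S (\<lambda>i j k. - f i j k) = - S f" "S (\<lambda>i j k. f i j k / 2) = S f / 2" "S (\<lambda>i j k. f i j k / 4) = S f / 4" for f g
    by (simp_all add: S_def case_prod_beta sum.distrib sum_subtractf sum_negf sum_divide_distrib)
  have Tr: "T k i j = T i j k" "T k j i = - T i j k" for i j k
    using sk1[of k i j] sk2[of i k j] sk1[of k j i] sk2[of j k i] sk1[of i j k] by simp_all
  let ?U = "S (\<lambda>i j k. A i j k * A j i k)" and ?V = "S (\<lambda>i j k. A i j k * T i j k)" and ?W = "S (\<lambda>i j k. T i j k * T i j k)"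
  have r2: "S (\<lambda>i j k. T i j k * A j i k) = - ?V"
  proof -
    have pt: "T j i k * A i j k = - (A i j k * T i j k)" for i j k by (simp add: sk1[of j i k])
    have "S (\<lambda>i j k. T i j k * A j i k) = S (\<lambda>i j k. - (A i j k * T i j k))"
      unfolding pt[symmetric] by (rule swap)
    then show ?thesis by (simp add: add)
  qed
  have r4: "S (\<lambda>i j k. A i j k * A k i j) = - ?U"
  proof -
    have "S (\<lambda>i j k. A i j k * A k i j) = S (\<lambda>i j k. A j k i * A i j k)"
      by (subst rot[symmetric]) simp
    also have pt: "A j k i * A i j k = - (A i j k * A j i k)" for i j k by (simp add: sk[of j k i])
    then have "S (\<lambda>i j k. A j k i * A i j k) = S (\<lambda>i j k. - (A i j k * A j i k))"
      by (simp only: pt)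
    finally show ?thesis by (simp add: add)
  qed
  have r6: "S (\<lambda>i j k. A j i k * A k i j) = ?U"
  proof -
    have "S (\<lambda>i j k. A j i k * A k i j) = S (\<lambda>i j k. A i j k * A k j i)"
      by (subst swap[symmetric]) simp
    also have pt: "A i j k * A k j i = - (A i j k * A k i j)" for i j k by (simp add: sk[of k j i])
    then have "S (\<lambda>i j k. A i j k * A k j i) = S (\<lambda>i j k. - (A i j k * A k i j))"
      by (simp only: pt)
    finally show ?thesis by (simp add: add r4)
  qed
  have r8: "S (\<lambda>i j k. T i j k * A k i j) = ?V"
    by (subst rot[of "\<lambda>i j k. A i j k * T i j k", symmetric]) (simp add: Tr(1) mult.commute)
  have g1: "G i j k * G j i k = A i j k * A j i k + A i j k * T i j k / 2 - T i j k * A j i k / 2 - T i j k * T i j k / 4" for i j k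
    unfolding G sk1[of j i k] by (simp add: field_simps)
  have g2: "c i j k * G k j i = - (A i j k * A k i j) + A i j k * T i j k / 2 + A j i k * A k i j
     - T i j k * A j i k / 2 + T i j k * A k i j - T i j k * T i j k / 2" for i j k
    unfolding G c Tr(2)[of k j i] sk[of k j i] by (simp add: field_simps)
  have "S (\<lambda>i j k. G i j k * G j i k) - S (\<lambda>i j k. c i j k * G k j i) = - ?U - ?V + ?W / 4"
    unfolding g1 g2 add r2 r4 r6 r8 by simp
  then show ?thesis by (simp add: S_def power2_eq_square)
qed

section \<open>The torsion-free case: curvature with values in the Lie algebra and the Chern-Simons
  form\<close>

lemma nested6:
  "(\<Sum>(i,j,k,l,m,n)\<in>UNIV. f i j k l m n) = (\<Sum>i\<in>UNIV. \<Sum>j\<in>UNIV. \<Sum>k\<in>UNIV. \<Sum>l\<in>UNIV. \<Sum>m\<in>UNIV. \<Sum>n\<in>UNIV. f i j k l m n)"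
  by (simp add: UNIV_Times_UNIV[symmetric] sum.cartesian_product del: UNIV_Times_UNIV)

lemma nested4:
  "(\<Sum>(i,j,k,l)\<in>UNIV. f i j k l) = (\<Sum>i\<in>UNIV. \<Sum>j\<in>UNIV. \<Sum>k\<in>UNIV. \<Sum>l\<in>UNIV. f i j k l)"
  by (simp add: UNIV_Times_UNIV[symmetric] sum.cartesian_product del: UNIV_Times_UNIV)

lemma ps_cyc124: "ps j l k i = ps i j k l"
  by (metis ps_swap12 ps_swap23 ps_swap34 minus_minus)

lemma ps_pair: "ps k l i j = ps i j k l"
  by (metis ps_swap12 ps_swap23 ps_swap34 minus_minus)

lemma ps_cyc4: "ps l i j k = - ps i j k l"
  by (metis ps_swap12 ps_swap23 ps_swap34 minus_minus)

text \<open>In the contraction of the product B C with \<phi>, \<open>is_g2_ph\<close> moves B to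
  the other two slots. One of the new terms is the contraction of C B, the other vanishes by the
  equations for C.\<close>

lemma is_g2_commutator:
  assumes B: "is_g2 B" and C: "is_g2 C"
  shows "is_g2 (\<lambda>a b. \<Sum>p\<in>UNIV. C a p * B p b - B a p * C p b)"
  unfolding is_g2_def
proof (intro conjI allI)
  fix a b
  have "(\<Sum>p\<in>UNIV. C b p * B p a - B b p * C p a) = (\<Sum>p\<in>UNIV. - (C a p * B p b - B a p * C p b))"
    by (intro sum.cong refl) (simp add: is_g2_skew[OF B, of b] is_g2_skew[OF C, of b] is_g2_skew[OF B, of _ a] is_g2_skew[OF C, of _ a])
  then show "(\<Sum>p\<in>UNIV. C b p * B p a - B b p * C p a) = - (\<Sum>p\<in>UNIV. C a p * B p b - B a p * C p b)"
    by (simp only: sum_negf)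
next
  fix l
  have "(\<Sum>j\<in>UNIV. B j p * ph j k l) = (\<Sum>m\<in>UNIV. B k m * ph p m l) + (\<Sum>m\<in>UNIV. B l m * ph p k m)" for p k
  proof -
    have "(\<Sum>j\<in>UNIV. B j p * ph j k l) = - (\<Sum>m\<in>UNIV. B p m * ph m k l)"
      unfolding sum_negf[symmetric] by (intro sum.cong refl) (simp add: is_g2_skew[OF B, of _ p])
    moreover have "(\<Sum>m\<in>UNIV. B p m * ph m k l + B k m * ph p m l + B l m * ph p k m) = 0"
      by (rule is_g2_ph[OF B])
    ultimately show ?thesis by (simp add: sum.distrib)
  qed
  note * = this
  have 1: "(\<Sum>j\<in>UNIV. \<Sum>k\<in>UNIV. (\<Sum>p\<in>UNIV. B j p * C p k) * ph j k l)
     = (\<Sum>p\<in>UNIV. \<Sum>k\<in>UNIV. C p k * (\<Sum>j\<in>UNIV. B j p * ph j k l))"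
  proof -
    have "(\<Sum>j\<in>UNIV. \<Sum>k\<in>UNIV. (\<Sum>p\<in>UNIV. B j p * C p k) * ph j k l)
      = (\<Sum>(j,k,p)\<in>UNIV. B j p * C p k * ph j k l)"
      by (simp add: nested3 sum_distrib_right)
    also have "\<dots> = (\<Sum>(p,k,j)\<in>UNIV. B j p * C p k * ph j k l)"
      by (rule sum.reindex_bij_witness[of _ "\<lambda>(p,k,j). (j,k,p)" "\<lambda>(j,k,p). (p,k,j)"]) auto
    also have "\<dots> = (\<Sum>p\<in>UNIV. \<Sum>k\<in>UNIV. C p k * (\<Sum>j\<in>UNIV. B j p * ph j k l))"
      by (simp add: nested3 sum_distrib_left mult.left_commute mult.assoc)
    finally show ?thesis .
  qed
  have "(\<Sum>p\<in>UNIV. \<Sum>k\<in>UNIV. C p k * (\<Sum>m\<in>UNIV. B l m * ph p k m)) = 0"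
  proof -
    have "(\<Sum>p\<in>UNIV. \<Sum>k\<in>UNIV. C p k * (\<Sum>m\<in>UNIV. B l m * ph p k m)) = (\<Sum>(p,k,m)\<in>UNIV. B l m * (C p k * ph p k m))"
      by (simp add: nested3 sum_distrib_left mult.left_commute)
    also have "\<dots> = (\<Sum>(m,p,k)\<in>UNIV. B l m * (C p k * ph p k m))"
      by (rule sum.reindex_bij_witness[of _ "\<lambda>(m,p,k). (p,k,m)" "\<lambda>(p,k,m). (m,p,k)"]) auto
    also have "\<dots> = 0"
      by (simp only: nested3 sum_distrib_left[symmetric] is_g2_phD[OF C]) simp
    finally show ?thesis .
  qed
  moreover have "(\<Sum>p\<in>UNIV. \<Sum>k\<in>UNIV. C p k * (\<Sum>m\<in>UNIV. B k m * ph p m l))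
    = (\<Sum>j\<in>UNIV. \<Sum>k\<in>UNIV. (\<Sum>p\<in>UNIV. C j p * B p k) * ph j k l)"
  proof -
    have "(\<Sum>p\<in>UNIV. \<Sum>k\<in>UNIV. C p k * (\<Sum>m\<in>UNIV. B k m * ph p m l)) = (\<Sum>(p,k,m)\<in>UNIV. C p k * B k m * ph p m l)"
      by (simp add: nested3 sum_distrib_left mult.assoc)
    also have "\<dots> = (\<Sum>(j,k,p)\<in>UNIV. C j p * B p k * ph j k l)"
      by (rule sum.reindex_bij_witness[of _ "\<lambda>(j,k,p). (j,p,k)" "\<lambda>(j,k,p). (j,p,k)"]) auto
    also have "\<dots> = (\<Sum>j\<in>UNIV. \<Sum>k\<in>UNIV. (\<Sum>p\<in>UNIV. C j p * B p k) * ph j k l)"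
      by (simp add: nested3 sum_distrib_right)
    finally show ?thesis .
  qed
  ultimately have "(\<Sum>j\<in>UNIV. \<Sum>k\<in>UNIV. (\<Sum>p\<in>UNIV. B j p * C p k) * ph j k l)
    = (\<Sum>j\<in>UNIV. \<Sum>k\<in>UNIV. (\<Sum>p\<in>UNIV. C j p * B p k) * ph j k l)"
    unfolding 1 * distrib_left sum.distrib by simp
  then show "(\<Sum>j\<in>UNIV. \<Sum>k\<in>UNIV. (\<Sum>p\<in>UNIV. C j p * B p k - B j p * C p k) * ph j k l) = 0"
    by (simp add: sum_subtractf left_diff_distrib)
qed

lemma is_g2_diff:
  assumes "is_g2 B" "is_g2 C"
  shows "is_g2 (\<lambda>a b. B a b - C a b)"
  unfolding is_g2_def
proof (intro conjI allI)
  show "B j i - C j i = - (B i j - C i j)" for i j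
    by (simp add: is_g2_skew[OF assms(1), of j] is_g2_skew[OF assms(2), of j])
qed (simp add: left_diff_distrib sum_subtractf is_g2_phD assms)

lemma is_g2_sum:
  assumes "\<And>m. is_g2 (B m)"
  shows "is_g2 (\<lambda>a b. \<Sum>m\<in>UNIV. (x m::real) * B (m::7) a b)"
  unfolding is_g2_def
proof (intro conjI allI)
  show "(\<Sum>m\<in>UNIV. x m * B m j i) = - (\<Sum>m\<in>UNIV. x m * B m i j)" for i j
    unfolding sum_negf[symmetric] by (intro sum.cong refl) (simp add: is_g2_skew[OF assms, where j=j and i=i])
  fix l
  have "(\<Sum>j\<in>UNIV. \<Sum>k\<in>UNIV. (\<Sum>m\<in>UNIV. x m * B m j k) * ph j k l)
    = (\<Sum>(j,k,m)\<in>UNIV. x m * (B m j k * ph j k l))"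
    by (simp add: nested3 sum_distrib_right mult.assoc)
  also have "\<dots> = (\<Sum>(m,j,k)\<in>UNIV. x m * (B m j k * ph j k l))"
    by (rule sum.reindex_bij_witness[of _ "\<lambda>(m,p,k). (p,k,m)" "\<lambda>(p,k,m). (m,p,k)"]) auto
  also have "\<dots> = 0"
    by (simp only: nested3 sum_distrib_left[symmetric] is_g2_phD[OF assms]) simp
  finally show "(\<Sum>j\<in>UNIV. \<Sum>k\<in>UNIV. (\<Sum>m\<in>UNIV. x m * B m j k) * ph j k l) = 0" .
qed

lemma trace_linear: "linear (trace :: real^'n^'n \<Rightarrow> real)"
  by (rule linearI) (simp_all add: trace_def sum.distrib sum_distrib_left)

lemma trace_diff: "trace (X - Y :: real^'n^'n) = trace X - trace Y"
  using linear_diff[OF trace_linear] .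

lemma matrix_diff_left: "(X - Y) ** (Z :: real^'n^'n) = X ** Z - Y ** Z"
  by (simp add: vec_eq_iff matrix_matrix_mult_def sum_subtractf left_diff_distrib)

lemma matrix_diff_right: "(Z :: real^'n^'n) ** (X - Y) = Z ** X - Z ** Y"
  by (simp add: vec_eq_iff matrix_matrix_mult_def sum_subtractf right_diff_distrib)

lemma matrix_sum_left: "(\<Sum>m\<in>I. x m *\<^sub>R X m) ** (Z :: real^'n^'n) = (\<Sum>m\<in>I. x m *\<^sub>R (X m ** Z))"
proof -
  interpret linear "\<lambda>X. X ** Z"
    by (rule linearI) (simp_all add: vec_eq_iff matrix_matrix_mult_def sum.distrib distrib_right sum_distrib_left mult.assoc)
  show ?thesis by (simp add: sum scale)
qed

lemma matrix_sum_right: "(Z :: real^'n^'n) ** (\<Sum>m\<in>I. x m *\<^sub>R X m) = (\<Sum>m\<in>I. x m *\<^sub>R (Z ** X m))"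
proof -
  interpret linear "\<lambda>X. Z ** X"
    by (rule linearI) (simp_all add: vec_eq_iff matrix_matrix_mult_def sum.distrib distrib_left sum_distrib_left mult.left_commute)
  show ?thesis by (simp add: sum scale)
qed

lemma trace_sum: "trace (\<Sum>m\<in>I. x m *\<^sub>R X m :: real^'n^'n) = (\<Sum>m\<in>I. x m * trace (X m))"
  by (simp add: linear_sum[OF trace_linear] linear_scale[OF trace_linear])

text \<open>The case T = 0. The relation between c and A says that the connection has no torsion, so
  A is the Levi-Civita connection.\<close>

locale g2_parallel = g2_skew +
  fixes c :: "7 \<Rightarrow> 7 \<Rightarrow> 7 \<Rightarrow> real"
  assumes c: "c i j k = A i j k - A j i k"
    and jac: "(\<Sum>m\<in>UNIV. c i j m * c m l n + c j l m * c m i n + c l i m * c m j n) = 0"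
begin

lemma c_swap: "c j i k = - c i j k" by (simp add: c)

text \<open>Up to a factor the sum is the inner product of d\<beta> with \<star>\<phi>. Both halves
  of c = A_ijk - A_jik contribute the same, and \<open>QQ_zero\<close> applies to each.\<close>

lemma cQ:
  assumes sk1: "\<And>i j k. \<beta> j i k = - \<beta> i j k" and sk2: "\<And>i j k. \<beta> i k j = - \<beta> i j k"
  shows "(\<Sum>(i,j,k,l,m)\<in>UNIV. c i j m * \<beta> m k l * ps i j k l) = 0"
proof -
  have "(\<Sum>(i,j,k,l,m)\<in>UNIV. A j i m * \<beta> m k l * ps i j k l) = (\<Sum>(i,j,k,l,m)\<in>UNIV. A i j m * \<beta> m k l * ps j i k l)"
    by (rule sum.reindex_bij_witness[of _ "\<lambda>(i,j,k,l,m). (j,i,k,l,m)" "\<lambda>(i,j,k,l,m). (j,i,k,l,m)"]) auto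
  also have "\<dots> = (\<Sum>(i,j,k,l,m)\<in>UNIV. - (A i j m * \<beta> m k l * ps i j k l))"
  proof (intro sum.cong refl, clarify)
    show "A i j m * \<beta> m k l * ps j i k l = - (A i j m * \<beta> m k l * ps i j k l)" for i j k l m
      using ps_swap12[of j i k l] by simp
  qed
  finally have "(\<Sum>(i,j,k,l,m)\<in>UNIV. A j i m * \<beta> m k l * ps i j k l) = 0"
    using QQ_zero[of \<beta>, OF sk1 sk2] by (simp add: QQ_def sum_negf case_prod_beta)
  then show ?thesis using QQ_zero[of \<beta>, OF sk1 sk2]
    by (simp add: c left_diff_distrib case_prod_beta sum_subtractf QQ_def)
qed

text \<open>Cyclic permutation of the slots 1, 2 and 4 leaves \<open>ps\<close> unchanged, so the
  contraction sees only the cyclic sum over i, j, l, which is zero by the Jacobi identity.\<close>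

lemma jac_ps: "(\<Sum>(i,j,l)\<in>UNIV. (\<Sum>m\<in>UNIV. c i j m * c m l n) * ps i j k l) = 0"
proof -
  define H where "H = (\<lambda>i j l. (\<Sum>m\<in>UNIV. c i j m * c m l n))"
  let ?S = "\<Sum>(i,j,l)\<in>UNIV. H i j l * ps i j k l"
  have 1: "(\<Sum>(i,j,l)\<in>UNIV. H j l i * ps i j k l) = ?S"
    by (rule sum.reindex_bij_witness[of _ "\<lambda>(j,l,i). (i,j,l)" "\<lambda>(i,j,l). (j,l,i)"]) (auto intro: ps_cyc124 ps_cyc124[symmetric])
  have 2: "(\<Sum>(i,j,l)\<in>UNIV. H l i j * ps i j k l) = ?S"
    by (rule sum.reindex_bij_witness[of _ "\<lambda>(l,i,j). (i,j,l)" "\<lambda>(i,j,l). (l,i,j)"]) (auto intro: ps_cyc124 ps_cyc124[symmetric])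
  have "H i j l + H j l i + H l i j = 0" for i j l
    using jac[of i j l n] by (simp add: H_def sum.distrib)
  then have "(\<Sum>(i,j,l)\<in>UNIV. (H i j l + H j l i + H l i j) * ps i j k l) = 0" by simp
  then have "?S + ?S + ?S = 0"
    using 1 2 by (simp add: distrib_right case_prod_beta sum.distrib)
  then show ?thesis by (simp add: H_def)
qed

text \<open>The matrix t is kept arbitrary; in \<open>Chern_Simons\<close> it is the trace form, and
  the sum collects the terms with a bracket inside a bracket.\<close>

lemma jac_contract1: "(\<Sum>(i,j,k,l,m)\<in>UNIV. c i j m * (\<Sum>n\<in>UNIV. c m l n * t n k) * ps i j k l) = 0"
proof -
  have "(\<Sum>(i,j,k,l,m)\<in>UNIV. c i j m * (\<Sum>n\<in>UNIV. c m l n * t n k) * ps i j k l)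
    = (\<Sum>(i,j,k,l,m,n)\<in>UNIV. t n k * (c i j m * c m l n * ps i j k l))"
    unfolding nested6 nested5 sum_distrib_left sum_distrib_right by (intro sum.cong refl) (simp add: mult_ac)
  also have "\<dots> = (\<Sum>(k,n,i,j,l,m)\<in>UNIV. t n k * (c i j m * c m l n * ps i j k l))"
    by (rule sum.reindex_bij_witness[of _ "\<lambda>(k,n,i,j,l,m). (i,j,k,l,m,n)" "\<lambda>(i,j,k,l,m,n). (k,n,i,j,l,m)"]) auto
  also have "\<dots> = (\<Sum>k\<in>UNIV. \<Sum>n\<in>UNIV. t n k * (\<Sum>(i,j,l)\<in>UNIV. (\<Sum>m\<in>UNIV. c i j m * c m l n) * ps i j k l))"
    unfolding nested6 nested3 by (simp only: sum_distrib_left sum_distrib_right)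
  finally show ?thesis by (simp add: jac_ps)
qed

lemma jac_contract2: "(\<Sum>(i,j,k,l,m)\<in>UNIV. c i j m * (\<Sum>n\<in>UNIV. c m k n * t n l) * ps i j k l) = 0"
proof -
  have "(\<Sum>(i,j,k,l,m)\<in>UNIV. c i j m * (\<Sum>n\<in>UNIV. c m k n * t n l) * ps i j k l)
    = (\<Sum>(i,j,k,l,m)\<in>UNIV. c i j m * (\<Sum>n\<in>UNIV. c m l n * t n k) * ps i j l k)"
    by (rule sum.reindex_bij_witness[of _ "\<lambda>(i,j,k,l,m). (i,j,l,k,m)" "\<lambda>(i,j,k,l,m). (i,j,l,k,m)"]) auto
  also have "\<dots> = (\<Sum>(i,j,k,l,m)\<in>UNIV. - (c i j m * (\<Sum>n\<in>UNIV. c m l n * t n k) * ps i j k l))"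
  proof (intro sum.cong refl, clarify)
    show "c i j m * (\<Sum>n\<in>UNIV. c m l n * t n k) * ps i j l k = - (c i j m * (\<Sum>n\<in>UNIV. c m l n * t n k) * ps i j k l)" for i j k l m
      using ps_swap34[of i j l k] by simp
  qed
  finally show ?thesis using jac_contract1[of t] by (simp add: sum_negf case_prod_beta)
qed

text \<open>Transposed, so that \<open>G i\<close> acts on column vectors as the covariant
  derivative along e_i.\<close>

definition G :: "7 \<Rightarrow> real^7^7" where "G i = (\<chi> b a. A i a b)"

definition R :: "7 \<Rightarrow> 7 \<Rightarrow> real^7^7" where
  "R i j = G i ** G j - G j ** G i - (\<Sum>m\<in>UNIV. c i j m *\<^sub>R G m)"

text \<open>Write R = X - M with the commutator part X and the part M linear in c. The trace of a
  fourfold product is cyclic while \<star>\<phi> is odd under a 4-cycle, so X X contributes nothing.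
  The mixed terms pair dG with the 3-form tr(G [G, G]), and M M leads to the cyclic sum of tr(G dG).
  These are the two pieces of the Chern-Simons form, and \<open>cQ\<close> applies to both.\<close>

lemma Chern_Simons: "(\<Sum>(i,j,k,l)\<in>UNIV. ps i j k l * trace (R i j ** R k l)) = 0"
proof -
  define X where "X = (\<lambda>i j. G i ** G j - G j ** G i)"
  define M where "M = (\<lambda>i j. \<Sum>m\<in>UNIV. c i j m *\<^sub>R G m)"
  define S where "S = (\<lambda>f. \<Sum>(i,j,k,l)\<in>UNIV. ps i j k l * (f i j k l :: real))"
  have add: "S (\<lambda>i j k l. f i j k l + g i j k l) = S f + S g" "S (\<lambda>i j k l. f i j k l - g i j k l) = S f - S g" for f g
    by (simp_all add: S_def case_prod_beta sum.distrib sum_subtractf distrib_left right_diff_distrib)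
  have p4: "- (ps i j k l * x) = ps l i j k * x" and p12: "- (ps i j k l * x) = ps j i k l * x"
     and p34: "- (ps i j k l * x) = ps i j l k * x" for i j k l x
    by (simp_all add: ps_cyc4[of l i j k] ps_swap12[of j i k l] ps_swap34[of i j l k])
  have rot: "S (\<lambda>i j k l. f j k l i) = - S f" for f
  proof -
    have "S (\<lambda>i j k l. f j k l i) = (\<Sum>(i,j,k,l)\<in>UNIV. - (ps i j k l * f i j k l))"
      unfolding S_def
      by (rule sum.reindex_bij_witness[of _ "\<lambda>(j,k,l,i). (i,j,k,l)" "\<lambda>(i,j,k,l). (j,k,l,i)"]) (auto intro: p4)
    then show ?thesis by (simp add: S_def sum_negf case_prod_beta)
  qed
  have s12: "S (\<lambda>i j k l. f j i k l) = - S f" for f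
  proof -
    have "S (\<lambda>i j k l. f j i k l) = (\<Sum>(i,j,k,l)\<in>UNIV. - (ps i j k l * f i j k l))"
      unfolding S_def
      by (rule sum.reindex_bij_witness[of _ "\<lambda>(j,i,k,l). (i,j,k,l)" "\<lambda>(i,j,k,l). (j,i,k,l)"]) (auto intro: p12)
    then show ?thesis by (simp add: S_def sum_negf case_prod_beta)
  qed
  have s34: "S (\<lambda>i j k l. f i j l k) = - S f" for f
  proof -
    have "S (\<lambda>i j k l. f i j l k) = (\<Sum>(i,j,k,l)\<in>UNIV. - (ps i j k l * f i j k l))"
      unfolding S_def
      by (rule sum.reindex_bij_witness[of _ "\<lambda>(i,j,l,k). (i,j,k,l)" "\<lambda>(i,j,k,l). (i,j,l,k)"]) (auto intro: p34)
    then show ?thesis by (simp add: S_def sum_negf case_prod_beta)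
  qed
  have pair: "S (\<lambda>i j k l. f k l i j) = S f" for f
    unfolding S_def
    by (rule sum.reindex_bij_witness[of _ "\<lambda>(k,l,i,j). (i,j,k,l)" "\<lambda>(i,j,k,l). (k,l,i,j)"]) (auto intro: ps_pair ps_pair[symmetric])
  define t where "t = (\<lambda>i j k l. trace (G i ** G j ** G k ** G l))"
  have tc: "t i j k l = t j k l i" for i j k l
    unfolding t_def using trace_mul_sym[of "G i" "G j ** G k ** G l"] by (simp add: matrix_mul_assoc)
  have "t = (\<lambda>i j k l. t j k l i)" by (intro ext tc)
  then have "S t = S (\<lambda>i j k l. t j k l i)" by (rule arg_cong)
  then have t0: "S t = 0" using rot[of t] by simp
  have XX: "trace (X i j ** X k l) = t i j k l - t i j l k - t j i k l + t j i l k" for i j k l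
    unfolding X_def t_def by (simp add: matrix_diff_left matrix_diff_right trace_diff matrix_mul_assoc)
  have a: "S (\<lambda>i j k l. trace (X i j ** X k l)) = 0"
    unfolding XX add s12[of "\<lambda>i j k l. t i j l k"] s34[of t] s12[of t] t0 by simp
  define \<beta> where "\<beta> = (\<lambda>m k l. trace (G m ** X k l))"
  have b: "S (\<lambda>i j k l. trace (M i j ** X k l)) = 0"
  proof -
    have "\<beta> i k j = - \<beta> i j k" for i j k
      by (simp add: \<beta>_def X_def matrix_diff_right trace_diff)
    moreover have "\<beta> j i k = - \<beta> i j k" for i j k
    proof -
      have "trace (G j ** G i ** G k) = trace (G i ** G k ** G j)"
        "trace (G j ** G k ** G i) = trace (G i ** G j ** G k)"
        using trace_mul_sym[of "G j" "G i ** G k"] trace_mul_sym[of "G j ** G k" "G i"] by (simp_all add: matrix_mul_assoc)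
      then show ?thesis by (simp add: \<beta>_def X_def matrix_diff_right trace_diff matrix_mul_assoc)
    qed
    ultimately have "(\<Sum>(i,j,k,l,m)\<in>UNIV. c i j m * \<beta> m k l * ps i j k l) = 0" by (rule cQ[rotated])
    moreover have "S (\<lambda>i j k l. trace (M i j ** X k l)) = (\<Sum>(i,j,k,l,m)\<in>UNIV. c i j m * \<beta> m k l * ps i j k l)"
      unfolding S_def nested5 nested4 M_def matrix_sum_left trace_sum \<beta>_def sum_distrib_left
      by (intro sum.cong refl) (simp add: mult_ac)
    ultimately show ?thesis by simp
  qed
  have b': "S (\<lambda>i j k l. trace (X i j ** M k l)) = 0"
  proof -
    have "(\<lambda>i j k l. trace (X i j ** M k l)) = (\<lambda>i j k l. trace (M k l ** X i j))"
      by (intro ext trace_mul_sym)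
    then show ?thesis using b pair[of "\<lambda>i j k l. trace (M i j ** X k l)"] by (simp only:)
  qed
  define t2 where "t2 = (\<lambda>m n. trace (G m ** G n))"
  define s where "s = (\<lambda>k l m. \<Sum>n\<in>UNIV. c k l n * t2 n m)"
  have d: "S (\<lambda>i j k l. trace (M i j ** M k l)) = 0"
  proof -
    have ss: "s l k m = - s k l m" for k l m
      unfolding s_def sum_negf[symmetric] by (intro sum.cong refl) (simp add: c_swap[of l k])
    \<comment> \<open>s is skew only in its first two arguments; the cyclic sum is totally skew and
      is, up to sign, the 3-form tr(G \<and> dG). The two terms added to s to obtain it are removed
      again by the contracted Jacobi identity.\<close>
    let ?b = "\<lambda>m k l. s k l m + s l m k + s m k l"
    have 0: "(\<Sum>(i,j,k,l,m)\<in>UNIV. c i j m * ?b m k l * ps i j k l) = 0"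
    proof (rule cQ)
      show "?b j i k = - ?b i j k" for i j k
        using ss[of j i k] ss[of k i j] ss[of k j i] by simp
      show "?b i k j = - ?b i j k" for i j k
        using ss[of k i j] ss[of j i k] ss[of k j i] by simp
    qed
    have alg: "w = x + y - z \<Longrightarrow> a * w * p = a * x * p + a * y * p - a * z * p" for w x y z a p :: real
      by hypsubst (simp add: algebra_simps)
    have 1: "(\<Sum>(i,j,k,l,m)\<in>UNIV. c i j m * s m l k * ps i j k l) = 0"
      unfolding s_def by (rule jac_contract1)
    have 2: "(\<Sum>(i,j,k,l,m)\<in>UNIV. c i j m * s m k l * ps i j k l) = 0"
      unfolding s_def by (rule jac_contract2)
    have "(\<Sum>(i,j,k,l,m)\<in>UNIV. c i j m * s k l m * ps i j k l)
      = (\<Sum>(i,j,k,l,m)\<in>UNIV. c i j m * ?b m k l * ps i j k l + c i j m * s m l k * ps i j k l - c i j m * s m k l * ps i j k l)"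
    proof (intro sum.cong refl, clarify)
      fix i j k l m
      have "s k l m = ?b m k l + s m l k - s m k l" using ss[of m l k] by simp
      then show "c i j m * s k l m * ps i j k l = c i j m * ?b m k l * ps i j k l + c i j m * s m l k * ps i j k l - c i j m * s m k l * ps i j k l"
        by (rule alg)
    qed
    also have "\<dots> = 0" using 0 1 2 by (simp add: case_prod_beta sum.distrib sum_subtractf)
    finally have "(\<Sum>(i,j,k,l,m)\<in>UNIV. c i j m * s k l m * ps i j k l) = 0" .
    moreover have "trace (G m ** M k l) = s k l m" for k l m
      unfolding M_def matrix_sum_right trace_sum s_def t2_def by (simp add: trace_mul_sym[of "G m"])
    then have "S (\<lambda>i j k l. trace (M i j ** M k l)) = (\<Sum>(i,j,k,l,m)\<in>UNIV. c i j m * s k l m * ps i j k l)"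
      unfolding S_def nested5 nested4 M_def[of ] matrix_sum_left trace_sum sum_distrib_left
      by (intro sum.cong refl) (simp add: mult_ac)
    ultimately show ?thesis by simp
  qed
  have RR: "trace (R i j ** R k l) = trace (X i j ** X k l) - trace (X i j ** M k l) - trace (M i j ** X k l) + trace (M i j ** M k l)" for i j k l
  proof -
    have "R i j = X i j - M i j" for i j by (simp add: R_def X_def M_def)
    then show ?thesis by (simp add: matrix_diff_left matrix_diff_right trace_diff)
  qed
  have "S (\<lambda>i j k l. trace (R i j ** R k l)) = 0"
    unfolding RR add a b b' d by simp
  then show ?thesis by (simp add: S_def)
qed

end

lemma pair_symmetry:
  fixes r :: "'a \<Rightarrow> 'a \<Rightarrow> 'a \<Rightarrow> 'a \<Rightarrow> real"
  assumes s1: "\<And>i j a b. r j i a b = - r i j a b" and s2: "\<And>i j a b. r i j b a = - r i j a b"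
    and bianchi: "\<And>i j a b. r i j a b + r j a i b + r a i j b = 0"
  shows "r a b i j = r i j a b"
proof -
  have "r i a b j = r a i j b" using s1[of i a b j] s2[of a i b j] by simp
  moreover have "r j b i a = r b j a i" using s1[of j b i a] s2[of b j i a] by simp
  ultimately show ?thesis
    using bianchi[of i j a b] bianchi[of j a b i] bianchi[of a b i j] bianchi[of b i j a]
      s2[of j a b i] s2[of a b j i] s2[of b i a j] s2[of i j b a]
    by linarith
qed

context g2_parallel
begin

lemma R_entry: "R i j $ b $ a = (\<Sum>p\<in>UNIV. A j a p * A i p b - A i a p * A j p b) - (\<Sum>p\<in>UNIV. c i j p * A p a b)"
  by (simp add: R_def G_def matrix_matrix_mult_def sum_subtractf mult.commute)

lemma R_g2: "is_g2 (\<lambda>a b. R i j $ b $ a)"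
  unfolding R_entry by (intro is_g2_diff is_g2_commutator is_g2_sum g2)

lemma R_bianchi: "R i j $ b $ a + R j a $ b $ i + R a i $ b $ j = 0"
proof -
  have "R i j $ b $ a + R j a $ b $ i + R a i $ b $ j
    = (\<Sum>p\<in>UNIV. (A j a p * A i p b - A i a p * A j p b - c i j p * A p a b)
      + (A a i p * A j p b - A j i p * A a p b - c j a p * A p i b)
      + (A i j p * A a p b - A a j p * A i p b - c a i p * A p j b))"
    unfolding R_entry by (simp add: sum.distrib sum_subtractf)
  also have "\<dots> = (\<Sum>p\<in>UNIV. - (c i j p * c p a b + c j a p * c p i b + c a i p * c p j b))"
    by (intro sum.cong refl) (simp add: c algebra_simps)
  also have "\<dots> = 0" using jac[of i j a b] by (simp only: sum_negf)
  finally show ?thesis .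
qed

lemma R_swap: "R j i = - R i j"
  unfolding R_def by (simp add: c_swap[of j i] sum_negf)

lemma flat: "R i j = 0"
proof -
  define r where "r = (\<lambda>i j a b. R i j $ b $ a)"
  have s1: "r j i a b = - r i j a b" for i j a b by (simp add: r_def R_swap[of j i])
  have s2: "r i j b a = - r i j a b" for i j a b
    unfolding r_def by (rule is_g2_skew[OF R_g2])
  have pair: "r a b i j = r i j a b" for i j a b
    by (rule pair_symmetry[OF s1 s2]) (simp add: r_def R_bianchi)
  \<comment> \<open>Pair symmetry transfers the g2-property from the endomorphism indices to the
    form indices, the ones that are contracted with \<open>ps\<close>; there \<open>ps\<close> acts
    as -2.\<close>
  have "is_g2 (r a b)" for a b using R_g2[of a b] by (simp add: r_def)
  moreover have "(\<lambda>k l. r k l a b) = r a b" for a b by (intro ext pair)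
  ultimately have "is_g2 (\<lambda>k l. r k l a b)" for a b by simp
  from is_g2_ps[OF this] have e: "(\<Sum>k\<in>UNIV. \<Sum>l\<in>UNIV. ps i j k l * r k l a b) = - 2 * r i j a b" for i j a b .
  have tr: "trace (R i j ** R k l) = - (\<Sum>a\<in>UNIV. \<Sum>b\<in>UNIV. r i j a b * r k l a b)" for i j k l
  proof -
    have "trace (R i j ** R k l) = (\<Sum>b\<in>UNIV. \<Sum>a\<in>UNIV. r i j a b * r k l b a)"
      by (simp add: trace_def matrix_matrix_mult_def r_def)
    also have "\<dots> = (\<Sum>b\<in>UNIV. \<Sum>a\<in>UNIV. - (r i j a b * r k l a b))"
    proof (intro sum.cong refl)
      show "r i j a b * r k l b a = - (r i j a b * r k l a b)" for a b by (simp add: s2[of k l b a])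
    qed
    also have "\<dots> = (\<Sum>a\<in>UNIV. \<Sum>b\<in>UNIV. - (r i j a b * r k l a b))" by (rule sum.swap)
    finally show ?thesis by (simp add: sum_negf)
  qed
  have "0 = (\<Sum>(i,j,k,l)\<in>UNIV. ps i j k l * (\<Sum>a\<in>UNIV. \<Sum>b\<in>UNIV. r i j a b * r k l a b))"
    using Chern_Simons by (simp add: tr case_prod_beta sum_negf)
  also have "\<dots> = (\<Sum>(i,j,k,l,a,b)\<in>UNIV. r i j a b * (ps i j k l * r k l a b))"
    unfolding nested6 nested4 sum_distrib_left by (intro sum.cong refl) (simp add: mult_ac)
  also have "\<dots> = (\<Sum>(i,j,a,b,k,l)\<in>UNIV. r i j a b * (ps i j k l * r k l a b))"
    by (rule sum.reindex_bij_witness[of _ "\<lambda>(i,j,a,b,k,l). (i,j,k,l,a,b)" "\<lambda>(i,j,k,l,a,b). (i,j,a,b,k,l)"]) auto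
  also have "\<dots> = (\<Sum>i\<in>UNIV. \<Sum>j\<in>UNIV. \<Sum>a\<in>UNIV. \<Sum>b\<in>UNIV. r i j a b * (- 2 * r i j a b))"
    unfolding nested6 by (simp only: sum_distrib_left[symmetric] e)
  also have "\<dots> = (\<Sum>i\<in>UNIV. \<Sum>j\<in>UNIV. \<Sum>a\<in>UNIV. \<Sum>b\<in>UNIV. - 2 * (r i j a b)\<^sup>2)"
    by (intro sum.cong refl) (simp add: power2_eq_square)
  also have "\<dots> = - 2 * (\<Sum>(i,j,a,b)\<in>UNIV. (r i j a b)\<^sup>2)"
    by (simp only: sum_distrib_left nested4)
  finally have "(\<Sum>x\<in>UNIV. (case x of (i,j,a,b) \<Rightarrow> (r i j a b)\<^sup>2)) = 0" by simp
  then have "\<forall>x\<in>UNIV. (case x of (i,j,a,b) \<Rightarrow> (r i j a b)\<^sup>2) = 0"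
    by (subst (asm) sum_nonneg_eq_0_iff) auto
  then have "r i j a b = 0" for i j a b by (drule_tac x = "(i,j,a,b)" in bspec) auto
  then show ?thesis by (simp add: vec_eq_iff r_def)
qed

lemma A_ph: "(\<Sum>m\<in>UNIV. A i j m * ph m k l - A i k m * ph m j l + A i l m * ph m j k) = 0"
proof -
  have "ph j m l = - ph m j l" "ph j k m = ph m j k" for m
    using ph_swap12 ph_cyc by metis+
  then show ?thesis using is_g2_ph[OF g2, of i j k l] by simp
qed

lemma A_ps: "(\<Sum>m\<in>UNIV. A i j m * ps m k l p - A i k m * ps m j l p + A i l m * ps m j k p - A i p m * ps m j k l) = 0"
proof -
  have "ps j m l p = - ps m j l p" "ps j k m p = ps m j k p" "ps j k l m = - ps m j k l" for m
    by (metis ps_swap12 ps_swap23 ps_swap34 minus_minus)+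
  then show ?thesis using is_g2_ps_inv[OF g2, of i j k l p] by simp
qed

text \<open>The exterior derivative is the alternation of the covariant derivative of a torsion-free
  connection, and \<phi> is parallel by \<open>A_ph\<close>. The same argument with
  \<open>A_ps\<close> gives \<open>d_ps\<close>.\<close>

lemma d_ph: "(\<Sum>m\<in>UNIV. - (c i j m * ph m k l) + c i k m * ph m j l - c j k m * ph m i l
    - c i l m * ph m j k + c j l m * ph m i k - c k l m * ph m i j) = 0"
  using A_ph[of i j k l] A_ph[of j i k l] A_ph[of k i j l] A_ph[of l i j k]
  by (simp add: c sum.distrib sum_subtractf algebra_simps sum_negf)

lemma d_ps: "(\<Sum>m\<in>UNIV. - (c i j m * ps m k l p) + c i k m * ps m j l p - c j k m * ps m i l p
    - c i l m * ps m j k p + c j l m * ps m i k p - c k l m * ps m i j p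
    + c i p m * ps m j k l - c j p m * ps m i k l + c k p m * ps m i j l - c l p m * ps m i j k) = 0"
  using A_ps[of i j k l p] A_ps[of j i k l p] A_ps[of k i j l p] A_ps[of l i j k p] A_ps[of p i j k l]
  by (simp add: c sum.distrib sum_subtractf algebra_simps sum_negf)

end

text \<open>The scalar curvature in terms of the structure constants alone, the form in which a
  basis adapted to the derived series can be used. G is the Koszul formula; cyclic renaming of
  indices leaves the norm of c and one mixed sum.\<close>

lemma scal_structure:
  fixes c G :: "'n::finite \<Rightarrow> 'n \<Rightarrow> 'n \<Rightarrow> real"
  assumes sk: "\<And>i j k. c j i k = - c i j k"
    and G: "\<And>i j k. G i j k = (c i j k - c j k i + c k i j) / 2"
  shows "(\<Sum>(i,j,k)\<in>UNIV. G i j k * G j i k) - (\<Sum>(i,j,k)\<in>UNIV. c i j k * G k j i)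
     = - (\<Sum>(i,j,k)\<in>UNIV. (c i j k)\<^sup>2) / 4 - (\<Sum>(i,j,k)\<in>UNIV. c i j k * c i k j) / 2"
proof -
  define S where "S = (\<lambda>f::'n \<Rightarrow> 'n \<Rightarrow> 'n \<Rightarrow> real. \<Sum>(i,j,k)\<in>UNIV. f i j k)"
  have rot: "S (\<lambda>i j k. f k i j) = S f" for f unfolding S_def
    by (rule sum.reindex_bij_witness[of _ "\<lambda>(k,i,j). (i,j,k)" "\<lambda>(i,j,k). (k,i,j)"]) auto
  have rot2: "S (\<lambda>i j k. f j k i) = S f" for f unfolding S_def
    by (rule sum.reindex_bij_witness[of _ "\<lambda>(j,k,i). (i,j,k)" "\<lambda>(i,j,k). (j,k,i)"]) auto
  have add: "S (\<lambda>i j k. f i j k + g i j k) = S f + S g" "S (\<lambda>i j k. f i j k - g i j k) = S f - S g"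
     "S (\<lambda>i j k. - f i j k) = - S f" "S (\<lambda>i j k. f i j k / 2) = S f / 2" "S (\<lambda>i j k. f i j k / 4) = S f / 4" for f g
    by (simp_all add: S_def case_prod_beta sum.distrib sum_subtractf sum_negf sum_divide_distrib)
  let ?N = "S (\<lambda>i j k. c i j k * c i j k)" and ?Q = "S (\<lambda>i j k. c i j k * c k i j)"
  have n1: "S (\<lambda>i j k. c k i j * c k i j) = ?N" and n2: "S (\<lambda>i j k. c j k i * c j k i) = ?N"
    by (rule rot[of "\<lambda>i j k. c i j k * c i j k"], rule rot2[of "\<lambda>i j k. c i j k * c i j k"])
  have q1: "S (\<lambda>i j k. c j k i * c k i j) = ?Q"
    using rot[of "\<lambda>i j k. c i j k * c k i j"] by (simp add: mult.commute)
  have q2: "S (\<lambda>i j k. c i j k * c j k i) = ?Q"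
    using rot2[of "\<lambda>i j k. c i j k * c k i j"] by (simp add: mult.commute)
  have g1: "G i j k * G j i k = (c k i j * c k i j + c j k i * c j k i - c j k i * c k i j - c j k i * c k i j - c i j k * c i j k) / 4" for i j k
    unfolding G sk[of j i k] sk[of i k j] sk[of k j i] by (simp add: field_simps)
  have g2: "c i j k * G k j i = (c i j k * c i j k - c i j k * c j k i - c i j k * c k i j) / 2" for i j k
    unfolding G sk[of k j i] sk[of i k j] sk[of j i k] by (simp add: field_simps)
  have p: "c i j k * c i k j = - (c i j k * c k i j)" for i j k
    by (simp add: sk[of i k j])
  have "S (\<lambda>i j k. G i j k * G j i k) - S (\<lambda>i j k. c i j k * G k j i) = - ?N / 4 - S (\<lambda>i j k. c i j k * c i k j) / 2"
    unfolding g1 g2 p add n1 n2 q1 q2 by (simp add: field_simps)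
  then show ?thesis by (simp add: S_def power2_eq_square)
qed

section \<open>Alternating forms on lists of vectors\<close>

text \<open>Only lists of length k are constrained, since the values of a form on other lists are
  arbitrary.\<close>

definition ml :: "nat \<Rightarrow> ('v::real_vector list \<Rightarrow> real) \<Rightarrow> bool" where
  "ml k W \<longleftrightarrow> (\<forall>us i. length us = k \<longrightarrow> i < k \<longrightarrow> linear (\<lambda>x. W (us[i := x])))"

definition altf :: "nat \<Rightarrow> ('v::real_vector list \<Rightarrow> real) \<Rightarrow> bool" where
  "altf k W \<longleftrightarrow> ml k W \<and>
    (\<forall>us i j. length us = k \<longrightarrow> i < k \<longrightarrow> j < k \<longrightarrow> i \<noteq> j \<longrightarrow> us ! i = us ! j \<longrightarrow> W us = 0)"

lemma mlD: "ml k W \<Longrightarrow> length us = k \<Longrightarrow> i < k \<Longrightarrow> linear (\<lambda>x. W (us[i := x]))"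
  by (simp add: ml_def)

lemma ml_mid:
  assumes "ml k W" "length xs + Suc (length ys) = k"
  shows "linear (\<lambda>x. W (xs @ x # ys))"
  using mlD[OF assms(1), of "xs @ 0 # ys" "length xs"] assms(2) by simp

lemma ml_head: "ml (Suc k) W \<Longrightarrow> length ys = k \<Longrightarrow> linear (\<lambda>x. W (x # ys))"
  using ml_mid[of "Suc k" W "[]" ys] by simp

lemma ml_Cons:
  fixes W :: "'v::real_vector list \<Rightarrow> real"
  assumes "ml (Suc k) W" shows "ml k (\<lambda>us. W (x # us))"
  unfolding ml_def
proof (intro allI impI)
  fix us :: "'v list" and i assume "length us = k" "i < k"
  then show "linear (\<lambda>y. W (x # us[i := y]))"
    using mlD[OF assms, of "x # us" "Suc i"] by simp
qed

lemma altf_ml: "altf k W \<Longrightarrow> ml k W" by (simp add: altf_def)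

lemma altf_zero:
  assumes "altf k W" "length us = k" "\<not> distinct us" shows "W us = 0"
proof -
  obtain i j where "i < length us" "j < length us" "i \<noteq> j" "us ! i = us ! j"
    using assms(3) unfolding distinct_conv_nth by blast
  then show ?thesis using assms(1,2) unfolding altf_def by blast
qed

lemma altf_swap:
  assumes W: "altf k W" and len: "length xs + Suc (Suc (length ys)) = k"
  shows "W (xs @ y # x # ys) = - W (xs @ x # y # ys)"
proof -
  have l1: "linear (\<lambda>a. W (xs @ a # b # ys))" for b
    using ml_mid[OF altf_ml[OF W], of xs "b # ys"] len by simp
  have l2: "linear (\<lambda>b. W (xs @ a # b # ys))" for a
    using ml_mid[OF altf_ml[OF W], of "xs @ [a]" ys] len by simp
  have z: "W (xs @ a # a # ys) = 0" for a
    by (rule altf_zero[OF W]) (use len in auto)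
  have "0 = W (xs @ (x + y) # (x + y) # ys)" by (simp add: z)
  also have "\<dots> = W (xs @ x # x # ys) + W (xs @ y # x # ys) + (W (xs @ x # y # ys) + W (xs @ y # y # ys))"
    by (simp add: linear_add[OF l1] linear_add[OF l2])
  finally show ?thesis by (simp add: z)
qed

lemma vec_axis_sum: "(\<Sum>i\<in>UNIV. x $ i *\<^sub>R axis i 1) = (x :: real ^ 'n)"
  by (simp add: vec_eq_iff axis_def if_distrib cong: if_cong)

lemma linear_axis_sum:
  assumes "linear (f :: real ^ 'n \<Rightarrow> real)"
  shows "f x = (\<Sum>i\<in>UNIV. x $ i * f (axis i 1))"
proof -
  have "f x = f (\<Sum>i\<in>UNIV. x $ i *\<^sub>R axis i 1)" by (simp add: vec_axis_sum)
  also have "\<dots> = (\<Sum>i\<in>UNIV. x $ i * f (axis i 1))"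
    by (simp add: linear_sum[OF assms] linear_scale[OF assms])
  finally show ?thesis .
qed

lemma ml_ext:
  fixes W W' :: "(real ^ 'n) list \<Rightarrow> real"
  assumes "ml k W" "ml k W'" "length us = k"
    and "\<And>is. length is = k \<Longrightarrow> W (map (\<lambda>i. axis i 1) is) = W' (map (\<lambda>i. axis i 1) is)"
  shows "W us = W' us"
  using assms
proof (induction k arbitrary: W W' us)
  case 0
  show ?case using "0.prems"(3) "0.prems"(4)[of "[]"] by simp
next
  case (Suc k)
  then obtain x ys where us: "us = x # ys" "length ys = k" by (cases us) auto
  have "W (axis i 1 # ys) = W' (axis i 1 # ys)" for i
  proof (rule Suc.IH[OF ml_Cons ml_Cons])
    show "W (axis i 1 # map (\<lambda>i. axis i 1) is) = W' (axis i 1 # map (\<lambda>i. axis i 1) is)" if "length is = k" for "is"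
      using Suc.prems(4)[of "i # is"] that by simp
  qed (use Suc us in auto)
  then show ?case
    using linear_axis_sum[OF ml_head[OF Suc.prems(1) us(2)], of x]
      linear_axis_sum[OF ml_head[OF Suc.prems(2) us(2)], of x] us by simp
qed

section \<open>Signs of sorting, and alternating forms on basis vectors\<close>

primrec inversions :: "'a::linorder list \<Rightarrow> nat" where
  "inversions [] = 0"
| "inversions (x # xs) = length (filter (\<lambda>y. y < x) xs) + inversions xs"

lemma sort_split:
  assumes "distinct (x # xs)"
  shows "sort (x # xs) = filter (\<lambda>y. y < x) (sort xs) @ x # filter (\<lambda>y. \<not> y < x) (sort xs)"
    and "sort xs = filter (\<lambda>y. y < x) (sort xs) @ filter (\<lambda>y. \<not> y < x) (sort xs)"
proof -
  have "sorted zs \<Longrightarrow> x \<notin> set zs \<Longrightarrow> insort x zs = filter (\<lambda>y. y < x) zs @ x # filter (\<lambda>y. \<not> y < x) zs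
     \<and> zs = filter (\<lambda>y. y < x) zs @ filter (\<lambda>y. \<not> y < x) zs" for zs
  proof (induction zs)
    case (Cons z zs)
    show ?case
    proof (cases "z < x")
      case True
      then show ?thesis using Cons by auto
    next
      case False
      then have "\<forall>y\<in>set zs. \<not> y < x" using Cons.prems by auto
      then have "filter (\<lambda>y. y < x) zs = []" "filter (\<lambda>y. \<not> y < x) zs = zs" by (auto simp: filter_empty_conv)
      then show ?thesis using False Cons.prems by auto
    qed
  qed simp
  from this[of "sort xs"] assms show "sort (x # xs) = filter (\<lambda>y. y < x) (sort xs) @ x # filter (\<lambda>y. \<not> y < x) (sort xs)"
    and "sort xs = filter (\<lambda>y. y < x) (sort xs) @ filter (\<lambda>y. \<not> y < x) (sort xs)" by auto
qed

text \<open>Insertion sort: the head x passes exactly the smaller entries behind it, and each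
  passage costs a factor s. With s = -1 this treats alternating forms, with s = 1 the products of
  two alternating forms, which are symmetric. The prefix \<open>pre\<close> makes the induction go
  through.\<close>

lemma sort_sign:
  fixes f :: "'a::linorder list \<Rightarrow> real"
  assumes sw: "\<And>xs x y ys. length xs + Suc (Suc (length ys)) = k \<Longrightarrow> f (xs @ y # x # ys) = s * f (xs @ x # y # ys)"
    and "length pre + length xs = k" "distinct xs"
  shows "f (pre @ xs) = s ^ inversions xs * f (pre @ sort xs)"
proof -
  have move: "f (pre @ x # ys @ zs) = s ^ length ys * f (pre @ ys @ x # zs)"
    if "length pre + Suc (length ys + length zs) = k" for pre x ys zs
    using that
  proof (induction ys arbitrary: pre)
    case (Cons y ys)
    have "f (pre @ x # (y # ys) @ zs) = s * f (pre @ y # x # ys @ zs)"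
      using sw[of pre "ys @ zs" x y] Cons.prems by simp
    also have "f (pre @ y # x # ys @ zs) = s ^ length ys * f (pre @ y # ys @ x # zs)"
      using Cons.IH[of "pre @ [y]"] Cons.prems by simp
    finally show ?case by simp
  qed simp
  show ?thesis using assms(2,3)
  proof (induction xs arbitrary: pre)
    case (Cons x xs)
    have "f (pre @ x # xs) = s ^ inversions xs * f (pre @ x # sort xs)"
      using Cons.IH[of "pre @ [x]"] Cons.prems by simp
    also have "f (pre @ x # sort xs) = f (pre @ x # filter (\<lambda>y. y < x) (sort xs) @ filter (\<lambda>y. \<not> y < x) (sort xs))"
      using sort_split(2)[OF Cons.prems(2)] by simp
    also have "\<dots> = s ^ length (filter (\<lambda>y. y < x) (sort xs)) * f (pre @ sort (x # xs))"
    proof -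
      have "length xs = length (filter (\<lambda>y. y < x) (sort xs)) + length (filter (\<lambda>y. \<not> y < x) (sort xs))"
        by (metis length_append length_sort sort_split(2)[OF Cons.prems(2)])
      then show ?thesis using Cons.prems unfolding sort_split(1)[OF Cons.prems(2)] by (subst move) auto
    qed
    also have "length (filter (\<lambda>y. y < x) (sort xs)) = length (filter (\<lambda>y. y < x) xs)"
      by (simp add: filter_sort)
    finally show ?case by (simp add: power_add)
  qed simp
qed

abbreviation isgn :: "'a::linorder list \<Rightarrow> real" where "isgn xs \<equiv> (-1) ^ inversions xs"

lemma altf_sort:
  assumes W: "altf k W" and "length xs = k" "distinct xs"
  shows "W (map e xs) = isgn xs * W (map e (sort xs))"
proof -
  define f where "f = (\<lambda>xs. W (map e xs))"
  have sw: "f (xs @ y # x # ys) = - 1 * f (xs @ x # y # ys)" if "length xs + Suc (Suc (length ys)) = k" for xs x y ys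
    using altf_swap[OF W, of "map e xs" "map e ys" "e y" "e x"] that by (simp add: f_def)
  then show ?thesis using sort_sign[of k f "-1" "[]" xs, OF sw] assms(2,3) by (simp add: f_def)
qed

lemma altf_ext:
  fixes W W' :: "(real ^ 'n::{finite,linorder}) list \<Rightarrow> real"
  assumes W: "altf k W" "altf k W'" "length us = k"
    and eq: "\<And>is. length is = k \<Longrightarrow> sorted is \<Longrightarrow> distinct is \<Longrightarrow> W (map (\<lambda>i. axis i 1) is) = W' (map (\<lambda>i. axis i 1) is)"
  shows "W us = W' us"
proof (rule ml_ext[OF altf_ml[OF W(1)] altf_ml[OF W(2)] W(3)])
  fix "is" :: "'n list" assume l: "length is = k"
  let ?e = "\<lambda>i. axis i (1::real)"
  show "W (map ?e is) = W' (map ?e is)"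
  proof (cases "distinct is")
    case True
    then show ?thesis using altf_sort[OF W(1) l, of ?e] altf_sort[OF W(2) l, of ?e] eq[of "sort is"] l by simp
  next
    case False
    then have "\<not> distinct (map ?e is)" by (simp add: distinct_map)
    then show ?thesis using altf_zero[OF W(1)] altf_zero[OF W(2)] l by simp
  qed
qed

section \<open>Full contractions over index tuples\<close>

lemma tuples_Suc: "tuples (Suc k) S = (\<lambda>(i, is). i # is) ` (S \<times> tuples k S)"
  by (auto simp: tuples_def length_Suc_conv image_iff)

lemma finite_tuples: "finite S \<Longrightarrow> finite (tuples k S)"
proof (induction k)
  case 0
  have "tuples 0 S = {[]}" by (auto simp: tuples_def)
  then show ?case by simp
next
  case (Suc k)
  then show ?case by (simp add: tuples_Suc)
qed

lemma sum_tuples_Suc: "(\<Sum>is\<in>tuples (Suc k) S. f is) = (\<Sum>i\<in>S. \<Sum>is\<in>tuples k S. f (i # is))"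
proof -
  have "inj_on (\<lambda>(i, is). i # is) (S \<times> tuples k S)" by (auto simp: inj_on_def)
  then show ?thesis unfolding tuples_Suc by (subst sum.reindex) (simp_all add: sum.cartesian_product case_prod_beta)
qed

lemma sum_tuples_0: "(\<Sum>is\<in>tuples 0 S. f is) = f []"
proof -
  have "tuples 0 S = {[]}" by (auto simp: tuples_def)
  then show ?thesis by simp
qed

lemma sum_tuples_add: "(\<Sum>is\<in>tuples (k + l) S. f is) = (\<Sum>is\<in>tuples k S. \<Sum>js\<in>tuples l S. f (is @ js))"
  by (induction k arbitrary: f) (simp_all add: sum_tuples_0 sum_tuples_Suc)

text \<open>Each slot contains the frame twice, so the slots can be exchanged one at a time by the
  equality of traces of bilinear forms. In particular the orientation of the frame does not affect
  the sum, which matters for the Hodge operator.\<close>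

lemma frame_independent:
  fixes W W' :: "(real ^ 'n) list \<Rightarrow> real"
  assumes "ml k W" "ml k W'"
    and tr: "\<And>\<beta>. bilinear \<beta> \<Longrightarrow> (\<Sum>i\<in>UNIV. \<beta> (F i) (F i)) = (\<Sum>i\<in>UNIV. \<beta> (axis i 1 :: real ^ 'n) (axis i 1) :: real)"
  shows "(\<Sum>is\<in>tuples k UNIV. W (map F is) * W' (map F is))
    = (\<Sum>is\<in>tuples k UNIV. W (map (\<lambda>i. axis i 1) is) * W' (map (\<lambda>i. axis i 1) is))"
  using assms(1,2)
proof (induction k arbitrary: W W')
  case 0
  then show ?case by (simp add: sum_tuples_0)
next
  case (Suc k)
  let ?e = "\<lambda>i. axis i 1 :: real ^ 'n"
  have "(\<Sum>is\<in>tuples (Suc k) UNIV. W (map F is) * W' (map F is))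
    = (\<Sum>i\<in>UNIV. \<Sum>is\<in>tuples k UNIV. W (F i # map F is) * W' (F i # map F is))"
    by (simp add: sum_tuples_Suc)
  also have "\<dots> = (\<Sum>i\<in>UNIV. \<Sum>is\<in>tuples k UNIV. W (F i # map ?e is) * W' (F i # map ?e is))"
    by (intro sum.cong refl Suc.IH ml_Cons Suc.prems)
  also have "\<dots> = (\<Sum>is\<in>tuples k UNIV. \<Sum>i\<in>UNIV. W (F i # map ?e is) * W' (F i # map ?e is))"
    by (rule sum.swap)
  also have "\<dots> = (\<Sum>is\<in>tuples k UNIV. \<Sum>i\<in>UNIV. W (?e i # map ?e is) * W' (?e i # map ?e is))"
  proof (intro sum.cong refl)
    fix "is" :: "'n list" assume "is \<in> tuples k UNIV"
    then have l: "length (map ?e is) = k" by (simp add: tuples_def)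
    have "bilinear (\<lambda>x y. W (x # map ?e is) * W' (y # map ?e is))"
      using ml_head[OF Suc.prems(1) l] ml_head[OF Suc.prems(2) l]
      by (auto simp: bilinear_def linear_iff algebra_simps)
    from tr[OF this] show "(\<Sum>i\<in>UNIV. W (F i # map ?e is) * W' (F i # map ?e is))
       = (\<Sum>i\<in>UNIV. W (?e i # map ?e is) * W' (?e i # map ?e is))" .
  qed
  also have "\<dots> = (\<Sum>i\<in>UNIV. \<Sum>is\<in>tuples k UNIV. W (?e i # map ?e is) * W' (?e i # map ?e is))"
    by (rule sum.swap)
  finally show ?case by (simp add: sum_tuples_Suc)
qed

text \<open>V vanishes on lists that repeat an index or meet \<open>js\<close>, so only the k!
  orderings of the complement L remain. The product of W and V does not change under adjacent swaps,
  so these orderings contribute equally.\<close>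

lemma hodge_complement:
  fixes W V :: "'v::real_vector list \<Rightarrow> real" and e :: "'n::{finite,linorder} \<Rightarrow> 'v"
  assumes W: "altf k W" and V: "altf (k + l) V" and js: "length js = l"
    and L: "length L = k" "distinct (L @ js)" "set (L @ js) = UNIV"
  shows "(\<Sum>is\<in>tuples k UNIV. W (map e is) * V (map e is @ map e js)) = fact k * (W (map e L) * V (map e L @ map e js))"
proof -
  define f where "f = (\<lambda>is. W (map e is) * V (map e is @ map e js))"
  have sw: "f (xs @ y # x # ys) = 1 * f (xs @ x # y # ys)" if "length xs + Suc (Suc (length ys)) = k" for xs x y ys
    using altf_swap[OF W, of "map e xs" "map e ys" "e y" "e x"]
      altf_swap[OF V, of "map e xs" "map e ys @ map e js" "e y" "e x"] that js
    by (simp add: f_def)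
  have fs: "f xs = f (sort xs)" if "length xs = k" "distinct xs" for xs
    using sort_sign[of k f 1 "[]" xs, OF sw] that by simp
  have sub: "permutations_of_set (set L) \<subseteq> tuples k UNIV"
    using L by (auto simp: tuples_def permutations_of_set_def) (metis distinct_card distinct_append)
  have "(\<Sum>is\<in>tuples k UNIV. f is) = (\<Sum>is\<in>permutations_of_set (set L). f is)"
  proof (rule sum.mono_neutral_right[OF finite_tuples sub], simp, rule ballI)
    fix "is" assume i: "is \<in> tuples k UNIV - permutations_of_set (set L)"
    have "\<not> distinct (is @ js)"
    proof
      assume d: "distinct (is @ js)"
      have "set is \<subseteq> set L" using d L(3) by auto
      moreover have "card (set is) = card (set L)" using d L(1,2) i by (simp add: distinct_card tuples_def)
      ultimately have "set is = set L" by (simp add: card_subset_eq)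
      then show False using i d by (simp add: permutations_of_set_def)
    qed
    then have "\<not> distinct (map e is @ map e js)" by (metis distinct_map map_append)
    then have "V (map e is @ map e js) = 0" using i js by (intro altf_zero[OF V]) (auto simp: tuples_def)
    then show "f is = 0" by (simp add: f_def)
  qed
  also have "\<dots> = (\<Sum>is\<in>permutations_of_set (set L). f L)"
  proof (intro sum.cong refl)
    fix "is" assume "is \<in> permutations_of_set (set L)"
    then have "mset is = mset L" "distinct is"
      using L(2) by (auto simp: permutations_of_set_def set_eq_iff_mset_eq_distinct)
    moreover from this have "length is = k" using L(1) mset_eq_length by blast
    ultimately show "f is = f L" using fs[of "is"] fs[of L] L(1,2) properties_for_sort[of "sort L" "is"] by simp
  qed
  also have "\<dots> = fact k * f L"
    using L by (simp add: card_permutations_of_set distinct_card)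
  finally show ?thesis by (simp add: f_def)
qed

text \<open>Descending induction along the filtration: a basis of \<open>V (Suc k)\<close> is
  completed by an orthonormal basis of its orthogonal complement inside \<open>V k\<close>.\<close>

lemma adapted_orthonormal_basis:
  fixes V :: "nat \<Rightarrow> 'a::euclidean_space set"
  assumes sub: "\<And>k. subspace (V k)" and dec: "\<And>k. V (Suc k) \<subseteq> V k" and "V n = {0}" "k \<le> n"
  shows "\<exists>B. B \<subseteq> V k \<and> pairwise orthogonal B \<and> (\<forall>x\<in>B. norm x = 1) \<and> span B = V k \<and>
    (\<forall>x\<in>B. \<exists>l. x \<in> V l \<and> (\<forall>y\<in>V (Suc l). x \<bullet> y = 0))"
  using assms(4)
proof (induction k rule: inc_induct)
  case base
  then show ?case using assms(3) by (intro exI[of _ "{}"]) auto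
next
  case (step k)
  then obtain B where B: "B \<subseteq> V (Suc k)" "pairwise orthogonal B" "\<forall>x\<in>B. norm x = 1" "span B = V (Suc k)"
    "\<forall>x\<in>B. \<exists>l. x \<in> V l \<and> (\<forall>y\<in>V (Suc l). x \<bullet> y = 0)" by blast
  define W where "W = {x \<in> V k. \<forall>y\<in>V (Suc k). x \<bullet> y = 0}"
  have "subspace W" using sub[of k] unfolding W_def subspace_def by (auto simp: inner_left_distrib)
  then obtain C where C: "C \<subseteq> W" "pairwise orthogonal C" "\<And>x. x \<in> C \<Longrightarrow> norm x = 1" "span C = W"
    by (metis orthonormal_basis_subspace)
  have "span (B \<union> C) = V k"
  proof
    show "span (B \<union> C) \<subseteq> V k"
      using B(1) C(1) dec[of k] sub[of k] by (intro span_minimal) (auto simp: W_def)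
    show "V k \<subseteq> span (B \<union> C)"
    proof
      fix x assume x: "x \<in> V k"
      obtain y z where yz: "y \<in> span (V (Suc k))" "\<And>w. w \<in> span (V (Suc k)) \<Longrightarrow> orthogonal z w" "x = y + z"
        using orthogonal_subspace_decomp_exists[of "V (Suc k)" x] by metis
      have y: "y \<in> V (Suc k)" using yz(1) sub span_eq_iff by blast
      then have "z \<in> V k" using yz(3) x dec[of k] sub[of k] by (metis add_diff_cancel_left' subsetD subspace_diff)
      moreover have "z \<bullet> w = 0" if "w \<in> V (Suc k)" for w
        using yz(2)[of w] that by (simp add: orthogonal_def span_base)
      ultimately have "z \<in> span C" unfolding C(4) W_def by blast
      moreover have "y \<in> span B" using y B(4) by simp
      ultimately have "y \<in> span (B \<union> C)" "z \<in> span (B \<union> C)"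
        by (meson span_mono subsetD Un_upper1 Un_upper2)+
      then show "x \<in> span (B \<union> C)" unfolding yz(3) by (rule span_add)
    qed
  qed
  moreover have "pairwise orthogonal (B \<union> C)"
  proof -
    have "orthogonal x y" "orthogonal y x" if "x \<in> B" "y \<in> C" for x y
    proof -
      have "x \<in> V (Suc k)" "y \<in> W" using that B(1) C(1) by auto
      then have "y \<bullet> x = 0" by (simp add: W_def)
      then show "orthogonal x y" "orthogonal y x" by (simp_all add: orthogonal_def inner_commute)
    qed
    then show ?thesis using B(2) C(2) unfolding pairwise_def by blast
  qed
  moreover have "B \<union> C \<subseteq> V k" using B(1) C(1) dec[of k] by (auto simp: W_def)
  moreover have "\<exists>l. x \<in> V l \<and> (\<forall>y\<in>V (Suc l). x \<bullet> y = 0)" if "x \<in> C" for x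
    using that C(1) by (intro exI[of _ k]) (auto simp: W_def)
  ultimately show ?case using B(3,5) C(3) by (intro exI[of _ "B \<union> C"]) auto
qed

lemma trace_orthonormal:
  fixes \<beta> :: "'a::euclidean_space \<Rightarrow> 'a \<Rightarrow> real"
  assumes \<beta>: "bilinear \<beta>" and B: "pairwise orthogonal B" "\<And>x. x \<in> B \<Longrightarrow> norm x = 1" "span B = UNIV"
  shows "(\<Sum>x\<in>B. \<beta> x x) = (\<Sum>b\<in>Basis. \<beta> b b)"
proof -
  have "0 \<notin> B" using B(2) by force
  then have ind: "independent B" using B(1) by (simp add: pairwise_orthogonal_independent)
  then have fin: "finite B" by (simp add: independent_imp_finite)
  have ip: "x \<bullet> y = (if x = y then 1 else 0)" if "x \<in> B" "y \<in> B" for x y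
    using B that by (auto simp: pairwise_def orthogonal_def norm_eq_1)
  have rep: "(\<Sum>x\<in>B. (b \<bullet> x) *\<^sub>R x) = b" for b
  proof -
    let ?d = "b - (\<Sum>x\<in>B. (b \<bullet> x) *\<^sub>R x)"
    have "?d \<bullet> y = 0" if "y \<in> B" for y
      using that fin by (simp add: inner_diff_left inner_sum_left ip if_distrib cong: if_cong)
    then have "orthogonal ?d y" if "y \<in> span B" for y
      using that orthogonal_to_span[of y B ?d] by (auto simp: orthogonal_def)
    then have "orthogonal ?d ?d" using B(3) by blast
    then show ?thesis by (simp add: orthogonal_def)
  qed
  have "(\<Sum>b\<in>Basis. \<beta> b b) = (\<Sum>b\<in>Basis. \<beta> (\<Sum>x\<in>B. (b \<bullet> x) *\<^sub>R x) (\<Sum>x\<in>B. (b \<bullet> x) *\<^sub>R x))"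
    by (simp add: rep)
  also have "\<dots> = (\<Sum>b\<in>Basis. \<Sum>(x,y)\<in>B\<times>B. (b \<bullet> x) * (b \<bullet> y) * \<beta> x y)"
    by (simp add: bilinear_sum[OF \<beta> ] bilinear_lmul[OF \<beta>] bilinear_rmul[OF \<beta>] case_prod_beta mult_ac)
  also have "\<dots> = (\<Sum>(x,y)\<in>B\<times>B. (\<Sum>b\<in>Basis. (b \<bullet> x) * (b \<bullet> y)) * \<beta> x y)"
    by (subst sum.swap) (simp add: case_prod_beta sum_distrib_right)
  also have "\<dots> = (\<Sum>(x,y)\<in>B\<times>B. (x \<bullet> y) * \<beta> x y)"
  proof -
    have "(\<Sum>b\<in>Basis. (b \<bullet> x) * (b \<bullet> y)) = x \<bullet> y" for x y :: 'a
      by (subst euclidean_inner[of x y]) (simp only: inner_commute)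
    then show ?thesis by simp
  qed
  also have "\<dots> = (\<Sum>x\<in>B. \<Sum>y\<in>B. (if x = y then 1 else 0) * \<beta> x y)"
    by (simp add: sum.cartesian_product[symmetric] ip)
  also have "\<dots> = (\<Sum>x\<in>B. \<beta> x x)"
    using fin by (simp add: mult_delta_left)
  finally show ?thesis by simp
qed

text \<open>The right side is minus the scalar curvature of \<open>scal_structure\<close>. If c_xyz
  and c_xzy are both nonzero for vectors of an adapted basis, then x has a strictly smaller level
  than y and z. These triples and their mirror images under the exchange of x and y are disjoint and
  carry the same squares, so the norm of c is at least twice its part over them. The squares of
  c_xyz + c_xzy over these triples then give the inequality.\<close>

lemma solvable_scal_nonpos:
  fixes br :: "'a::euclidean_space \<Rightarrow> 'a \<Rightarrow> 'a"
  assumes br: "bilinear br" and skew: "\<And>x y. br y x = - br x y"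
    and sub: "\<And>k. subspace (V k)" and dec: "\<And>k. V (Suc k) \<subseteq> V k" and V: "V 0 = UNIV" "V n = {0}"
    and brV: "\<And>k x y. x \<in> V k \<Longrightarrow> y \<in> V k \<Longrightarrow> br x y \<in> V (Suc k)"
  shows "0 \<le> (\<Sum>x\<in>Basis. \<Sum>y\<in>Basis. \<Sum>z\<in>Basis. (br x y \<bullet> z)\<^sup>2) / 4
    + (\<Sum>x\<in>Basis. \<Sum>y\<in>Basis. \<Sum>z\<in>Basis. (br x y \<bullet> z) * (br x z \<bullet> y)) / 2"
proof -
  obtain B where B: "pairwise orthogonal B" "\<And>x. x \<in> B \<Longrightarrow> norm x = 1" "span B = UNIV"
     and "\<forall>x\<in>B. \<exists>l. x \<in> V l \<and> (\<forall>y\<in>V (Suc l). x \<bullet> y = 0)"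
    using adapted_orthonormal_basis[OF sub dec V(2), of 0] V(1) by auto
  then obtain l where l: "\<And>x. x \<in> B \<Longrightarrow> x \<in> V (l x)" "\<And>x y. x \<in> B \<Longrightarrow> y \<in> V (Suc (l x)) \<Longrightarrow> x \<bullet> y = 0"
    by metis
  have mono: "V b \<subseteq> V a" if "a \<le> b" for a b
    using that dec by (rule lift_Suc_antimono_le[rotated])
  have "0 \<notin> B" using B(2) by force
  then have fin: "finite B" using B(1) by (simp add: pairwise_orthogonal_independent independent_imp_finite)
  define c where "c = (\<lambda>x y z. br x y \<bullet> z)"
  have lin: "linear (\<lambda>x. br x y)" "linear (br x)" for x y using br by (auto simp: bilinear_def)
  note lins = linear_add[OF lin(1)] linear_add[OF lin(2)] linear_scale[OF lin(1)] linear_scale[OF lin(2)]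
  \<comment> \<open>With m the smaller of the levels of x and y, the bracket lies in
    \<open>V (Suc m)\<close>, which is orthogonal to every basis vector of level at most m.\<close>
  have level: "min (l x) (l y) < l z" if "x \<in> B" "y \<in> B" "z \<in> B" "c x y z \<noteq> 0" for x y z
  proof (rule ccontr)
    let ?m = "min (l x) (l y)"
    assume "\<not> ?m < l z"
    then have "l z \<le> ?m" by (simp only: not_less)
    have "x \<in> V ?m" "y \<in> V ?m" using that l(1) mono[of ?m "l x"] mono[of ?m "l y"] by auto
    then have "br x y \<in> V (Suc ?m)" by (rule brV)
    then have *: "br x y \<in> V (Suc (l z))" using mono[of "Suc (l z)" "Suc ?m"] \<open>l z \<le> ?m\<close> by auto
    then show False using l(2)[OF that(3) *] that(4) by (simp add: c_def inner_commute)
  qed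
  \<comment> \<open>Every index occurs twice, so the sum is a trace in each of them and the standard
    basis can be replaced by B one index at a time.\<close>
  have eq1: "(\<Sum>x\<in>Basis. \<Sum>y\<in>Basis. \<Sum>z\<in>Basis. c x y z * c x y z) = (\<Sum>x\<in>B. \<Sum>y\<in>B. \<Sum>z\<in>B. c x y z * c x y z)"
  proof -
    have "(\<Sum>z\<in>Basis. (u \<bullet> z) * (u \<bullet> z)) = (\<Sum>z\<in>B. (u \<bullet> z) * (u \<bullet> z))" for u
      by (rule trace_orthonormal[symmetric, OF _ B]) (auto simp: bilinear_def linear_iff inner_right_distrib algebra_simps)
    moreover have "(\<Sum>y\<in>Basis. \<Sum>z\<in>B. c x y z * c x y z) = (\<Sum>y\<in>B. \<Sum>z\<in>B. c x y z * c x y z)" for x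
      by (rule trace_orthonormal[symmetric, OF _ B, of "\<lambda>y y'. \<Sum>z\<in>B. c x y z * c x y' z"])
        (auto simp: bilinear_def linear_iff c_def lins inner_left_distrib algebra_simps sum.distrib sum_distrib_left)
    moreover have "(\<Sum>x\<in>Basis. \<Sum>y\<in>B. \<Sum>z\<in>B. c x y z * c x y z) = (\<Sum>x\<in>B. \<Sum>y\<in>B. \<Sum>z\<in>B. c x y z * c x y z)"
      by (rule trace_orthonormal[symmetric, OF _ B, of "\<lambda>x x'. \<Sum>y\<in>B. \<Sum>z\<in>B. c x y z * c x' y z"])
        (auto simp: bilinear_def linear_iff c_def lins inner_left_distrib algebra_simps sum.distrib sum_distrib_left)
    ultimately show ?thesis by (simp add: c_def)
  qed
  have eq2: "(\<Sum>x\<in>Basis. \<Sum>y\<in>Basis. \<Sum>z\<in>Basis. c x y z * c x z y) = (\<Sum>x\<in>B. \<Sum>y\<in>B. \<Sum>z\<in>B. c x y z * c x z y)"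
  proof -
    have "(\<Sum>z\<in>Basis. c x y z * c x z y) = (\<Sum>z\<in>B. c x y z * c x z y)" for x y
      by (rule trace_orthonormal[symmetric, OF _ B, of "\<lambda>z z'. c x y z * c x z' y"])
       (auto simp: bilinear_def linear_iff c_def lins inner_left_distrib inner_right_distrib algebra_simps)
    moreover have "(\<Sum>y\<in>Basis. \<Sum>z\<in>B. c x y z * c x z y) = (\<Sum>y\<in>B. \<Sum>z\<in>B. c x y z * c x z y)" for x
      by (rule trace_orthonormal[symmetric, OF _ B, of "\<lambda>y y'. \<Sum>z\<in>B. c x y z * c x z y'"])
        (auto simp: bilinear_def linear_iff c_def lins inner_left_distrib inner_right_distrib algebra_simps sum.distrib sum_distrib_left)
    moreover have "(\<Sum>x\<in>Basis. \<Sum>y\<in>B. \<Sum>z\<in>B. c x y z * c x z y) = (\<Sum>x\<in>B. \<Sum>y\<in>B. \<Sum>z\<in>B. c x y z * c x z y)"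
      by (rule trace_orthonormal[symmetric, OF _ B, of "\<lambda>x x'. \<Sum>y\<in>B. \<Sum>z\<in>B. c x y z * c x' z y"])
        (auto simp: bilinear_def linear_iff c_def lins inner_left_distrib algebra_simps sum.distrib sum_distrib_left)
    ultimately show ?thesis by simp
  qed
  define U where "U = B \<times> B \<times> B"
  define T where "T = {(x,y,z). (x,y,z) \<in> U \<and> l x < l y \<and> l x < l z}"
  define T' where "T' = {(x,y,z). (x,y,z) \<in> U \<and> l y < l x \<and> l y < l z}"
  have fU: "finite U" using fin by (simp add: U_def)
  have TU: "T \<subseteq> U" "T' \<subseteq> U" by (auto simp: T_def T'_def)
  have fT: "finite T" "finite T'" using fU TU by (auto intro: finite_subset)
  have N: "(\<Sum>x\<in>B. \<Sum>y\<in>B. \<Sum>z\<in>B. c x y z * c x y z) = (\<Sum>(x,y,z)\<in>U. c x y z * c x y z)"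
    by (simp add: U_def sum.cartesian_product)
  have P: "(\<Sum>x\<in>B. \<Sum>y\<in>B. \<Sum>z\<in>B. c x y z * c x z y) = (\<Sum>(x,y,z)\<in>T. c x y z * c x z y)"
  proof -
    have "(\<Sum>(x,y,z)\<in>U. c x y z * c x z y) = (\<Sum>(x,y,z)\<in>T. c x y z * c x z y)"
    proof (rule sum.mono_neutral_right[OF fU TU(1)], rule ballI)
      fix t assume t: "t \<in> U - T"
      obtain x y z where xyz: "t = (x,y,z)" by (cases t)
      have xB: "x \<in> B" "y \<in> B" "z \<in> B" using t xyz by (auto simp: U_def)
      have "c x y z = 0 \<or> c x z y = 0"
      proof (rule ccontr)
        assume "\<not> ?thesis"
        then have "min (l x) (l y) < l z" "min (l x) (l z) < l y" using level xB by auto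
        then have "t \<in> T" using t xyz by (auto simp: T_def min_def split: if_splits)
        then show False using t by simp
      qed
      then show "(case t of (x,y,z) \<Rightarrow> c x y z * c x z y) = 0" by (auto simp: xyz)
    qed
    then show ?thesis by (simp add: U_def sum.cartesian_product)
  qed
  have cs: "c x y z * c x y z = c y x z * c y x z" for x y z by (simp add: c_def skew[of y x])
  have T': "(\<Sum>(x,y,z)\<in>T'. c x y z * c x y z) = (\<Sum>(x,y,z)\<in>T. c x y z * c x y z)"
    by (rule sum.reindex_bij_witness[of _ "\<lambda>(x,y,z). (y,x,z)" "\<lambda>(x,y,z). (y,x,z)"])
      (auto simp: T_def T'_def U_def intro: cs)
  have Tsw: "(\<Sum>(x,y,z)\<in>T. c x z y * c x z y) = (\<Sum>(x,y,z)\<in>T. c x y z * c x y z)"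
    by (rule sum.reindex_bij_witness[of _ "\<lambda>(x,y,z). (x,z,y)" "\<lambda>(x,y,z). (x,z,y)"])
      (auto simp: T_def U_def)
  have "T \<inter> T' = {}" by (auto simp: T_def T'_def)
  then have "(\<Sum>(x,y,z)\<in>T. c x y z * c x y z) + (\<Sum>(x,y,z)\<in>T'. c x y z * c x y z) = (\<Sum>(x,y,z)\<in>T \<union> T'. c x y z * c x y z)"
    using fT by (simp add: sum.union_disjoint)
  also have "\<dots> \<le> (\<Sum>(x,y,z)\<in>U. c x y z * c x y z)"
    using fU TU by (intro sum_mono2) auto
  finally have "2 * (\<Sum>(x,y,z)\<in>T. c x y z * c x y z) \<le> (\<Sum>(x,y,z)\<in>U. c x y z * c x y z)" using T' by simp
  moreover have "0 \<le> (\<Sum>(x,y,z)\<in>T. (c x y z + c x z y)\<^sup>2)" by (intro sum_nonneg) auto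
  then have "0 \<le> 2 * (\<Sum>(x,y,z)\<in>T. c x y z * c x y z) + 2 * (\<Sum>(x,y,z)\<in>T. c x y z * c x z y)"
  proof -
    have "(\<Sum>(x,y,z)\<in>T. (c x y z + c x z y)\<^sup>2)
      = (\<Sum>(x,y,z)\<in>T. c x y z * c x y z) + (\<Sum>(x,y,z)\<in>T. c x z y * c x z y) + 2 * (\<Sum>(x,y,z)\<in>T. c x y z * c x z y)"
      unfolding sum_distrib_left sum.distrib[symmetric] by (intro sum.cong refl) (auto simp: power2_eq_square algebra_simps)
    then show ?thesis using Tsw \<open>0 \<le> (\<Sum>(x,y,z)\<in>T. (c x y z + c x z y)\<^sup>2)\<close> by simp
  qed
  ultimately have "0 \<le> (\<Sum>(x,y,z)\<in>U. c x y z * c x y z) / 4 + (\<Sum>(x,y,z)\<in>T. c x y z * c x z y) / 2" by argo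
  then show ?thesis
    using eq1 eq2 N P by (simp add: c_def power2_eq_square)
qed

section \<open>The characteristic connection preserves the three-form\<close>

lemma less_7:
  "((0::7) < 0) = False" "((0::7) < 1) = True" "((0::7) < 2) = True" "((0::7) < 3) = True" "((0::7) < 4) = True" "((0::7) < 5) = True" "((0::7) < 6) = True"
  "((1::7) < 0) = False" "((1::7) < 1) = False" "((1::7) < 2) = True" "((1::7) < 3) = True" "((1::7) < 4) = True" "((1::7) < 5) = True" "((1::7) < 6) = True"
  "((2::7) < 0) = False" "((2::7) < 1) = False" "((2::7) < 2) = False" "((2::7) < 3) = True" "((2::7) < 4) = True" "((2::7) < 5) = True" "((2::7) < 6) = True"
  "((3::7) < 0) = False" "((3::7) < 1) = False" "((3::7) < 2) = False" "((3::7) < 3) = False" "((3::7) < 4) = True" "((3::7) < 5) = True" "((3::7) < 6) = True"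
  "((4::7) < 0) = False" "((4::7) < 1) = False" "((4::7) < 2) = False" "((4::7) < 3) = False" "((4::7) < 4) = False" "((4::7) < 5) = True" "((4::7) < 6) = True"
  "((5::7) < 0) = False" "((5::7) < 1) = False" "((5::7) < 2) = False" "((5::7) < 3) = False" "((5::7) < 4) = False" "((5::7) < 5) = False" "((5::7) < 6) = True"
  "((6::7) < 0) = False" "((6::7) < 1) = False" "((6::7) < 2) = False" "((6::7) < 3) = False" "((6::7) < 4) = False" "((6::7) < 5) = False" "((6::7) < 6) = False"
  by (simp_all add: less_bit1_def bit1.Rep_numeral bit1.Rep_0 bit1.Rep_1)

lemma ps_rows:
  "ps 0 1 2 m = (if m = 4 then 1 else 0)" "ps 0 1 3 m = (if m = 5 then -1 else 0)" "ps 0 1 4 m = (if m = 2 then -1 else 0)"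
  "ps 0 1 5 m = (if m = 3 then 1 else 0)" "ps 0 1 6 m = 0" "ps 0 2 3 m = (if m = 6 then -1 else 0)"
  "ps 0 2 4 m = (if m = 1 then 1 else 0)" "ps 0 2 5 m = 0" "ps 0 2 6 m = (if m = 3 then 1 else 0)"
  "ps 0 3 4 m = 0" "ps 0 3 5 m = (if m = 1 then -1 else 0)" "ps 0 3 6 m = (if m = 2 then -1 else 0)"
  "ps 0 4 5 m = (if m = 6 then -1 else 0)" "ps 0 4 6 m = (if m = 5 then 1 else 0)" "ps 0 5 6 m = (if m = 4 then -1 else 0)"
  "ps 1 2 3 m = 0" "ps 1 2 4 m = (if m = 0 then -1 else 0)" "ps 1 2 5 m = (if m = 6 then -1 else 0)"
  "ps 1 2 6 m = (if m = 5 then 1 else 0)" "ps 1 3 4 m = (if m = 6 then -1 else 0)" "ps 1 3 5 m = (if m = 0 then 1 else 0)"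
  "ps 1 3 6 m = (if m = 4 then 1 else 0)" "ps 1 4 5 m = 0" "ps 1 4 6 m = (if m = 3 then -1 else 0)"
  "ps 1 5 6 m = (if m = 2 then -1 else 0)" "ps 2 3 4 m = (if m = 5 then 1 else 0)" "ps 2 3 5 m = (if m = 4 then -1 else 0)"
  "ps 2 3 6 m = (if m = 0 then 1 else 0)" "ps 2 4 5 m = (if m = 3 then 1 else 0)" "ps 2 4 6 m = 0"
  "ps 2 5 6 m = (if m = 1 then 1 else 0)" "ps 3 4 5 m = (if m = 2 then -1 else 0)" "ps 3 4 6 m = (if m = 1 then 1 else 0)"
  "ps 3 5 6 m = 0" "ps 4 5 6 m = (if m = 0 then 1 else 0)"
  by (simp_all add: ps_def ph_rows mult_delta_left of_bool_def)

text \<open>The components of d\<phi> when c are the structure constants of the coframe. The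
  summation index stands last in \<open>ph\<close> to fit \<open>ph_rows\<close>.\<close>

definition d3 :: "(7 \<Rightarrow> 7 \<Rightarrow> 7 \<Rightarrow> real) \<Rightarrow> 7 \<Rightarrow> 7 \<Rightarrow> 7 \<Rightarrow> 7 \<Rightarrow> real" where
  "d3 c i j k l = (\<Sum>m\<in>UNIV. - (c i j m * ph k l m) + c i k m * ph j l m - c j k m * ph i l m
    - c i l m * ph j k m + c j l m * ph i k m - c k l m * ph i j m)"

text \<open>The components of d\<star>\<phi>. Moving the summation index of \<open>ps\<close> to the
  last slot is an odd permutation, so the signs are opposite to those of \<open>d3\<close>.\<close>

definition d4 :: "(7 \<Rightarrow> 7 \<Rightarrow> 7 \<Rightarrow> real) \<Rightarrow> 7 \<Rightarrow> 7 \<Rightarrow> 7 \<Rightarrow> 7 \<Rightarrow> 7 \<Rightarrow> real" where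
  "d4 c i j k l p = (\<Sum>m\<in>UNIV. c i j m * ps k l p m - c i k m * ps j l p m + c j k m * ps i l p m
    + c i l m * ps j k p m - c j l m * ps i k p m + c k l m * ps i j p m
    - c i p m * ps j k l m + c j p m * ps i k l m - c k p m * ps i j l m + c l p m * ps i j k m)"

text \<open>The equations \<open>h\<close> are the contractions with \<phi> for the free index 0, 1,
  up to 6 in this order, written in the entries above the diagonal.\<close>

lemma is_g2I:
  assumes sk: "\<And>i j. B j i = - B i j"
    and h: "B 1 6 = B 2 5 + B 3 4" "B 0 6 = B 2 3 + B 4 5" "B 0 5 = B 1 3 - B 4 6" "B 0 4 = - B 1 2 + B 5 6" "B 0 3 = - B 1 5 - B 2 6" "B 0 2 = B 1 4 + B 3 6" "B 0 1 = - B 2 4 + B 3 5"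
  shows "is_g2 B"
proof -
  have s: "B 0 0 = 0" "B 1 1 = 0" "B 2 2 = 0" "B 3 3 = 0" "B 4 4 = 0" "B 5 5 = 0" "B 6 6 = 0"
    "B 1 0 = - B 0 1" "B 2 0 = - B 0 2" "B 3 0 = - B 0 3" "B 4 0 = - B 0 4" "B 5 0 = - B 0 5" "B 6 0 = - B 0 6"
    "B 2 1 = - B 1 2" "B 3 1 = - B 1 3" "B 4 1 = - B 1 4" "B 5 1 = - B 1 5" "B 6 1 = - B 1 6"
    "B 3 2 = - B 2 3" "B 4 2 = - B 2 4" "B 5 2 = - B 2 5" "B 6 2 = - B 2 6"
    "B 4 3 = - B 3 4" "B 5 3 = - B 3 5" "B 6 3 = - B 3 6"
    "B 5 4 = - B 4 5" "B 6 4 = - B 4 6" "B 6 5 = - B 5 6"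
    using sk by (metis equal_neg_zero)+
  have c: "(\<Sum>j\<in>UNIV. \<Sum>k\<in>UNIV. B j k * ph l j k) = 0" for l
    using exhaust_7[of l] by (elim disjE) (simp_all add: sum_7 ph_rows s h)
  have "(\<Sum>j\<in>UNIV. \<Sum>k\<in>UNIV. B j k * ph j k l) = 0" for l
  proof -
    have "(\<Sum>j\<in>UNIV. \<Sum>k\<in>UNIV. B j k * ph j k l) = (\<Sum>j\<in>UNIV. \<Sum>k\<in>UNIV. B j k * ph l j k)"
      by (intro sum.cong refl arg_cong2[of _ _ _ _ "(*)"] ph_cyc)
    then show ?thesis by (simp add: c)
  qed
  then show ?thesis unfolding is_g2_def using sk by blast
qed

text \<open>The torsion is built so that the Levi-Civita connection plus T/2 preserves \<phi>. In
  components this amounts to 49 linear identities in the structure constants, modulo the Lee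
  equation and the definition of s: seven equations of \<open>is_g2I\<close> for each of the seven
  matrices.\<close>

lemma characteristic_g2:
  fixes c T st sh :: "7 \<Rightarrow> 7 \<Rightarrow> 7 \<Rightarrow> real" and \<theta> :: "7 \<Rightarrow> real"
  assumes sk: "\<And>i j k. c j i k = - c i j k"
    and T: "\<And>i j k. T i j k = s / 6 * ph i j k - st i j k + sh i j k"
    and s: "s = st 0 1 6 - st 0 2 5 - st 0 3 4 + st 1 2 3 + st 1 4 5 + st 2 4 6 - st 3 5 6"
    and st: "\<And>a b x d i j k. distinct [a,b,x,d,i,j,k] \<Longrightarrow> st i j k = isgn [a,b,x,d,i,j,k] * d3 c a b x d"
    and sh: "\<And>a b x d i j k. distinct [a,b,x,d,i,j,k] \<Longrightarrow> sh i j k = isgn [a,b,x,d,i,j,k] *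
       (\<theta> a * ph b x d - \<theta> b * ph a x d + \<theta> x * ph a b d - \<theta> d * ph a b x)"
    and Tsk: "\<And>i j k. T j i k = - T i j k" "\<And>i j k. T i k j = - T i j k"
    and lee: "\<And>i j k l p. d4 c i j k l p = \<theta> i * ps j k l p - \<theta> j * ps i k l p + \<theta> k * ps i j l p - \<theta> l * ps i j k p + \<theta> p * ps i j k l"
    and A: "\<And>i j k. A i j k = (c i j k - c j k i + c k i j) / 2 + T i j k / 2"
  shows "is_g2 (A i)"
proof -
  have ci: "c 0 0 k = 0" "c 1 1 k = 0" "c 2 2 k = 0" "c 3 3 k = 0" "c 4 4 k = 0" "c 5 5 k = 0" "c 6 6 k = 0" for k
    using sk by (metis equal_neg_zero)+
  have cs: "c 1 0 k = - c 0 1 k" "c 2 0 k = - c 0 2 k" "c 3 0 k = - c 0 3 k" "c 4 0 k = - c 0 4 k" "c 5 0 k = - c 0 5 k" "c 6 0 k = - c 0 6 k"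
    "c 2 1 k = - c 1 2 k" "c 3 1 k = - c 1 3 k" "c 4 1 k = - c 1 4 k" "c 5 1 k = - c 1 5 k" "c 6 1 k = - c 1 6 k"
    "c 3 2 k = - c 2 3 k" "c 4 2 k = - c 2 4 k" "c 5 2 k = - c 2 5 k" "c 6 2 k = - c 2 6 k"
    "c 4 3 k = - c 3 4 k" "c 5 3 k = - c 3 5 k" "c 6 3 k = - c 3 6 k"
    "c 5 4 k = - c 4 5 k" "c 6 4 k = - c 4 6 k"
    "c 6 5 k = - c 5 6 k"
     for k
    by (rule sk)+
  note red = ci cs d3_def d4_def ph_rows ps_rows mult_delta_right sum.distrib sum_subtractf sum_negf
  have T0: "T 0 0 k = 0" "T k 0 0 = 0" "T 1 1 k = 0" "T k 1 1 = 0" "T 2 2 k = 0" "T k 2 2 = 0" "T 3 3 k = 0" "T k 3 3 = 0" "T 4 4 k = 0" "T k 4 4 = 0" "T 5 5 k = 0" "T k 5 5 = 0" "T 6 6 k = 0" "T k 6 6 = 0" for k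
    using Tsk by (metis equal_neg_zero)+
  have Ts: "T 1 0 k = - T 0 1 k" "T k 1 0 = - T k 0 1" "T 2 0 k = - T 0 2 k" "T k 2 0 = - T k 0 2" "T 3 0 k = - T 0 3 k" "T k 3 0 = - T k 0 3" "T 4 0 k = - T 0 4 k" "T k 4 0 = - T k 0 4" "T 5 0 k = - T 0 5 k" "T k 5 0 = - T k 0 5" "T 6 0 k = - T 0 6 k" "T k 6 0 = - T k 0 6"
    "T 2 1 k = - T 1 2 k" "T k 2 1 = - T k 1 2" "T 3 1 k = - T 1 3 k" "T k 3 1 = - T k 1 3" "T 4 1 k = - T 1 4 k" "T k 4 1 = - T k 1 4" "T 5 1 k = - T 1 5 k" "T k 5 1 = - T k 1 5" "T 6 1 k = - T 1 6 k" "T k 6 1 = - T k 1 6"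
    "T 3 2 k = - T 2 3 k" "T k 3 2 = - T k 2 3" "T 4 2 k = - T 2 4 k" "T k 4 2 = - T k 2 4" "T 5 2 k = - T 2 5 k" "T k 5 2 = - T k 2 5" "T 6 2 k = - T 2 6 k" "T k 6 2 = - T k 2 6"
    "T 4 3 k = - T 3 4 k" "T k 4 3 = - T k 3 4" "T 5 3 k = - T 3 5 k" "T k 5 3 = - T k 3 5" "T 6 3 k = - T 3 6 k" "T k 6 3 = - T k 3 6"
    "T 5 4 k = - T 4 5 k" "T k 5 4 = - T k 4 5" "T 6 4 k = - T 4 6 k" "T k 6 4 = - T k 4 6"
    "T 6 5 k = - T 5 6 k" "T k 6 5 = - T k 5 6" for k
    by (rule Tsk)+
  \<comment> \<open>For each of the 35 increasing triples: the components of \<star>d\<phi> and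
    \<star>(\<theta> \<and> \<phi>), read off at the four complementary indices, and the resulting
    component of T.\<close>
  have st012: "st 0 1 2 = c 3 4 3 + c 3 5 2 - c 3 6 1 - c 4 5 5 - c 4 6 6 + c 5 6 0" using st[of 3 4 5 6 0 1 2] by (simp add: less_7 red)
  have sh012: "sh 0 1 2 = \<theta> 4" using sh[of 3 4 5 6 0 1 2] by (simp add: less_7 red)
  have T012: "T 0 1 2 =  - st 0 1 2 + sh 0 1 2" by (simp add: T ph_rows)
  have st013: "st 0 1 3 = - c 2 4 3 - c 2 5 2 + c 2 6 1 - c 4 5 4 + c 4 6 0 + c 5 6 6" using st[of 2 4 5 6 0 1 3] by (simp add: less_7 red)
  have sh013: "sh 0 1 3 = - \<theta> 5" using sh[of 2 4 5 6 0 1 3] by (simp add: less_7 red)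
  have T013: "T 0 1 3 =  - st 0 1 3 + sh 0 1 3" by (simp add: T ph_rows)
  have st014: "st 0 1 4 = c 2 3 3 + c 2 5 5 + c 2 6 6 + c 3 5 4 - c 3 6 0 - c 5 6 1" using st[of 2 3 5 6 0 1 4] by (simp add: less_7 red)
  have sh014: "sh 0 1 4 = - \<theta> 2" using sh[of 2 3 5 6 0 1 4] by (simp add: less_7 red)
  have T014: "T 0 1 4 =  - st 0 1 4 + sh 0 1 4" by (simp add: T ph_rows)
  have st015: "st 0 1 5 = c 2 3 2 - c 2 4 5 - c 2 6 0 - c 3 4 4 - c 3 6 6 + c 4 6 1" using st[of 2 3 4 6 0 1 5] by (simp add: less_7 red)
  have sh015: "sh 0 1 5 = \<theta> 3" using sh[of 2 3 4 6 0 1 5] by (simp add: less_7 red)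
  have T015: "T 0 1 5 =  - st 0 1 5 + sh 0 1 5" by (simp add: T ph_rows)
  have st016: "st 0 1 6 = - c 2 3 1 - c 2 4 6 + c 2 5 0 + c 3 4 0 + c 3 5 6 - c 4 5 1" using st[of 2 3 4 5 0 1 6] by (simp add: less_7 red)
  have sh016: "sh 0 1 6 = 0" using sh[of 2 3 4 5 0 1 6] by (simp add: less_7 red)
  have T016: "T 0 1 6 = s / 6 - st 0 1 6 + sh 0 1 6" by (simp add: T ph_rows)
  have st023: "st 0 2 3 = c 1 4 3 + c 1 5 2 - c 1 6 1 - c 4 5 0 - c 4 6 4 - c 5 6 5" using st[of 1 4 5 6 0 2 3] by (simp add: less_7 red)
  have sh023: "sh 0 2 3 = - \<theta> 6" using sh[of 1 4 5 6 0 2 3] by (simp add: less_7 red)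
  have T023: "T 0 2 3 =  - st 0 2 3 + sh 0 2 3" by (simp add: T ph_rows)
  have st024: "st 0 2 4 = - c 1 3 3 - c 1 5 5 - c 1 6 6 + c 3 5 0 + c 3 6 4 - c 5 6 2" using st[of 1 3 5 6 0 2 4] by (simp add: less_7 red)
  have sh024: "sh 0 2 4 = \<theta> 1" using sh[of 1 3 5 6 0 2 4] by (simp add: less_7 red)
  have T024: "T 0 2 4 =  - st 0 2 4 + sh 0 2 4" by (simp add: T ph_rows)
  have st025: "st 0 2 5 = - c 1 3 2 + c 1 4 5 + c 1 6 0 - c 3 4 0 + c 3 6 5 + c 4 6 2" using st[of 1 3 4 6 0 2 5] by (simp add: less_7 red)
  have sh025: "sh 0 2 5 = 0" using sh[of 1 3 4 6 0 2 5] by (simp add: less_7 red)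
  have T025: "T 0 2 5 = - s / 6 - st 0 2 5 + sh 0 2 5" by (simp add: T ph_rows)
  have st026: "st 0 2 6 = c 1 3 1 + c 1 4 6 - c 1 5 0 - c 3 4 4 - c 3 5 5 - c 4 5 2" using st[of 1 3 4 5 0 2 6] by (simp add: less_7 red)
  have sh026: "sh 0 2 6 = \<theta> 3" using sh[of 1 3 4 5 0 2 6] by (simp add: less_7 red)
  have T026: "T 0 2 6 =  - st 0 2 6 + sh 0 2 6" by (simp add: T ph_rows)
  have st034: "st 0 3 4 = c 1 2 3 - c 1 5 4 + c 1 6 0 - c 2 5 0 - c 2 6 4 - c 5 6 3" using st[of 1 2 5 6 0 3 4] by (simp add: less_7 red)
  have sh034: "sh 0 3 4 = 0" using sh[of 1 2 5 6 0 3 4] by (simp add: less_7 red)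
  have T034: "T 0 3 4 = - s / 6 - st 0 3 4 + sh 0 3 4" by (simp add: T ph_rows)
  have st035: "st 0 3 5 = c 1 2 2 + c 1 4 4 + c 1 6 6 + c 2 4 0 - c 2 6 5 + c 4 6 3" using st[of 1 2 4 6 0 3 5] by (simp add: less_7 red)
  have sh035: "sh 0 3 5 = - \<theta> 1" using sh[of 1 2 4 6 0 3 5] by (simp add: less_7 red)
  have T035: "T 0 3 5 =  - st 0 3 5 + sh 0 3 5" by (simp add: T ph_rows)
  have st036: "st 0 3 6 = - c 1 2 1 - c 1 4 0 - c 1 5 6 + c 2 4 4 + c 2 5 5 - c 4 5 3" using st[of 1 2 4 5 0 3 6] by (simp add: less_7 red)
  have sh036: "sh 0 3 6 = - \<theta> 2" using sh[of 1 2 4 5 0 3 6] by (simp add: less_7 red)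
  have T036: "T 0 3 6 =  - st 0 3 6 + sh 0 3 6" by (simp add: T ph_rows)
  have st045: "st 0 4 5 = - c 1 2 5 - c 1 3 4 - c 1 6 1 - c 2 3 0 - c 2 6 2 - c 3 6 3" using st[of 1 2 3 6 0 4 5] by (simp add: less_7 red)
  have sh045: "sh 0 4 5 = - \<theta> 6" using sh[of 1 2 3 6 0 4 5] by (simp add: less_7 red)
  have T045: "T 0 4 5 =  - st 0 4 5 + sh 0 4 5" by (simp add: T ph_rows)
  have st046: "st 0 4 6 = - c 1 2 6 + c 1 3 0 + c 1 5 1 - c 2 3 4 + c 2 5 2 + c 3 5 3" using st[of 1 2 3 5 0 4 6] by (simp add: less_7 red)
  have sh046: "sh 0 4 6 = \<theta> 5" using sh[of 1 2 3 5 0 4 6] by (simp add: less_7 red)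
  have T046: "T 0 4 6 =  - st 0 4 6 + sh 0 4 6" by (simp add: T ph_rows)
  have st056: "st 0 5 6 = c 1 2 0 + c 1 3 6 - c 1 4 1 - c 2 3 5 - c 2 4 2 - c 3 4 3" using st[of 1 2 3 4 0 5 6] by (simp add: less_7 red)
  have sh056: "sh 0 5 6 = - \<theta> 4" using sh[of 1 2 3 4 0 5 6] by (simp add: less_7 red)
  have T056: "T 0 5 6 =  - st 0 5 6 + sh 0 5 6" by (simp add: T ph_rows)
  have st123: "st 1 2 3 = - c 0 4 3 - c 0 5 2 + c 0 6 1 - c 4 5 1 - c 4 6 2 + c 5 6 3" using st[of 0 4 5 6 1 2 3] by (simp add: less_7 red)
  have sh123: "sh 1 2 3 = 0" using sh[of 0 4 5 6 1 2 3] by (simp add: less_7 red)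
  have T123: "T 1 2 3 = s / 6 - st 1 2 3 + sh 1 2 3" by (simp add: T ph_rows)
  have st124: "st 1 2 4 = c 0 3 3 + c 0 5 5 + c 0 6 6 + c 3 5 1 + c 3 6 2 + c 5 6 4" using st[of 0 3 5 6 1 2 4] by (simp add: less_7 red)
  have sh124: "sh 1 2 4 = - \<theta> 0" using sh[of 0 3 5 6 1 2 4] by (simp add: less_7 red)
  have T124: "T 1 2 4 =  - st 1 2 4 + sh 1 2 4" by (simp add: T ph_rows)
  have st125: "st 1 2 5 = c 0 3 2 - c 0 4 5 - c 0 6 0 - c 3 4 1 - c 3 6 3 - c 4 6 4" using st[of 0 3 4 6 1 2 5] by (simp add: less_7 red)
  have sh125: "sh 1 2 5 = - \<theta> 6" using sh[of 0 3 4 6 1 2 5] by (simp add: less_7 red)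
  have T125: "T 1 2 5 =  - st 1 2 5 + sh 1 2 5" by (simp add: T ph_rows)
  have st126: "st 1 2 6 = - c 0 3 1 - c 0 4 6 + c 0 5 0 - c 3 4 2 + c 3 5 3 + c 4 5 4" using st[of 0 3 4 5 1 2 6] by (simp add: less_7 red)
  have sh126: "sh 1 2 6 = \<theta> 5" using sh[of 0 3 4 5 1 2 6] by (simp add: less_7 red)
  have T126: "T 1 2 6 =  - st 1 2 6 + sh 1 2 6" by (simp add: T ph_rows)
  have st134: "st 1 3 4 = - c 0 2 3 + c 0 5 4 - c 0 6 0 - c 2 5 1 - c 2 6 2 - c 5 6 5" using st[of 0 2 5 6 1 3 4] by (simp add: less_7 red)
  have sh134: "sh 1 3 4 = - \<theta> 6" using sh[of 0 2 5 6 1 3 4] by (simp add: less_7 red)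
  have T134: "T 1 3 4 =  - st 1 3 4 + sh 1 3 4" by (simp add: T ph_rows)
  have st135: "st 1 3 5 = - c 0 2 2 - c 0 4 4 - c 0 6 6 + c 2 4 1 + c 2 6 3 + c 4 6 5" using st[of 0 2 4 6 1 3 5] by (simp add: less_7 red)
  have sh135: "sh 1 3 5 = \<theta> 0" using sh[of 0 2 4 6 1 3 5] by (simp add: less_7 red)
  have T135: "T 1 3 5 =  - st 1 3 5 + sh 1 3 5" by (simp add: T ph_rows)
  have st136: "st 1 3 6 = c 0 2 1 + c 0 4 0 + c 0 5 6 + c 2 4 2 - c 2 5 3 - c 4 5 5" using st[of 0 2 4 5 1 3 6] by (simp add: less_7 red)
  have sh136: "sh 1 3 6 = \<theta> 4" using sh[of 0 2 4 5 1 3 6] by (simp add: less_7 red)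
  have T136: "T 1 3 6 =  - st 1 3 6 + sh 1 3 6" by (simp add: T ph_rows)
  have st145: "st 1 4 5 = c 0 2 5 + c 0 3 4 + c 0 6 1 - c 2 3 1 + c 2 6 4 - c 3 6 5" using st[of 0 2 3 6 1 4 5] by (simp add: less_7 red)
  have sh145: "sh 1 4 5 = 0" using sh[of 0 2 3 6 1 4 5] by (simp add: less_7 red)
  have T145: "T 1 4 5 = s / 6 - st 1 4 5 + sh 1 4 5" by (simp add: T ph_rows)
  have st146: "st 1 4 6 = c 0 2 6 - c 0 3 0 - c 0 5 1 - c 2 3 2 - c 2 5 4 + c 3 5 5" using st[of 0 2 3 5 1 4 6] by (simp add: less_7 red)
  have sh146: "sh 1 4 6 = - \<theta> 3" using sh[of 0 2 3 5 1 4 6] by (simp add: less_7 red)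
  have T146: "T 1 4 6 =  - st 1 4 6 + sh 1 4 6" by (simp add: T ph_rows)
  have st156: "st 1 5 6 = - c 0 2 0 - c 0 3 6 + c 0 4 1 + c 2 3 3 + c 2 4 4 - c 3 4 5" using st[of 0 2 3 4 1 5 6] by (simp add: less_7 red)
  have sh156: "sh 1 5 6 = - \<theta> 2" using sh[of 0 2 3 4 1 5 6] by (simp add: less_7 red)
  have T156: "T 1 5 6 =  - st 1 5 6 + sh 1 5 6" by (simp add: T ph_rows)
  have st234: "st 2 3 4 = c 0 1 3 + c 0 5 0 + c 0 6 4 + c 1 5 1 + c 1 6 2 - c 5 6 6" using st[of 0 1 5 6 2 3 4] by (simp add: less_7 red)
  have sh234: "sh 2 3 4 = \<theta> 5" using sh[of 0 1 5 6 2 3 4] by (simp add: less_7 red)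
  have T234: "T 2 3 4 =  - st 2 3 4 + sh 2 3 4" by (simp add: T ph_rows)
  have st235: "st 2 3 5 = c 0 1 2 - c 0 4 0 + c 0 6 5 - c 1 4 1 - c 1 6 3 + c 4 6 6" using st[of 0 1 4 6 2 3 5] by (simp add: less_7 red)
  have sh235: "sh 2 3 5 = - \<theta> 4" using sh[of 0 1 4 6 2 3 5] by (simp add: less_7 red)
  have T235: "T 2 3 5 =  - st 2 3 5 + sh 2 3 5" by (simp add: T ph_rows)
  have st236: "st 2 3 6 = - c 0 1 1 - c 0 4 4 - c 0 5 5 - c 1 4 2 + c 1 5 3 - c 4 5 6" using st[of 0 1 4 5 2 3 6] by (simp add: less_7 red)
  have sh236: "sh 2 3 6 = \<theta> 0" using sh[of 0 1 4 5 2 3 6] by (simp add: less_7 red)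
  have T236: "T 2 3 6 =  - st 2 3 6 + sh 2 3 6" by (simp add: T ph_rows)
  have st245: "st 2 4 5 = - c 0 1 5 + c 0 3 0 + c 0 6 2 + c 1 3 1 - c 1 6 4 - c 3 6 6" using st[of 0 1 3 6 2 4 5] by (simp add: less_7 red)
  have sh245: "sh 2 4 5 = \<theta> 3" using sh[of 0 1 3 6 2 4 5] by (simp add: less_7 red)
  have T245: "T 2 4 5 =  - st 2 4 5 + sh 2 4 5" by (simp add: T ph_rows)
  have st246: "st 2 4 6 = - c 0 1 6 + c 0 3 4 - c 0 5 2 + c 1 3 2 + c 1 5 4 + c 3 5 6" using st[of 0 1 3 5 2 4 6] by (simp add: less_7 red)
  have sh246: "sh 2 4 6 = 0" using sh[of 0 1 3 5 2 4 6] by (simp add: less_7 red)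
  have T246: "T 2 4 6 = s / 6 - st 2 4 6 + sh 2 4 6" by (simp add: T ph_rows)
  have st256: "st 2 5 6 = c 0 1 0 + c 0 3 5 + c 0 4 2 - c 1 3 3 - c 1 4 4 - c 3 4 6" using st[of 0 1 3 4 2 5 6] by (simp add: less_7 red)
  have sh256: "sh 2 5 6 = \<theta> 1" using sh[of 0 1 3 4 2 5 6] by (simp add: less_7 red)
  have T256: "T 2 5 6 =  - st 2 5 6 + sh 2 5 6" by (simp add: T ph_rows)
  have st345: "st 3 4 5 = - c 0 1 4 - c 0 2 0 + c 0 6 3 - c 1 2 1 + c 1 6 5 + c 2 6 6" using st[of 0 1 2 6 3 4 5] by (simp add: less_7 red)
  have sh345: "sh 3 4 5 = - \<theta> 2" using sh[of 0 1 2 6 3 4 5] by (simp add: less_7 red)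
  have T345: "T 3 4 5 =  - st 3 4 5 + sh 3 4 5" by (simp add: T ph_rows)
  have st346: "st 3 4 6 = c 0 1 0 - c 0 2 4 - c 0 5 3 - c 1 2 2 - c 1 5 5 - c 2 5 6" using st[of 0 1 2 5 3 4 6] by (simp add: less_7 red)
  have sh346: "sh 3 4 6 = \<theta> 1" using sh[of 0 1 2 5 3 4 6] by (simp add: less_7 red)
  have T346: "T 3 4 6 =  - st 3 4 6 + sh 3 4 6" by (simp add: T ph_rows)
  have st356: "st 3 5 6 = c 0 1 6 - c 0 2 5 + c 0 4 3 + c 1 2 3 + c 1 4 5 + c 2 4 6" using st[of 0 1 2 4 3 5 6] by (simp add: less_7 red)
  have sh356: "sh 3 5 6 = 0" using sh[of 0 1 2 4 3 5 6] by (simp add: less_7 red)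
  have T356: "T 3 5 6 = - s / 6 - st 3 5 6 + sh 3 5 6" by (simp add: T ph_rows)
  have st456: "st 4 5 6 = - c 0 1 1 - c 0 2 2 - c 0 3 3 + c 1 2 4 - c 1 3 5 - c 2 3 6" using st[of 0 1 2 3 4 5 6] by (simp add: less_7 red)
  have sh456: "sh 4 5 6 = \<theta> 0" using sh[of 0 1 2 3 4 5 6] by (simp add: less_7 red)
  have T456: "T 4 5 6 =  - st 4 5 6 + sh 4 5 6" by (simp add: T ph_rows)
  \<comment> \<open>The 21 components of the Lee equation. The two indices missing from a 5-tuple
    lie on one line of the Fano plane, and its third point is the single index of \<theta> that
    appears.\<close>
  have E01234: "c 0 1 5 + c 0 2 6 - c 0 3 0 - c 1 3 1 - c 1 4 6 - c 2 3 2 + c 2 4 5 + c 3 4 4 = - \<theta> 3" using lee[of 0 1 2 3 4] by (simp add: red)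
  have E01235: "- c 0 1 4 - c 0 2 0 - c 0 3 6 - c 1 2 1 - c 1 5 6 + c 2 3 3 + c 2 5 5 + c 3 5 4 = - \<theta> 2" using lee[of 0 1 2 3 5] by (simp add: red)
  have E01236: "c 0 1 0 - c 0 2 4 + c 0 3 5 - c 1 2 2 - c 1 3 3 - c 1 6 6 + c 2 6 5 + c 3 6 4 = \<theta> 1" using lee[of 0 1 2 3 6] by (simp add: red)
  have E01245: "c 0 1 3 - c 0 4 6 + c 0 5 0 - c 1 2 6 + c 1 5 1 + c 2 4 3 + c 2 5 2 + c 4 5 4 = \<theta> 5" using lee[of 0 1 2 4 5] by (simp add: red)
  have E01246: "c 0 2 3 + c 0 4 5 + c 0 6 0 + c 1 2 5 - c 1 4 3 + c 1 6 1 + c 2 6 2 + c 4 6 4 = \<theta> 6" using lee[of 0 1 2 4 6] by (simp add: red)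
  have E01256: "c 0 1 1 + c 0 2 2 + c 0 5 5 + c 0 6 6 - c 1 2 4 - c 1 5 3 - c 2 6 3 + c 5 6 4 = - \<theta> 0" using lee[of 0 1 2 5 6] by (simp add: red)
  have E01345: "- c 0 1 2 + c 0 4 0 + c 0 5 6 - c 1 3 6 + c 1 4 1 + c 3 4 3 + c 3 5 2 - c 4 5 5 = \<theta> 4" using lee[of 0 1 3 4 5] by (simp add: red)
  have E01346: "c 0 1 1 + c 0 3 3 + c 0 4 4 + c 0 6 6 + c 1 3 5 + c 1 4 2 + c 3 6 2 - c 4 6 5 = - \<theta> 0" using lee[of 0 1 3 4 6] by (simp add: red)
  have E01356: "c 0 3 2 + c 0 5 4 - c 0 6 0 - c 1 3 4 + c 1 5 2 - c 1 6 1 - c 3 6 3 - c 5 6 5 = - \<theta> 6" using lee[of 0 1 3 5 6] by (simp add: red)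
  have E01456: "c 0 1 0 + c 0 4 2 - c 0 5 3 - c 1 4 4 - c 1 5 5 - c 1 6 6 - c 4 6 3 - c 5 6 2 = \<theta> 1" using lee[of 0 1 4 5 6] by (simp add: red)
  have E02345: "- c 0 2 2 - c 0 3 3 - c 0 4 4 - c 0 5 5 - c 2 3 6 + c 2 4 1 - c 3 5 1 - c 4 5 6 = \<theta> 0" using lee[of 0 2 3 4 5] by (simp add: red)
  have E02346: "c 0 2 1 + c 0 4 0 - c 0 6 5 + c 2 3 5 + c 2 4 2 + c 3 4 3 - c 3 6 1 - c 4 6 6 = \<theta> 4" using lee[of 0 2 3 4 6] by (simp add: red)
  have E02356: "- c 0 3 1 + c 0 5 0 + c 0 6 4 - c 2 3 4 + c 2 5 2 - c 2 6 1 + c 3 5 3 - c 5 6 6 = \<theta> 5" using lee[of 0 2 3 5 6] by (simp add: red)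
  have E02456: "c 0 2 0 - c 0 4 1 - c 0 6 3 - c 2 4 4 - c 2 5 5 - c 2 6 6 + c 4 5 3 + c 5 6 1 = \<theta> 2" using lee[of 0 2 4 5 6] by (simp add: red)
  have E03456: "c 0 3 0 + c 0 5 1 + c 0 6 2 - c 3 4 4 - c 3 5 5 - c 3 6 6 - c 4 5 2 + c 4 6 1 = \<theta> 3" using lee[of 0 3 4 5 6] by (simp add: red)
  have E12345: "- c 1 2 2 - c 1 3 3 - c 1 4 4 - c 1 5 5 - c 2 4 0 - c 2 5 6 - c 3 4 6 + c 3 5 0 = \<theta> 1" using lee[of 1 2 3 4 5] by (simp add: red)
  have E12346: "c 1 2 1 + c 1 4 0 - c 1 6 5 - c 2 3 3 - c 2 4 4 - c 2 6 6 + c 3 4 5 + c 3 6 0 = \<theta> 2" using lee[of 1 2 3 4 6] by (simp add: red)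
  have E12356: "- c 1 3 1 + c 1 5 0 + c 1 6 4 - c 2 3 2 - c 2 5 4 + c 2 6 0 + c 3 5 5 + c 3 6 6 = - \<theta> 3" using lee[of 1 2 3 5 6] by (simp add: red)
  have E12456: "c 1 2 0 - c 1 4 1 - c 1 6 3 - c 2 4 2 + c 2 5 3 + c 4 5 5 + c 4 6 6 - c 5 6 0 = - \<theta> 4" using lee[of 1 2 4 5 6] by (simp add: red)
  have E13456: "c 1 3 0 + c 1 5 1 + c 1 6 2 - c 3 4 2 + c 3 5 3 + c 4 5 4 - c 4 6 0 - c 5 6 6 = \<theta> 5" using lee[of 1 3 4 5 6] by (simp add: red)
  have E23456: "c 2 3 0 + c 2 5 1 + c 2 6 2 + c 3 4 1 + c 3 6 3 + c 4 5 0 + c 4 6 4 + c 5 6 5 = \<theta> 6" using lee[of 2 3 4 5 6] by (simp add: red)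
  \<comment> \<open>In the names g00 to g66 the first digit is i and the second the free index of
    the contraction with \<phi>. When the digits agree, the identity comes from the definition of s;
    otherwise it takes two components of the Lee equation.\<close>
  have a016: "A 0 1 6 = 1 / 2 * T 0 1 6 + 1 / 2 * c 0 1 6 - 1 / 2 * c 0 6 1 - 1 / 2 * c 1 6 0" by (simp add: A ci cs T0 Ts)
  have a025: "A 0 2 5 = 1 / 2 * T 0 2 5 + 1 / 2 * c 0 2 5 - 1 / 2 * c 0 5 2 - 1 / 2 * c 2 5 0" by (simp add: A ci cs T0 Ts)
  have a034: "A 0 3 4 = 1 / 2 * T 0 3 4 + 1 / 2 * c 0 3 4 - 1 / 2 * c 0 4 3 - 1 / 2 * c 3 4 0" by (simp add: A ci cs T0 Ts)
  have g00: "A 0 1 6 = A 0 2 5 + A 0 3 4" using a016 T016 st016 sh016 a025 T025 st025 sh025 a034 T034 st034 sh034 s st123 st145 st246 st356 by linarith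
  have a006: "A 0 0 6 = - c 0 6 0" by (simp add: A ci cs T0 Ts)
  have a023: "A 0 2 3 = 1 / 2 * T 0 2 3 + 1 / 2 * c 0 2 3 - 1 / 2 * c 0 3 2 - 1 / 2 * c 2 3 0" by (simp add: A ci cs T0 Ts)
  have a045: "A 0 4 5 = 1 / 2 * T 0 4 5 + 1 / 2 * c 0 4 5 - 1 / 2 * c 0 5 4 - 1 / 2 * c 4 5 0" by (simp add: A ci cs T0 Ts)
  have g01: "A 0 0 6 = A 0 2 3 + A 0 4 5" using a006 a023 T023 st023 sh023 a045 T045 st045 sh045 E01246 E01356 by linarith
  have a005: "A 0 0 5 = - c 0 5 0" by (simp add: A ci cs T0 Ts)
  have a013: "A 0 1 3 = 1 / 2 * T 0 1 3 + 1 / 2 * c 0 1 3 - 1 / 2 * c 0 3 1 - 1 / 2 * c 1 3 0" by (simp add: A ci cs T0 Ts)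
  have a046: "A 0 4 6 = 1 / 2 * T 0 4 6 + 1 / 2 * c 0 4 6 - 1 / 2 * c 0 6 4 - 1 / 2 * c 4 6 0" by (simp add: A ci cs T0 Ts)
  have g02: "A 0 0 5 = A 0 1 3 - A 0 4 6" using a005 a013 T013 st013 sh013 a046 T046 st046 sh046 E01245 E02356 by linarith
  have a004: "A 0 0 4 = - c 0 4 0" by (simp add: A ci cs T0 Ts)
  have a012: "A 0 1 2 = 1 / 2 * T 0 1 2 + 1 / 2 * c 0 1 2 - 1 / 2 * c 0 2 1 - 1 / 2 * c 1 2 0" by (simp add: A ci cs T0 Ts)
  have a056: "A 0 5 6 = 1 / 2 * T 0 5 6 + 1 / 2 * c 0 5 6 - 1 / 2 * c 0 6 5 - 1 / 2 * c 5 6 0" by (simp add: A ci cs T0 Ts)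
  have g03: "A 0 0 4 = - A 0 1 2 + A 0 5 6" using a004 a012 T012 st012 sh012 a056 T056 st056 sh056 E01345 E02346 by linarith
  have a003: "A 0 0 3 = - c 0 3 0" by (simp add: A ci cs T0 Ts)
  have a015: "A 0 1 5 = 1 / 2 * T 0 1 5 + 1 / 2 * c 0 1 5 - 1 / 2 * c 0 5 1 - 1 / 2 * c 1 5 0" by (simp add: A ci cs T0 Ts)
  have a026: "A 0 2 6 = 1 / 2 * T 0 2 6 + 1 / 2 * c 0 2 6 - 1 / 2 * c 0 6 2 - 1 / 2 * c 2 6 0" by (simp add: A ci cs T0 Ts)
  have g04: "A 0 0 3 = - A 0 1 5 - A 0 2 6" using a003 a015 T015 st015 sh015 a026 T026 st026 sh026 E01234 E03456 by linarith
  have a002: "A 0 0 2 = - c 0 2 0" by (simp add: A ci cs T0 Ts)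
  have a014: "A 0 1 4 = 1 / 2 * T 0 1 4 + 1 / 2 * c 0 1 4 - 1 / 2 * c 0 4 1 - 1 / 2 * c 1 4 0" by (simp add: A ci cs T0 Ts)
  have a036: "A 0 3 6 = 1 / 2 * T 0 3 6 + 1 / 2 * c 0 3 6 - 1 / 2 * c 0 6 3 - 1 / 2 * c 3 6 0" by (simp add: A ci cs T0 Ts)
  have g05: "A 0 0 2 = A 0 1 4 + A 0 3 6" using a002 a014 T014 st014 sh014 a036 T036 st036 sh036 E01235 E02456 by linarith
  have a001: "A 0 0 1 = - c 0 1 0" by (simp add: A ci cs T0 Ts)
  have a024: "A 0 2 4 = 1 / 2 * T 0 2 4 + 1 / 2 * c 0 2 4 - 1 / 2 * c 0 4 2 - 1 / 2 * c 2 4 0" by (simp add: A ci cs T0 Ts)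
  have a035: "A 0 3 5 = 1 / 2 * T 0 3 5 + 1 / 2 * c 0 3 5 - 1 / 2 * c 0 5 3 - 1 / 2 * c 3 5 0" by (simp add: A ci cs T0 Ts)
  have g06: "A 0 0 1 = - A 0 2 4 + A 0 3 5" using a001 a024 T024 st024 sh024 a035 T035 st035 sh035 E01236 E01456 by linarith
  have a116: "A 1 1 6 = - c 1 6 1" by (simp add: A ci cs T0 Ts)
  have a125: "A 1 2 5 = 1 / 2 * T 1 2 5 + 1 / 2 * c 1 2 5 - 1 / 2 * c 1 5 2 - 1 / 2 * c 2 5 1" by (simp add: A ci cs T0 Ts)
  have a134: "A 1 3 4 = 1 / 2 * T 1 3 4 + 1 / 2 * c 1 3 4 - 1 / 2 * c 1 4 3 - 1 / 2 * c 3 4 1" by (simp add: A ci cs T0 Ts)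
  have g10: "A 1 1 6 = A 1 2 5 + A 1 3 4" using a116 a125 T125 st125 sh125 a134 T134 st134 sh134 E01246 E01356 by linarith
  have a106: "A 1 0 6 = - 1 / 2 * T 0 1 6 - 1 / 2 * c 0 1 6 - 1 / 2 * c 0 6 1 - 1 / 2 * c 1 6 0" by (simp add: A ci cs T0 Ts)
  have a123: "A 1 2 3 = 1 / 2 * T 1 2 3 + 1 / 2 * c 1 2 3 - 1 / 2 * c 1 3 2 - 1 / 2 * c 2 3 1" by (simp add: A ci cs T0 Ts)
  have a145: "A 1 4 5 = 1 / 2 * T 1 4 5 + 1 / 2 * c 1 4 5 - 1 / 2 * c 1 5 4 - 1 / 2 * c 4 5 1" by (simp add: A ci cs T0 Ts)
  have g11: "A 1 0 6 = A 1 2 3 + A 1 4 5" using a106 T016 st016 sh016 a123 T123 st123 sh123 a145 T145 st145 sh145 s st025 st034 st246 st356 by linarith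
  have a105: "A 1 0 5 = - 1 / 2 * T 0 1 5 - 1 / 2 * c 0 1 5 - 1 / 2 * c 0 5 1 - 1 / 2 * c 1 5 0" by (simp add: A ci cs T0 Ts)
  have a113: "A 1 1 3 = - c 1 3 1" by (simp add: A ci cs T0 Ts)
  have a146: "A 1 4 6 = 1 / 2 * T 1 4 6 + 1 / 2 * c 1 4 6 - 1 / 2 * c 1 6 4 - 1 / 2 * c 4 6 1" by (simp add: A ci cs T0 Ts)
  have g12: "A 1 0 5 = A 1 1 3 - A 1 4 6" using a105 T015 st015 sh015 a113 a146 T146 st146 sh146 E01234 E12356 by linarith
  have a104: "A 1 0 4 = - 1 / 2 * T 0 1 4 - 1 / 2 * c 0 1 4 - 1 / 2 * c 0 4 1 - 1 / 2 * c 1 4 0" by (simp add: A ci cs T0 Ts)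
  have a112: "A 1 1 2 = - c 1 2 1" by (simp add: A ci cs T0 Ts)
  have a156: "A 1 5 6 = 1 / 2 * T 1 5 6 + 1 / 2 * c 1 5 6 - 1 / 2 * c 1 6 5 - 1 / 2 * c 5 6 1" by (simp add: A ci cs T0 Ts)
  have g13: "A 1 0 4 = - A 1 1 2 + A 1 5 6" using a104 T014 st014 sh014 a112 a156 T156 st156 sh156 E12346 E01235 by linarith
  have a103: "A 1 0 3 = - 1 / 2 * T 0 1 3 - 1 / 2 * c 0 1 3 - 1 / 2 * c 0 3 1 - 1 / 2 * c 1 3 0" by (simp add: A ci cs T0 Ts)
  have a115: "A 1 1 5 = - c 1 5 1" by (simp add: A ci cs T0 Ts)
  have a126: "A 1 2 6 = 1 / 2 * T 1 2 6 + 1 / 2 * c 1 2 6 - 1 / 2 * c 1 6 2 - 1 / 2 * c 2 6 1" by (simp add: A ci cs T0 Ts)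
  have g14: "A 1 0 3 = - A 1 1 5 - A 1 2 6" using a103 T013 st013 sh013 a115 a126 T126 st126 sh126 E01245 E13456 by linarith
  have a102: "A 1 0 2 = - 1 / 2 * T 0 1 2 - 1 / 2 * c 0 1 2 - 1 / 2 * c 0 2 1 - 1 / 2 * c 1 2 0" by (simp add: A ci cs T0 Ts)
  have a114: "A 1 1 4 = - c 1 4 1" by (simp add: A ci cs T0 Ts)
  have a136: "A 1 3 6 = 1 / 2 * T 1 3 6 + 1 / 2 * c 1 3 6 - 1 / 2 * c 1 6 3 - 1 / 2 * c 3 6 1" by (simp add: A ci cs T0 Ts)
  have g15: "A 1 0 2 = A 1 1 4 + A 1 3 6" using a102 T012 st012 sh012 a114 a136 T136 st136 sh136 E12456 E01345 by linarith
  have a101: "A 1 0 1 = - c 0 1 1" by (simp add: A ci cs T0 Ts)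
  have a124: "A 1 2 4 = 1 / 2 * T 1 2 4 + 1 / 2 * c 1 2 4 - 1 / 2 * c 1 4 2 - 1 / 2 * c 2 4 1" by (simp add: A ci cs T0 Ts)
  have a135: "A 1 3 5 = 1 / 2 * T 1 3 5 + 1 / 2 * c 1 3 5 - 1 / 2 * c 1 5 3 - 1 / 2 * c 3 5 1" by (simp add: A ci cs T0 Ts)
  have g16: "A 1 0 1 = - A 1 2 4 + A 1 3 5" using a101 a124 T124 st124 sh124 a135 T135 st135 sh135 E01256 E01346 by linarith
  have a216: "A 2 1 6 = - 1 / 2 * T 1 2 6 - 1 / 2 * c 1 2 6 - 1 / 2 * c 1 6 2 - 1 / 2 * c 2 6 1" by (simp add: A ci cs T0 Ts)
  have a225: "A 2 2 5 = - c 2 5 2" by (simp add: A ci cs T0 Ts)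
  have a234: "A 2 3 4 = 1 / 2 * T 2 3 4 + 1 / 2 * c 2 3 4 - 1 / 2 * c 2 4 3 - 1 / 2 * c 3 4 2" by (simp add: A ci cs T0 Ts)
  have g20: "A 2 1 6 = A 2 2 5 + A 2 3 4" using a216 T126 st126 sh126 a225 a234 T234 st234 sh234 E01245 E02356 by linarith
  have a206: "A 2 0 6 = - 1 / 2 * T 0 2 6 - 1 / 2 * c 0 2 6 - 1 / 2 * c 0 6 2 - 1 / 2 * c 2 6 0" by (simp add: A ci cs T0 Ts)
  have a223: "A 2 2 3 = - c 2 3 2" by (simp add: A ci cs T0 Ts)
  have a245: "A 2 4 5 = 1 / 2 * T 2 4 5 + 1 / 2 * c 2 4 5 - 1 / 2 * c 2 5 4 - 1 / 2 * c 4 5 2" by (simp add: A ci cs T0 Ts)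
  have g21: "A 2 0 6 = A 2 2 3 + A 2 4 5" using a206 T026 st026 sh026 a223 a245 T245 st245 sh245 E01234 E12356 by linarith
  have a205: "A 2 0 5 = - 1 / 2 * T 0 2 5 - 1 / 2 * c 0 2 5 - 1 / 2 * c 0 5 2 - 1 / 2 * c 2 5 0" by (simp add: A ci cs T0 Ts)
  have a213: "A 2 1 3 = - 1 / 2 * T 1 2 3 - 1 / 2 * c 1 2 3 - 1 / 2 * c 1 3 2 - 1 / 2 * c 2 3 1" by (simp add: A ci cs T0 Ts)
  have a246: "A 2 4 6 = 1 / 2 * T 2 4 6 + 1 / 2 * c 2 4 6 - 1 / 2 * c 2 6 4 - 1 / 2 * c 4 6 2" by (simp add: A ci cs T0 Ts)
  have g22: "A 2 0 5 = A 2 1 3 - A 2 4 6" using a205 T025 st025 sh025 a213 T123 st123 sh123 a246 T246 st246 sh246 s st016 st034 st145 st356 by linarith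
  have a204: "A 2 0 4 = - 1 / 2 * T 0 2 4 - 1 / 2 * c 0 2 4 - 1 / 2 * c 0 4 2 - 1 / 2 * c 2 4 0" by (simp add: A ci cs T0 Ts)
  have a212: "A 2 1 2 = - c 1 2 2" by (simp add: A ci cs T0 Ts)
  have a256: "A 2 5 6 = 1 / 2 * T 2 5 6 + 1 / 2 * c 2 5 6 - 1 / 2 * c 2 6 5 - 1 / 2 * c 5 6 2" by (simp add: A ci cs T0 Ts)
  have g23: "A 2 0 4 = - A 2 1 2 + A 2 5 6" using a204 T024 st024 sh024 a212 a256 T256 st256 sh256 E12345 E01236 by linarith
  have a203: "A 2 0 3 = - 1 / 2 * T 0 2 3 - 1 / 2 * c 0 2 3 - 1 / 2 * c 0 3 2 - 1 / 2 * c 2 3 0" by (simp add: A ci cs T0 Ts)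
  have a215: "A 2 1 5 = - 1 / 2 * T 1 2 5 - 1 / 2 * c 1 2 5 - 1 / 2 * c 1 5 2 - 1 / 2 * c 2 5 1" by (simp add: A ci cs T0 Ts)
  have a226: "A 2 2 6 = - c 2 6 2" by (simp add: A ci cs T0 Ts)
  have g24: "A 2 0 3 = - A 2 1 5 - A 2 2 6" using a203 T023 st023 sh023 a215 T125 st125 sh125 a226 E01246 E23456 by linarith
  have a202: "A 2 0 2 = - c 0 2 2" by (simp add: A ci cs T0 Ts)
  have a214: "A 2 1 4 = - 1 / 2 * T 1 2 4 - 1 / 2 * c 1 2 4 - 1 / 2 * c 1 4 2 - 1 / 2 * c 2 4 1" by (simp add: A ci cs T0 Ts)
  have a236: "A 2 3 6 = 1 / 2 * T 2 3 6 + 1 / 2 * c 2 3 6 - 1 / 2 * c 2 6 3 - 1 / 2 * c 3 6 2" by (simp add: A ci cs T0 Ts)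
  have g25: "A 2 0 2 = A 2 1 4 + A 2 3 6" using a202 a214 T124 st124 sh124 a236 T236 st236 sh236 E01256 E02345 by linarith
  have a201: "A 2 0 1 = 1 / 2 * T 0 1 2 - 1 / 2 * c 0 1 2 - 1 / 2 * c 0 2 1 + 1 / 2 * c 1 2 0" by (simp add: A ci cs T0 Ts)
  have a224: "A 2 2 4 = - c 2 4 2" by (simp add: A ci cs T0 Ts)
  have a235: "A 2 3 5 = 1 / 2 * T 2 3 5 + 1 / 2 * c 2 3 5 - 1 / 2 * c 2 5 3 - 1 / 2 * c 3 5 2" by (simp add: A ci cs T0 Ts)
  have g26: "A 2 0 1 = - A 2 2 4 + A 2 3 5" using a201 T012 st012 sh012 a224 a235 T235 st235 sh235 E12456 E02346 by linarith
  have a316: "A 3 1 6 = - 1 / 2 * T 1 3 6 - 1 / 2 * c 1 3 6 - 1 / 2 * c 1 6 3 - 1 / 2 * c 3 6 1" by (simp add: A ci cs T0 Ts)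
  have a325: "A 3 2 5 = - 1 / 2 * T 2 3 5 - 1 / 2 * c 2 3 5 - 1 / 2 * c 2 5 3 - 1 / 2 * c 3 5 2" by (simp add: A ci cs T0 Ts)
  have a334: "A 3 3 4 = - c 3 4 3" by (simp add: A ci cs T0 Ts)
  have g30: "A 3 1 6 = A 3 2 5 + A 3 3 4" using a316 T136 st136 sh136 a325 T235 st235 sh235 a334 E01345 E02346 by linarith
  have a306: "A 3 0 6 = - 1 / 2 * T 0 3 6 - 1 / 2 * c 0 3 6 - 1 / 2 * c 0 6 3 - 1 / 2 * c 3 6 0" by (simp add: A ci cs T0 Ts)
  have a323: "A 3 2 3 = - c 2 3 3" by (simp add: A ci cs T0 Ts)
  have a345: "A 3 4 5 = 1 / 2 * T 3 4 5 + 1 / 2 * c 3 4 5 - 1 / 2 * c 3 5 4 - 1 / 2 * c 4 5 3" by (simp add: A ci cs T0 Ts)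
  have g31: "A 3 0 6 = A 3 2 3 + A 3 4 5" using a306 T036 st036 sh036 a323 a345 T345 st345 sh345 E12346 E01235 by linarith
  have a305: "A 3 0 5 = - 1 / 2 * T 0 3 5 - 1 / 2 * c 0 3 5 - 1 / 2 * c 0 5 3 - 1 / 2 * c 3 5 0" by (simp add: A ci cs T0 Ts)
  have a313: "A 3 1 3 = - c 1 3 3" by (simp add: A ci cs T0 Ts)
  have a346: "A 3 4 6 = 1 / 2 * T 3 4 6 + 1 / 2 * c 3 4 6 - 1 / 2 * c 3 6 4 - 1 / 2 * c 4 6 3" by (simp add: A ci cs T0 Ts)
  have g32: "A 3 0 5 = A 3 1 3 - A 3 4 6" using a305 T035 st035 sh035 a313 a346 T346 st346 sh346 E12345 E01236 by linarith
  have a304: "A 3 0 4 = - 1 / 2 * T 0 3 4 - 1 / 2 * c 0 3 4 - 1 / 2 * c 0 4 3 - 1 / 2 * c 3 4 0" by (simp add: A ci cs T0 Ts)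
  have a312: "A 3 1 2 = 1 / 2 * T 1 2 3 - 1 / 2 * c 1 2 3 - 1 / 2 * c 1 3 2 + 1 / 2 * c 2 3 1" by (simp add: A ci cs T0 Ts)
  have a356: "A 3 5 6 = 1 / 2 * T 3 5 6 + 1 / 2 * c 3 5 6 - 1 / 2 * c 3 6 5 - 1 / 2 * c 5 6 3" by (simp add: A ci cs T0 Ts)
  have g33: "A 3 0 4 = - A 3 1 2 + A 3 5 6" using a304 T034 st034 sh034 a312 T123 st123 sh123 a356 T356 st356 sh356 s st016 st025 st145 st246 by linarith
  have a303: "A 3 0 3 = - c 0 3 3" by (simp add: A ci cs T0 Ts)
  have a315: "A 3 1 5 = - 1 / 2 * T 1 3 5 - 1 / 2 * c 1 3 5 - 1 / 2 * c 1 5 3 - 1 / 2 * c 3 5 1" by (simp add: A ci cs T0 Ts)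
  have a326: "A 3 2 6 = - 1 / 2 * T 2 3 6 - 1 / 2 * c 2 3 6 - 1 / 2 * c 2 6 3 - 1 / 2 * c 3 6 2" by (simp add: A ci cs T0 Ts)
  have g34: "A 3 0 3 = - A 3 1 5 - A 3 2 6" using a303 a315 T135 st135 sh135 a326 T236 st236 sh236 E01346 E02345 by linarith
  have a302: "A 3 0 2 = 1 / 2 * T 0 2 3 - 1 / 2 * c 0 2 3 - 1 / 2 * c 0 3 2 + 1 / 2 * c 2 3 0" by (simp add: A ci cs T0 Ts)
  have a314: "A 3 1 4 = - 1 / 2 * T 1 3 4 - 1 / 2 * c 1 3 4 - 1 / 2 * c 1 4 3 - 1 / 2 * c 3 4 1" by (simp add: A ci cs T0 Ts)
  have a336: "A 3 3 6 = - c 3 6 3" by (simp add: A ci cs T0 Ts)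
  have g35: "A 3 0 2 = A 3 1 4 + A 3 3 6" using a302 T023 st023 sh023 a314 T134 st134 sh134 a336 E01356 E23456 by linarith
  have a301: "A 3 0 1 = 1 / 2 * T 0 1 3 - 1 / 2 * c 0 1 3 - 1 / 2 * c 0 3 1 + 1 / 2 * c 1 3 0" by (simp add: A ci cs T0 Ts)
  have a324: "A 3 2 4 = - 1 / 2 * T 2 3 4 - 1 / 2 * c 2 3 4 - 1 / 2 * c 2 4 3 - 1 / 2 * c 3 4 2" by (simp add: A ci cs T0 Ts)
  have a335: "A 3 3 5 = - c 3 5 3" by (simp add: A ci cs T0 Ts)
  have g36: "A 3 0 1 = - A 3 2 4 + A 3 3 5" using a301 T013 st013 sh013 a324 T234 st234 sh234 a335 E13456 E02356 by linarith
  have a416: "A 4 1 6 = - 1 / 2 * T 1 4 6 - 1 / 2 * c 1 4 6 - 1 / 2 * c 1 6 4 - 1 / 2 * c 4 6 1" by (simp add: A ci cs T0 Ts)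
  have a425: "A 4 2 5 = - 1 / 2 * T 2 4 5 - 1 / 2 * c 2 4 5 - 1 / 2 * c 2 5 4 - 1 / 2 * c 4 5 2" by (simp add: A ci cs T0 Ts)
  have a434: "A 4 3 4 = - c 3 4 4" by (simp add: A ci cs T0 Ts)
  have g40: "A 4 1 6 = A 4 2 5 + A 4 3 4" using a416 T146 st146 sh146 a425 T245 st245 sh245 a434 E01234 E03456 by linarith
  have a406: "A 4 0 6 = - 1 / 2 * T 0 4 6 - 1 / 2 * c 0 4 6 - 1 / 2 * c 0 6 4 - 1 / 2 * c 4 6 0" by (simp add: A ci cs T0 Ts)
  have a423: "A 4 2 3 = 1 / 2 * T 2 3 4 - 1 / 2 * c 2 3 4 - 1 / 2 * c 2 4 3 + 1 / 2 * c 3 4 2" by (simp add: A ci cs T0 Ts)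
  have a445: "A 4 4 5 = - c 4 5 4" by (simp add: A ci cs T0 Ts)
  have g41: "A 4 0 6 = A 4 2 3 + A 4 4 5" using a406 T046 st046 sh046 a423 T234 st234 sh234 a445 E01245 E13456 by linarith
  have a405: "A 4 0 5 = - 1 / 2 * T 0 4 5 - 1 / 2 * c 0 4 5 - 1 / 2 * c 0 5 4 - 1 / 2 * c 4 5 0" by (simp add: A ci cs T0 Ts)
  have a413: "A 4 1 3 = 1 / 2 * T 1 3 4 - 1 / 2 * c 1 3 4 - 1 / 2 * c 1 4 3 + 1 / 2 * c 3 4 1" by (simp add: A ci cs T0 Ts)
  have a446: "A 4 4 6 = - c 4 6 4" by (simp add: A ci cs T0 Ts)
  have g42: "A 4 0 5 = A 4 1 3 - A 4 4 6" using a405 T045 st045 sh045 a413 T134 st134 sh134 a446 E01246 E23456 by linarith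
  have a404: "A 4 0 4 = - c 0 4 4" by (simp add: A ci cs T0 Ts)
  have a412: "A 4 1 2 = 1 / 2 * T 1 2 4 - 1 / 2 * c 1 2 4 - 1 / 2 * c 1 4 2 + 1 / 2 * c 2 4 1" by (simp add: A ci cs T0 Ts)
  have a456: "A 4 5 6 = 1 / 2 * T 4 5 6 + 1 / 2 * c 4 5 6 - 1 / 2 * c 4 6 5 - 1 / 2 * c 5 6 4" by (simp add: A ci cs T0 Ts)
  have g43: "A 4 0 4 = - A 4 1 2 + A 4 5 6" using a404 a412 T124 st124 sh124 a456 T456 st456 sh456 E01346 E02345 by linarith
  have a403: "A 4 0 3 = 1 / 2 * T 0 3 4 - 1 / 2 * c 0 3 4 - 1 / 2 * c 0 4 3 + 1 / 2 * c 3 4 0" by (simp add: A ci cs T0 Ts)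
  have a415: "A 4 1 5 = - 1 / 2 * T 1 4 5 - 1 / 2 * c 1 4 5 - 1 / 2 * c 1 5 4 - 1 / 2 * c 4 5 1" by (simp add: A ci cs T0 Ts)
  have a426: "A 4 2 6 = - 1 / 2 * T 2 4 6 - 1 / 2 * c 2 4 6 - 1 / 2 * c 2 6 4 - 1 / 2 * c 4 6 2" by (simp add: A ci cs T0 Ts)
  have g44: "A 4 0 3 = - A 4 1 5 - A 4 2 6" using a403 T034 st034 sh034 a415 T145 st145 sh145 a426 T246 st246 sh246 s st016 st025 st123 st356 by linarith
  have a402: "A 4 0 2 = 1 / 2 * T 0 2 4 - 1 / 2 * c 0 2 4 - 1 / 2 * c 0 4 2 + 1 / 2 * c 2 4 0" by (simp add: A ci cs T0 Ts)
  have a414: "A 4 1 4 = - c 1 4 4" by (simp add: A ci cs T0 Ts)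
  have a436: "A 4 3 6 = - 1 / 2 * T 3 4 6 - 1 / 2 * c 3 4 6 - 1 / 2 * c 3 6 4 - 1 / 2 * c 4 6 3" by (simp add: A ci cs T0 Ts)
  have g45: "A 4 0 2 = A 4 1 4 + A 4 3 6" using a402 T024 st024 sh024 a414 a436 T346 st346 sh346 E12345 E01456 by linarith
  have a401: "A 4 0 1 = 1 / 2 * T 0 1 4 - 1 / 2 * c 0 1 4 - 1 / 2 * c 0 4 1 + 1 / 2 * c 1 4 0" by (simp add: A ci cs T0 Ts)
  have a424: "A 4 2 4 = - c 2 4 4" by (simp add: A ci cs T0 Ts)
  have a435: "A 4 3 5 = - 1 / 2 * T 3 4 5 - 1 / 2 * c 3 4 5 - 1 / 2 * c 3 5 4 - 1 / 2 * c 4 5 3" by (simp add: A ci cs T0 Ts)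
  have g46: "A 4 0 1 = - A 4 2 4 + A 4 3 5" using a401 T014 st014 sh014 a424 a435 T345 st345 sh345 E12346 E02456 by linarith
  have a516: "A 5 1 6 = - 1 / 2 * T 1 5 6 - 1 / 2 * c 1 5 6 - 1 / 2 * c 1 6 5 - 1 / 2 * c 5 6 1" by (simp add: A ci cs T0 Ts)
  have a525: "A 5 2 5 = - c 2 5 5" by (simp add: A ci cs T0 Ts)
  have a534: "A 5 3 4 = 1 / 2 * T 3 4 5 - 1 / 2 * c 3 4 5 - 1 / 2 * c 3 5 4 + 1 / 2 * c 4 5 3" by (simp add: A ci cs T0 Ts)
  have g50: "A 5 1 6 = A 5 2 5 + A 5 3 4" using a516 T156 st156 sh156 a525 a534 T345 st345 sh345 E01235 E02456 by linarith
  have a506: "A 5 0 6 = - 1 / 2 * T 0 5 6 - 1 / 2 * c 0 5 6 - 1 / 2 * c 0 6 5 - 1 / 2 * c 5 6 0" by (simp add: A ci cs T0 Ts)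
  have a523: "A 5 2 3 = 1 / 2 * T 2 3 5 - 1 / 2 * c 2 3 5 - 1 / 2 * c 2 5 3 + 1 / 2 * c 3 5 2" by (simp add: A ci cs T0 Ts)
  have a545: "A 5 4 5 = - c 4 5 5" by (simp add: A ci cs T0 Ts)
  have g51: "A 5 0 6 = A 5 2 3 + A 5 4 5" using a506 T056 st056 sh056 a523 T235 st235 sh235 a545 E12456 E01345 by linarith
  have a505: "A 5 0 5 = - c 0 5 5" by (simp add: A ci cs T0 Ts)
  have a513: "A 5 1 3 = 1 / 2 * T 1 3 5 - 1 / 2 * c 1 3 5 - 1 / 2 * c 1 5 3 + 1 / 2 * c 3 5 1" by (simp add: A ci cs T0 Ts)
  have a546: "A 5 4 6 = - 1 / 2 * T 4 5 6 - 1 / 2 * c 4 5 6 - 1 / 2 * c 4 6 5 - 1 / 2 * c 5 6 4" by (simp add: A ci cs T0 Ts)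
  have g52: "A 5 0 5 = A 5 1 3 - A 5 4 6" using a505 a513 T135 st135 sh135 a546 T456 st456 sh456 E01256 E02345 by linarith
  have a504: "A 5 0 4 = 1 / 2 * T 0 4 5 - 1 / 2 * c 0 4 5 - 1 / 2 * c 0 5 4 + 1 / 2 * c 4 5 0" by (simp add: A ci cs T0 Ts)
  have a512: "A 5 1 2 = 1 / 2 * T 1 2 5 - 1 / 2 * c 1 2 5 - 1 / 2 * c 1 5 2 + 1 / 2 * c 2 5 1" by (simp add: A ci cs T0 Ts)
  have a556: "A 5 5 6 = - c 5 6 5" by (simp add: A ci cs T0 Ts)
  have g53: "A 5 0 4 = - A 5 1 2 + A 5 5 6" using a504 T045 st045 sh045 a512 T125 st125 sh125 a556 E01356 E23456 by linarith
  have a503: "A 5 0 3 = 1 / 2 * T 0 3 5 - 1 / 2 * c 0 3 5 - 1 / 2 * c 0 5 3 + 1 / 2 * c 3 5 0" by (simp add: A ci cs T0 Ts)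
  have a515: "A 5 1 5 = - c 1 5 5" by (simp add: A ci cs T0 Ts)
  have a526: "A 5 2 6 = - 1 / 2 * T 2 5 6 - 1 / 2 * c 2 5 6 - 1 / 2 * c 2 6 5 - 1 / 2 * c 5 6 2" by (simp add: A ci cs T0 Ts)
  have g54: "A 5 0 3 = - A 5 1 5 - A 5 2 6" using a503 T035 st035 sh035 a515 a526 T256 st256 sh256 E12345 E01456 by linarith
  have a502: "A 5 0 2 = 1 / 2 * T 0 2 5 - 1 / 2 * c 0 2 5 - 1 / 2 * c 0 5 2 + 1 / 2 * c 2 5 0" by (simp add: A ci cs T0 Ts)
  have a514: "A 5 1 4 = 1 / 2 * T 1 4 5 - 1 / 2 * c 1 4 5 - 1 / 2 * c 1 5 4 + 1 / 2 * c 4 5 1" by (simp add: A ci cs T0 Ts)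
  have a536: "A 5 3 6 = - 1 / 2 * T 3 5 6 - 1 / 2 * c 3 5 6 - 1 / 2 * c 3 6 5 - 1 / 2 * c 5 6 3" by (simp add: A ci cs T0 Ts)
  have g55: "A 5 0 2 = A 5 1 4 + A 5 3 6" using a502 T025 st025 sh025 a514 T145 st145 sh145 a536 T356 st356 sh356 s st016 st034 st123 st246 by linarith
  have a501: "A 5 0 1 = 1 / 2 * T 0 1 5 - 1 / 2 * c 0 1 5 - 1 / 2 * c 0 5 1 + 1 / 2 * c 1 5 0" by (simp add: A ci cs T0 Ts)
  have a524: "A 5 2 4 = 1 / 2 * T 2 4 5 - 1 / 2 * c 2 4 5 - 1 / 2 * c 2 5 4 + 1 / 2 * c 4 5 2" by (simp add: A ci cs T0 Ts)
  have a535: "A 5 3 5 = - c 3 5 5" by (simp add: A ci cs T0 Ts)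
  have g56: "A 5 0 1 = - A 5 2 4 + A 5 3 5" using a501 T015 st015 sh015 a524 T245 st245 sh245 a535 E12356 E03456 by linarith
  have a616: "A 6 1 6 = - c 1 6 6" by (simp add: A ci cs T0 Ts)
  have a625: "A 6 2 5 = 1 / 2 * T 2 5 6 - 1 / 2 * c 2 5 6 - 1 / 2 * c 2 6 5 + 1 / 2 * c 5 6 2" by (simp add: A ci cs T0 Ts)
  have a634: "A 6 3 4 = 1 / 2 * T 3 4 6 - 1 / 2 * c 3 4 6 - 1 / 2 * c 3 6 4 + 1 / 2 * c 4 6 3" by (simp add: A ci cs T0 Ts)
  have g60: "A 6 1 6 = A 6 2 5 + A 6 3 4" using a616 a625 T256 st256 sh256 a634 T346 st346 sh346 E01236 E01456 by linarith
  have a606: "A 6 0 6 = - c 0 6 6" by (simp add: A ci cs T0 Ts)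
  have a623: "A 6 2 3 = 1 / 2 * T 2 3 6 - 1 / 2 * c 2 3 6 - 1 / 2 * c 2 6 3 + 1 / 2 * c 3 6 2" by (simp add: A ci cs T0 Ts)
  have a645: "A 6 4 5 = 1 / 2 * T 4 5 6 - 1 / 2 * c 4 5 6 - 1 / 2 * c 4 6 5 + 1 / 2 * c 5 6 4" by (simp add: A ci cs T0 Ts)
  have g61: "A 6 0 6 = A 6 2 3 + A 6 4 5" using a606 a623 T236 st236 sh236 a645 T456 st456 sh456 E01256 E01346 by linarith
  have a605: "A 6 0 5 = 1 / 2 * T 0 5 6 - 1 / 2 * c 0 5 6 - 1 / 2 * c 0 6 5 + 1 / 2 * c 5 6 0" by (simp add: A ci cs T0 Ts)
  have a613: "A 6 1 3 = 1 / 2 * T 1 3 6 - 1 / 2 * c 1 3 6 - 1 / 2 * c 1 6 3 + 1 / 2 * c 3 6 1" by (simp add: A ci cs T0 Ts)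
  have a646: "A 6 4 6 = - c 4 6 6" by (simp add: A ci cs T0 Ts)
  have g62: "A 6 0 5 = A 6 1 3 - A 6 4 6" using a605 T056 st056 sh056 a613 T136 st136 sh136 a646 E12456 E02346 by linarith
  have a604: "A 6 0 4 = 1 / 2 * T 0 4 6 - 1 / 2 * c 0 4 6 - 1 / 2 * c 0 6 4 + 1 / 2 * c 4 6 0" by (simp add: A ci cs T0 Ts)
  have a612: "A 6 1 2 = 1 / 2 * T 1 2 6 - 1 / 2 * c 1 2 6 - 1 / 2 * c 1 6 2 + 1 / 2 * c 2 6 1" by (simp add: A ci cs T0 Ts)
  have a656: "A 6 5 6 = - c 5 6 6" by (simp add: A ci cs T0 Ts)
  have g63: "A 6 0 4 = - A 6 1 2 + A 6 5 6" using a604 T046 st046 sh046 a612 T126 st126 sh126 a656 E13456 E02356 by linarith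
  have a603: "A 6 0 3 = 1 / 2 * T 0 3 6 - 1 / 2 * c 0 3 6 - 1 / 2 * c 0 6 3 + 1 / 2 * c 3 6 0" by (simp add: A ci cs T0 Ts)
  have a615: "A 6 1 5 = 1 / 2 * T 1 5 6 - 1 / 2 * c 1 5 6 - 1 / 2 * c 1 6 5 + 1 / 2 * c 5 6 1" by (simp add: A ci cs T0 Ts)
  have a626: "A 6 2 6 = - c 2 6 6" by (simp add: A ci cs T0 Ts)
  have g64: "A 6 0 3 = - A 6 1 5 - A 6 2 6" using a603 T036 st036 sh036 a615 T156 st156 sh156 a626 E12346 E02456 by linarith
  have a602: "A 6 0 2 = 1 / 2 * T 0 2 6 - 1 / 2 * c 0 2 6 - 1 / 2 * c 0 6 2 + 1 / 2 * c 2 6 0" by (simp add: A ci cs T0 Ts)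
  have a614: "A 6 1 4 = 1 / 2 * T 1 4 6 - 1 / 2 * c 1 4 6 - 1 / 2 * c 1 6 4 + 1 / 2 * c 4 6 1" by (simp add: A ci cs T0 Ts)
  have a636: "A 6 3 6 = - c 3 6 6" by (simp add: A ci cs T0 Ts)
  have g65: "A 6 0 2 = A 6 1 4 + A 6 3 6" using a602 T026 st026 sh026 a614 T146 st146 sh146 a636 E12356 E03456 by linarith
  have a601: "A 6 0 1 = 1 / 2 * T 0 1 6 - 1 / 2 * c 0 1 6 - 1 / 2 * c 0 6 1 + 1 / 2 * c 1 6 0" by (simp add: A ci cs T0 Ts)
  have a624: "A 6 2 4 = 1 / 2 * T 2 4 6 - 1 / 2 * c 2 4 6 - 1 / 2 * c 2 6 4 + 1 / 2 * c 4 6 2" by (simp add: A ci cs T0 Ts)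
  have a635: "A 6 3 5 = 1 / 2 * T 3 5 6 - 1 / 2 * c 3 5 6 - 1 / 2 * c 3 6 5 + 1 / 2 * c 5 6 3" by (simp add: A ci cs T0 Ts)
  have g66: "A 6 0 1 = - A 6 2 4 + A 6 3 5" using a601 T016 st016 sh016 a624 T246 st246 sh246 a635 T356 st356 sh356 s st025 st034 st123 st145 by linarith
  have Ask: "A i k j = - A i j k" for i j k
    using sk[of j k i] sk[of i j k] sk[of k i j] sk[of i k j] Tsk(2)[of i j k] sk[of k j i] sk[of j i k] unfolding A by (simp add: field_simps)
  show ?thesis
    using exhaust_7[of i]
  proof (elim disjE)
    show "i = 0 \<Longrightarrow> is_g2 (A i)" using is_g2I[of "A 0", OF Ask g00 g01 g02 g03 g04 g05 g06] by simp
  next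
    show "i = 1 \<Longrightarrow> is_g2 (A i)" using is_g2I[of "A 1", OF Ask g10 g11 g12 g13 g14 g15 g16] by simp
  next
    show "i = 2 \<Longrightarrow> is_g2 (A i)" using is_g2I[of "A 2", OF Ask g20 g21 g22 g23 g24 g25 g26] by simp
  next
    show "i = 3 \<Longrightarrow> is_g2 (A i)" using is_g2I[of "A 3", OF Ask g30 g31 g32 g33 g34 g35 g36] by simp
  next
    show "i = 4 \<Longrightarrow> is_g2 (A i)" using is_g2I[of "A 4", OF Ask g40 g41 g42 g43 g44 g45 g46] by simp
  next
    show "i = 5 \<Longrightarrow> is_g2 (A i)" using is_g2I[of "A 5", OF Ask g50 g51 g52 g53 g54 g55 g56] by simp
  next
    show "i = 6 \<Longrightarrow> is_g2 (A i)" using is_g2I[of "A 6", OF Ask g60 g61 g62 g63 g64 g65 g66] by simp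
  qed
qed

section \<open>Calculus of smooth maps\<close>

abbreviation fd :: "('a::real_normed_vector \<Rightarrow> 'b::real_normed_vector) \<Rightarrow> 'a \<Rightarrow> 'a \<Rightarrow> 'b" where
  "fd f x \<equiv> frechet_derivative f (at x)"

lemma fd_eqI: "(f has_derivative f') (at x) \<Longrightarrow> fd f x v = f' v"
  using frechet_derivative_at by metis

lemma differentiable_fd: "f differentiable (at x) \<Longrightarrow> (f has_derivative fd f x) (at x)"
  by (simp add: frechet_derivative_works)

lemma fd_cong:
  assumes "eventually (\<lambda>y. f y = g y) (nhds x)"
  shows "fd f x = fd g x"
proof -
  have e: "f x = g x" using eventually_nhds_x_imp_x[OF assms] .
  have ev: "eventually (\<lambda>y. f y = g y) (at x)"
    using assms by (simp add: eventually_nhds_conv_at)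
  have "(f has_derivative D) (at x) \<longleftrightarrow> (g has_derivative D) (at x)" for D
    using has_derivative_transform_eventually[of f D x UNIV g]
      has_derivative_transform_eventually[of g D x UNIV f] ev e
    by (auto simp: eq_commute)
  then show ?thesis by (simp add: frechet_derivative_def)
qed

lemma differentiable_cong:
  assumes "eventually (\<lambda>y. f y = g y) (nhds x)" "f differentiable (at x)"
  shows "g differentiable (at x)"
proof -
  have e: "f x = g x" using eventually_nhds_x_imp_x[OF assms(1)] .
  have ev: "eventually (\<lambda>y. f y = g y) (at x)"
    using assms by (simp add: eventually_nhds_conv_at)
  show ?thesis
    using has_derivative_transform_eventually[of f _ x UNIV g] ev e assms(2)
    unfolding differentiable_def by auto
qed

lemma fd_cong_open:
  assumes "open S" "x \<in> S" "\<And>y. y \<in> S \<Longrightarrow> f y = g y"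
  shows "fd f x = fd g x"
  by (rule fd_cong) (use assms in \<open>auto simp: eventually_nhds\<close>)

lemma differentiable_cong_open:
  assumes "open S" "x \<in> S" "\<And>y. y \<in> S \<Longrightarrow> f y = g y" "f differentiable (at x)"
  shows "g differentiable (at x)"
  by (rule differentiable_cong[of f]) (use assms in \<open>auto simp: eventually_nhds\<close>)

lemma fd_linear:
  assumes "f differentiable (at x)"
  shows "linear (fd f x)"
  using assms by (simp add: linear_frechet_derivative)

lemma Ck_mono: "Ck (Suc k) f S \<Longrightarrow> Ck k f S"
proof (induction k arbitrary: f)
  case 0
  then show ?case by (simp add: differentiable_imp_continuous_on)
next
  case (Suc k)
  then show ?case by (metis Ck.simps(2))
qed

lemma Ck_subset: "Ck k f S \<Longrightarrow> T \<subseteq> S \<Longrightarrow> Ck k f T"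
  by (induction k arbitrary: f) (auto intro: continuous_on_subset differentiable_on_subset)

lemma Ck_cong:
  assumes "open S" "\<And>x. x \<in> S \<Longrightarrow> f x = g x" "Ck k f S"
  shows "Ck k g S"
  using assms(2,3)
proof (induction k arbitrary: f g)
  case 0
  then show ?case using continuous_on_cong by (metis Ck.simps(1))
next
  case (Suc k)
  have 1: "g differentiable_on S"
    using Suc.prems assms(1) differentiable_cong_open[OF assms(1), of _ f g]
    by (auto simp: differentiable_on_eq_differentiable_at)
  have 2: "Ck k (\<lambda>x. fd g x v) S" for v
  proof (rule Suc.IH)
    show "Ck k (\<lambda>x. fd f x v) S" using Suc.prems by simp
    show "fd f x v = fd g x v" if "x \<in> S" for x
      using fd_cong_open[OF assms(1) that, of f g] Suc.prems by simp
  qed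
  show ?case using 1 2 by simp
qed

lemma Ck_local:
  assumes "open S" "\<And>x. x \<in> S \<Longrightarrow> \<exists>T. open T \<and> x \<in> T \<and> Ck k f T"
  shows "Ck k f S"
  using assms(2)
proof (induction k arbitrary: f)
  case 0
  have "\<forall>x\<in>S. continuous (at x) f"
    using 0 by (meson Ck.simps(1) continuous_on_eq_continuous_at)
  then show ?case using assms(1) by (simp add: continuous_on_eq_continuous_at)
next
  case (Suc k)
  have "\<forall>x\<in>S. f differentiable (at x)"
    using Suc.prems by (metis Ck.simps(2) differentiable_on_eq_differentiable_at)
  moreover have "Ck k (\<lambda>x. fd f x v) S" for v
    using Suc.prems by (intro Suc.IH) (metis Ck.simps(2))
  ultimately show ?case using assms(1) by (simp add: differentiable_on_eq_differentiable_at)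
qed

lemma Ck_const: "Ck k (\<lambda>x. c) S"
  by (induction k arbitrary: c) (simp_all add: frechet_derivative_const)

lemma Ck_differentiable: "open S \<Longrightarrow> Ck (Suc k) f S \<Longrightarrow> x \<in> S \<Longrightarrow> f differentiable (at x)"
  by (simp add: differentiable_on_eq_differentiable_at)

lemma Ck_add:
  assumes "open S" "Ck k f S" "Ck k g S"
  shows "Ck k (\<lambda>x. f x + g x) S"
  using assms(2,3)
proof (induction k arbitrary: f g)
  case 0
  then show ?case by (simp add: continuous_on_add)
next
  case (Suc k)
  have "Ck k (\<lambda>x. fd (\<lambda>x. f x + g x) x v) S" for v
  proof (rule Ck_cong[OF assms(1)])
    show "Ck k (\<lambda>x. fd f x v + fd g x v) S" using Suc by simp
    show "fd f x v + fd g x v = fd (\<lambda>x. f x + g x) x v" if "x \<in> S" for x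
      using has_derivative_add[OF differentiable_fd differentiable_fd, of f x g] Suc.prems that assms(1)
      by (subst fd_eqI[of "\<lambda>x. f x + g x" "\<lambda>v. fd f x v + fd g x v"]) (auto simp: differentiable_on_eq_differentiable_at)
  qed
  then show ?case using Suc.prems by (simp add: differentiable_on_add)
qed

lemma Ck_sum:
  assumes "open S" "\<And>i. i \<in> I \<Longrightarrow> Ck k (f i) S"
  shows "Ck k (\<lambda>x. \<Sum>i\<in>I. f i x) S"
  using assms(2)
proof (induction I rule: infinite_finite_induct)
  case (insert i I)
  then show ?case by (simp add: Ck_add[OF assms(1)])
qed (simp_all add: Ck_const)

lemma Ck_scaleR:
  fixes g :: "'a::euclidean_space \<Rightarrow> 'b::real_normed_vector"
  assumes "open S" "Ck k f S" "Ck k g S"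
  shows "Ck k (\<lambda>x. f x *\<^sub>R g x) S"
  using assms(2,3)
proof (induction k arbitrary: f g)
  case 0
  then show ?case by (simp add: continuous_on_scaleR)
next
  case (Suc k)
  have d: "f differentiable (at x)" "g differentiable (at x)" if "x \<in> S" for x
    using that Suc.prems assms(1) by (auto simp: differentiable_on_eq_differentiable_at)
  have h: "((\<lambda>x. f x *\<^sub>R g x) has_derivative (\<lambda>v. f x *\<^sub>R fd g x v + fd f x v *\<^sub>R g x)) (at x)"
    if "x \<in> S" for x
    using has_derivative_scaleR[OF differentiable_fd differentiable_fd, OF d[OF that]] by simp
  have "Ck k (\<lambda>x. fd (\<lambda>x. f x *\<^sub>R g x) x v) S" for v
  proof (rule Ck_cong[OF assms(1)])
    show "Ck k (\<lambda>x. f x *\<^sub>R fd g x v + fd f x v *\<^sub>R g x) S"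
      using Suc.prems Ck_mono[OF Suc.prems(1)] Ck_mono[OF Suc.prems(2)]
      by (intro Ck_add[OF assms(1)] Suc.IH) auto
    show "f x *\<^sub>R fd g x v + fd f x v *\<^sub>R g x = fd (\<lambda>x. f x *\<^sub>R g x) x v" if "x \<in> S" for x
      using fd_eqI[OF h[OF that]] by simp
  qed
  moreover have "(\<lambda>x. f x *\<^sub>R g x) differentiable_on S"
    using h assms(1) by (auto simp: differentiable_on_eq_differentiable_at differentiable_def)
  ultimately show ?case by simp
qed

lemma Ck_bounded_linear:
  assumes "open S" "bounded_linear L" "Ck k f S"
  shows "Ck k (\<lambda>x. L (f x)) S"
  using assms(3)
proof (induction k arbitrary: f)
  case 0
  then show ?case using assms(2) by (simp add: bounded_linear.continuous_on)
next
  case (Suc k)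
  have h: "((\<lambda>x. L (f x)) has_derivative (\<lambda>v. L (fd f x v))) (at x)"
    if "x \<in> S" for x
    using bounded_linear.has_derivative[OF assms(2) differentiable_fd] that Suc.prems assms(1)
     by (auto simp: differentiable_on_eq_differentiable_at)
  have "Ck k (\<lambda>x. fd (\<lambda>x. L (f x)) x v) S" for v
  proof (rule Ck_cong[OF assms(1)])
    show "Ck k (\<lambda>x. L (fd f x v)) S" using Suc by auto
    show "L (fd f x v) = fd (\<lambda>x. L (f x)) x v" if "x \<in> S" for x
      using fd_eqI[OF h[OF that]] by simp
  qed
  moreover have "(\<lambda>x. L (f x)) differentiable_on S"
    using h assms(1) by (auto simp: differentiable_on_eq_differentiable_at differentiable_def)
  ultimately show ?case by simp
qed

lemma fd_compose:
  assumes "f differentiable (at x)" "g differentiable (at (f x))"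
  shows "((\<lambda>x. g (f x)) has_derivative (\<lambda>v. fd g (f x) (fd f x v))) (at x)"
  using has_derivative_compose[OF differentiable_fd[OF assms(1)] differentiable_fd[OF assms(2)]] .

lemma fd_Basis:
  fixes f :: "'a::euclidean_space \<Rightarrow> 'b::real_normed_vector"
  assumes "f differentiable (at x)"
  shows "fd f x v = (\<Sum>b\<in>Basis. (v \<bullet> b) *\<^sub>R fd f x b)"
proof -
  interpret linear "fd f x" by (rule fd_linear[OF assms])
  have "fd f x (\<Sum>b\<in>Basis. (v \<bullet> b) *\<^sub>R b) = (\<Sum>b\<in>Basis. (v \<bullet> b) *\<^sub>R fd f x b)"
    by (simp add: sum scale)
  then show ?thesis by (simp add: euclidean_representation)
qed

text \<open>\<open>Ck\<close> controls derivatives in fixed directions, while the chain rule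
  produces the moving direction Df(x) v. Expanding this direction in \<open>Basis\<close> brings the
  induction hypothesis into play.\<close>

lemma Ck_comp:
  fixes g :: "'b::euclidean_space \<Rightarrow> 'c::real_normed_vector"
  assumes "open S" "open T" "f ` S \<subseteq> T" "Ck k f S" "Ck k g T"
  shows "Ck k (\<lambda>x. g (f x)) S"
  using assms(4,5)
proof (induction k arbitrary: g)
  case 0
  then show ?case using assms(3) by (auto intro: continuous_on_compose2)
next
  case (Suc k)
  have d: "f differentiable (at x)" "g differentiable (at (f x))" if "x \<in> S" for x
    using that Suc.prems assms(1,2,3) by (auto simp: differentiable_on_eq_differentiable_at)
  have "Ck k (\<lambda>x. fd (\<lambda>x. g (f x)) x v) S" for v
  proof (rule Ck_cong[OF assms(1)])
    show "Ck k (\<lambda>x. \<Sum>b\<in>Basis. (fd f x v \<bullet> b) *\<^sub>R fd g (f x) b) S"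
    proof (intro Ck_sum[OF assms(1)] Ck_scaleR[OF assms(1)])
      fix b :: 'b
      show "Ck k (\<lambda>x. fd f x v \<bullet> b) S"
        using Suc.prems by (intro Ck_bounded_linear[OF assms(1) bounded_linear_inner_left]) auto
      show "Ck k (\<lambda>x. fd g (f x) b) S"
        using Suc.prems Ck_mono[OF Suc.prems(1)] by (intro Suc.IH) auto
    qed
    show "(\<Sum>b\<in>Basis. (fd f x v \<bullet> b) *\<^sub>R fd g (f x) b) = fd (\<lambda>x. g (f x)) x v" if "x \<in> S" for x
      by (rule trans[OF fd_Basis[OF d(2)[OF that], symmetric] fd_eqI[OF fd_compose[OF d[OF that]], symmetric]])
  qed
  moreover have "(\<lambda>x. g (f x)) differentiable_on S"
    using fd_compose[OF d] assms(1) by (auto simp: differentiable_on_eq_differentiable_at differentiable_def)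
  ultimately show ?case by simp
qed

lemma Ck_id: "open S \<Longrightarrow> Ck k (\<lambda>x. x) S"
proof (induction k)
  case (Suc k)
  have "fd (\<lambda>x. x) x v = v" for x v :: 'a
    by (rule fd_eqI) auto
  then show ?case using Suc by (auto simp: Ck_const)
qed simp

text \<open>Smoothness of a germ. Unlike \<open>smooth_on\<close> it can be composed and
  differentiated without carrying the domains along.\<close>

definition smooth_near :: "('a::euclidean_space \<Rightarrow> 'b::real_normed_vector) \<Rightarrow> 'a \<Rightarrow> bool" where
  "smooth_near f x \<longleftrightarrow> (\<exists>S. open S \<and> x \<in> S \<and> smooth_on S f)"

lemma smooth_on_iff_near:
  assumes "open S"
  shows "smooth_on S f \<longleftrightarrow> (\<forall>x\<in>S. smooth_near f x)"
proof
  assume "smooth_on S f"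
  then show "\<forall>x\<in>S. smooth_near f x" using assms by (auto simp: smooth_near_def)
next
  assume r: "\<forall>x\<in>S. smooth_near f x"
  show "smooth_on S f" unfolding smooth_on_def
  proof (intro allI Ck_local[OF assms])
    fix k x assume "x \<in> S"
    then obtain T where "open T" "x \<in> T" "smooth_on T f" using r by (auto simp: smooth_near_def)
    then show "\<exists>T. open T \<and> x \<in> T \<and> Ck k f T" by (auto simp: smooth_on_def)
  qed
qed

lemma smooth_nearI: "open S \<Longrightarrow> x \<in> S \<Longrightarrow> smooth_on S f \<Longrightarrow> smooth_near f x"
  by (auto simp: smooth_near_def)

lemma smooth_near_eventually:
  "smooth_near f x \<Longrightarrow> eventually (smooth_near f) (nhds x)"
  unfolding smooth_near_def eventually_nhds by auto

lemma smooth_near_cong: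
  assumes "smooth_near f x" "eventually (\<lambda>y. f y = g y) (nhds x)"
  shows "smooth_near g x"
proof -
  obtain S where S: "open S" "x \<in> S" "smooth_on S f" using assms(1) by (auto simp: smooth_near_def)
  obtain T where T: "open T" "x \<in> T" "\<And>y. y \<in> T \<Longrightarrow> f y = g y"
    using assms(2) by (auto simp: eventually_nhds)
  have "Ck k g (S \<inter> T)" for k
    by (rule Ck_cong[of _ f]) (use S T in \<open>auto simp: smooth_on_def intro: Ck_subset\<close>)
  then show ?thesis using S T by (intro smooth_nearI[of "S \<inter> T"]) (auto simp: smooth_on_def)
qed

lemma smooth_near_differentiable: "smooth_near f x \<Longrightarrow> f differentiable (at x)"
  unfolding smooth_near_def smooth_on_def by (auto intro: Ck_differentiable[of _ 0])

lemma smooth_near_continuous: "smooth_near f x \<Longrightarrow> isCont f x"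
  by (simp add: differentiable_imp_continuous_within smooth_near_differentiable)

lemma smooth_near_binop:
  assumes "\<And>S k. open S \<Longrightarrow> Ck k f S \<Longrightarrow> Ck k g S \<Longrightarrow> Ck k h S" "smooth_near f x" "smooth_near g x"
  shows "smooth_near h x"
proof -
  obtain S T where S: "open S" "x \<in> S" "smooth_on S f" "open T" "x \<in> T" "smooth_on T g"
    using assms(2,3) by (auto simp: smooth_near_def)
  have "Ck k h (S \<inter> T)" for k
    by (rule assms(1)) (use S in \<open>auto simp: smooth_on_def intro: Ck_subset\<close>)
  then show ?thesis using S by (intro smooth_nearI[of "S \<inter> T"]) (auto simp: smooth_on_def)
qed

lemma smooth_near_const: "smooth_near (\<lambda>x. c) x"
  by (rule smooth_nearI[of UNIV]) (simp_all add: smooth_on_def Ck_const)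

lemma smooth_near_id: "smooth_near (\<lambda>x. x) x"
  by (rule smooth_nearI[of UNIV]) (simp_all add: smooth_on_def Ck_id)

lemma smooth_near_add: "smooth_near f x \<Longrightarrow> smooth_near g x \<Longrightarrow> smooth_near (\<lambda>x. f x + g x) x"
  by (rule smooth_near_binop[of f g]) (auto intro: Ck_add)

lemma smooth_near_scaleR: "smooth_near f x \<Longrightarrow> smooth_near g x \<Longrightarrow> smooth_near (\<lambda>x. f x *\<^sub>R g x) x"
  by (rule smooth_near_binop[of f g]) (auto intro: Ck_scaleR)

lemma smooth_near_mult:
  fixes f g :: "'a::euclidean_space \<Rightarrow> real"
  shows "smooth_near f x \<Longrightarrow> smooth_near g x \<Longrightarrow> smooth_near (\<lambda>x. f x * g x) x"
  using smooth_near_scaleR[of f x g] by simp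

lemma smooth_near_sum:
  "(\<And>i. i \<in> I \<Longrightarrow> smooth_near (f i) x) \<Longrightarrow> smooth_near (\<lambda>x. \<Sum>i\<in>I. f i x) x"
  by (induction I rule: infinite_finite_induct) (auto simp: smooth_near_const smooth_near_add)

lemma smooth_near_linear: "bounded_linear L \<Longrightarrow> smooth_near f x \<Longrightarrow> smooth_near (\<lambda>x. L (f x)) x"
  by (rule smooth_near_binop[of f f]) (auto intro: Ck_bounded_linear)

lemma smooth_near_comp:
  fixes g :: "'b::euclidean_space \<Rightarrow> 'c::real_normed_vector"
  assumes "smooth_near f x" "smooth_near g (f x)"
  shows "smooth_near (\<lambda>x. g (f x)) x"
proof -
  obtain S T where S: "open S" "x \<in> S" "smooth_on S f" "open T" "f x \<in> T" "smooth_on T g"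
    using assms by (auto simp: smooth_near_def)
  have "continuous_on S f" using S(3) Ck.simps(1)[of f S] unfolding smooth_on_def by auto
  then have o: "open (S \<inter> f -` T)" using S by (simp add: continuous_open_preimage)
  have "Ck k (\<lambda>x. g (f x)) (S \<inter> f -` T)" for k
    by (rule Ck_comp[OF o S(4)]) (use S in \<open>auto simp: smooth_on_def intro: Ck_subset\<close>)
  then show ?thesis using S o by (intro smooth_nearI[of "S \<inter> f -` T"]) (auto simp: smooth_on_def)
qed

lemma smooth_near_fd: "smooth_near f x \<Longrightarrow> smooth_near (\<lambda>x. fd f x v) x"
proof -
  assume "smooth_near f x"
  then obtain S where S: "open S" "x \<in> S" "smooth_on S f" by (auto simp: smooth_near_def)
  then have "Ck k (\<lambda>x. fd f x v) S" for k using Ck.simps(2)[of k f S] by (auto simp: smooth_on_def)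
  then show ?thesis using S by (intro smooth_nearI[of S]) (auto simp: smooth_on_def)
qed

lemma smooth_near_Pair:
  fixes f :: "'a::euclidean_space \<Rightarrow> 'b::euclidean_space" and g :: "'a \<Rightarrow> 'c::euclidean_space"
  assumes "smooth_near f x" "smooth_near g x"
  shows "smooth_near (\<lambda>x. (f x, g x)) x"
proof -
  have "smooth_near (\<lambda>x. (f x, 0::'c) + (0::'b, g x)) x"
    by (intro smooth_near_add smooth_near_linear[of "\<lambda>y. (y, 0)"] smooth_near_linear[of "\<lambda>y. (0, y)"]
      bounded_linear_Pair bounded_linear_ident bounded_linear_zero assms)
  then show ?thesis by simp
qed

text \<open>The moving direction is expanded in \<open>Basis\<close>. The expansion holds where f is
  differentiable, hence the passage to a neighbourhood of x.\<close>

lemma smooth_near_fd_var: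
  fixes f :: "'b::euclidean_space \<Rightarrow> 'c::real_normed_vector"
  assumes "smooth_near f (p x)" "smooth_near p x" "smooth_near w x"
  shows "smooth_near (\<lambda>x. fd f (p x) (w x)) x"
proof (rule smooth_near_cong)
  show "smooth_near (\<lambda>x. \<Sum>b\<in>Basis. (w x \<bullet> b) *\<^sub>R fd f (p x) b) x"
    by (intro smooth_near_sum smooth_near_scaleR smooth_near_linear[OF bounded_linear_inner_left]
      smooth_near_comp[of p x "\<lambda>y. fd f y _"] smooth_near_fd assms)
  have "eventually (\<lambda>y. smooth_near f (p y)) (nhds x)"
    using smooth_near_eventually[OF assms(1)] smooth_near_continuous[OF assms(2)]
    unfolding isCont_def tendsto_at_iff_tendsto_nhds[of p x] filterlim_iff[of p "nhds (p x)" "nhds x"] by blast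
  then show "eventually (\<lambda>y. (\<Sum>b\<in>Basis. (w y \<bullet> b) *\<^sub>R fd f (p y) b) = fd f (p y) (w y)) (nhds x)"
    by eventually_elim (simp add: fd_Basis[symmetric] smooth_near_differentiable)
qed

lemma smooth_near_componentwise:
  fixes f :: "'a::euclidean_space \<Rightarrow> real ^ 'n"
  assumes "\<And>i. smooth_near (\<lambda>x. f x $ i) x"
  shows "smooth_near f x"
proof -
  have "smooth_near (\<lambda>x. \<Sum>i\<in>UNIV. (f x $ i) *\<^sub>R (axis i 1 :: real ^ 'n)) x"
    by (intro smooth_near_sum smooth_near_scaleR smooth_near_const assms)
  moreover have "(\<Sum>i\<in>UNIV. (f x $ i) *\<^sub>R (axis i 1 :: real ^ 'n)) = f x" for x
    by (simp add: vec_eq_iff axis_def if_distrib cong: if_cong)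
  ultimately show ?thesis by simp
qed

lemma smooth_near_nth:
  fixes f :: "'a::euclidean_space \<Rightarrow> real ^ 'n"
  shows "smooth_near f x \<Longrightarrow> smooth_near (\<lambda>x. f x $ i) x"
  by (rule smooth_near_linear[OF bounded_linear_vec_nth])

section \<open>Smooth functions on a Lie group\<close>

lemma isCont_eventually:
  assumes "isCont k z" "open W" "k z \<in> W"
  shows "eventually (\<lambda>y. k y \<in> W) (nhds z)"
proof -
  have "(k \<longlongrightarrow> k z) (nhds z)" using assms(1) by (simp add: isCont_def tendsto_at_iff_tendsto_nhds)
  then show ?thesis using assms(2,3) by (rule topological_tendstoD)
qed

locale lie =
  fixes G :: "'g::{t2_space,second_countable_topology} monoid" (structure)
    and A :: "('g, 'n::finite) atlas"
  assumes lie: "lie_group G A"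
begin

lemma grp: "group G" and carr: "carrier G = UNIV" and atl: "smooth_atlas A"
  and cont_mult: "continuous_on UNIV (\<lambda>(x, y). x \<otimes> y)" and cont_inv: "continuous_on UNIV (\<lambda>x. inv x)"
  and lie_mult: "(U, c) \<in> A \<Longrightarrow> (V, d) \<in> A \<Longrightarrow> (W, e) \<in> A \<Longrightarrow>
        smooth_on {(x, y). x \<in> c ` U \<and> y \<in> d ` V \<and> inv_into U c x \<otimes> inv_into V d y \<in> W}
          (\<lambda>(x, y). e (inv_into U c x \<otimes> inv_into V d y))"
  and lie_inv: "(U, c) \<in> A \<Longrightarrow> (V, d) \<in> A \<Longrightarrow>
        smooth_on {x \<in> c ` U. inv (inv_into U c x) \<in> V} (\<lambda>x. d (inv (inv_into U c x)))"
  using lie unfolding lie_group_def by blast+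

sublocale group G by (rule grp)

lemma assoc: "x \<otimes> y \<otimes> z = x \<otimes> (y \<otimes> z)" by (rule m_assoc) (simp_all add: carr)
lemma one_l [simp]: "\<one> \<otimes> x = x" by (simp add: carr)
lemma one_r [simp]: "x \<otimes> \<one> = x" by (simp add: carr)
lemma inv_l [simp]: "inv x \<otimes> x = \<one>" by (simp add: carr)
lemma inv_r [simp]: "x \<otimes> inv x = \<one>" by (simp add: carr)
lemma inv_l' [simp]: "inv x \<otimes> (x \<otimes> y) = y" using assoc[of "inv x" x y] by simp
lemma inv_r' [simp]: "x \<otimes> (inv x \<otimes> y) = y" using assoc[of x "inv x" y] by simp

lemma chart:
  assumes "(U, c) \<in> A"
  shows "open U" "open (c ` U)" "continuous_on U c" "continuous_on (c ` U) (inv_into U c)"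
    "p \<in> U \<Longrightarrow> inv_into U c (c p) = p"
proof -
  have "open U \<and> open (c ` U) \<and> homeomorphism U (c ` U) c (inv_into U c)"
    using atl assms unfolding smooth_atlas_def by blast
  then show "open U" "open (c ` U)" "continuous_on U c" "continuous_on (c ` U) (inv_into U c)"
    "p \<in> U \<Longrightarrow> inv_into U c (c p) = p"
    unfolding homeomorphism_def by blast+
qed

lemma chart_ex: "\<exists>U c. (U, c) \<in> A \<and> p \<in> U"
  using atl unfolding smooth_atlas_def by blast

lemma chart_open:
  assumes "(U, c) \<in> A" "open W" shows "open (c ` (U \<inter> W))"
proof -
  have "c ` (U \<inter> W) = c ` U \<inter> inv_into U c -` W"
    using chart(5)[OF assms(1)] by (auto simp: image_iff)
  then show ?thesis
    using continuous_open_preimage[OF chart(4)[OF assms(1)] chart(2)[OF assms(1)] assms(2)] by simp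
qed

lemma chart_inv_isCont: "(U, c) \<in> A \<Longrightarrow> x \<in> c ` U \<Longrightarrow> isCont (inv_into U c) x"
  using chart(2,4) continuous_on_eq_continuous_at by blast

lemma transition:
  assumes "(U, c) \<in> A" "(V, d) \<in> A" "p \<in> U" "p \<in> V"
  shows "smooth_near (\<lambda>x. d (inv_into U c x)) (c p)"
proof (rule smooth_nearI)
  show "open (c ` (U \<inter> V))" using chart_open[OF assms(1)] chart(1)[OF assms(2)] by blast
  show "c p \<in> c ` (U \<inter> V)" using assms by blast
  show "smooth_on (c ` (U \<inter> V)) (\<lambda>x. d (inv_into U c x))"
    using atl assms(1,2) unfolding smooth_atlas_def comp_def by blast
qed

text \<open>Smoothness at z of a map from a Euclidean space into the group. Continuity is demanded
  separately because a chart is meaningful only on its domain. All charts at \<open>k z\<close> are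
  asked for here; by \<open>smGI\<close> a single one suffices.\<close>

definition smG :: "('a::euclidean_space \<Rightarrow> 'g) \<Rightarrow> 'a \<Rightarrow> bool" where
  "smG k z \<longleftrightarrow> isCont k z \<and> (\<forall>(V, d)\<in>A. k z \<in> V \<longrightarrow> smooth_near (\<lambda>z. d (k z)) z)"

lemma smG_isCont: "smG k z \<Longrightarrow> isCont k z" by (simp add: smG_def)

lemma smG_chart: "smG k z \<Longrightarrow> (V, d) \<in> A \<Longrightarrow> k z \<in> V \<Longrightarrow> smooth_near (\<lambda>z. d (k z)) z"
  by (auto simp: smG_def)

lemma smGI:
  assumes "isCont k z" "(U, c) \<in> A" "k z \<in> U" "smooth_near (\<lambda>z. c (k z)) z"
  shows "smG k z"
  unfolding smG_def
proof (intro conjI ballI, goal_cases)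
  case (2 Vd)
  obtain V d where Vd: "Vd = (V, d)" by (cases Vd)
  have "smooth_near (\<lambda>z. d (k z)) z" if "k z \<in> V"
  proof (rule smooth_near_cong)
    show "smooth_near (\<lambda>z. d (inv_into U c (c (k z)))) z"
      using smooth_near_comp[OF assms(4), of "\<lambda>x. d (inv_into U c x)"] transition[OF assms(2), of V d "k z"] 2 Vd that assms(3)
      by simp
    show "\<forall>\<^sub>F z in nhds z. d (inv_into U c (c (k z))) = d (k z)"
      using isCont_eventually[OF assms(1) chart(1)[OF assms(2)] assms(3)]
      by eventually_elim (simp add: chart(5)[OF assms(2)])
  qed
  then show ?case by (simp add: Vd)
qed (rule assms(1))

lemma smG_const: "smG (\<lambda>z. p) z"
  using chart_ex[of p] by (auto intro!: smGI smooth_near_const)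

lemma smG_comp:
  fixes h :: "'a::euclidean_space \<Rightarrow> 'b::euclidean_space"
  assumes "smG k (h z)" "smooth_near h z"
  shows "smG (\<lambda>z. k (h z)) z"
proof -
  obtain U c where c: "(U, c) \<in> A" "k (h z) \<in> U" using chart_ex by blast
  show ?thesis
  proof (rule smGI[where k="\<lambda>z. k (h z)" and z=z and U=U and c=c, OF _ c])
    show "isCont (\<lambda>z. k (h z)) z"
      using isCont_o2[OF smooth_near_continuous[OF assms(2)] smG_isCont[OF assms(1)]] .
    show "smooth_near (\<lambda>z. c (k (h z))) z"
      using smooth_near_comp[OF assms(2) smG_chart[OF assms(1) c]] .
  qed
qed

lemma smG_chart_inv:
  assumes "(U, c) \<in> A" "x \<in> c ` U" shows "smG (inv_into U c) x"
proof (rule smGI[OF _ assms(1)])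
  show "isCont (inv_into U c) x" by (rule chart_inv_isCont[OF assms])
  show "inv_into U c x \<in> U" using assms(2) by (rule inv_into_into)
  show "smooth_near (\<lambda>z. c (inv_into U c z)) x"
  proof (rule smooth_near_cong[OF smooth_near_id])
    show "\<forall>\<^sub>F y in nhds x. y = c (inv_into U c y)"
      using eventually_nhds_in_open[OF chart(2)[OF assms(1)] assms(2)]
      by eventually_elim (simp add: f_inv_into_f)
  qed
qed

lemma isCont_mult:
  assumes "isCont k z" "isCont l z" shows "isCont (\<lambda>z. k z \<otimes> l z) z"
proof -
  have "isCont (\<lambda>(x, y). x \<otimes> y) (k z, l z)"
    using cont_mult by (simp add: continuous_on_eq_continuous_at)
  from isCont_o2[OF isCont_Pair[OF assms] this] show ?thesis by simp
qed

lemma isCont_inv: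
  assumes "isCont k z" shows "isCont (\<lambda>z. inv (k z)) z"
proof -
  have "isCont (\<lambda>x. inv x) (k z)"
    using cont_inv by (simp add: continuous_on_eq_continuous_at)
  from isCont_o2[OF assms this] show ?thesis by simp
qed

lemma smG_mult:
  assumes "smG k z" "smG l z" shows "smG (\<lambda>z. k z \<otimes> l z) z"
proof -
  obtain U c where c: "(U, c) \<in> A" "k z \<in> U" using chart_ex by blast
  obtain V d where d: "(V, d) \<in> A" "l z \<in> V" using chart_ex by blast
  obtain W e where e: "(W, e) \<in> A" "k z \<otimes> l z \<in> W" using chart_ex by blast
  let ?S = "{(x, y). x \<in> c ` U \<and> y \<in> d ` V \<and> inv_into U c x \<otimes> inv_into V d y \<in> W}"
  have "continuous_on (c ` U \<times> d ` V) (\<lambda>(x, y). inv_into U c x \<otimes> inv_into V d y)"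
  proof -
    have "isCont (\<lambda>q. inv_into U c (fst q) \<otimes> inv_into V d (snd q)) q" if "q \<in> c ` U \<times> d ` V" for q
    proof (rule isCont_mult)
      show "isCont (\<lambda>q. inv_into U c (fst q)) q"
        using isCont_o2[OF isCont_fst[OF continuous_ident]] chart_inv_isCont[OF c(1)] that by fastforce
      show "isCont (\<lambda>q. inv_into V d (snd q)) q"
        using isCont_o2[OF isCont_snd[OF continuous_ident]] chart_inv_isCont[OF d(1)] that by fastforce
    qed
    then show ?thesis by (simp add: continuous_at_imp_continuous_on case_prod_beta)
  qed
  then have "open ((c ` U \<times> d ` V) \<inter> (\<lambda>(x, y). inv_into U c x \<otimes> inv_into V d y) -` W)"
    using chart(2)[OF c(1)] chart(2)[OF d(1)] chart(1)[OF e(1)] by (intro continuous_open_preimage open_Times)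
  moreover have "(c ` U \<times> d ` V) \<inter> (\<lambda>(x, y). inv_into U c x \<otimes> inv_into V d y) -` W = ?S" by auto
  ultimately have "open ?S" by simp
  then have m: "smooth_near (\<lambda>(x, y). e (inv_into U c x \<otimes> inv_into V d y)) (c (k z), d (l z))"
    by (rule smooth_nearI[OF _ _ lie_mult[OF c(1) d(1) e(1)]])
      (use c d e chart(5)[OF c(1)] chart(5)[OF d(1)] in auto)
  show ?thesis
  proof (rule smGI[where k="\<lambda>z. k z \<otimes> l z" and z=z and U=W and c=e, OF _ e])
    show "isCont (\<lambda>z. k z \<otimes> l z) z" using assms by (intro isCont_mult smG_isCont)
    show "smooth_near (\<lambda>z. e (k z \<otimes> l z)) z"
    proof (rule smooth_near_cong)
      show "smooth_near (\<lambda>z. (\<lambda>(x, y). e (inv_into U c x \<otimes> inv_into V d y)) (c (k z), d (l z))) z"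
        by (rule smooth_near_comp[OF smooth_near_Pair[OF smG_chart[OF assms(1) c] smG_chart[OF assms(2) d]] m])
      show "\<forall>\<^sub>F z in nhds z. (\<lambda>(x, y). e (inv_into U c x \<otimes> inv_into V d y)) (c (k z), d (l z)) = e (k z \<otimes> l z)"
        using isCont_eventually[OF smG_isCont[OF assms(1)] chart(1)[OF c(1)] c(2)]
          isCont_eventually[OF smG_isCont[OF assms(2)] chart(1)[OF d(1)] d(2)]
        by eventually_elim (simp add: chart(5)[OF c(1)] chart(5)[OF d(1)])
    qed
  qed
qed

lemma smG_inv:
  assumes "smG k z" shows "smG (\<lambda>z. inv (k z)) z"
proof -
  obtain U c where c: "(U, c) \<in> A" "k z \<in> U" using chart_ex by blast
  obtain V d where d: "(V, d) \<in> A" "inv (k z) \<in> V" using chart_ex by blast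
  let ?S = "{x \<in> c ` U. inv (inv_into U c x) \<in> V}"
  have "continuous_on (c ` U) (\<lambda>x. inv (inv_into U c x))"
    by (intro continuous_at_imp_continuous_on ballI isCont_inv chart_inv_isCont[OF c(1)])
  then have "open ((c ` U) \<inter> (\<lambda>x. inv (inv_into U c x)) -` V)"
    using chart(2)[OF c(1)] chart(1)[OF d(1)] by (intro continuous_open_preimage)
  moreover have "(c ` U) \<inter> (\<lambda>x. inv (inv_into U c x)) -` V = ?S" by auto
  ultimately have "open ?S" by simp
  then have m: "smooth_near (\<lambda>x. d (inv (inv_into U c x))) (c (k z))"
    by (rule smooth_nearI[OF _ _ lie_inv[OF c(1) d(1)]]) (use c d chart(5)[OF c(1)] in auto)
  show ?thesis
  proof (rule smGI[where k="\<lambda>z. inv (k z)" and z=z and U=V and c=d, OF _ d])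
    show "isCont (\<lambda>z. inv (k z)) z" using assms by (intro isCont_inv smG_isCont)
    show "smooth_near (\<lambda>z. d (inv (k z))) z"
    proof (rule smooth_near_cong)
      show "smooth_near (\<lambda>z. d (inv (inv_into U c (c (k z))))) z"
        by (rule smooth_near_comp[OF smG_chart[OF assms(1) c] m])
      show "\<forall>\<^sub>F z in nhds z. d (inv (inv_into U c (c (k z)))) = d (inv (k z))"
        using isCont_eventually[OF smG_isCont[OF assms(1)] chart(1)[OF c(1)] c(2)]
        by eventually_elim (simp add: chart(5)[OF c(1)])
    qed
  qed
qed

text \<open>The transition maps carry smoothness from the chart d to all others; the neighbourhood W
  consists of the points of V that d maps into the Euclidean domain of smoothness.\<close>

lemma smooth_at_chart:
  assumes V: "(V, d) \<in> A" "p \<in> V"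
  shows "smooth_at A p f \<longleftrightarrow> smooth_near (\<lambda>x. f (inv_into V d x)) (d p)"
proof
  assume "smooth_at A p f"
  then obtain W where W: "open W" "p \<in> W" "smooth_fun A W f" by (auto simp: smooth_at_def)
  then have "smooth_on (d ` (V \<inter> W)) (f \<circ> inv_into V d)" using V by (auto simp: smooth_fun_def)
  then show "smooth_near (\<lambda>x. f (inv_into V d x)) (d p)"
    using V W chart_open[OF V(1) W(1)] by (intro smooth_nearI[of "d ` (V \<inter> W)"]) (auto simp: comp_def)
next
  assume "smooth_near (\<lambda>x. f (inv_into V d x)) (d p)"
  then obtain S where S: "open S" "d p \<in> S" "smooth_on S (\<lambda>x. f (inv_into V d x))" by (auto simp: smooth_near_def)
  define W where "W = V \<inter> d -` S"
  have W: "open W" "p \<in> W"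
    using continuous_open_preimage[OF chart(3,1)[OF V(1)] S(1)] S(2) V by (auto simp: W_def)
  have "smooth_fun A W f" unfolding smooth_fun_def
  proof (intro ballI, clarify)
    fix U c assume U: "(U, c) \<in> A"
    show "smooth_on (c ` (U \<inter> W)) (f \<circ> inv_into U c)"
      unfolding smooth_on_iff_near[OF chart_open[OF U W(1)]]
    proof (clarify)
      fix q assume q: "q \<in> U" "q \<in> W"
      then have qV: "q \<in> V" "d q \<in> S" by (auto simp: W_def)
      have "smooth_near (\<lambda>x. f (inv_into V d (d (inv_into U c x)))) (c q)"
        using smooth_near_comp[OF transition[OF U V(1) q(1) qV(1)], of "\<lambda>x. f (inv_into V d x)"]
          smooth_nearI[OF S(1) _ S(3), of "d q"] qV chart(5)[OF U q(1)] by simp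
      moreover have "\<forall>\<^sub>F x in nhds (c q). inv_into U c x \<in> V"
        using q qV(1) chart(5)[OF U q(1)] by (intro isCont_eventually chart_inv_isCont[OF U] chart(1)[OF V(1)]) auto
      then have "\<forall>\<^sub>F x in nhds (c q). f (inv_into V d (d (inv_into U c x))) = (f \<circ> inv_into U c) x"
        by eventually_elim (simp add: chart(5)[OF V(1)])
      ultimately show "smooth_near (f \<circ> inv_into U c) (c q)" by (rule smooth_near_cong)
    qed
  qed
  then show "smooth_at A p f" using W by (auto simp: smooth_at_def)
qed

lemma smooth_fun_iff:
  assumes "open W" shows "smooth_fun A W f \<longleftrightarrow> (\<forall>p\<in>W. smooth_at A p f)"
proof
  assume "smooth_fun A W f"
  then show "\<forall>p\<in>W. smooth_at A p f" using assms by (auto simp: smooth_at_def)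
next
  assume *: "\<forall>p\<in>W. smooth_at A p f"
  show "smooth_fun A W f" unfolding smooth_fun_def
  proof (intro ballI, clarify)
    fix U c assume U: "(U, c) \<in> A"
    show "smooth_on (c ` (U \<inter> W)) (f \<circ> inv_into U c)"
      unfolding smooth_on_iff_near[OF chart_open[OF U assms]]
      using * smooth_at_chart[OF U] by (auto simp: comp_def)
  qed
qed

lemma smooth_at_smG:
  assumes "smooth_at A (k z) f" "smG k z"
  shows "smooth_near (\<lambda>z. f (k z)) z"
proof -
  obtain V d where V: "(V, d) \<in> A" "k z \<in> V" using chart_ex by blast
  show ?thesis
  proof (rule smooth_near_cong)
    show "smooth_near (\<lambda>z. f (inv_into V d (d (k z)))) z"
      using smooth_near_comp[OF smG_chart[OF assms(2) V], of "\<lambda>x. f (inv_into V d x)"] assms(1) smooth_at_chart[OF V] by simp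
    show "\<forall>\<^sub>F z in nhds z. f (inv_into V d (d (k z))) = f (k z)"
      using isCont_eventually[OF smG_isCont[OF assms(2)] chart(1)[OF V(1)] V(2)]
      by eventually_elim (simp add: chart(5)[OF V(1)])
  qed
qed

end

section \<open>Second derivatives\<close>

lemma fd_line:
  fixes f :: "'a::real_normed_vector \<Rightarrow> real"
  assumes "f differentiable (at (y + s *\<^sub>R u))"
  shows "((\<lambda>s. f (y + s *\<^sub>R u)) has_real_derivative fd f (y + s *\<^sub>R u) u) (at s)"
proof -
  have "((\<lambda>s. y + s *\<^sub>R u) has_derivative (\<lambda>a. a *\<^sub>R u)) (at s)" by (auto intro!: derivative_eq_intros)
  from has_derivative_compose[OF this differentiable_fd[OF assms]]
  have "((\<lambda>s. f (y + s *\<^sub>R u)) has_derivative (\<lambda>a. fd f (y + s *\<^sub>R u) (a *\<^sub>R u))) (at s)" .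
  then show ?thesis
    unfolding has_field_derivative_def by (simp add: linear_scale[OF fd_linear[OF assms]] mult_commute_abs)
qed

text \<open>Two applications of the mean value theorem, first in the direction u and then in v, turn
  the quotient into a mixed derivative at a nearby point. The quotient is symmetric in u and v,
  which yields \<open>Schwarz_real\<close>.\<close>

lemma second_difference:
  fixes f :: "'a::euclidean_space \<Rightarrow> real"
  assumes f: "smooth_near f x"
  shows "((\<lambda>h. (f (x + h *\<^sub>R u + h *\<^sub>R v) - f (x + h *\<^sub>R u) - f (x + h *\<^sub>R v) + f x) / h\<^sup>2)
    \<longlongrightarrow> fd (\<lambda>z. fd f z u) x v) (at_right 0)"
proof (rule tendstoI)
  fix e :: real assume e: "e > 0"
  let ?g = "\<lambda>z. fd f z u"
  let ?D = "\<lambda>z. fd ?g z v"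
  have sg: "smooth_near ?g x" by (rule smooth_near_fd[OF f])
  have "(?D \<longlongrightarrow> ?D x) (nhds x)" using smooth_near_continuous[OF smooth_near_fd[OF sg, of v]]
    unfolding isCont_def by (rule tendsto_at_iff_tendsto_nhds[THEN iffD1])
  then have "eventually (\<lambda>z. smooth_near f z \<and> smooth_near ?g z \<and> dist (?D z) (?D x) < e) (nhds x)"
    by (intro eventually_conj smooth_near_eventually[OF f] smooth_near_eventually[OF sg] tendstoD e)
  then obtain r where r: "r > 0" "\<And>z. dist z x < r \<Longrightarrow> smooth_near f z \<and> smooth_near ?g z \<and> dist (?D z) (?D x) < e"
    unfolding eventually_nhds_metric by blast
  define R where "R = r / (norm u + norm v + 1)"
  have R: "R > 0" using r(1) by (simp add: R_def add_nonneg_pos)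
  have near: "dist (x + s *\<^sub>R u + t *\<^sub>R v) x < r" if "0 \<le> s" "s < R" "0 \<le> t" "t < R" for s t
  proof -
    have "norm (s *\<^sub>R u + t *\<^sub>R v) \<le> s * norm u + t * norm v"
      using norm_triangle_ineq[of "s *\<^sub>R u" "t *\<^sub>R v"] that by simp
    also have "\<dots> \<le> R * norm u + R * norm v" using that by (intro add_mono mult_right_mono) auto
    also have "\<dots> < R * (norm u + norm v + 1)" using R by (simp add: algebra_simps)
    also have "\<dots> = r" by (simp add: R_def add_nonneg_eq_0_iff)
    finally show ?thesis by (simp add: dist_norm add.assoc)
  qed
  have "dist ((f (x + h *\<^sub>R u + h *\<^sub>R v) - f (x + h *\<^sub>R u) - f (x + h *\<^sub>R v) + f x) / h\<^sup>2) (?D x) < e"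
    if h: "0 < h" "h < R" for h
  proof -
    define \<phi> where "\<phi> = (\<lambda>s. f (x + h *\<^sub>R v + s *\<^sub>R u) - f (x + s *\<^sub>R u))"
    have comm: "x + h *\<^sub>R v + s *\<^sub>R u = x + s *\<^sub>R u + h *\<^sub>R v" for s by (simp add: add_ac)
    have d1: "(\<phi> has_real_derivative (?g (x + s *\<^sub>R u + h *\<^sub>R v) - ?g (x + s *\<^sub>R u))) (at s)" if "0 \<le> s" "s \<le> h" for s
      unfolding \<phi>_def comm[symmetric]
    proof (intro DERIV_diff fd_line smooth_near_differentiable)
      show "smooth_near f (x + h *\<^sub>R v + s *\<^sub>R u)" unfolding comm using near[of s h] r(2) that h by simp
      show "smooth_near f (x + s *\<^sub>R u)" using near[of s 0] r(2) that h by simp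
    qed
    obtain s where s: "0 < s" "s < h" "\<phi> h - \<phi> 0 = h * (?g (x + s *\<^sub>R u + h *\<^sub>R v) - ?g (x + s *\<^sub>R u))"
      using MVT2[OF h(1), of \<phi>, OF d1] by auto
    have d2: "((\<lambda>t. ?g (x + s *\<^sub>R u + t *\<^sub>R v)) has_real_derivative ?D (x + s *\<^sub>R u + t *\<^sub>R v)) (at t)" if "0 \<le> t" "t \<le> h" for t
      using near[of s t] r(2) that s h by (intro fd_line smooth_near_differentiable) auto
    obtain t where t: "0 < t" "t < h" "?g (x + s *\<^sub>R u + h *\<^sub>R v) - ?g (x + s *\<^sub>R u + 0 *\<^sub>R v) = h * ?D (x + s *\<^sub>R u + t *\<^sub>R v)"
      using MVT2[OF h(1), of "\<lambda>t. ?g (x + s *\<^sub>R u + t *\<^sub>R v)", OF d2] by auto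
    have "f (x + h *\<^sub>R u + h *\<^sub>R v) - f (x + h *\<^sub>R u) - f (x + h *\<^sub>R v) + f x = \<phi> h - \<phi> 0" by (simp add: \<phi>_def comm)
    also have "\<dots> = h\<^sup>2 * ?D (x + s *\<^sub>R u + t *\<^sub>R v)" using s(3) t(3) by (simp add: power2_eq_square)
    finally have "(f (x + h *\<^sub>R u + h *\<^sub>R v) - f (x + h *\<^sub>R u) - f (x + h *\<^sub>R v) + f x) / h\<^sup>2 = ?D (x + s *\<^sub>R u + t *\<^sub>R v)"
      using h by simp
    then show ?thesis using near[of s t] r(2) s t h by auto
  qed
  then show "\<forall>\<^sub>F h in at_right 0. dist ((f (x + h *\<^sub>R u + h *\<^sub>R v) - f (x + h *\<^sub>R u) - f (x + h *\<^sub>R v) + f x) / h\<^sup>2) (?D x) < e"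
    using R unfolding eventually_at_right_field by blast
qed

lemma Schwarz_real:
  fixes f :: "'a::euclidean_space \<Rightarrow> real"
  assumes f: "smooth_near f x"
  shows "fd (\<lambda>z. fd f z u) x v = fd (\<lambda>z. fd f z v) x u"
proof (rule tendsto_unique[OF trivial_limit_at_right_real])
  show "((\<lambda>h. (f (x + h *\<^sub>R u + h *\<^sub>R v) - f (x + h *\<^sub>R u) - f (x + h *\<^sub>R v) + f x) / h\<^sup>2)
    \<longlongrightarrow> fd (\<lambda>z. fd f z u) x v) (at_right 0)" by (rule second_difference[OF f])
  have eq: "f (x + h *\<^sub>R u + h *\<^sub>R v) - f (x + h *\<^sub>R u) - f (x + h *\<^sub>R v) + f x =
    f (x + h *\<^sub>R v + h *\<^sub>R u) - f (x + h *\<^sub>R v) - f (x + h *\<^sub>R u) + f x" for h by (simp add: add_ac)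
  show "((\<lambda>h. (f (x + h *\<^sub>R u + h *\<^sub>R v) - f (x + h *\<^sub>R u) - f (x + h *\<^sub>R v) + f x) / h\<^sup>2)
    \<longlongrightarrow> fd (\<lambda>z. fd f z v) x u) (at_right 0)" unfolding eq by (rule second_difference[OF f])
qed

lemma fd_inner:
  fixes f :: "'a::euclidean_space \<Rightarrow> 'b::real_inner"
  assumes "f differentiable (at x)"
  shows "fd (\<lambda>z. f z \<bullet> b) x v = fd f x v \<bullet> b"
  by (rule fd_eqI) (use has_derivative_inner_left[OF differentiable_fd[OF assms], of b] in simp)

lemma Schwarz:
  fixes f :: "'a::euclidean_space \<Rightarrow> 'b::euclidean_space"
  assumes f: "smooth_near f x"
  shows "fd (\<lambda>z. fd f z u) x v = fd (\<lambda>z. fd f z v) x u"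
proof (rule euclidean_eqI)
  fix b :: 'b
  have *: "fd (\<lambda>z. fd f z u) x v \<bullet> b = fd (\<lambda>z. fd (\<lambda>z. f z \<bullet> b) z u) x v" for u v
  proof -
    have "fd (\<lambda>z. fd f z u) x v \<bullet> b = fd (\<lambda>z. fd f z u \<bullet> b) x v"
      by (rule fd_inner[symmetric, OF smooth_near_differentiable[OF smooth_near_fd[OF f]]])
    also have "\<dots> = fd (\<lambda>z. fd (\<lambda>z. f z \<bullet> b) z u) x v"
      by (rule arg_cong[of _ _ "\<lambda>g. g v"], rule fd_cong)
        (use smooth_near_eventually[OF f] in \<open>eventually_elim; simp add: fd_inner smooth_near_differentiable\<close>)
    finally show ?thesis .
  qed
  have "smooth_near (\<lambda>z. f z \<bullet> b) x" by (rule smooth_near_linear[OF bounded_linear_inner_left f])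
  then show "fd (\<lambda>z. fd f z u) x v \<bullet> b = fd (\<lambda>z. fd f z v) x u \<bullet> b"
    unfolding * by (rule Schwarz_real)
qed

lemma fd_fd_var:
  fixes F :: "'b::euclidean_space \<Rightarrow> 'c::real_normed_vector" and w :: "'b \<Rightarrow> 'b"
  assumes F: "smooth_near F x" and w: "smooth_near w x"
  shows "fd (\<lambda>z. fd F z (w z)) x v = fd F x (fd w x v) + fd (\<lambda>z. fd F z (w x)) x v"
proof -
  have dF: "F differentiable (at x)" "\<And>b. (\<lambda>z. fd F z b) differentiable (at x)" "w differentiable (at x)"
    using F w by (auto intro: smooth_near_differentiable smooth_near_fd)
  have eq: "eventually (\<lambda>z. (\<Sum>b\<in>Basis. (u z \<bullet> b) *\<^sub>R fd F z b) = fd F z (u z)) (nhds x)" for u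
    using smooth_near_eventually[OF F]
    by eventually_elim (rule fd_Basis[symmetric, OF smooth_near_differentiable])
  have "((\<lambda>z. \<Sum>b\<in>Basis. (w z \<bullet> b) *\<^sub>R fd F z b) has_derivative
    (\<lambda>v. \<Sum>b\<in>Basis. (w x \<bullet> b) *\<^sub>R fd (\<lambda>z. fd F z b) x v + (fd w x v \<bullet> b) *\<^sub>R fd F x b)) (at x)"
    by (intro has_derivative_sum has_derivative_scaleR has_derivative_inner_left differentiable_fd dF)
  from fd_eqI[OF this] have 1: "fd (\<lambda>z. fd F z (w z)) x v = (\<Sum>b\<in>Basis. (w x \<bullet> b) *\<^sub>R fd (\<lambda>z. fd F z b) x v + (fd w x v \<bullet> b) *\<^sub>R fd F x b)"
    using fd_cong[OF eq[of w]] by simp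
  have "((\<lambda>z. \<Sum>b\<in>Basis. (w x \<bullet> b) *\<^sub>R fd F z b) has_derivative
    (\<lambda>v. \<Sum>b\<in>Basis. (w x \<bullet> b) *\<^sub>R fd (\<lambda>z. fd F z b) x v)) (at x)"
    by (intro has_derivative_sum has_derivative_scaleR_right differentiable_fd dF)
  from fd_eqI[OF this] have 2: "fd (\<lambda>z. fd F z (w x)) x v = (\<Sum>b\<in>Basis. (w x \<bullet> b) *\<^sub>R fd (\<lambda>z. fd F z b) x v)"
    using fd_cong[OF eq[of "\<lambda>_. w x"]] by simp
  show ?thesis unfolding 1 2 fd_Basis[OF dF(1), of "fd w x v"] by (simp add: sum.distrib)
qed

text \<open>A single chart at the identity, composed with an affine map, is carried around by left
  translations: z \<mapsto> p K(z) parametrises a neighbourhood of p. This trivialises the tangent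
  bundle by left-invariant fields without the exponential map. The matrix B leaves room to make the
  basis at the identity adapted to \<phi>.\<close>

locale lie_param = lie G A for G :: "'g::{t2_space,second_countable_topology} monoid" (structure)
    and A :: "('g, 'n::finite) atlas" +
  fixes U :: "'g set" and c :: "'g \<Rightarrow> real ^ 'n" and B :: "real ^ 'n ^ 'n"
  assumes chart1: "(U, c) \<in> A" "\<one> \<in> U" and B: "invertible B"
begin

definition K :: "real ^ 'n \<Rightarrow> 'g" where "K z = inv_into U c (c \<one> + B *v z)"
definition C :: "'g \<Rightarrow> real ^ 'n" where "C p = matrix_inv B *v (c p - c \<one>)"
definition N :: "(real ^ 'n) set" where "N = {z. c \<one> + B *v z \<in> c ` U}"

lemma B_inv: "B *v (matrix_inv B *v x) = x" "matrix_inv B *v (B *v x) = x"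
proof -
  have "B ** matrix_inv B = mat 1 \<and> matrix_inv B ** B = mat 1"
    using someI_ex[OF B[unfolded invertible_def]] by (simp add: matrix_inv_def)
  then show "B *v (matrix_inv B *v x) = x" "matrix_inv B *v (B *v x) = x"
    by (simp_all add: matrix_vector_mul_assoc)
qed

lemma K0 [simp]: "K 0 = \<one>" and C1 [simp]: "C \<one> = 0" and N0: "0 \<in> N"
  using chart(5)[OF chart1] chart1(2) by (auto simp: K_def C_def N_def)

lemma KU: "z \<in> N \<Longrightarrow> K z \<in> U" by (auto simp: N_def K_def inv_into_into)

lemma CK: "z \<in> N \<Longrightarrow> C (K z) = z" by (auto simp: N_def K_def C_def f_inv_into_f B_inv)

lemma CN: "p \<in> U \<Longrightarrow> C p \<in> N" and KC: "p \<in> U \<Longrightarrow> K (C p) = p"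
  using chart(5)[OF chart1(1)] by (auto simp: N_def K_def C_def B_inv)

lemma openU: "open U" using chart(1)[OF chart1(1)] .

lemma smooth_affine: "smooth_near (\<lambda>z. x + M *v z) (z::real^'n)"
  by (rule smooth_near_add[OF smooth_near_const smooth_near_linear[OF matrix_vector_mul_bounded_linear smooth_near_id]])

lemma openN: "open N"
proof -
  have "continuous_on UNIV (\<lambda>z. c \<one> + B *v z)"
    by (intro continuous_on_add continuous_on_const linear_continuous_on matrix_vector_mul_bounded_linear)
  then have "open ((\<lambda>z. c \<one> + B *v z) -` (c ` U))" using chart(2)[OF chart1(1)]
    by (simp add: open_vimage)
  then show ?thesis by (simp add: N_def vimage_def)
qed

lemma smG_K: "z \<in> N \<Longrightarrow> smG K z"
  unfolding K_def by (rule smG_comp[OF smG_chart_inv[OF chart1(1)] smooth_affine]) (simp add: N_def)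

lemma smooth_C:
  assumes "smG k z" "k z \<in> U" shows "smooth_near (\<lambda>z. C (k z)) z"
proof -
  have "smooth_near (\<lambda>z. matrix_inv B *v (c (k z) + - c \<one>)) z"
    by (intro smooth_near_linear[OF matrix_vector_mul_bounded_linear] smooth_near_add smooth_near_const smG_chart[OF assms(1) chart1(1) assms(2)])
  then show ?thesis by (simp add: C_def)
qed

lemma smG_left: "smG k z \<Longrightarrow> smG (\<lambda>z. p \<otimes> k z) z"
  by (intro smG_mult smG_const)

lemma smooth_C_back: "smG (\<lambda>x. k x) x \<Longrightarrow> k x = p \<Longrightarrow> smooth_near (\<lambda>x. C (inv p \<otimes> k x)) x"
  using chart1(2) by (intro smooth_C smG_left) auto

lemma eventually_back:
  assumes "smG k x" "k x = p"
  shows "\<forall>\<^sub>F x in nhds x. p \<otimes> K (C (inv p \<otimes> k x)) = k x"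
proof -
  have "\<forall>\<^sub>F x in nhds x. inv p \<otimes> k x \<in> U"
    using assms chart1(2) by (intro isCont_eventually smG_isCont smG_left openU) auto
  then show ?thesis by eventually_elim (simp add: KC)
qed

abbreviation sm :: "'g \<Rightarrow> ('g \<Rightarrow> 'b::real_normed_vector) \<Rightarrow> bool" where
  "sm p h \<equiv> smooth_near (\<lambda>z. h (p \<otimes> K z)) 0"

text \<open>The left-invariant vector field with value u at the identity, applied to h at p.
  Vector-valued h are allowed; the Jacobi identity is proved with such an h.\<close>

abbreviation dv :: "'g \<Rightarrow> real ^ 'n \<Rightarrow> ('g \<Rightarrow> 'b::real_normed_vector) \<Rightarrow> 'b" where
  "dv p u h \<equiv> fd (\<lambda>z. h (p \<otimes> K z)) 0 u"

definition tv :: "'g \<Rightarrow> real ^ 'n \<Rightarrow> 'g tvec" where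
  "tv p u = (\<lambda>f. if sm p f then dv p u f else 0)"

lemma smG_pK: "smG (\<lambda>z. p \<otimes> K z) 0"
  by (intro smG_left smG_K N0)

text \<open>Near x the map k factors through the translated chart as p K(C(p^{-1} k)), so smoothness
  in that one parametrisation is enough.\<close>

lemma sm_smG:
  fixes h :: "'g \<Rightarrow> 'b::real_normed_vector"
  assumes "sm p h" "smG k x" "k x = p"
  shows "smooth_near (\<lambda>x. h (k x)) x"
proof (rule smooth_near_cong)
  show "smooth_near (\<lambda>x. h (p \<otimes> K (C (inv p \<otimes> k x)))) x"
    using smooth_near_comp[OF smooth_C_back[OF assms(2,3)], of "\<lambda>z. h (p \<otimes> K z)"] assms(1,3) by simp
  show "\<forall>\<^sub>F x in nhds x. h (p \<otimes> K (C (inv p \<otimes> k x))) = h (k x)"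
    using eventually_back[OF assms(2,3)] by eventually_elim simp
qed

lemma fd_smG:
  fixes h :: "'g \<Rightarrow> 'b::real_normed_vector"
  assumes "sm p h" "smG k x" "k x = p"
  shows "fd (\<lambda>x. h (k x)) x v = dv p (fd (\<lambda>x. C (inv p \<otimes> k x)) x v) h"
proof -
  have "fd (\<lambda>x. h (k x)) x v = fd (\<lambda>x. h (p \<otimes> K (C (inv p \<otimes> k x)))) x v"
    by (rule arg_cong[of _ _ "\<lambda>g. g v"], rule fd_cong)
      (use eventually_back[OF assms(2,3)] in \<open>eventually_elim; simp\<close>)
  also have "\<dots> = dv p (fd (\<lambda>x. C (inv p \<otimes> k x)) x v) h"
    using fd_eqI[OF fd_compose[OF smooth_near_differentiable[OF smooth_C_back[OF assms(2,3)]], of "\<lambda>z. h (p \<otimes> K z)"]]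
      smooth_near_differentiable[OF assms(1)] assms(3) by simp
  finally show ?thesis .
qed

lemma smooth_at_iff: "smooth_at A p f \<longleftrightarrow> sm p f"
proof
  assume "smooth_at A p f"
  then show "sm p f" by (intro smooth_at_smG smG_pK) simp
next
  assume sm: "sm p f"
  obtain V d where V: "(V, d) \<in> A" "p \<in> V" using chart_ex by blast
  have "smooth_near (\<lambda>x. f (inv_into V d x)) (d p)"
    by (rule sm_smG[OF sm smG_chart_inv[OF V(1)]]) (use V chart(5)[OF V] in auto)
  then show "smooth_at A p f" using smooth_at_chart[OF V] by simp
qed

lemma smooth_fun_sm: "open W \<Longrightarrow> smooth_fun A W f \<longleftrightarrow> (\<forall>p\<in>W. sm p f)"
  using smooth_fun_iff smooth_at_iff by simp

text \<open>By the chain rule a direction in an arbitrary chart corresponds to a direction in the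
  translated chart at p, through the derivative of the change of coordinates; the two inclusions use
  the two directions of this change.\<close>

lemma tangent_space_eq: "tangent_space A p = range (tv p)"
proof (rule subset_antisym; rule subsetI)
  fix v assume "v \<in> tangent_space A p"
  then obtain V d u where V: "(V, d) \<in> A" "p \<in> V"
    and v: "v = (\<lambda>f. if smooth_at A p f then fd (f \<circ> inv_into V d) (d p) u else 0)"
    unfolding tangent_space_def by blast
  have "v = tv p (fd (\<lambda>x. C (inv p \<otimes> inv_into V d x)) (d p) u)"
    unfolding v tv_def smooth_at_iff comp_def
    by (rule ext) (use V chart(5)[OF V] in \<open>auto intro!: fd_smG smG_chart_inv\<close>)
  then show "v \<in> range (tv p)" by blast
next
  fix v assume "v \<in> range (tv p)"
  then obtain u where v: "v = tv p u" by blast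
  obtain V d where V: "(V, d) \<in> A" "p \<in> V" using chart_ex by blast
  have "v = (\<lambda>f. if smooth_at A p f then fd (f \<circ> inv_into V d) (d p) (fd (\<lambda>z. d (p \<otimes> K z)) 0 u) else 0)"
  proof (rule ext)
    fix f
    show "v f = (if smooth_at A p f then fd (f \<circ> inv_into V d) (d p) (fd (\<lambda>z. d (p \<otimes> K z)) 0 u) else 0)"
    proof (cases "sm p f")
      case True
      have d: "smooth_near (\<lambda>z. d (p \<otimes> K z)) 0" by (rule smG_chart[OF smG_pK V(1)]) (simp add: V)
      have f: "smooth_near (\<lambda>x. f (inv_into V d x)) (d p)" using True smooth_at_iff smooth_at_chart[OF V] by simp
      have "fd (\<lambda>z. f (p \<otimes> K z)) 0 u = fd (\<lambda>z. f (inv_into V d (d (p \<otimes> K z)))) 0 u"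
      proof (rule arg_cong[of _ _ "\<lambda>g. g u"], rule fd_cong)
        have "\<forall>\<^sub>F z in nhds 0. p \<otimes> K z \<in> V"
          by (rule isCont_eventually[OF smG_isCont[OF smG_pK] chart(1)[OF V(1)]]) (simp add: V)
        then show "\<forall>\<^sub>F z in nhds 0. f (p \<otimes> K z) = f (inv_into V d (d (p \<otimes> K z)))"
          by eventually_elim (simp add: chart(5)[OF V(1)])
      qed
      also have "\<dots> = fd (\<lambda>x. f (inv_into V d x)) (d p) (fd (\<lambda>z. d (p \<otimes> K z)) 0 u)"
        using fd_eqI[OF fd_compose[OF smooth_near_differentiable[OF d], of "\<lambda>x. f (inv_into V d x)"]]
          smooth_near_differentiable[OF f] by simp
      finally show ?thesis using True by (simp add: v tv_def smooth_at_iff comp_def)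
    qed (simp add: v tv_def smooth_at_iff)
  qed
  then show "v \<in> tangent_space A p" unfolding tangent_space_def using V by blast
qed

lemma sm_const [simp]: "sm p (\<lambda>q. k)" by (rule smooth_near_const)

lemma sm_coord:
  assumes "inv p \<otimes> q \<in> U" shows "sm q (\<lambda>q. C (inv p \<otimes> q))"
  using assms by (intro smooth_C smG_left smG_K N0) simp

lemma dv_coord: "dv p u (\<lambda>q. C (inv p \<otimes> q)) = u"
proof -
  have "\<forall>\<^sub>F z in nhds 0. C (inv p \<otimes> (p \<otimes> K z)) = z"
    using eventually_nhds_in_open[OF openN N0] by eventually_elim (simp add: CK)
  then have "fd (\<lambda>z. C (inv p \<otimes> (p \<otimes> K z))) 0 = fd (\<lambda>z. z) 0" by (rule fd_cong)
  moreover have "fd (\<lambda>z. z) 0 u = u" by (rule fd_eqI) auto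
  ultimately show ?thesis by simp
qed

lemma fd_nth:
  fixes f :: "'a::euclidean_space \<Rightarrow> real ^ 'm"
  shows "f differentiable (at x) \<Longrightarrow> fd (\<lambda>z. f z $ i) x v = fd f x v $ i"
  using fd_inner[of f x "axis i 1" v] by (simp add: inner_axis)

text \<open>The coordinate functions centred at p recover u from the tangent vector, so coefficient
  vectors are well defined.\<close>

lemma tv_coord: "tv p u (\<lambda>q. C (inv p \<otimes> q) $ i) = u $ i"
proof -
  have s: "sm p (\<lambda>q. C (inv p \<otimes> q))" by (rule sm_coord) (simp add: chart1)
  then have "sm p (\<lambda>q. C (inv p \<otimes> q) $ i)" by (rule smooth_near_nth)
  then show ?thesis unfolding tv_def
    using fd_nth[OF smooth_near_differentiable[OF s], of i u] dv_coord[of p u] by simp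
qed

lemma tv_inj: "tv p u = tv p v \<longleftrightarrow> u = v"
proof
  assume "tv p u = tv p v"
  then show "u = v" using tv_coord[of p u] tv_coord[of p v] by (simp add: vec_eq_iff)
qed simp

lemma dv_linear: "sm p h \<Longrightarrow> linear (\<lambda>u. dv p u h)"
  using fd_linear[OF smooth_near_differentiable] by blast

lemma tv_linear: "linear (\<lambda>u. tv p u f)"
  using dv_linear[where p=p and h=f] by (cases "sm p f") (simp_all add: tv_def linear_zero)

lemma tv_lincomb: "lincomb a (tv p u) b (tv p v) = tv p (a *\<^sub>R u + b *\<^sub>R v)"
  by (rule ext) (simp add: lincomb_def linear_add[OF tv_linear] linear_scale[OF tv_linear])

text \<open>Left translations do not change coefficient vectors. Hence a form is invariant when its
  coefficients do not depend on p.\<close>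

lemma push_tv: "push (\<lambda>y. x \<otimes> y) (tv p u) = tv (x \<otimes> p) u"
  by (rule ext) (simp add: push_def tv_def comp_def assoc)

definition m :: "(real ^ 'n) \<times> (real ^ 'n) \<Rightarrow> real ^ 'n" where
  "m zw = C (K (fst zw) \<otimes> K (snd zw))"

lemma smG_KK:
  assumes "fst zw \<in> N" "snd zw \<in> N" shows "smG (\<lambda>zw. K (fst zw) \<otimes> K (snd zw)) zw"
  by (intro smG_mult smG_comp[OF smG_K] assms smooth_near_linear[OF bounded_linear_fst]
      smooth_near_linear[OF bounded_linear_snd] smooth_near_id)

lemma smooth_m:
  assumes "fst zw \<in> N" "snd zw \<in> N" "K (fst zw) \<otimes> K (snd zw) \<in> U" shows "smooth_near m zw"
  unfolding m_def by (rule smooth_C[OF smG_KK]) (use assms in auto)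

lemma m_right0: "z \<in> N \<Longrightarrow> m (z, 0) = z" and m_left0: "z \<in> N \<Longrightarrow> m (0, z) = z"
  by (simp_all add: m_def CK)

lemma smooth_m0: "smooth_near m (z, 0)" if "z \<in> N"
  by (rule smooth_m) (use that N0 KU in auto)

definition H :: "'g \<Rightarrow> ('g \<Rightarrow> 'b) \<Rightarrow> (real ^ 'n) \<times> (real ^ 'n) \<Rightarrow> 'b" where
  "H p h zw = h (p \<otimes> (K (fst zw) \<otimes> K (snd zw)))"

lemma smooth_H:
  fixes h :: "'g \<Rightarrow> 'b::real_normed_vector"
  assumes "sm p h" shows "smooth_near (H p h) (0, 0)"
  unfolding H_def using sm_smG[OF assms smG_left[OF smG_KK[of "(0,0)"]], of p] N0 by simp

lemma eventually_Pair0: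
  fixes x :: "'a::euclidean_space" and y :: "'b::euclidean_space"
  assumes "eventually P (nhds (x, y))" shows "\<forall>\<^sub>F z in nhds x. P (z, y)"
proof -
  have "isCont (\<lambda>z. (z, y)) x" by (intro continuous_intros)
  then have "((\<lambda>z. (z, y)) \<longlongrightarrow> (x, y)) (nhds x)" unfolding isCont_def by (rule tendsto_at_iff_tendsto_nhds[THEN iffD1])
  then show ?thesis using assms unfolding filterlim_iff by blast
qed

lemma smooth_near_slice:
  fixes g :: "'a::euclidean_space \<times> 'b::euclidean_space \<Rightarrow> 'c::real_normed_vector"
  assumes "smooth_near g (x, y)" shows "smooth_near (\<lambda>w. g (x, w)) y"
  by (rule smooth_near_comp[OF smooth_near_Pair[OF smooth_near_const smooth_near_id] assms])

lemma fd_slice: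
  fixes g :: "'a::euclidean_space \<times> 'b::euclidean_space \<Rightarrow> 'c::real_normed_vector"
  assumes "g differentiable (at (x, y))" shows "fd (\<lambda>w. g (x, w)) y u = fd g (x, y) (0, u)"
proof -
  have "((\<lambda>w. (x, w)) has_derivative (\<lambda>u. (0, u))) (at y)" by (auto intro!: derivative_eq_intros)
  from fd_eqI[OF has_derivative_compose[OF this differentiable_fd[OF assms]]] show ?thesis .
qed

text \<open>Derivatives at the points p K(z) are partial derivatives of the jointly smooth function
  \<open>H p h\<close> of two variables. This gives smoothness of \<open>dv\<close> in its base
  point.\<close>

lemma sm_eventually:
  fixes h :: "'g \<Rightarrow> 'b::real_normed_vector"
  assumes "sm p h" shows "\<forall>\<^sub>F z in nhds 0. sm (p \<otimes> K z) h \<and> (\<forall>u. dv (p \<otimes> K z) u h = fd (H p h) (z, 0) (0, u))"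
  using eventually_Pair0[OF smooth_near_eventually[OF smooth_H[OF assms]]]
proof eventually_elim
  case (elim z)
  then show ?case using smooth_near_slice[OF elim] fd_slice[OF smooth_near_differentiable[OF elim]]
    by (simp add: H_def assoc)
qed

lemma sm_dv_var:
  fixes h :: "'g \<Rightarrow> 'b::real_normed_vector"
  assumes "sm p h" "sm p a" shows "sm p (\<lambda>q. dv q (a q) h)"
proof (rule smooth_near_cong)
  have "smooth_near (\<lambda>z. (0::real^'n, a (p \<otimes> K z))) 0" by (intro smooth_near_Pair smooth_near_const assms)
  then show "smooth_near (\<lambda>z. fd (H p h) (z, 0) (0, a (p \<otimes> K z))) 0"
    by (intro smooth_near_fd_var smooth_H assms smooth_near_Pair smooth_near_const smooth_near_id)
  show "\<forall>\<^sub>F z in nhds 0. fd (H p h) (z, 0) (0, a (p \<otimes> K z)) = dv (p \<otimes> K z) (a (p \<otimes> K z)) h"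
    using sm_eventually[OF assms(1)] by eventually_elim simp
qed

lemma sm_dv:
  fixes h :: "'g \<Rightarrow> 'b::real_normed_vector"
  assumes "sm p h" shows "sm p (\<lambda>q. dv q u h)"
  by (rule sm_dv_var[OF assms]) simp

lemma dv_cong:
  assumes "\<forall>\<^sub>F z in nhds 0. h (p \<otimes> K z) = h' (p \<otimes> K z)" shows "dv p u h = dv p u h'"
  using fd_cong[OF assms] by simp

text \<open>The coordinate velocity at \<open>K z\<close> of the left-invariant field with value u
  at the identity.\<close>

definition PP :: "real ^ 'n \<Rightarrow> real ^ 'n \<Rightarrow> real ^ 'n" where "PP z u = fd m (z, 0) (0, u)"

text \<open>The bilinear part of the multiplication in coordinates: m(z, w) = z + w + \<beta> z w +
  higher order, as m(z, 0) = z and m(0, w) = w.\<close>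

definition \<beta> :: "real ^ 'n \<Rightarrow> real ^ 'n \<Rightarrow> real ^ 'n" where "\<beta> v u = fd (\<lambda>z. PP z u) 0 v"

definition br :: "real ^ 'n \<Rightarrow> real ^ 'n \<Rightarrow> real ^ 'n" where "br u v = \<beta> u v - \<beta> v u"

lemma smooth_PP: "z \<in> N \<Longrightarrow> smooth_near (\<lambda>z. PP z u) z"
  unfolding PP_def by (intro smooth_near_fd_var smooth_m0 smooth_near_Pair smooth_near_const smooth_near_id)

lemma PP0: "PP 0 u = u"
proof -
  have "fd (\<lambda>w. m (0, w)) 0 = fd (\<lambda>w. w) 0"
    by (rule fd_cong) (use eventually_nhds_in_open[OF openN N0] in \<open>eventually_elim; simp add: m_left0\<close>)
  moreover have "fd (\<lambda>w. w) 0 u = u" by (rule fd_eqI) auto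
  ultimately show ?thesis
    using fd_slice[OF smooth_near_differentiable[OF smooth_m0[OF N0]], of u] by (simp add: PP_def)
qed

text \<open>In coordinates the field u is z \<mapsto> \<open>PP z u\<close>. Differentiating along
  it twice gives the Hessian of h and a first-order term from the derivative of \<open>PP\<close> at
  0. The Hessian is symmetric and cancels in \<open>dv_commutator\<close>.\<close>

lemma dv_dv:
  fixes h :: "'g \<Rightarrow> 'b::real_normed_vector"
  assumes h: "sm p h"
  shows "dv p v (\<lambda>q. dv q u h) = fd (\<lambda>z. fd (\<lambda>z. h (p \<otimes> K z)) z u) 0 v + dv p (\<beta> v u) h"
proof -
  define F where "F = (\<lambda>z. h (p \<otimes> K z))"
  have F: "smooth_near F 0" using h by (simp add: F_def)
  have HF: "\<forall>\<^sub>F zw in nhds (0,0). H p h zw = F (m zw)"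
  proof -
    have "\<forall>\<^sub>F zw in nhds (0,0). K (fst zw) \<otimes> K (snd zw) \<in> U"
      by (rule isCont_eventually[OF smG_isCont[OF smG_KK] openU]) (use N0 chart1 in auto)
    then show ?thesis by eventually_elim (simp add: H_def F_def m_def KC)
  qed
  have e1: "\<forall>\<^sub>F z in nhds 0. fd (H p h) (z, 0) = fd (\<lambda>zw. F (m zw)) (z, 0)"
  proof -
    have "\<forall>\<^sub>F y in nhds (0,0). \<forall>\<^sub>F zw in nhds y. H p h zw = F (m zw)"
      using HF by (simp add: eventually_eventually)
    from eventually_Pair0[OF this] show ?thesis by eventually_elim (rule fd_cong)
  qed
  have e: "\<forall>\<^sub>F z in nhds 0. dv (p \<otimes> K z) u h = fd F z (PP z u)"
    using e1 sm_eventually[OF h] smooth_near_eventually[OF F] eventually_nhds_in_open[OF openN N0]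
  proof eventually_elim
    case (elim z)
    have "fd (\<lambda>zw. F (m zw)) (z, 0) (0, u) = fd F (m (z, 0)) (fd m (z, 0) (0, u))"
      using elim m_right0[of z] by (intro fd_eqI[OF fd_compose] smooth_near_differentiable smooth_m0) auto
    then show ?case using elim m_right0[of z] by (simp add: PP_def)
  qed
  have "dv p v (\<lambda>q. dv q u h) = fd (\<lambda>z. fd F z (PP z u)) 0 v"
    using fd_cong[OF e] by simp
  also have "\<dots> = fd F 0 (fd (\<lambda>z. PP z u) 0 v) + fd (\<lambda>z. fd F z (PP 0 u)) 0 v"
    by (rule fd_fd_var[OF F smooth_PP[OF N0]])
  finally show ?thesis by (simp add: PP0 \<beta>_def F_def add.commute)
qed

lemma dv_commutator:
  fixes h :: "'g \<Rightarrow> 'b::euclidean_space"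
  assumes h: "sm p h"
  shows "dv p u (\<lambda>q. dv q v h) - dv p v (\<lambda>q. dv q u h) = dv p (br u v) h"
  unfolding dv_dv[OF h] br_def using Schwarz[OF h, of u v] linear_diff[OF dv_linear[OF h]] by simp

end

lemma linear_vec_sum:
  fixes L :: "real ^ 'n \<Rightarrow> 'b::real_vector"
  assumes "linear L" shows "L x = (\<Sum>i\<in>UNIV. x $ i *\<^sub>R L (axis i 1))"
proof -
  have "(\<Sum>i\<in>UNIV. x $ i *\<^sub>R axis i 1) = x" by (simp add: vec_eq_iff axis_def if_distrib cong: if_cong)
  then have "L x = L (\<Sum>i\<in>UNIV. x $ i *\<^sub>R axis i 1)" by simp
  also have "\<dots> = (\<Sum>i\<in>UNIV. x $ i *\<^sub>R L (axis i 1))"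
    by (simp add: linear_sum[OF assms] linear_scale[OF assms])
  finally show ?thesis .
qed

lemma smooth_near_bilinear:
  fixes b :: "real ^ 'n \<Rightarrow> real ^ 'n \<Rightarrow> real ^ 'n"
  assumes b: "bilinear b" and "smooth_near f x" "smooth_near g x"
  shows "smooth_near (\<lambda>z. b (f z) (g z)) x"
proof -
  have "smooth_near (\<lambda>z. \<Sum>i\<in>UNIV. f z $ i *\<^sub>R (\<Sum>j\<in>UNIV. g z $ j *\<^sub>R b (axis i 1) (axis j 1))) x"
    by (intro smooth_near_sum smooth_near_scaleR smooth_near_nth smooth_near_const assms)
  moreover have "(\<lambda>z. b (f z) (g z)) = (\<lambda>z. \<Sum>i\<in>UNIV. f z $ i *\<^sub>R (\<Sum>j\<in>UNIV. g z $ j *\<^sub>R b (axis i 1) (axis j 1)))"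
  proof
    fix z
    have l: "linear (\<lambda>u. b u (g z))" "linear (b (axis i 1))" for i using b by (auto simp: bilinear_def)
    show "b (f z) (g z) = (\<Sum>i\<in>UNIV. f z $ i *\<^sub>R (\<Sum>j\<in>UNIV. g z $ j *\<^sub>R b (axis i 1) (axis j 1)))"
      unfolding linear_vec_sum[OF l(2), symmetric] by (rule linear_vec_sum[OF l(1)])
  qed
  ultimately show ?thesis by (simp only:)
qed

context lie_param
begin

lemma tv_sm: "sm p f \<Longrightarrow> tv p u f = dv p u f" by (simp add: tv_def)

lemma dv_bilinear:
  assumes "bounded_bilinear b" "sm p f" "sm p h"
  shows "dv p u (\<lambda>q. b (f q) (h q)) = b (f p) (dv p u h) + b (dv p u f) (h p)"
  using fd_eqI[OF bounded_bilinear.FDERIV[OF assms(1) differentiable_fd differentiable_fd,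
    OF smooth_near_differentiable[OF assms(2)] smooth_near_differentiable[OF assms(3)]]] by simp

lemma dv_add: "sm p f \<Longrightarrow> sm p h \<Longrightarrow> dv p u (\<lambda>q. f q + h q) = dv p u f + dv p u h"
  by (rule fd_eqI[OF has_derivative_add[OF differentiable_fd differentiable_fd]]; rule smooth_near_differentiable)

lemma dv_diff: "sm p f \<Longrightarrow> sm p h \<Longrightarrow> dv p u (\<lambda>q. f q - h q) = dv p u f - dv p u h"
  by (rule fd_eqI[OF has_derivative_diff[OF differentiable_fd differentiable_fd]]; rule smooth_near_differentiable)

lemma dv_sum: "(\<And>i. i \<in> I \<Longrightarrow> sm p (f i)) \<Longrightarrow> dv p u (\<lambda>q. \<Sum>i\<in>I. f i q) = (\<Sum>i\<in>I. dv p u (f i))"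
  by (rule fd_eqI, rule has_derivative_sum, rule differentiable_fd, rule smooth_near_differentiable)

lemma dv_const: "dv p u (\<lambda>q. k) = 0"
  by (simp add: frechet_derivative_const)

lemma dv_nth:
  fixes a :: "'g \<Rightarrow> real ^ 'm"
  shows "sm p a \<Longrightarrow> dv p u (\<lambda>q. a q $ i) = dv p u a $ i"
  by (rule fd_nth[OF smooth_near_differentiable])

lemma dv_dv_var:
  fixes h :: "'g \<Rightarrow> 'b::real_normed_vector"
  assumes h: "sm p h" and b: "sm p b"
  shows "dv p u (\<lambda>q. dv q (b q) h) = dv p (dv p u b) h + dv p u (\<lambda>q. dv q (b p) h)"
proof -
  have ev: "\<forall>\<^sub>F z in nhds 0. dv (p \<otimes> K z) (w (p \<otimes> K z)) h = (\<Sum>i\<in>UNIV. w (p \<otimes> K z) $ i *\<^sub>R dv (p \<otimes> K z) (axis i 1) h)" for w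
    using sm_eventually[OF h] by eventually_elim (rule linear_vec_sum, rule dv_linear, simp)
  have "dv p u (\<lambda>q. dv q (w q) h) = (\<Sum>i\<in>UNIV. w p $ i *\<^sub>R dv p u (\<lambda>q. dv q (axis i 1) h) + dv p u w $ i *\<^sub>R dv p (axis i 1) h)"
    if w: "sm p w" for w
  proof -
    have "dv p u (\<lambda>q. dv q (w q) h) = dv p u (\<lambda>q. \<Sum>i\<in>UNIV. w q $ i *\<^sub>R dv q (axis i 1) h)"
      by (rule dv_cong[OF ev])
    also have "\<dots> = (\<Sum>i\<in>UNIV. dv p u (\<lambda>q. w q $ i *\<^sub>R dv q (axis i 1) h))"
      by (intro dv_sum smooth_near_scaleR smooth_near_nth sm_dv h w)
    also have "\<dots> = (\<Sum>i\<in>UNIV. w p $ i *\<^sub>R dv p u (\<lambda>q. dv q (axis i 1) h) + dv p u w $ i *\<^sub>R dv p (axis i 1) h)"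
      using dv_bilinear[OF bounded_bilinear_scaleR smooth_near_nth[OF w] sm_dv[OF h]] dv_nth[OF w] by simp
    finally show ?thesis .
  qed
  from this[OF b] this[of "\<lambda>_. b p"] show ?thesis
    using linear_vec_sum[OF dv_linear[OF h], of "dv p u b"] by (simp add: sum.distrib dv_const)
qed

subsection \<open>Vector fields\<close>

lemma smooth_fun_UNIV: "smooth_fun A UNIV f \<longleftrightarrow> (\<forall>p. sm p f)"
  using smooth_fun_sm[OF open_UNIV] by simp

lemma sm_tv_var:
  assumes "sm p f" "sm p a" shows "sm p (\<lambda>q. tv q (a q) f)" "dv p u (\<lambda>q. tv q (a q) f) = dv p u (\<lambda>q. dv q (a q) f)"
proof -
  have ev: "\<forall>\<^sub>F z in nhds 0. dv (p \<otimes> K z) (a (p \<otimes> K z)) f = tv (p \<otimes> K z) (a (p \<otimes> K z)) f"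
    using sm_eventually[OF assms(1)] by eventually_elim (simp add: tv_sm)
  show "sm p (\<lambda>q. tv q (a q) f)" by (rule smooth_near_cong[OF sm_dv_var[OF assms] ev])
  show "dv p u (\<lambda>q. tv q (a q) f) = dv p u (\<lambda>q. dv q (a q) f)" by (rule dv_cong[OF ev, symmetric])
qed

lemma vector_fieldI:
  assumes "\<And>p. sm p a" shows "vector_field A (\<lambda>p. tv p (a p))"
  unfolding vector_field_def using smooth_fun_sm sm_tv_var(1)[OF _ assms] by (auto simp: tangent_space_eq)

text \<open>Left multiplication by K(z) followed by left multiplication by its inverse is the
  identity. The derivative of this relation inverts \<open>PP z\<close> by an expression that is
  smooth in z.\<close>

lemma PP_back:
  shows "\<forall>\<^sub>F z in nhds 0. \<forall>u. fd m (C (inv (K z)), z) (0, PP z u) = u"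
proof -
  have si: "smG (\<lambda>z. inv (K z)) 0" by (intro smG_inv smG_K N0)
  have "\<forall>\<^sub>F z in nhds 0. inv (K z) \<in> U"
    by (rule isCont_eventually[OF smG_isCont[OF si] openU]) (simp add: chart1)
  then show ?thesis using eventually_nhds_in_open[OF openN N0]
  proof eventually_elim
    case (elim z)
    let ?i = "C (inv (K z))"
    have i: "?i \<in> N" "K ?i = inv (K z)" using elim CN KC by auto
    have sm1: "smooth_near m (z, 0)" using elim by (intro smooth_m0)
    have sm2: "smooth_near m (?i, z)" using i elim chart1 by (intro smooth_m) auto
    have ev: "\<forall>\<^sub>F w in nhds 0. m (?i, m (z, w)) = w"
    proof -
      have "\<forall>\<^sub>F w in nhds 0. K z \<otimes> K w \<in> U"
        using elim KU by (intro isCont_eventually[OF smG_isCont[OF smG_left[OF smG_K[OF N0]]] openU]) auto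
      then show ?thesis using eventually_nhds_in_open[OF openN N0]
        by eventually_elim (simp add: m_def i KC CK)
    qed
    show ?case
    proof
      fix u
      have d: "((\<lambda>w. m (z, w)) has_derivative (\<lambda>u. PP z u)) (at 0)"
      proof -
        have "fd (\<lambda>w. m (z, w)) 0 = (\<lambda>u. PP z u)"
          unfolding PP_def by (rule ext) (rule fd_slice[OF smooth_near_differentiable[OF sm1]])
        with differentiable_fd[OF smooth_near_differentiable[OF smooth_near_slice[OF sm1]]] show ?thesis by (simp only:)
      qed
      have "((\<lambda>w. (?i, m (z, w))) has_derivative (\<lambda>u. (0, PP z u))) (at 0)"
        by (intro has_derivative_Pair has_derivative_const d)
      from fd_eqI[OF has_derivative_compose[OF this, of m "fd m (?i, z)"]]
      have "fd (\<lambda>w. m (?i, m (z, w))) 0 u = fd m (?i, z) (0, PP z u)"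
        using differentiable_fd[OF smooth_near_differentiable[OF sm2]] elim by (simp add: m_right0)
      moreover have "fd (\<lambda>w. m (?i, m (z, w))) 0 u = u"
        using fd_cong[OF ev] fd_eqI[of "\<lambda>w. w" "\<lambda>u. u" 0 u] by simp
      ultimately show "fd m (?i, z) (0, PP z u) = u" by simp
    qed
  qed
qed

lemma smooth_inv_K: "smooth_near (\<lambda>z. C (inv (K z))) 0"
  by (intro smooth_C smG_inv smG_K N0) (simp add: chart1)

text \<open>Smoothness of X is known only through its action on functions. On the coordinate
  functions centred at p this action is \<open>PP z\<close> applied to the coefficients, and
  \<open>PP_back\<close> recovers the coefficients smoothly.\<close>

lemma vector_fieldD:
  assumes "vector_field A X"
  shows "\<exists>a. (\<forall>p. sm p a) \<and> X = (\<lambda>p. tv p (a p))"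
proof -
  have "\<forall>p. \<exists>u. X p = tv p u" using assms by (auto simp: vector_field_def tangent_space_eq)
  then obtain a where a: "\<And>p. X p = tv p (a p)" by metis
  have "sm p a" for p
  proof -
    let ?W = "{q. inv p \<otimes> q \<in> U}"
    have "continuous_on UNIV (\<lambda>q. inv p \<otimes> q)"
    proof -
      have "continuous_on UNIV (\<lambda>q. (inv p, q))" by (intro continuous_intros)
      from continuous_on_compose2[OF cont_mult this] show ?thesis by simp
    qed
    then have W: "open ?W" "p \<in> ?W" using openU chart1 by (auto simp: open_vimage vimage_def[symmetric])
    \<comment> \<open>These functions are smooth on the neighbourhood \<open>?W\<close> of p; this
      is where the local form of smoothness in \<open>vector_field\<close>, over all open sets, is
      used.\<close>
    define f where "f = (\<lambda>i q. C (inv p \<otimes> q) $ i)"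
    have sf: "sm q (f i)" if "q \<in> ?W" for q i
      unfolding f_def using sm_coord[of p q] that by (intro smooth_near_nth) auto
    then have "smooth_fun A ?W (f i)" for i using smooth_fun_sm[OF W(1)] by blast
    then have "smooth_fun A ?W (\<lambda>q. X q (f i))" for i using assms W(1) by (auto simp: vector_field_def)
    then have sX: "sm p (\<lambda>q. X q (f i))" for i using smooth_fun_sm[OF W(1), of "\<lambda>q. X q (f i)"] W(2) by simp
    have ev: "\<forall>\<^sub>F z in nhds 0. K z \<in> U \<and> z \<in> N"
      using eventually_nhds_in_open[OF openN N0] by eventually_elim (simp add: KU)
    have Y: "smooth_near (\<lambda>z. PP z (a (p \<otimes> K z))) 0"
    proof (rule smooth_near_componentwise)
      fix i
      show "smooth_near (\<lambda>z. PP z (a (p \<otimes> K z)) $ i) 0"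
      proof (rule smooth_near_cong[OF sX[of i]])
        show "\<forall>\<^sub>F z in nhds 0. X (p \<otimes> K z) (f i) = PP z (a (p \<otimes> K z)) $ i"
          using ev
        proof eventually_elim
          case (elim z)
          then have "p \<otimes> K z \<in> ?W" by simp
          then have "X (p \<otimes> K z) (f i) = dv (p \<otimes> K z) (a (p \<otimes> K z)) (f i)" using sf by (simp add: a tv_sm)
          also have "\<dots> = fd (\<lambda>w. m (z, w) $ i) 0 (a (p \<otimes> K z))" by (simp add: f_def m_def assoc)
          also have "\<dots> = PP z (a (p \<otimes> K z)) $ i"
            using elim smooth_m0[of z] fd_slice[of m z 0] fd_nth[of "\<lambda>w. m (z, w)" 0 i]
            by (simp add: PP_def smooth_near_differentiable smooth_near_slice)
          finally show ?case .
        qed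
      qed
    qed
    have "smooth_near (\<lambda>z. fd m (C (inv (K z)), z) (0, PP z (a (p \<otimes> K z)))) 0"
      using smooth_m0[OF N0]
      by (intro smooth_near_fd_var smooth_near_Pair smooth_inv_K smooth_near_id smooth_near_const Y) simp
    then show ?thesis
      by (rule smooth_near_cong) (use PP_back in \<open>eventually_elim; simp\<close>)
  qed
  moreover have "X = (\<lambda>p. tv p (a p))" using a by (rule ext)
  ultimately show ?thesis by (intro exI[of _ a] conjI allI)
qed

text \<open>The extension is a choice, so formulas that involve it have to hold for every smooth
  coefficient function with the value u at p.\<close>

lemma extend:
  obtains a where "\<And>q. sm q a" "extend A p (tv p u) = (\<lambda>q. tv q (a q))" "a p = u"
proof -
  have "vector_field A (\<lambda>q. tv q u) \<and> (\<lambda>q. tv q u) p = tv p u" using vector_fieldI[of "\<lambda>q. u"] by simp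
  then have "vector_field A (extend A p (tv p u)) \<and> extend A p (tv p u) p = tv p u"
    unfolding extend_def by (rule someI[of "\<lambda>X. vector_field A X \<and> X p = tv p u"])
  then have "vector_field A (extend A p (tv p u))" and e: "extend A p (tv p u) p = tv p u" by auto
  from this(1) obtain a where a: "\<And>q. sm q a" "extend A p (tv p u) = (\<lambda>q. tv q (a q))" using vector_fieldD by blast
  moreover have "a p = u" using e unfolding a(2) tv_inj .
  ultimately show thesis by (rule that)
qed

lemma bracket_tv:
  assumes a: "\<And>p. sm p a" and b: "\<And>p. sm p b"
  shows "bracket A (\<lambda>p. tv p (a p)) (\<lambda>p. tv p (b p)) = (\<lambda>p. tv p (dv p (a p) b - dv p (b p) a + br (a p) (b p)))"
proof (intro ext)
  fix p f
  show "bracket A (\<lambda>p. tv p (a p)) (\<lambda>p. tv p (b p)) p f = tv p (dv p (a p) b - dv p (b p) a + br (a p) (b p)) f"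
  proof (cases "sm p f")
    case True
    note s = sm_tv_var[OF True a] sm_tv_var[OF True b]
    have "bracket A (\<lambda>p. tv p (a p)) (\<lambda>p. tv p (b p)) p f = dv p (a p) (\<lambda>q. dv q (b q) f) - dv p (b p) (\<lambda>q. dv q (a q) f)"
      using True s by (simp add: bracket_def smooth_at_iff tv_sm)
    also have "\<dots> = dv p (dv p (a p) b) f - dv p (dv p (b p) a) f + (dv p (a p) (\<lambda>q. dv q (b p) f) - dv p (b p) (\<lambda>q. dv q (a p) f))"
      using dv_dv_var[OF True a, of "b p"] dv_dv_var[OF True b, of "a p"] by simp
    also have "\<dots> = dv p (dv p (a p) b - dv p (b p) a + br (a p) (b p)) f"
      unfolding dv_commutator[OF True] by (simp add: linear_add[OF dv_linear[OF True]] linear_diff[OF dv_linear[OF True]])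
    finally show ?thesis using True by (simp add: tv_sm)
  qed (simp add: bracket_def smooth_at_iff tv_def)
qed

subsection \<open>The Lie algebra\<close>

lemma bilinear_\<beta>: "bilinear \<beta>"
  unfolding bilinear_def
proof (intro conjI allI)
  show "linear (\<lambda>v. \<beta> v u)" for u
    unfolding \<beta>_def by (rule fd_linear[OF smooth_near_differentiable[OF smooth_PP[OF N0]]])
  have lin: "linear (PP z)" if "z \<in> N" for z
  proof -
    have "linear (fd m (z, 0))" by (rule fd_linear[OF smooth_near_differentiable[OF smooth_m0[OF that]]])
    moreover have "linear (\<lambda>u. (0::real^'n, u::real^'n))" by (rule linearI) simp_all
    ultimately have "linear (fd m (z, 0) \<circ> (\<lambda>u. (0, u)))" by (intro linear_compose)
    then show ?thesis by (simp add: PP_def[abs_def] comp_def)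
  qed
  have s: "(\<lambda>z. PP z u) differentiable (at 0)" for u by (rule smooth_near_differentiable[OF smooth_PP[OF N0]])
  show "linear (\<lambda>u. \<beta> v u)" for v
  proof (rule linearI)
    fix u u'
    have "\<forall>\<^sub>F z in nhds 0. PP z (u + u') = PP z u + PP z u'"
      using eventually_nhds_in_open[OF openN N0] by eventually_elim (simp add: linear_add[OF lin])
    from fd_cong[OF this] show "\<beta> v (u + u') = \<beta> v u + \<beta> v u'"
      using fd_eqI[OF has_derivative_add[OF differentiable_fd[OF s] differentiable_fd[OF s]], of u u' v] by (simp add: \<beta>_def)
  next
    fix r u
    have "\<forall>\<^sub>F z in nhds 0. PP z (r *\<^sub>R u) = r *\<^sub>R PP z u"
      using eventually_nhds_in_open[OF openN N0] by eventually_elim (simp add: linear_scale[OF lin])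
    from fd_cong[OF this] show "\<beta> v (r *\<^sub>R u) = r *\<^sub>R \<beta> v u"
      using fd_eqI[OF has_derivative_scaleR_right[OF differentiable_fd[OF s]], of r u v] by (simp add: \<beta>_def)
  qed
qed

lemma bilinear_br: "bilinear br"
  using bilinear_\<beta> unfolding bilinear_def br_def by (auto intro: linear_compose_sub)

lemma br_skew: "br v u = - br u v" by (simp add: br_def)

text \<open>The coordinate map h has derivative x along x at the identity, so brackets can be read
  off from commutators of derivations applied to h. The cyclic sum then consists of third
  derivatives of h that cancel in pairs.\<close>

lemma Jacobi: "br u (br v w) + br v (br w u) + br w (br u v) = 0"
proof -
  define h where "h = (\<lambda>q. C (inv \<one> \<otimes> q))"
  have h: "sm \<one> h" unfolding h_def by (rule sm_coord) (simp add: chart1)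
  have id: "dv \<one> x h = x" for x unfolding h_def by (rule dv_coord)
  \<comment> \<open>The commutator formula is needed near the identity and not only at it, because
    it is differentiated once more.\<close>
  have ev: "\<forall>\<^sub>F z in nhds 0. dv (\<one> \<otimes> K z) (br v w) h = dv (\<one> \<otimes> K z) v (\<lambda>q. dv q w h) - dv (\<one> \<otimes> K z) w (\<lambda>q. dv q v h)" for v w
    using sm_eventually[OF h] by eventually_elim (rule dv_commutator[symmetric], simp)
  have e: "br u (br v w) = dv \<one> u (\<lambda>q. dv q v (\<lambda>q. dv q w h)) - dv \<one> u (\<lambda>q. dv q w (\<lambda>q. dv q v h))
      - (dv \<one> v (\<lambda>q. dv q w (\<lambda>q. dv q u h)) - dv \<one> w (\<lambda>q. dv q v (\<lambda>q. dv q u h)))" for u v w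
  proof -
    have "br u (br v w) = dv \<one> u (\<lambda>q. dv q (br v w) h) - dv \<one> (br v w) (\<lambda>q. dv q u h)"
      unfolding dv_commutator[OF h] id ..
    also have "dv \<one> u (\<lambda>q. dv q (br v w) h) = dv \<one> u (\<lambda>q. dv q v (\<lambda>q. dv q w h) - dv q w (\<lambda>q. dv q v h))"
      by (rule dv_cong[OF ev])
    also have "\<dots> = dv \<one> u (\<lambda>q. dv q v (\<lambda>q. dv q w h)) - dv \<one> u (\<lambda>q. dv q w (\<lambda>q. dv q v h))"
      by (intro dv_diff sm_dv h)
    also have "dv \<one> (br v w) (\<lambda>q. dv q u h) = dv \<one> v (\<lambda>q. dv q w (\<lambda>q. dv q u h)) - dv \<one> w (\<lambda>q. dv q v (\<lambda>q. dv q u h))"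
      by (rule dv_commutator[OF sm_dv[OF h], symmetric])
    finally show ?thesis .
  qed
  show ?thesis unfolding e by simp
qed

end

context lie_param
begin

subsection \<open>The Levi-Civita connection\<close>

text \<open>The Koszul formula on left-invariant fields, for the metric in which the coordinate
  basis is orthonormal.\<close>

definition nab :: "real ^ 'n \<Rightarrow> real ^ 'n \<Rightarrow> real ^ 'n" where
  "nab u v = (\<chi> k. (br u v \<bullet> axis k 1 - br v (axis k 1) \<bullet> u + br (axis k 1) u \<bullet> v) / 2)"

lemma nab_inner: "nab u v \<bullet> w = (br u v \<bullet> w - br v w \<bullet> u + br w u \<bullet> v) / 2"
proof -
  have "linear (\<lambda>w. (br u v \<bullet> w - br v w \<bullet> u + br w u \<bullet> v) / 2)"
    using bilinear_br by (auto simp: bilinear_def linear_iff inner_add_left inner_add_right field_simps)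
  from linear_vec_sum[OF this, of w] show ?thesis
    by (simp add: nab_def inner_vec_def mult.commute)
qed

lemma nab_torsion: "nab u v - nab v u = br u v"
proof (rule vector_eq_ldot[THEN iffD1], rule allI)
  fix w
  show "w \<bullet> (nab u v - nab v u) = w \<bullet> br u v"
    using nab_inner[of u v w] nab_inner[of v u w] br_skew[of v u] br_skew[of w u] br_skew[of w v]
    by (simp add: inner_diff_left inner_commute[of w] field_simps)
qed

lemma nab_metric: "nab u v \<bullet> w = - (v \<bullet> nab u w)"
  using nab_inner[of u v w] nab_inner[of u w v] br_skew[of v u] br_skew[of w u] br_skew[of w v]
  by (simp add: inner_commute[of v] field_simps)

lemma bilinear_nab: "bilinear nab"
proof -
  have "linear (\<lambda>u. nab u v)" for v
  proof (rule linearI)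
    show "nab (x + y) v = nab x v + nab y v" for x y
      by (rule vector_eq_rdot[THEN iffD1])
        (simp add: nab_inner inner_add_left inner_add_right bilinear_ladd[OF bilinear_br] bilinear_radd[OF bilinear_br] field_simps)
    show "nab (r *\<^sub>R x) v = r *\<^sub>R nab x v" for r x
      by (rule vector_eq_rdot[THEN iffD1])
        (simp add: nab_inner bilinear_lmul[OF bilinear_br] bilinear_rmul[OF bilinear_br] field_simps)
  qed
  moreover have "linear (nab u)" for u
  proof (rule linearI)
    show "nab u (x + y) = nab u x + nab u y" for x y
      by (rule vector_eq_rdot[THEN iffD1])
        (simp add: nab_inner inner_add_left inner_add_right bilinear_ladd[OF bilinear_br] bilinear_radd[OF bilinear_br] field_simps)
    show "nab u (r *\<^sub>R x) = r *\<^sub>R nab u x" for r x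
      by (rule vector_eq_rdot[THEN iffD1])
        (simp add: nab_inner bilinear_lmul[OF bilinear_br] bilinear_rmul[OF bilinear_br] field_simps)
  qed
  ultimately show ?thesis by (simp add: bilinear_def)
qed

definition co :: "'g vfield \<Rightarrow> 'g \<Rightarrow> real ^ 'n" where "co X p = (SOME u. X p = tv p u)"

lemma co_tv [simp]: "co (\<lambda>p. tv p (a p)) = a"
  by (rule ext) (simp add: co_def tv_inj)

definition LC :: "'g vfield \<Rightarrow> 'g vfield \<Rightarrow> 'g vfield" where
  "LC X Y = (\<lambda>p. tv p (dv p (co X p) (co Y) + nab (co X p) (co Y p)))"

lemma sm_LC:
  fixes a b :: "'g \<Rightarrow> real ^ 'n"
  assumes "sm p a" "sm p b" shows "sm p (\<lambda>q. dv q (a q) b + nab (a q) (b q))"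
  using smooth_near_add[OF sm_dv_var[where h=b and a=a and p=p] smooth_near_bilinear[OF bilinear_nab, of "\<lambda>z. a (p \<otimes> K z)" 0 "\<lambda>z. b (p \<otimes> K z)"]] assms by simp

lemma vf_co: "vector_field A X \<Longrightarrow> X = (\<lambda>p. tv p (co X p)) \<and> (\<forall>p. sm p (co X))"
  using vector_fieldD[of X] by (metis co_tv)

lemma vector_field_LC:
  assumes "vector_field A X" "vector_field A Y" shows "vector_field A (LC X Y)"
  unfolding LC_def by (rule vector_fieldI) (rule sm_LC; use assms vf_co in blast)

end

lemma frame_trace:
  fixes \<beta> :: "real ^ 'n \<Rightarrow> real ^ 'n \<Rightarrow> real" and F :: "'n \<Rightarrow> real ^ 'n"
  assumes \<beta>: "bilinear \<beta>" and F: "\<And>i j. F i \<bullet> F j = (if i = j then 1 else 0)"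
  shows "(\<Sum>i\<in>UNIV. \<beta> (F i) (F i)) = (\<Sum>i\<in>UNIV. \<beta> (axis i 1) (axis i 1))"
proof -
  have inj: "inj F"
  proof (rule injI)
    fix i j assume "F i = F j" then show "i = j" using F[of i j] F[of i i] by (auto split: if_splits)
  qed
  have n: "norm (F i) = 1" for i using F[of i i] by (simp add: norm_eq_1)
  have po: "pairwise orthogonal (range F)"
    using F by (auto simp: pairwise_def orthogonal_def)
  have "independent (range F)"
    by (rule pairwise_orthogonal_independent[OF po]) (use n in \<open>metis norm_zero rangeE zero_neq_one\<close>)
  then have "span (range F) = UNIV"
    using card_ge_dim_independent[of "range F" UNIV] by (simp add: card_image[OF inj] top.extremum_unique)
  from trace_orthonormal[OF \<beta> po _ this] n
  have "(\<Sum>x\<in>range F. \<beta> x x) = (\<Sum>b\<in>Basis. \<beta> b b)" by auto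
  moreover have "(\<Sum>x\<in>range F. \<beta> x x) = (\<Sum>i\<in>UNIV. \<beta> (F i) (F i))"
    by (simp add: sum.reindex[OF inj])
  moreover have "(\<Sum>b\<in>Basis. \<beta> b b) = (\<Sum>i\<in>UNIV. \<beta> (axis i 1) (axis i 1))"
  proof -
    have "(Basis :: (real ^ 'n) set) = (\<lambda>i. axis i 1) ` UNIV" by (auto simp: Basis_vec_def)
    then have "(\<Sum>b\<in>Basis. \<beta> b b) = (\<Sum>b\<in>(\<lambda>i :: 'n. axis i 1) ` UNIV. \<beta> b b)" by (rule arg_cong)
    also have "\<dots> = (\<Sum>i\<in>UNIV. \<beta> (axis i 1) (axis i 1))"
      by (rule sum.reindex_cong[OF _ refl refl]) (auto simp: inj_def axis_eq_axis)
    finally show ?thesis .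
  qed
  ultimately show ?thesis by simp
qed

locale lie_metric = lie_param G A U c B
  for G :: "'g::{t2_space,second_countable_topology} monoid" (structure)
    and A :: "('g, 'n::finite) atlas" and U c B +
  fixes g :: "'g metric"
  assumes g_tv: "g p (tv p u) (tv p v) = u \<bullet> v"
begin

lemma is_levi_civita_LC: "is_levi_civita A g LC"
  unfolding is_levi_civita_def
proof (intro conjI allI impI; (elim conjE)?)
  fix X Y assume X: "vector_field A X" and Y: "vector_field A Y"
  show "vector_field A (LC X Y)" by (rule vector_field_LC[OF X Y])
  obtain a where a: "\<And>p. sm p a" "X = (\<lambda>p. tv p (a p))" using vector_fieldD[OF X] by blast
  obtain b where b: "\<And>p. sm p b" "Y = (\<lambda>p. tv p (b p))" using vector_fieldD[OF Y] by blast
  show "(\<lambda>p. lincomb 1 (LC X Y p) (-1) (LC Y X p)) = bracket A X Y"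
    unfolding a(2) b(2) bracket_tv[OF a(1) b(1)]
  proof (rule ext)
    fix p
    have "1 *\<^sub>R (dv p (a p) b + nab (a p) (b p)) + (- 1) *\<^sub>R (dv p (b p) a + nab (b p) (a p)) = dv p (a p) b - dv p (b p) a + br (a p) (b p)"
      using nab_torsion[of "a p" "b p"] by (simp add: algebra_simps)
    then show "lincomb 1 (LC (\<lambda>p. tv p (a p)) (\<lambda>p. tv p (b p)) p) (- 1) (LC (\<lambda>p. tv p (b p)) (\<lambda>p. tv p (a p)) p) =
      tv p (dv p (a p) b - dv p (b p) a + br (a p) (b p))"
      unfolding LC_def tv_lincomb co_tv by (simp only:)
  qed
  fix Z assume Z: "vector_field A Z"
  obtain d where d: "\<And>p. sm p d" "Z = (\<lambda>p. tv p (d p))" using vector_fieldD[OF Z] by blast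
  show "LC X (\<lambda>p. lincomb 1 (Y p) 1 (Z p)) = (\<lambda>p. lincomb 1 (LC X Y p) 1 (LC X Z p))"
    unfolding a(2) b(2) d(2) LC_def tv_lincomb co_tv
    by (simp add: dv_add[OF b(1) d(1)] bilinear_radd[OF bilinear_nab] ac_simps)
  show "X p (\<lambda>q. g q (Y q) (Z q)) = g p (LC X Y p) (Z p) + g p (Y p) (LC X Z p)" for p
  proof -
    have s: "sm p (\<lambda>q. b q \<bullet> d q)"
      unfolding inner_vec_def by (intro smooth_near_sum) (simp, intro smooth_near_mult smooth_near_nth b d)
    show ?thesis
      unfolding a(2) b(2) d(2) LC_def g_tv co_tv tv_sm[OF s] dv_bilinear[OF bounded_bilinear_inner b(1) d(1)]
      using nab_metric[of "a p" "b p" "d p"] by (simp add: inner_add_left inner_add_right)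
  qed
next
  fix X Y f assume X: "vector_field A X" and Y: "vector_field A Y" and f: "smooth_fun A UNIV f"
  obtain a where a: "\<And>p. sm p a" "X = (\<lambda>p. tv p (a p))" using vector_fieldD[OF X] by blast
  obtain b where b: "\<And>p. sm p b" "Y = (\<lambda>p. tv p (b p))" using vector_fieldD[OF Y] by blast
  have f: "sm p f" for p using f smooth_fun_UNIV by blast
  show "LC X (\<lambda>p. lincomb (f p) (Y p) 0 (Y p)) = (\<lambda>p. lincomb (X p f) (Y p) (f p) (LC X Y p))"
    unfolding a(2) b(2) LC_def tv_lincomb co_tv tv_sm[OF f] scaleR_zero_left add_0_right dv_bilinear[OF bounded_bilinear_scaleR f b(1)]
    by (simp add: bilinear_rmul[OF bilinear_nab] algebra_simps)
next
  fix X Y Z f h assume X: "vector_field A X" and Y: "vector_field A Y" and Z: "vector_field A Z"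
  obtain a where a: "\<And>p. sm p a" "X = (\<lambda>p. tv p (a p))" using vector_fieldD[OF X] by blast
  obtain b where b: "\<And>p. sm p b" "Y = (\<lambda>p. tv p (b p))" using vector_fieldD[OF Y] by blast
  obtain d where d: "\<And>p. sm p d" "Z = (\<lambda>p. tv p (d p))" using vector_fieldD[OF Z] by blast
  show "LC (\<lambda>p. lincomb (f p) (X p) (h p) (Y p)) Z = (\<lambda>p. lincomb (f p) (LC X Z p) (h p) (LC Y Z p))"
    unfolding a(2) b(2) d(2) LC_def tv_lincomb co_tv linear_add[OF dv_linear[OF d(1)]] linear_scale[OF dv_linear[OF d(1)]]
    by (simp add: bilinear_ladd[OF bilinear_nab] bilinear_lmul[OF bilinear_nab] algebra_simps)
qed

lemma is_levi_civitaD: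
  assumes "is_levi_civita A g D" "vector_field A X" "vector_field A Y"
  shows "lincomb 1 (D X Y p) (-1) (D Y X p) = bracket A X Y p"
    and "vector_field A Z \<Longrightarrow> X p (\<lambda>q. g q (Y q) (Z q)) = g p (D X Y p) (Z p) + g p (Y p) (D X Z p)"
proof -
  have "(\<lambda>p. lincomb 1 (D X Y p) (-1) (D Y X p)) = bracket A X Y"
    using assms unfolding is_levi_civita_def by simp
  from fun_cong[OF this, of p] show "lincomb 1 (D X Y p) (-1) (D Y X p) = bracket A X Y p" .
  assume "vector_field A Z"
  with assms show "X p (\<lambda>q. g q (Y q) (Z q)) = g p (D X Y p) (Z p) + g p (Y p) (D X Z p)"
    unfolding is_levi_civita_def by simp
qed

text \<open>\<open>levi_civita\<close> is a choice, and it is determined on vector fields only. The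
  difference s of two candidates is symmetric in X and Y by torsion-freeness and skew in Y and Z by
  metricity, hence zero.\<close>

lemma levi_civita_unique:
  assumes D: "is_levi_civita A g D" "is_levi_civita A g D'" and X: "vector_field A X" and Y: "vector_field A Y"
  shows "D X Y = D' X Y"
proof -
  define s where "s = (\<lambda>X Y p. co (D X Y) p - co (D' X Y) p)"
  have vfD: "vector_field A (D X Y)" "vector_field A (D' X Y)" if "vector_field A X" "vector_field A Y" for X Y
    using D that by (simp_all add: is_levi_civita_def)
  have cD: "D X Y p = tv p (co (D X Y) p)" "D' X Y p = tv p (co (D' X Y) p)" if "vector_field A X" "vector_field A Y" for X Y p
    using vf_co[OF vfD(1)[OF that]] vf_co[OF vfD(2)[OF that]] by metis+
  have cX: "X p = tv p (co X p)" if "vector_field A X" for X p using vf_co[OF that] by metis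
  have sym: "s X Y p = s Y X p" if "vector_field A X" "vector_field A Y" for X Y p
  proof -
    have "lincomb 1 (D X Y p) (-1) (D Y X p) = lincomb 1 (D' X Y p) (-1) (D' Y X p)"
      unfolding is_levi_civitaD(1)[OF D(1) that] is_levi_civitaD(1)[OF D(2) that] ..
    then have "lincomb 1 (tv p (co (D X Y) p)) (-1) (tv p (co (D Y X) p)) = lincomb 1 (tv p (co (D' X Y) p)) (-1) (tv p (co (D' Y X) p))"
      unfolding cD[OF that, symmetric] cD[OF that(2,1), symmetric] .
    then show ?thesis unfolding tv_lincomb tv_inj s_def by (simp add: algebra_simps)
  qed
  have skew: "s X Y p \<bullet> co Z p = - (s X Z p \<bullet> co Y p)" if v: "vector_field A X" "vector_field A Y" "vector_field A Z" for X Y Z p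
  proof -
    have "g p (D X Y p) (Z p) + g p (Y p) (D X Z p) = g p (D' X Y p) (Z p) + g p (Y p) (D' X Z p)"
      unfolding is_levi_civitaD(2)[OF D(1) v, symmetric] is_levi_civitaD(2)[OF D(2) v, symmetric] ..
    then have "g p (tv p (co (D X Y) p)) (tv p (co Z p)) + g p (tv p (co Y p)) (tv p (co (D X Z) p))
      = g p (tv p (co (D' X Y) p)) (tv p (co Z p)) + g p (tv p (co Y p)) (tv p (co (D' X Z) p))"
      unfolding cD[OF v(1,2), symmetric] cD[OF v(1,3), symmetric] cX[OF v(2), symmetric] cX[OF v(3), symmetric] .
    then show ?thesis unfolding g_tv s_def
      by (simp add: inner_diff_left inner_commute[of "co Y p"])
  qed
  have "s X Y p = 0" for p
  proof (rule vector_eq_rdot[THEN iffD1], rule allI)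
    fix z
    define Z where "Z = (\<lambda>q. tv q z)"
    have Z: "vector_field A Z" unfolding Z_def by (rule vector_fieldI) simp
    have "s X Y p \<bullet> co Z p = - (s X Y p \<bullet> co Z p)"
      using skew[OF X Y Z, of p, unfolded sym[OF X Z, of p]] skew[OF Z X Y, of p, unfolded sym[OF Z Y, of p]]
        skew[OF Y Z X, of p, unfolded sym[OF Y X, of p]]
      by linarith
    then show "s X Y p \<bullet> z = 0 \<bullet> z" by (simp add: Z_def)
  qed
  then have "co (D X Y) p = co (D' X Y) p" for p by (simp add: s_def)
  then show ?thesis using trans[OF cD(1)[OF X Y] trans[OF arg_cong[of _ _ "tv _"] cD(2)[OF X Y, symmetric]]] by (intro ext) auto
qed

definition R0 :: "real ^ 'n \<Rightarrow> real ^ 'n \<Rightarrow> real ^ 'n \<Rightarrow> real ^ 'n" where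
  "R0 u v w = nab u (nab v w) - nab v (nab u w) - nab (br u v) w"

text \<open>The second derivatives of the coefficients combine by \<open>dv_commutator\<close> with
  the derivative along the bracket, and the first-order terms cancel in pairs. What remains is the
  curvature of the left-invariant fields with the same values at p.\<close>

lemma curvature_tv:
  assumes a: "\<And>p. sm p a" and b: "\<And>p. sm p b" and d: "\<And>p. sm p d"
  shows "curvature A g (\<lambda>p. tv p (a p)) (\<lambda>p. tv p (b p)) (\<lambda>p. tv p (d p)) p = tv p (R0 (a p) (b p) (d p))"
proof -
  have lc: "is_levi_civita A g (levi_civita A g)"
    unfolding levi_civita_def by (rule someI[of "is_levi_civita A g", OF is_levi_civita_LC])
  note u = levi_civita_unique[OF lc is_levi_civita_LC]
  note vf = vector_fieldI[OF a] vector_fieldI[OF b] vector_fieldI[OF d]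
  define w where "w = (\<lambda>p. dv p (a p) b - dv p (b p) a + br (a p) (b p))"
  have br: "bracket A (\<lambda>p. tv p (a p)) (\<lambda>p. tv p (b p)) = (\<lambda>p. tv p (w p))"
    unfolding w_def by (rule bracket_tv[OF a b])
  have "sm p w" for p
  proof -
    have "w = (\<lambda>p. (dv p (a p) b + nab (a p) (b p)) + (-1) *\<^sub>R (dv p (b p) a + nab (b p) (a p)))"
      unfolding w_def nab_torsion[symmetric] by (rule ext) simp
    then show ?thesis
      using smooth_near_add[OF sm_LC[OF a b] smooth_near_scaleR[OF smooth_near_const sm_LC[OF b a]], of p "-1"] by simp
  qed
  note vfw = vector_fieldI[OF this]
  have second: "dv p x (\<lambda>q. dv q (y q) d + nab (y q) (d q)) + nab x (dv p (y p) d + nab (y p) (d p))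
     = dv p (dv p x y) d + dv p x (\<lambda>q. dv q (y p) d) + nab (dv p x y) (d p) + nab (y p) (dv p x d) + nab x (dv p (y p) d) + nab x (nab (y p) (d p))"
    if y: "\<And>p. sm p y" for x y
  proof -
    have bb: "bounded_bilinear nab" using bilinear_nab bilinear_conv_bounded_bilinear by blast
    have "dv p x (\<lambda>q. dv q (y q) d + nab (y q) (d q)) = dv p x (\<lambda>q. dv q (y q) d) + dv p x (\<lambda>q. nab (y q) (d q))"
      by (rule dv_add[OF sm_dv_var[OF d y] smooth_near_bilinear[OF bilinear_nab y d]])
    then show ?thesis
      unfolding dv_bilinear[OF bb y d] dv_dv_var[OF d y] bilinear_radd[OF bilinear_nab] by (simp add: algebra_simps)
  qed
  have "curvature A g (\<lambda>p. tv p (a p)) (\<lambda>p. tv p (b p)) (\<lambda>p. tv p (d p)) p =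
    (\<lambda>f. LC (\<lambda>p. tv p (a p)) (LC (\<lambda>p. tv p (b p)) (\<lambda>p. tv p (d p))) p f - LC (\<lambda>p. tv p (b p)) (LC (\<lambda>p. tv p (a p)) (\<lambda>p. tv p (d p))) p f
      - LC (\<lambda>p. tv p (w p)) (\<lambda>p. tv p (d p)) p f)"
    unfolding curvature_def Let_def br u[OF vf(2,3)] u[OF vf(1,3)] u[OF vfw vf(3)]
      u[OF vf(1) vector_field_LC[OF vf(2,3)]] u[OF vf(2) vector_field_LC[OF vf(1,3)]] ..
  also have "\<dots> = tv p (R0 (a p) (b p) (d p))"
    unfolding LC_def co_tv linear_diff[OF tv_linear, symmetric] second[OF a] second[OF b]
  proof (rule ext, rule arg_cong[of _ _ "\<lambda>z. tv p z _"])
    note lin = linear_add[OF dv_linear[OF d]] linear_diff[OF dv_linear[OF d]]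
      bilinear_ladd[OF bilinear_nab] bilinear_lsub[OF bilinear_nab]
    show "dv p (dv p (a p) b) d + dv p (a p) (\<lambda>q. dv q (b p) d) + nab (dv p (a p) b) (d p) +
       nab (b p) (dv p (a p) d) + nab (a p) (dv p (b p) d) + nab (a p) (nab (b p) (d p)) -
       (dv p (dv p (b p) a) d + dv p (b p) (\<lambda>q. dv q (a p) d) + nab (dv p (b p) a) (d p) +
        nab (a p) (dv p (b p) d) + nab (b p) (dv p (a p) d) + nab (b p) (nab (a p) (d p))) -
       (dv p (w p) d + nab (w p) (d p)) = R0 (a p) (b p) (d p)"
      unfolding w_def lin R0_def dv_commutator[OF d, symmetric] by (simp add: algebra_simps)
  qed
  finally show ?thesis .
qed

lemma flat_iff: "flat A g \<longleftrightarrow> (\<forall>u v w. R0 u v w = 0)"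
proof
  assume f: "flat A g"
  show "\<forall>u v w. R0 u v w = 0"
  proof (intro allI)
    fix u v w
    have "curvature A g (\<lambda>p. tv p u) (\<lambda>p. tv p v) (\<lambda>p. tv p w) \<one> = (\<lambda>f. 0)"
      using f vector_fieldI[of "\<lambda>_. u"] vector_fieldI[of "\<lambda>_. v"] vector_fieldI[of "\<lambda>_. w"] by (simp add: flat_def)
    then have "tv \<one> (R0 u v w) = (\<lambda>f. 0)" using curvature_tv[of "\<lambda>_. u" "\<lambda>_. v" "\<lambda>_. w" \<one>] by simp
    also have "\<dots> = tv \<one> 0" using linear_0[OF tv_linear] by (simp add: fun_eq_iff)
    finally show "R0 u v w = 0" by (simp add: tv_inj)
  qed
next
  assume R: "\<forall>u v w. R0 u v w = 0"
  show "flat A g" unfolding flat_def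
  proof (intro allI impI; elim conjE)
    fix X Y Z p assume X: "vector_field A X" and Y: "vector_field A Y" and Z: "vector_field A Z"
    obtain a where a: "\<And>p. sm p a" "X = (\<lambda>p. tv p (a p))" using vector_fieldD[OF X] by blast
    obtain b where b: "\<And>p. sm p b" "Y = (\<lambda>p. tv p (b p))" using vector_fieldD[OF Y] by blast
    obtain d where d: "\<And>p. sm p d" "Z = (\<lambda>p. tv p (d p))" using vector_fieldD[OF Z] by blast
    show "curvature A g X Y Z p = (\<lambda>f. 0)"
      unfolding a(2) b(2) d(2) curvature_tv[OF a(1) b(1) d(1)] using R linear_0[OF tv_linear] by (simp add: fun_eq_iff)
  qed
qed

lemma some_frame_tv:
  "\<exists>F. (\<forall>i. some_frame A g p i = tv p (F i)) \<and> (\<forall>i j. F i \<bullet> F j = (if i = j then 1 else 0))"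
proof -
  have "orthonormal_frame A g p (\<lambda>i. tv p (axis i 1))"
    by (simp add: orthonormal_frame_def tangent_space_eq g_tv inner_axis_axis)
  then have o: "orthonormal_frame A g p (some_frame A g p)"
    unfolding some_frame_def by (rule someI[of "orthonormal_frame A g p"])
  then have "\<forall>i. \<exists>u. some_frame A g p i = tv p u" by (auto simp: orthonormal_frame_def tangent_space_eq)
  then obtain F where F: "\<And>i. some_frame A g p i = tv p (F i)" by metis
  moreover have "F i \<bullet> F j = (if i = j then 1 else 0)" for i j
    using o g_tv[of p "F i" "F j"] by (simp add: orthonormal_frame_def F)
  ultimately show ?thesis by (intro exI[of _ F]) auto
qed

text \<open>The chosen frame is orthonormal but otherwise unknown; the double trace is moved to the
  standard basis one index at a time.\<close>

lemma scalar_curvature_eq: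
  "scalar_curvature A g p = (\<Sum>i\<in>UNIV. \<Sum>j\<in>UNIV. R0 (axis i 1) (axis j 1) (axis j 1) \<bullet> axis i 1)"
proof -
  obtain F where F: "\<And>i. some_frame A g p i = tv p (F i)" "\<And>i j. F i \<bullet> F j = (if i = j then 1 else 0)"
    using some_frame_tv by blast
  have "g p (curvature A g (extend A p (tv p (F i))) (extend A p (tv p (F j))) (extend A p (tv p (F j))) p) (extend A p (tv p (F i)) p)
    = R0 (F i) (F j) (F j) \<bullet> F i" for i j
  proof -
    obtain a where a: "\<And>q. sm q a" "extend A p (tv p (F i)) = (\<lambda>q. tv q (a q))" "a p = F i" using extend[of p "F i"] by blast
    obtain b where b: "\<And>q. sm q b" "extend A p (tv p (F j)) = (\<lambda>q. tv q (b q))" "b p = F j" using extend[of p "F j"] by blast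
    show ?thesis unfolding a(2) b(2) curvature_tv[OF a(1) b(1) b(1)] by (simp add: g_tv a(3) b(3))
  qed
  then have "scalar_curvature A g p = (\<Sum>i\<in>UNIV. \<Sum>j\<in>UNIV. R0 (F i) (F j) (F j) \<bullet> F i)"
    by (simp add: scalar_curvature_def Let_def F(1))
  also have "\<dots> = (\<Sum>i\<in>UNIV. \<Sum>j\<in>UNIV. R0 (F i) (axis j 1) (axis j 1) \<bullet> F i)"
  proof (rule sum.cong[OF refl])
    fix i
    show "(\<Sum>j\<in>UNIV. R0 (F i) (F j) (F j) \<bullet> F i) = (\<Sum>j\<in>UNIV. R0 (F i) (axis j 1) (axis j 1) \<bullet> F i)"
    proof (rule frame_trace[OF _ F(2), of "\<lambda>v w. R0 (F i) v w \<bullet> F i"])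
      show "bilinear (\<lambda>v w. R0 (F i) v w \<bullet> F i)"
        using bilinear_nab bilinear_br unfolding bilinear_def linear_iff R0_def by (simp add: algebra_simps)
    qed
  qed
  also have "\<dots> = (\<Sum>j\<in>UNIV. \<Sum>i\<in>UNIV. R0 (F i) (axis j 1) (axis j 1) \<bullet> F i)" by (rule sum.swap)
  also have "\<dots> = (\<Sum>j\<in>UNIV. \<Sum>i\<in>UNIV. R0 (axis i 1) (axis j 1) (axis j 1) \<bullet> axis i 1)"
  proof (rule sum.cong[OF refl])
    fix j
    show "(\<Sum>i\<in>UNIV. R0 (F i) (axis j 1) (axis j 1) \<bullet> F i) = (\<Sum>i\<in>UNIV. R0 (axis i 1) (axis j 1) (axis j 1) \<bullet> axis i 1)"
    proof (rule frame_trace[OF _ F(2), of "\<lambda>v w. R0 v (axis j 1) (axis j 1) \<bullet> w"])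
      show "bilinear (\<lambda>v w. R0 v (axis j 1) (axis j 1) \<bullet> w)"
        using bilinear_nab bilinear_br unfolding bilinear_def linear_iff R0_def by (simp add: algebra_simps)
    qed
  qed
  also have "\<dots> = (\<Sum>i\<in>UNIV. \<Sum>j\<in>UNIV. R0 (axis i 1) (axis j 1) (axis j 1) \<bullet> axis i 1)" by (rule sum.swap)
  finally show ?thesis .
qed

end

section \<open>Unimodularity and solvability\<close>

text \<open>The Leibniz expansion is differentiated factor by factor at the identity matrix. A
  permutation other than \<open>id\<close> moves at least two points, so a zero factor survives in
  each of its products.\<close>

lemma has_derivative_det:
  fixes M :: "'a::real_normed_vector \<Rightarrow> real ^ 'n ^ 'n"
  assumes d: "\<And>i j. ((\<lambda>x. M x $ i $ j) has_derivative D i j) (at x)" and M: "M x = mat 1"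
  shows "((\<lambda>x. det (M x)) has_derivative (\<lambda>v. \<Sum>i\<in>UNIV. D i i v)) (at x)"
proof -
  have "((\<lambda>x. det (M x)) has_derivative (\<lambda>v. \<Sum>p | p permutes UNIV. of_int (sign p) *
      (\<Sum>i\<in>UNIV. D i (p i) v * (\<Prod>j\<in>UNIV - {i}. M x $ j $ p j)))) (at x)"
    unfolding det_def by (intro has_derivative_sum has_derivative_mult_right has_derivative_prod d)
  moreover have "(\<Sum>p | p permutes UNIV. of_int (sign p) * (\<Sum>i\<in>UNIV. D i (p i) v * (\<Prod>j\<in>UNIV - {i}. M x $ j $ p j)))
    = (\<Sum>i\<in>UNIV. D i i v)" for v
  proof -
    have z: "(\<Prod>j\<in>UNIV - {i}. M x $ j $ p j) = 0" if p: "p permutes (UNIV::'n set)" "p \<noteq> id" for p i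
    proof -
      have "\<exists>j. j \<noteq> i \<and> p j \<noteq> j"
      proof (rule ccontr)
        assume "\<nexists>j. j \<noteq> i \<and> p j \<noteq> j"
        then have fx: "\<And>j. j \<noteq> i \<Longrightarrow> p j = j" by blast
        have "p i = i" using fx[of "p i"] permutes_inj[OF p(1)] by (metis injD)
        with fx have "p = id" by (metis eq_id_iff)
        with p show False by simp
      qed
      then obtain j where "j \<noteq> i" "p j \<noteq> j" by blast
      then show ?thesis by (intro prod_zero bexI[of _ j]) (auto simp: M mat_def)
    qed
    have o: "(\<Prod>j\<in>UNIV - {i}. M x $ j $ id j) = 1" for i by (simp add: M mat_def)
    have "(\<Sum>p | p permutes UNIV. of_int (sign p) * (\<Sum>i\<in>UNIV. D i (p i) v * (\<Prod>j\<in>UNIV - {i}. M x $ j $ p j)))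
      = (\<Sum>p\<in>{id}. of_int (sign p) * (\<Sum>i\<in>UNIV. D i (p i) v * (\<Prod>j\<in>UNIV - {i}. M x $ j $ p j)))"
      by (rule sum.mono_neutral_right) (auto simp: z permutes_id finite_permutations)
    also have "\<dots> = (\<Sum>i\<in>UNIV. D i i v)" using o by simp
    finally show ?thesis .
  qed
  ultimately show ?thesis by simp
qed

lemma fd_slice_left:
  fixes g :: "'a::euclidean_space \<times> 'b::euclidean_space \<Rightarrow> 'c::real_normed_vector"
  assumes "g differentiable (at (x, y))" shows "fd (\<lambda>w. g (w, y)) x u = fd g (x, y) (u, 0)"
proof -
  have "((\<lambda>w. (w, y)) has_derivative (\<lambda>u. (u, 0))) (at x)" by (auto intro!: derivative_eq_intros)
  from fd_eqI[OF has_derivative_compose[OF this differentiable_fd[OF assms]]] show ?thesis .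
qed

context lie_param
begin

definition AdM :: "'g \<Rightarrow> real ^ 'n \<Rightarrow> real ^ 'n" where
  "AdM x u = fd (\<lambda>z. C (x \<otimes> K z \<otimes> inv x)) 0 u"

lemma smG_conj: "smG (\<lambda>z. x \<otimes> K z \<otimes> inv x) 0"
  by (intro smG_mult smG_const smG_K N0)

lemma smooth_conj: "smooth_near (\<lambda>z. C (x \<otimes> K z \<otimes> inv x)) 0"
  by (rule smooth_C[OF smG_conj]) (simp add: chart1)

lemma Ad_tv: "Ad G x (tv \<one> u) = tv \<one> (AdM x u)"
proof (rule ext)
  fix f
  have imp: "sm \<one> (\<lambda>q. f (y \<otimes> q \<otimes> inv y))" if "sm \<one> f" for f :: "'g \<Rightarrow> real" and y
    using sm_smG[OF that smG_conj[of y]] by simp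
  show "Ad G x (tv \<one> u) f = tv \<one> (AdM x u) f"
  proof (cases "sm \<one> f")
    case True
    have "dv \<one> u (\<lambda>q. f (x \<otimes> q \<otimes> inv x)) = dv \<one> (AdM x u) f"
      using fd_smG[OF True smG_conj[of x], of u] by (simp add: AdM_def carr)
    then show ?thesis using imp[OF True, of x] True by (simp add: Ad_def push_def tv_def comp_def)
  next
    case False
    have "\<not> sm \<one> (\<lambda>q. f (x \<otimes> q \<otimes> inv x))"
    proof
      assume "sm \<one> (\<lambda>q. f (x \<otimes> q \<otimes> inv x))"
      from imp[OF this, of "inv x"] have "sm \<one> f" by (simp add: assoc carr)
      with False show False ..
    qed
    then show ?thesis using False by (simp add: Ad_def push_def tv_def comp_def)
  qed
qed

lemma fd_m0: "fd m (0, 0) (p, q) = p + q"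
proof -
  have d: "m differentiable (at (0, 0))" by (rule smooth_near_differentiable[OF smooth_m0[OF N0]])
  have e: "\<forall>\<^sub>F w in nhds 0. m (w, 0) = w" "\<forall>\<^sub>F w in nhds 0. m (0, w) = w"
    using eventually_nhds_in_open[OF openN N0] by (eventually_elim; simp add: m_left0 m_right0)+
  have i: "fd (\<lambda>w. w) 0 u = u" for u :: "real ^ 'n" by (rule fd_eqI) auto
  have "fd m (0, 0) (p, 0) = p" "fd m (0, 0) (0, q) = q"
    using fd_slice_left[OF d, of p] fd_slice[OF d, of q] fd_cong[OF e(1)] fd_cong[OF e(2)] i by simp_all
  moreover have "(p, q) = (p, 0) + (0, q)" by simp
  ultimately show ?thesis using linear_add[OF fd_linear[OF d], of "(p, 0)" "(0, q)"] by simp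
qed

lemma conj_smooth:
  "smooth_near (\<lambda>yz. C (K (fst yz) \<otimes> K (snd yz) \<otimes> inv (K (fst yz)))) (0, 0)"
proof (rule smooth_C)
  have 1: "smG (\<lambda>yz. K (fst yz)) (0, 0 :: real ^ 'n)" "smG (\<lambda>yz. K (snd yz)) (0 :: real ^ 'n, 0)"
    by (rule smG_comp[OF smG_K], use N0 in simp, intro smooth_near_linear[OF bounded_linear_fst] smooth_near_id)
       (rule smG_comp[OF smG_K], use N0 in simp, intro smooth_near_linear[OF bounded_linear_snd] smooth_near_id)
  show "smG (\<lambda>yz. K (fst yz) \<otimes> K (snd yz) \<otimes> inv (K (fst yz))) (0, 0)"
    by (intro smG_mult smG_inv 1)
qed (simp add: chart1 carr)

lemma AdM_K:
  "\<forall>\<^sub>F y in nhds 0. \<forall>u. AdM (K y) u = fd (\<lambda>yz. C (K (fst yz) \<otimes> K (snd yz) \<otimes> inv (K (fst yz)))) (y, 0) (0, u)"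
  using eventually_Pair0[OF smooth_near_eventually[OF conj_smooth]]
  by eventually_elim (use fd_slice[OF smooth_near_differentiable] in \<open>fastforce simp: AdM_def\<close>)

lemma smooth_AdM: "smooth_near (\<lambda>y. AdM (K y) u) 0"
proof (rule smooth_near_cong)
  show "smooth_near (\<lambda>y. fd (\<lambda>yz. C (K (fst yz) \<otimes> K (snd yz) \<otimes> inv (K (fst yz)))) (y, 0) (0, u)) 0"
    by (intro smooth_near_fd_var conj_smooth smooth_near_Pair smooth_near_const smooth_near_id)
qed (use AdM_K in \<open>eventually_elim; simp\<close>)

lemma AdM_one: "AdM \<one> u = u"
proof -
  have "\<forall>\<^sub>F z in nhds 0. C (\<one> \<otimes> K z \<otimes> inv \<one>) = z"
    using eventually_nhds_in_open[OF openN N0] by eventually_elim (simp add: CK carr)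
  from fd_cong[OF this] have "AdM \<one> u = fd (\<lambda>z. z) 0 u" by (simp add: AdM_def)
  also have "\<dots> = u" by (rule fd_eqI) auto
  finally show ?thesis .
qed

text \<open>The relation \<open>(y z y\<^sup>-\<^sup>1) y = y z\<close> is differentiated, first in \<open>z\<close> and then in \<open>y\<close>.\<close>

lemma fd_AdM: "fd (\<lambda>y. AdM (K y) u) 0 v = br v u"
proof -
  have m0: "smooth_near m (0, 0)" by (rule smooth_m0[OF N0])
  define w where "w = (\<lambda>yz :: (real ^ 'n) \<times> (real ^ 'n). (AdM (K (snd yz)) u, 0 :: real ^ 'n))"
  have w: "smooth_near w (0, 0)" unfolding w_def
    by (rule smooth_near_Pair[OF smooth_near_comp[of snd _ "\<lambda>y. AdM (K y) u"] smooth_near_const])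
      (use smooth_AdM[of u] in \<open>auto intro: smooth_near_linear[OF bounded_linear_snd] smooth_near_id\<close>)
  have ev: "\<forall>\<^sub>F y in nhds 0. fd m (0, y) (AdM (K y) u, 0) = PP y u"
    using eventually_nhds_in_open[OF openN N0] eventually_Pair0[OF smooth_near_eventually[OF m0]]
  proof eventually_elim
    case (elim y)
    have sy: "smooth_near m (0, y)" by (rule smooth_m) (use elim N0 KU in auto)
    have s1: "smooth_near (\<lambda>z. C (K y \<otimes> K z \<otimes> inv (K y))) 0" by (rule smooth_conj)
    have "\<forall>\<^sub>F z in nhds 0. K y \<otimes> K z \<otimes> inv (K y) \<in> U"
      by (rule isCont_eventually[OF smG_isCont[OF smG_conj] openU]) (simp add: chart1 carr)
    then have e: "\<forall>\<^sub>F z in nhds 0. m (C (K y \<otimes> K z \<otimes> inv (K y)), y) = m (y, z)"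
      by eventually_elim (simp add: m_def KC assoc carr)
    have "((\<lambda>z. (C (K y \<otimes> K z \<otimes> inv (K y)), y)) has_derivative (\<lambda>u. (AdM (K y) u, 0))) (at 0)"
      unfolding AdM_def by (intro has_derivative_Pair has_derivative_const differentiable_fd smooth_near_differentiable s1)
    from has_derivative_compose[OF this, of m "fd m (0, y)"]
    have "fd (\<lambda>z. m (C (K y \<otimes> K z \<otimes> inv (K y)), y)) 0 u = fd m (0, y) (AdM (K y) u, 0)"
      using differentiable_fd[OF smooth_near_differentiable[OF sy]] by (intro fd_eqI) (simp add: carr)
    moreover have "fd (\<lambda>z. m (y, z)) 0 u = PP y u"
      using elim smooth_m0 unfolding PP_def by (intro fd_slice smooth_near_differentiable) auto
    ultimately show ?case using fd_cong[OF e] by simp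
  qed
  have F: "(\<lambda>z. fd m z (w z)) differentiable (at (0, 0))" "(\<lambda>z. fd m z (w (0, 0))) differentiable (at (0, 0))" "w differentiable (at (0, 0))"
    by (intro smooth_near_differentiable[OF smooth_near_fd_var[of m "\<lambda>z. z"]] m0 smooth_near_id w)
       (intro smooth_near_differentiable smooth_near_fd m0 w)+
  have "\<beta> v u = fd (\<lambda>y. fd m (0, y) (AdM (K y) u, 0)) 0 v"
    using fd_cong[OF ev] by (simp add: \<beta>_def)
  also have "\<dots> = fd (\<lambda>z. fd m z (w z)) (0, 0) (0, v)"
    using fd_slice[OF F(1), of v] by (simp add: w_def)
  also have "\<dots> = fd m (0, 0) (fd w (0, 0) (0, v)) + fd (\<lambda>z. fd m z (w (0, 0))) (0, 0) (0, v)"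
    by (rule fd_fd_var[OF m0 w])
  also have "fd w (0, 0) (0, v) = (fd (\<lambda>y. AdM (K y) u) 0 v, 0)"
  proof -
    have "fd w (0, 0) (0, v) = fd (\<lambda>y. w (0, y)) 0 v" by (rule fd_slice[OF F(3), symmetric])
    also have "\<dots> = (fd (\<lambda>y. AdM (K y) u) 0 v, 0)" unfolding w_def
      by (rule fd_eqI) (auto intro!: has_derivative_Pair differentiable_fd[OF smooth_near_differentiable[OF smooth_AdM]])
    finally show ?thesis .
  qed
  also have "w (0, 0) = (u, 0)" by (simp add: w_def AdM_one)
  also have "fd (\<lambda>z. fd m z (u, 0)) (0, 0) (0, v) = fd (\<lambda>z. fd m z (0, v)) (0, 0) (u, 0)"
    by (rule Schwarz[OF m0])
  also have "\<dots> = \<beta> u v"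
    unfolding \<beta>_def PP_def by (rule fd_slice_left[symmetric]) (rule smooth_near_differentiable[OF smooth_near_fd[OF m0]])
  finally show ?thesis by (simp add: fd_m0 br_def)
qed

text \<open>The determinant of Ad is continuous, equals 1 at the identity and has absolute value 1,
  so it is locally constant. By \<open>has_derivative_det\<close> and \<open>fd_AdM\<close> its
  derivative along v is the trace of ad v.\<close>

lemma unimodular_trace:
  assumes "unimodular_group G A"
  shows "(\<Sum>i\<in>UNIV. br v (axis i 1) $ i) = 0"
proof -
  define M where "M = (\<lambda>y. matrix (AdM (K y)))"
  have b: "tangent_basis A \<one> (\<lambda>i. tv \<one> (axis i 1))"
  proof -
    have "(\<lambda>x :: real ^ 'n. (\<lambda>f. \<Sum>i\<in>UNIV. x $ i * tv \<one> (axis i 1) f)) = tv \<one>"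
      by (intro ext linear_axis_sum[OF tv_linear, symmetric])
    then show ?thesis unfolding tangent_basis_def tangent_space_eq by (simp add: bij_betw_def inj_on_def tv_inj)
  qed
  have "\<bar>det (matrix (AdM x))\<bar> = 1" for x
  proof -
    have "Ad G x (tv \<one> (axis j 1)) = (\<lambda>f. \<Sum>i\<in>UNIV. matrix (AdM x) $ i $ j * tv \<one> (axis i 1) f)" for j
      unfolding Ad_tv by (rule ext) (simp add: matrix_def, rule linear_axis_sum[OF tv_linear])
    then show ?thesis using assms b unfolding unimodular_group_def by blast
  qed
  then have abs: "\<bar>det (M y)\<bar> = 1" for y by (simp add: M_def)
  have d: "((\<lambda>y. M y $ i $ j) has_derivative (\<lambda>v. br v (axis j 1) $ i)) (at 0)" for i j
  proof -
    have "((\<lambda>y. AdM (K y) (axis j 1)) has_derivative (\<lambda>v. br v (axis j 1))) (at 0)"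
      using differentiable_fd[OF smooth_near_differentiable[OF smooth_AdM, of "axis j 1"]] by (simp add: fd_AdM[abs_def])
    from bounded_linear.has_derivative[OF bounded_linear_vec_nth this] show ?thesis
      by (simp add: M_def matrix_def)
  qed
  have M0: "M 0 = mat 1" by (simp add: M_def matrix_def mat_def AdM_one axis_def vec_eq_iff)
  note D = has_derivative_det[OF d M0]
  have "isCont (\<lambda>y. det (M y)) 0" using has_derivative_continuous[OF D] .
  from isCont_eventually[OF this, of "{0<..}"] have "\<forall>\<^sub>F y in nhds 0. 0 < det (M y)" by (simp add: M0)
  then have "\<forall>\<^sub>F y in nhds 0. det (M y) = 1" by eventually_elim (use abs in \<open>metis abs_of_pos\<close>)
  from fd_cong[OF this] have "fd (\<lambda>y. det (M y)) 0 v = 0" by (simp add: frechet_derivative_const)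
  then show ?thesis using fd_eqI[OF D] by simp
qed

end

section \<open>Commutator curves and tangent cones of the derived series\<close>

lemma eventually_nhds_0_norm:
  fixes P :: "'a::real_normed_vector \<Rightarrow> bool"
  shows "eventually P (nhds 0) \<longleftrightarrow> (\<exists>d>0. \<forall>x. norm x < d \<longrightarrow> P x)"
  by (simp add: eventually_nhds_metric dist_norm)

lemma tendsto_zero_rate:
  fixes w :: "real \<Rightarrow> 'a::real_normed_vector"
  assumes "((\<lambda>s. w s /\<^sub>R s) \<longlongrightarrow> a) (at_right 0)" shows "(w \<longlongrightarrow> 0) (at_right 0)"
proof -
  have "((\<lambda>s :: real. s) \<longlongrightarrow> 0) (at_right 0)" by (rule tendsto_ident_at)
  from tendsto_scaleR[OF this assms] have "((\<lambda>s. s *\<^sub>R (w s /\<^sub>R s)) \<longlongrightarrow> 0) (at_right 0)" by simp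
  moreover have "\<forall>\<^sub>F s in at_right 0. s *\<^sub>R (w s /\<^sub>R s) = w s"
    using eventually_at_right_less[of 0] by eventually_elim simp
  ultimately show ?thesis by (rule Lim_transform_eventually)
qed

lemma second_derivative_expand:
  fixes F :: "(real ^ 'n) \<times> (real ^ 'n) \<Rightarrow> real"
  assumes F: "smooth_near F \<zeta>"
  shows "fd (\<lambda>z. fd F z (x, 0)) \<zeta> (0, y) = (\<Sum>i\<in>UNIV. \<Sum>j\<in>UNIV. x $ i * y $ j * fd (\<lambda>z. fd F z (axis i 1, 0)) \<zeta> (0, axis j 1))"
proof -
  have d: "(\<lambda>z. fd F z w) differentiable (at \<zeta>)" for w by (rule smooth_near_differentiable[OF smooth_near_fd[OF F]])
  have lp: "linear (\<lambda>y :: real ^ 'n. (0 :: real ^ 'n, y))" "linear (\<lambda>x :: real ^ 'n. (x, 0 :: real ^ 'n))"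
    by (auto intro: linearI)
  have "\<forall>\<^sub>F z in nhds \<zeta>. fd F z (x, 0) = (\<Sum>i\<in>UNIV. x $ i * fd F z (axis i 1, 0))"
    using smooth_near_eventually[OF F]
  proof eventually_elim
    case (elim z)
    from linear_axis_sum[OF linear_compose[OF lp(2) fd_linear[OF smooth_near_differentiable[OF elim]]], of x]
    show ?case by (simp add: comp_def)
  qed
  then have "fd (\<lambda>z. fd F z (x, 0)) \<zeta> (0, y) = fd (\<lambda>z. \<Sum>i\<in>UNIV. x $ i * fd F z (axis i 1, 0)) \<zeta> (0, y)"
    by (simp add: fd_cong)
  also have "\<dots> = (\<Sum>i\<in>UNIV. x $ i * fd (\<lambda>z. fd F z (axis i 1, 0)) \<zeta> (0, y))"
    by (intro fd_eqI has_derivative_sum has_derivative_mult_right differentiable_fd d)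
  also have "\<dots> = (\<Sum>i\<in>UNIV. \<Sum>j\<in>UNIV. x $ i * y $ j * fd (\<lambda>z. fd F z (axis i 1, 0)) \<zeta> (0, axis j 1))"
  proof (rule sum.cong[OF refl])
    fix i
    from linear_axis_sum[OF linear_compose[OF lp(1) fd_linear[OF d[of "(axis i 1, 0)"]]], of y]
    show "x $ i * fd (\<lambda>z. fd F z (axis i 1, 0)) \<zeta> (0, y) = (\<Sum>j\<in>UNIV. x $ i * y $ j * fd (\<lambda>z. fd F z (axis i 1, 0)) \<zeta> (0, axis j 1))"
      by (simp add: comp_def sum_distrib_left mult.assoc)
  qed
  finally show ?thesis .
qed

text \<open>Since F vanishes on both axes, two applications of the mean value theorem write F(x, y)
  exactly as a sum of x_i y_j times mixed second derivatives at an intermediate point. After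
  division by s^2 the curves x and y enter only through their first-order behaviour at 0.\<close>

lemma mixed_difference:
  fixes F :: "(real ^ 'n) \<times> (real ^ 'n) \<Rightarrow> real"
  assumes F: "smooth_near F (0, 0)"
    and l: "\<forall>\<^sub>F y in nhds 0. F (0, y) = 0" and r: "\<forall>\<^sub>F x in nhds 0. F (x, 0) = 0"
    and x: "((\<lambda>s. x s /\<^sub>R s) \<longlongrightarrow> u) (at_right 0)" and y: "((\<lambda>s. y s /\<^sub>R s) \<longlongrightarrow> v) (at_right 0)"
  shows "((\<lambda>s. F (x s, y s) / s\<^sup>2) \<longlongrightarrow> fd (\<lambda>z. fd F z (u, 0)) (0, 0) (0, v)) (at_right 0)"
proof -
  obtain d1 where d1: "d1 > 0" "\<And>z. norm z < d1 \<Longrightarrow> smooth_near F z"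
    using smooth_near_eventually[OF F] unfolding zero_prod_def[symmetric] eventually_nhds_0_norm by blast
  obtain d2 where d2: "d2 > 0" "\<And>y. norm y < d2 \<Longrightarrow> F (0, y) = 0" using l unfolding eventually_nhds_0_norm by blast
  obtain d3 where d3: "d3 > 0" "\<And>x. norm x < d3 \<Longrightarrow> F (x, 0) = 0" using r unfolding eventually_nhds_0_norm by blast
  \<comment> \<open>Half of d1, because the norm of a pair is bounded by the sum of the
    norms.\<close>
  define d where "d = min (d1 / 2) (min d2 d3)"
  have d: "d > 0" using d1 d2 d3 by (simp add: d_def)
  have sm: "smooth_near F (x, y)" if "norm x < d" "norm y < d" for x y
    using that norm_Pair_le[of x y] by (intro d1) (auto simp: d_def)
  define Q where "Q = (\<lambda>i j \<zeta>. fd (\<lambda>z. fd F z (axis i 1, 0)) \<zeta> (0, axis j 1))"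
  have key: "\<exists>\<zeta>. norm (fst \<zeta>) \<le> norm x \<and> norm (snd \<zeta>) \<le> norm y \<and> F (x, y) = (\<Sum>i\<in>UNIV. \<Sum>j\<in>UNIV. x $ i * y $ j * Q i j \<zeta>)"
    if xy: "norm x < d" "norm y < d" for x y
  proof -
    have sc: "norm (t *\<^sub>R z) \<le> norm z" if "0 \<le> t" "t \<le> 1" for t and z :: "real ^ 'n"
      using that by (simp add: mult_left_le_one_le)
    have "((\<lambda>s. F ((0, y) + s *\<^sub>R (x, 0))) has_real_derivative fd F ((0, y) + t *\<^sub>R (x, 0)) (x, 0)) (at t)"
      if "0 \<le> t" "t \<le> 1" for t
      using sm[of "t *\<^sub>R x" y] sc[OF that, of x] xy by (intro fd_line smooth_near_differentiable) simp
    from MVT2[OF zero_less_one this] obtain t where t: "0 < t" "t < 1"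
      and e1: "F (x, y) - F (0, y) = fd F (t *\<^sub>R x, y) (x, 0)" by auto
    define f where "f = (\<lambda>z. fd F z (x, 0))"
    have tx: "norm (t *\<^sub>R x) \<le> norm x" using sc t by simp
    have smf: "smooth_near f (t *\<^sub>R x, s *\<^sub>R y)" if "0 \<le> s" "s \<le> 1" for s
      unfolding f_def using sm[of "t *\<^sub>R x" "s *\<^sub>R y"] tx sc[OF that, of y] xy by (intro smooth_near_fd) simp
    have "((\<lambda>s. f ((t *\<^sub>R x, 0) + s *\<^sub>R (0, y))) has_real_derivative fd f ((t *\<^sub>R x, 0) + s *\<^sub>R (0, y)) (0, y)) (at s)"
      if "0 \<le> s" "s \<le> 1" for s
      using smf[OF that] by (intro fd_line smooth_near_differentiable) simp
    from MVT2[OF zero_less_one this] obtain s where s: "0 < s" "s < 1"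
      and e2: "f (t *\<^sub>R x, y) - f (t *\<^sub>R x, 0) = fd f (t *\<^sub>R x, s *\<^sub>R y) (0, y)" by auto
    have "f (t *\<^sub>R x, 0) = 0"
    proof -
      have st: "smooth_near F (t *\<^sub>R x, 0)" by (rule sm) (use tx xy d in auto)
      have "open {w :: real ^ 'n. norm w < d3}" by (intro open_Collect_less continuous_intros)
      then have "\<forall>\<^sub>F w in nhds (t *\<^sub>R x). w \<in> {w. norm w < d3}"
        using tx xy by (intro eventually_nhds_in_open) (auto simp: d_def)
      then have "\<forall>\<^sub>F w in nhds (t *\<^sub>R x). F (w, 0) = 0" by eventually_elim (simp add: d3)
      from fd_cong[OF this] have "fd (\<lambda>w. F (w, 0)) (t *\<^sub>R x) x = 0" by (simp add: frechet_derivative_const)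
      then show ?thesis unfolding f_def fd_slice_left[OF smooth_near_differentiable[OF st], symmetric] .
    qed
    moreover have "F (0, y) = 0" using xy by (intro d2) (simp add: d_def)
    moreover have sz: "norm (s *\<^sub>R y) \<le> norm y" using sc s by simp
    ultimately show ?thesis
      using e1 e2 second_derivative_expand[OF sm[of "t *\<^sub>R x" "s *\<^sub>R y"], of x y] tx xy
      by (intro exI[of _ "(t *\<^sub>R x, s *\<^sub>R y)"]) (simp add: f_def Q_def del: norm_scaleR)
  qed
  note zero = tendsto_zero_rate
  have small: "\<forall>\<^sub>F s in at_right 0. norm (w s) < d" if "(w \<longlongrightarrow> 0) (at_right 0)" for w :: "real \<Rightarrow> real ^ 'n"
    using tendsto_norm_zero[OF that] d by (auto dest: order_tendstoD)
  \<comment> \<open>The intermediate point for the parameter s. Its components are bounded by x and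
    y at s, so it tends to 0 and the second derivatives converge by continuity.\<close>
  define \<zeta> where "\<zeta> = (\<lambda>s. SOME \<zeta>. norm (fst \<zeta>) \<le> norm (x s) \<and> norm (snd \<zeta>) \<le> norm (y s) \<and>
      F (x s, y s) = (\<Sum>i\<in>UNIV. \<Sum>j\<in>UNIV. x s $ i * y s $ j * Q i j \<zeta>))"
  have \<zeta>: "\<forall>\<^sub>F s in at_right 0. norm (fst (\<zeta> s)) \<le> norm (x s) \<and> norm (snd (\<zeta> s)) \<le> norm (y s) \<and>
      F (x s, y s) = (\<Sum>i\<in>UNIV. \<Sum>j\<in>UNIV. x s $ i * y s $ j * Q i j (\<zeta> s))"
    using small[OF zero[OF x]] small[OF zero[OF y]]
    by eventually_elim (unfold \<zeta>_def, rule someI_ex, rule key)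
  have "((\<lambda>s. fst (\<zeta> s)) \<longlongrightarrow> 0) (at_right 0)"
    by (rule Lim_null_comparison[OF _ tendsto_norm_zero[OF zero[OF x]]]) (use \<zeta> in \<open>eventually_elim; simp\<close>)
  moreover have "((\<lambda>s. snd (\<zeta> s)) \<longlongrightarrow> 0) (at_right 0)"
    by (rule Lim_null_comparison[OF _ tendsto_norm_zero[OF zero[OF y]]]) (use \<zeta> in \<open>eventually_elim; simp\<close>)
  ultimately have lim: "(\<zeta> \<longlongrightarrow> (0, 0)) (at_right 0)"
    using tendsto_Pair[of "\<lambda>s. fst (\<zeta> s)" 0 "at_right 0" "\<lambda>s. snd (\<zeta> s)" 0] by simp
  have Q: "((\<lambda>s. Q i j (\<zeta> s)) \<longlongrightarrow> Q i j (0, 0)) (at_right 0)" for i j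
    unfolding Q_def by (rule isCont_tendsto_compose[OF smooth_near_continuous[OF smooth_near_fd[OF smooth_near_fd[OF F]]] lim])
  have nth: "((\<lambda>s. w s $ i / s) \<longlongrightarrow> a $ i) (at_right 0)" if "((\<lambda>s. w s /\<^sub>R s) \<longlongrightarrow> a) (at_right 0)" for w and a :: "real ^ 'n" and i
    using tendsto_vec_nth[OF that, of i] by (simp add: divide_inverse mult.commute)
  have lim2: "((\<lambda>s. \<Sum>i\<in>UNIV. \<Sum>j\<in>UNIV. (x s $ i / s) * (y s $ j / s) * Q i j (\<zeta> s)) \<longlongrightarrow> (\<Sum>i\<in>UNIV. \<Sum>j\<in>UNIV. u $ i * v $ j * Q i j (0, 0))) (at_right 0)"
    by (intro tendsto_sum tendsto_mult Q nth x y)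
  have val: "(\<Sum>i\<in>UNIV. \<Sum>j\<in>UNIV. u $ i * v $ j * Q i j (0, 0)) = fd (\<lambda>z. fd F z (u, 0)) (0, 0) (0, v)"
    unfolding Q_def by (rule second_derivative_expand[OF F, symmetric])
  have ev: "\<forall>\<^sub>F s in at_right 0. (\<Sum>i\<in>UNIV. \<Sum>j\<in>UNIV. (x s $ i / s) * (y s $ j / s) * Q i j (\<zeta> s)) = F (x s, y s) / s\<^sup>2"
    using \<zeta> by eventually_elim (simp add: sum_divide_distrib power2_eq_square)
  show ?thesis using Lim_transform_eventually[OF lim2 ev] unfolding val .
qed

context lie_param
begin

text \<open>The tangent vectors at \<open>\<one>\<close> of curves in \<open>S\<close> that need only be differentiable at their starting
  point, so that the square root in the commutator curve does no harm.\<close>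

definition cone :: "'g set \<Rightarrow> (real ^ 'n) set" where
  "cone S = {u. \<exists>h. (\<forall>s. h s \<in> S) \<and> (\<forall>\<^sub>F s in at_right 0. h s \<in> U) \<and> ((\<lambda>s. C (h s) /\<^sub>R s) \<longlongrightarrow> u) (at_right (0::real))}"

lemma cone_mono: "S \<subseteq> S' \<Longrightarrow> cone S \<subseteq> cone S'"
  unfolding cone_def by blast

lemma cone_one: "cone {\<one>} \<subseteq> {0}"
proof
  fix u assume "u \<in> cone {\<one>}"
  then have "((\<lambda>s::real. 0 :: real ^ 'n) \<longlongrightarrow> u) (at_right 0)" unfolding cone_def by auto
  then have "u = 0" using tendsto_unique[OF trivial_limit_at_right_real tendsto_const] by blast
  then show "u \<in> {0}" by simp
qed

lemma eventually_small_scale: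
  assumes "\<forall>\<^sub>F z in nhds (0 :: real ^ 'n). P z" shows "\<forall>\<^sub>F s in at_right (0::real). P (s *\<^sub>R u)"
proof -
  have "((\<lambda>s::real. s *\<^sub>R u) \<longlongrightarrow> 0 *\<^sub>R u) (at_right 0)" by (intro tendsto_intros)
  then show ?thesis using assms unfolding filterlim_iff by simp
qed

lemma cone_UNIV: "cone UNIV = UNIV"
proof -
  have "u \<in> cone UNIV" for u
  proof -
    have ev: "\<forall>\<^sub>F s in at_right (0::real). s *\<^sub>R u \<in> N" by (rule eventually_small_scale[OF eventually_nhds_in_open[OF openN N0]])
    have 1: "\<forall>\<^sub>F s in at_right (0::real). K (s *\<^sub>R u) \<in> U" using ev by eventually_elim (rule KU)
    have "\<forall>\<^sub>F s in at_right (0::real). u = C (K (s *\<^sub>R u)) /\<^sub>R s"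
      using ev eventually_at_right_less[of 0] by eventually_elim (simp add: CK)
    then have "((\<lambda>s. C (K (s *\<^sub>R u)) /\<^sub>R s) \<longlongrightarrow> u) (at_right (0::real))"
      by (rule Lim_transform_eventually[OF tendsto_const])
    with 1 show ?thesis unfolding cone_def by auto
  qed
  then show ?thesis by blast
qed

definition W4 :: "(real ^ 'n) \<times> (real ^ 'n) \<Rightarrow> 'g" where
  "W4 z = K (fst z) \<otimes> K (snd z) \<otimes> inv (K (fst z)) \<otimes> inv (K (snd z))"

lemma smG_W4: "smG W4 (0, 0)"
proof -
  have 1: "smG (\<lambda>yz. K (fst yz)) (0, 0 :: real ^ 'n)" "smG (\<lambda>yz. K (snd yz)) (0 :: real ^ 'n, 0)"
    by (rule smG_comp[OF smG_K], use N0 in simp, intro smooth_near_linear[OF bounded_linear_fst] smooth_near_id)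
       (rule smG_comp[OF smG_K], use N0 in simp, intro smooth_near_linear[OF bounded_linear_snd] smooth_near_id)
  show ?thesis unfolding W4_def[abs_def] by (intro smG_mult smG_inv 1)
qed

lemma W4_0 [simp]: "W4 (0, y) = \<one>" "W4 (x, 0) = \<one>" by (simp_all add: W4_def carr)

lemma smooth_W4: "smooth_near (\<lambda>z. C (W4 z)) (0, 0)"
  by (rule smooth_C[OF smG_W4]) (simp add: chart1)

text \<open>By Schwarz the second variable can be differentiated first. In it the commutator is (x z
  x^{-1}) z^{-1}, with derivative Ad x plus a map independent of x; differentiating in x leaves the
  derivative of Ad.\<close>

lemma mixed_W4: "fd (\<lambda>z. fd (\<lambda>z. C (W4 z)) z (u, 0)) (0, 0) (0, v) = br u v"
proof -
  define J where "J = fd (\<lambda>z. C (inv (K z))) 0 v"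
  have ev: "\<forall>\<^sub>F x in nhds 0. fd (\<lambda>z. C (W4 z)) (x, 0) (0, v) = AdM (K x) v + J"
    using eventually_nhds_in_open[OF openN N0] eventually_Pair0[OF smooth_near_eventually[OF smooth_W4]]
  proof eventually_elim
    case (elim x)
    have "\<forall>\<^sub>F z in nhds 0. K x \<otimes> K z \<otimes> inv (K x) \<in> U" "\<forall>\<^sub>F z in nhds 0. inv (K z) \<in> U"
      by (rule isCont_eventually[OF smG_isCont[OF smG_conj] openU], simp add: chart1 carr)
         (rule isCont_eventually[OF smG_isCont[OF smG_inv[OF smG_K[OF N0]]] openU], simp add: chart1)
    then have e: "\<forall>\<^sub>F z in nhds 0. C (W4 (x, z)) = m (C (K x \<otimes> K z \<otimes> inv (K x)), C (inv (K z)))"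
      by eventually_elim (simp add: m_def W4_def KC)
    have "((\<lambda>z. (C (K x \<otimes> K z \<otimes> inv (K x)), C (inv (K z)))) has_derivative
        (\<lambda>v. (AdM (K x) v, fd (\<lambda>z. C (inv (K z))) 0 v))) (at 0)"
      unfolding AdM_def by (intro has_derivative_Pair differentiable_fd smooth_near_differentiable smooth_conj smooth_inv_K)
    from has_derivative_compose[OF this, of m "fd m (0, 0)"]
    have "fd (\<lambda>z. m (C (K x \<otimes> K z \<otimes> inv (K x)), C (inv (K z)))) 0 v = fd m (0, 0) (AdM (K x) v, J)"
      using differentiable_fd[OF smooth_near_differentiable[OF smooth_m0[OF N0]]] unfolding J_def by (intro fd_eqI) (simp add: carr)
    moreover have "fd (\<lambda>z. C (W4 (x, z))) 0 v = fd (\<lambda>z. C (W4 z)) (x, 0) (0, v)"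
      by (rule fd_slice[OF smooth_near_differentiable[OF elim(2)]])
    ultimately show ?case using fd_cong[OF e] by (simp add: fd_m0)
  qed
  have "fd (\<lambda>z. fd (\<lambda>z. C (W4 z)) z (u, 0)) (0, 0) (0, v) = fd (\<lambda>z. fd (\<lambda>z. C (W4 z)) z (0, v)) (0, 0) (u, 0)"
    by (rule Schwarz[OF smooth_W4])
  also have "\<dots> = fd (\<lambda>x. fd (\<lambda>z. C (W4 z)) (x, 0) (0, v)) 0 u"
    by (rule fd_slice_left[symmetric, OF smooth_near_differentiable[OF smooth_near_fd[OF smooth_W4]]])
  also have "\<dots> = fd (\<lambda>x. AdM (K x) v + J) 0 u" using fd_cong[OF ev] by simp
  also have "\<dots> = fd (\<lambda>x. AdM (K x) v) 0 u"
    by (rule fd_eqI) (auto intro!: derivative_eq_intros differentiable_fd[OF smooth_near_differentiable[OF smooth_AdM]])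
  finally show ?thesis by (simp add: fd_AdM)
qed

text \<open>\<open>W4\<close> is the identity on both axes, so the commutators of two curves with
  velocities u and v deviate from the identity by s^2 \<open>br u v\<close> to leading order.
  Inserting the square root of s as parameter gives a curve in the derived subgroup with velocity
  \<open>br u v\<close>.\<close>

lemma cone_br:
  assumes u: "u \<in> cone S" and v: "v \<in> cone S" shows "br u v \<in> cone (derived G S)"
proof -
  obtain h where h: "\<And>s. h s \<in> S" "\<forall>\<^sub>F s in at_right 0. h s \<in> U" "((\<lambda>s. C (h s) /\<^sub>R s) \<longlongrightarrow> u) (at_right (0::real))"
    using u unfolding cone_def by blast
  obtain k where k: "\<And>s. k s \<in> S" "\<forall>\<^sub>F s in at_right 0. k s \<in> U" "((\<lambda>s. C (k s) /\<^sub>R s) \<longlongrightarrow> v) (at_right (0::real))"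
    using v unfolding cone_def by blast
  define q where "q = (\<lambda>s. h s \<otimes> k s \<otimes> inv (h s) \<otimes> inv (k s))"
  have cS: "q s \<in> derived G S" for s
    unfolding derived_def by (rule generate.incl) (use h(1) k(1) in \<open>auto simp: q_def\<close>)
  have cW: "\<forall>\<^sub>F s in at_right 0. W4 (C (h s), C (k s)) = q s"
    using h(2) k(2) by eventually_elim (simp add: W4_def q_def KC)
  note zero = tendsto_zero_rate
  have lim: "((\<lambda>s. C (q s) /\<^sub>R s\<^sup>2) \<longlongrightarrow> br u v) (at_right 0)"
  proof (rule vec_tendstoI)
    fix i
    have si: "smooth_near (\<lambda>z. C (W4 z) $ i) (0, 0)" by (rule smooth_near_nth[OF smooth_W4])
    have "((\<lambda>s. C (W4 (C (h s), C (k s))) $ i / s\<^sup>2) \<longlongrightarrow> fd (\<lambda>z. fd (\<lambda>z. C (W4 z) $ i) z (u, 0)) (0, 0) (0, v)) (at_right 0)"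
      by (rule mixed_difference[OF si _ _ h(3) k(3)]) simp_all
    also have "fd (\<lambda>z. fd (\<lambda>z. C (W4 z) $ i) z (u, 0)) (0, 0) (0, v) = br u v $ i"
    proof -
      have "\<forall>\<^sub>F z in nhds (0,0). fd (\<lambda>z. C (W4 z) $ i) z (u, 0) = fd (\<lambda>z. C (W4 z)) z (u, 0) $ i"
        using smooth_near_eventually[OF smooth_W4] by eventually_elim (rule fd_nth[OF smooth_near_differentiable])
      then have "fd (\<lambda>z. fd (\<lambda>z. C (W4 z) $ i) z (u, 0)) (0, 0) (0, v) = fd (\<lambda>z. fd (\<lambda>z. C (W4 z)) z (u, 0) $ i) (0, 0) (0, v)"
        by (simp add: fd_cong)
      also have "\<dots> = br u v $ i"
        unfolding mixed_W4[symmetric] by (rule fd_nth[OF smooth_near_differentiable[OF smooth_near_fd[OF smooth_W4]]])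
      finally show ?thesis .
    qed
    finally have "((\<lambda>s. C (W4 (C (h s), C (k s))) $ i / s\<^sup>2) \<longlongrightarrow> br u v $ i) (at_right 0)" .
    moreover have "\<forall>\<^sub>F s in at_right 0. C (W4 (C (h s), C (k s))) $ i / s\<^sup>2 = (C (q s) /\<^sub>R s\<^sup>2) $ i"
      using cW by eventually_elim (simp add: divide_inverse mult.commute)
    ultimately show "((\<lambda>s. (C (q s) /\<^sub>R s\<^sup>2) $ i) \<longlongrightarrow> br u v $ i) (at_right 0)"
      by (rule Lim_transform_eventually)
  qed
  have cU: "\<forall>\<^sub>F s in at_right 0. q s \<in> U"
  proof -
    have "((\<lambda>s. (C (h s), C (k s))) \<longlongrightarrow> (0, 0)) (at_right 0)" by (intro tendsto_Pair zero[OF h(3)] zero[OF k(3)])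
    moreover have "\<forall>\<^sub>F z in nhds (0,0). W4 z \<in> U" by (rule isCont_eventually[OF smG_isCont[OF smG_W4] openU]) (simp add: chart1)
    ultimately have "\<forall>\<^sub>F s in at_right 0. W4 (C (h s), C (k s)) \<in> U" unfolding filterlim_iff by blast
    then show ?thesis using cW by eventually_elim simp
  qed
  have sq: "filterlim sqrt (at_right 0) (at_right (0::real))"
  proof -
    have "(sqrt \<longlongrightarrow> sqrt 0) (at_right 0)" by (intro tendsto_intros)
    then show ?thesis by (simp add: filterlim_at eventually_at_right_less eventually_at_filter)
  qed
  have "((\<lambda>s. C (q (sqrt s)) /\<^sub>R (sqrt s)\<^sup>2) \<longlongrightarrow> br u v) (at_right 0)" by (rule filterlim_compose[OF lim sq])
  moreover have "\<forall>\<^sub>F s in at_right 0. C (q (sqrt s)) /\<^sub>R (sqrt s)\<^sup>2 = C (q (sqrt s)) /\<^sub>R s"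
    using eventually_at_right_less[of 0] by eventually_elim simp
  ultimately have "((\<lambda>s. C (q (sqrt s)) /\<^sub>R s) \<longlongrightarrow> br u v) (at_right 0)" by (rule Lim_transform_eventually)
  moreover have "\<forall>\<^sub>F s in at_right 0. q (sqrt s) \<in> U" using sq cU unfolding filterlim_iff by blast
  ultimately show ?thesis unfolding cone_def using cS by (auto intro!: exI[of _ "\<lambda>s. q (sqrt s)"])
qed

text \<open>Tangent cones are not known to be subspaces; the filtration consists of their spans, to
  which bilinearity extends the bracket relation.\<close>

lemma br_span:
  assumes "\<And>u v. u \<in> S \<Longrightarrow> v \<in> S \<Longrightarrow> br u v \<in> T" and x: "x \<in> span S" and y: "y \<in> span S"
  shows "br x y \<in> span T"
proof -
  have 1: "br u y \<in> span T" if "u \<in> S" for u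
    using y
  proof (rule span_induct)
    show "subspace {y. br u y \<in> span T}"
      by (simp add: subspace_def bilinear_rzero[OF bilinear_br] bilinear_radd[OF bilinear_br] bilinear_rmul[OF bilinear_br] span_zero span_add span_mul)
  qed (use assms(1) that in \<open>auto intro: span_base\<close>)
  from x show ?thesis
  proof (rule span_induct)
    show "subspace {x. br x y \<in> span T}"
      by (simp add: subspace_def bilinear_lzero[OF bilinear_br] bilinear_ladd[OF bilinear_br] bilinear_lmul[OF bilinear_br] span_zero span_add span_mul)
  qed (use 1 in auto)
qed

lemma solvable_br:
  assumes "solvable G"
  shows "0 \<le> (\<Sum>x\<in>Basis. \<Sum>y\<in>Basis. \<Sum>z\<in>Basis. (br x y \<bullet> z)\<^sup>2) / 4
    + (\<Sum>x\<in>Basis. \<Sum>y\<in>Basis. \<Sum>z\<in>Basis. (br x y \<bullet> z) * (br x z \<bullet> y)) / 2"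
proof -
  obtain n where n: "(derived G ^^ n) UNIV = {\<one>}" using assms solvable_iff_trivial_derived_seq carr by auto
  define V where "V = (\<lambda>k. span (cone ((derived G ^^ k) UNIV)))"
  have sub: "(derived G ^^ Suc k) UNIV \<subseteq> (derived G ^^ k) UNIV" for k
  proof -
    have "subgroup ((derived G ^^ k) UNIV) G" using exp_of_derived_is_subgroup[OF subgroup_self, of k] by (simp add: carr)
    then show ?thesis using derived_incl[of "(derived G ^^ k) UNIV" "(derived G ^^ k) UNIV"] by simp
  qed
  show ?thesis
  proof (rule solvable_scal_nonpos[OF bilinear_br br_skew, of V n])
    show "subspace (V k)" for k by (simp add: V_def)
    show "V (Suc k) \<subseteq> V k" for k unfolding V_def by (intro span_mono cone_mono sub)
    show "V 0 = UNIV" by (simp add: V_def cone_UNIV)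
    show "V n = {0}" using span_mono[OF cone_one] span_0[of "cone {\<one>}"] unfolding V_def n by auto
    show "br x y \<in> V (Suc k)" if "x \<in> V k" "y \<in> V k" for k x y
      using that br_span[OF cone_br] unfolding V_def by simp
  qed
qed

end

section \<open>Left-invariant forms\<close>

lemma nths_compl:
  "nths (a # xs) (- {0}) = xs"
  "nths (a # xs) (- {Suc i}) = a # nths xs (- {i})"
  "nths (a # xs) (- {0, Suc j}) = nths xs (- {j})"
  "nths (a # xs) (- {Suc i, Suc j}) = a # nths xs (- {i, j})"
proof -
  have 1: "{j. Suc j \<in> - {0}} = UNIV" "{j. Suc j \<in> - {Suc i}} = - {i}" "{k. Suc k \<in> - {0, Suc j}} = - {j}" "{k. Suc k \<in> - {Suc i, Suc j}} = - {i, j}"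
    by auto
  show "nths (a # xs) (- {0}) = xs"
  "nths (a # xs) (- {Suc i}) = a # nths xs (- {i})"
  "nths (a # xs) (- {0, Suc j}) = nths xs (- {j})"
  "nths (a # xs) (- {Suc i, Suc j}) = a # nths xs (- {i, j})"
    unfolding nths_Cons 1 by (simp_all add: nths_all)
qed

lemma altf_head3:
  assumes "altf 3 W"
  shows "W [y, x, z] = - W [x, y, z]" "W [y, z, x] = W [x, y, z]"
  using altf_swap[OF assms, of "[]" "[z]" x y] altf_swap[OF assms, of "[y]" "[]" x z] by simp_all

lemma altf_head4:
  assumes "altf 4 W"
  shows "W [y, x, z, w] = - W [x, y, z, w]" "W [y, z, x, w] = W [x, y, z, w]" "W [y, z, w, x] = - W [x, y, z, w]"
  using altf_swap[OF assms, of "[]" "[z, w]" x y] altf_swap[OF assms, of "[y]" "[w]" x z] altf_swap[OF assms, of "[y, z]" "[]" x w] by simp_all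

lemma altf_linear_head:
  assumes "altf (Suc k) W" "length xs = k"
  shows "W ((x + y) # xs) = W (x # xs) + W (y # xs)" "W ((x - y) # xs) = W (x # xs) - W (y # xs)"
  using linear_add[OF ml_head[OF altf_ml[OF assms(1)] assms(2)]] linear_diff[OF ml_head[OF altf_ml[OF assms(1)] assms(2)]] by auto

context lie_param
begin

text \<open>The Leibniz rule by induction on k. Expanding the first argument in the basis leaves a
  form with constant head, to which the induction hypothesis applies.\<close>

lemma ml_deriv:
  fixes W :: "(real ^ 'n) list \<Rightarrow> real"
  assumes "ml k W" "length as = k" "\<And>a. a \<in> set as \<Longrightarrow> sm p a"
  shows "sm p (\<lambda>q. W (map (\<lambda>a. a q) as)) \<and>
    dv p v (\<lambda>q. W (map (\<lambda>a. a q) as)) = (\<Sum>j<k. W ((map (\<lambda>a. a p) as)[j := dv p v (as ! j)]))"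
  using assms
proof (induction k arbitrary: W as)
  case 0 then show ?case by (simp add: dv_const)
next
  case (Suc k)
  then obtain a bs where as: "as = a # bs" "length bs = k" by (cases as) auto
  let ?V = "\<lambda>i q. W (axis i 1 # map (\<lambda>a. a q) bs)"
  have a: "sm p a" using Suc.prems as by simp
  have IH: "sm p (?V i)" "dv p v (?V i) = (\<Sum>j<k. W (axis i 1 # (map (\<lambda>a. a p) bs)[j := dv p v (bs ! j)]))" for i
    using Suc.IH[OF ml_Cons[OF Suc.prems(1)] as(2), of "axis i 1"] Suc.prems as by auto
  have eq: "W (map (\<lambda>a. a q) as) = (\<Sum>i\<in>UNIV. a q $ i * ?V i q)" for q
    using linear_axis_sum[OF ml_head[OF Suc.prems(1)], of "map (\<lambda>a. a q) bs" "a q"] as by simp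
  have "sm p (\<lambda>q. \<Sum>i\<in>UNIV. a q $ i * ?V i q)"
    by (intro smooth_near_sum smooth_near_mult smooth_near_nth[OF a] IH)
  moreover have "dv p v (\<lambda>q. \<Sum>i\<in>UNIV. a q $ i * ?V i q) = (\<Sum>j<Suc k. W ((map (\<lambda>a. a p) as)[j := dv p v (as ! j)]))"
  proof -
    have "dv p v (\<lambda>q. \<Sum>i\<in>UNIV. a q $ i * ?V i q) = (\<Sum>i\<in>UNIV. dv p v (\<lambda>q. a q $ i * ?V i q))"
      by (rule dv_sum) (intro smooth_near_mult smooth_near_nth[OF a] IH)
    also have "\<dots> = (\<Sum>i\<in>UNIV. a p $ i * dv p v (?V i) + dv p v a $ i * ?V i p)"
      by (intro sum.cong refl) (simp only: dv_bilinear[OF bounded_bilinear_mult smooth_near_nth[OF a] IH(1)] dv_nth[OF a])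
    also have "\<dots> = (\<Sum>j<k. \<Sum>i\<in>UNIV. a p $ i * W (axis i 1 # (map (\<lambda>a. a p) bs)[j := dv p v (bs ! j)])) + W (dv p v a # map (\<lambda>a. a p) bs)"
      unfolding sum.distrib IH(2) sum_distrib_left
      by (subst sum.swap, subst linear_axis_sum[OF ml_head[OF Suc.prems(1)], of "map (\<lambda>a. a p) bs" "dv p v a"]) (simp_all add: as)
    also have "\<dots> = (\<Sum>j<k. W (a p # (map (\<lambda>a. a p) bs)[j := dv p v (bs ! j)])) + W (dv p v a # map (\<lambda>a. a p) bs)"
    proof -
      have "(\<Sum>i\<in>UNIV. a p $ i * W (axis i 1 # ys)) = W (a p # ys)" if "length ys = k" for ys
        by (rule linear_axis_sum[OF ml_head[OF Suc.prems(1) that], symmetric])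
      then show ?thesis using as by simp
    qed
    also have "\<dots> = (\<Sum>j<Suc k. W ((map (\<lambda>a. a p) as)[j := dv p v (as ! j)]))"
      unfolding sum.lessThan_Suc_shift by (simp add: as)
    finally show ?thesis .
  qed
  ultimately show ?case unfolding eq by blast
qed

lemma form_deriv:
  assumes W: "altf k W" and \<omega>: "\<And>q us. length us = k \<Longrightarrow> \<omega> q (map (tv q) us) = W us"
    and as: "length as = k" "\<And>a. a \<in> set as \<Longrightarrow> \<forall>q. sm q a"
  shows "tv p v (\<lambda>q. \<omega> q (map (\<lambda>X. X q) (map (\<lambda>a q. tv q (a q)) as))) = (\<Sum>j<k. W ((map (\<lambda>a. a p) as)[j := dv p v (as ! j)]))"
proof -
  have e: "(\<lambda>q. \<omega> q (map (\<lambda>X. X q) (map (\<lambda>a q. tv q (a q)) as))) = (\<lambda>q. W (map (\<lambda>a. a q) as))"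
    using \<omega>[of "map (\<lambda>a. a q) as" q for q] as(1) by (simp add: comp_def)
  show ?thesis unfolding e using ml_deriv[OF altf_ml[OF W] as(1), of p v] as(2) by (simp add: tv_sm)
qed

text \<open>As W is constant, the first sum of the invariant formula differentiates only the
  coefficients of the chosen extensions. These terms cancel against the derivative part of the
  brackets in \<open>bracket_tv\<close>, and the Chevalley-Eilenberg formula remains.\<close>

lemma ext_deriv_3:
  assumes W: "altf 3 W" and \<omega>: "\<And>q us. length us = 3 \<Longrightarrow> \<omega> q (map (tv q) us) = W us"
  shows "ext_deriv A \<omega> p [tv p u0, tv p u1, tv p u2, tv p u3] =
    - W [br u0 u1, u2, u3] + W [br u0 u2, u1, u3] - W [br u1 u2, u0, u3] - W [br u0 u3, u1, u2] + W [br u1 u3, u0, u2] - W [br u2 u3, u0, u1]"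
proof -
  obtain a0 where a0: "\<forall>q. sm q a0" "extend A p (tv p u0) = (\<lambda>q. tv q (a0 q))" "a0 p = u0" using extend[of p u0] by blast
  obtain a1 where a1: "\<forall>q. sm q a1" "extend A p (tv p u1) = (\<lambda>q. tv q (a1 q))" "a1 p = u1" using extend[of p u1] by blast
  obtain a2 where a2: "\<forall>q. sm q a2" "extend A p (tv p u2) = (\<lambda>q. tv q (a2 q))" "a2 p = u2" using extend[of p u2] by blast
  obtain a3 where a3: "\<forall>q. sm q a3" "extend A p (tv p u3) = (\<lambda>q. tv q (a3 q))" "a3 p = u3" using extend[of p u3] by blast
  note sa = a0(1)[rule_format] a1(1)[rule_format] a2(1)[rule_format] a3(1)[rule_format]
  note fe = a0(2) a1(2) a2(2) a3(2)
  have W': "altf (Suc 2) W" using W by simp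
  note lin = altf_linear_head[OF W']
  have d: "tv p v (\<lambda>q. \<omega> q [tv q (a q), tv q (b q), tv q (c q)]) = W [dv p v a, b p, c p] + W [a p, dv p v b, c p] + W [a p, b p, dv p v c]"
    if "\<forall>q. sm q a" "\<forall>q. sm q b" "\<forall>q. sm q c" for v a b c
  proof -
    have "\<And>aa. aa \<in> set [a, b, c] \<Longrightarrow> \<forall>q. sm q aa" using that by auto
    from form_deriv[where \<omega>=\<omega> and as="[a, b, c]" and p=p and v=v, OF W \<omega> _ this] show ?thesis by (simp add: eval_nat_numeral)
  qed
  have w: "\<omega> p [tv p x, tv p y, tv p z] = W [x, y, z]" for x y z using \<omega>[of "[x, y, z]" p] by simp
  \<comment> \<open>Moves a differentiated coefficient to the first slot, where the brackets produce
    it, so that the terms match for cancellation.\<close>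
  note h = altf_head3[OF W]
  show ?thesis
    unfolding ext_deriv_def ext_deriv_fields_def list.map fe
    by (simp add: lessThan_nat_numeral lessThan_Suc insert_commute[of _ 0] nths_compl bracket_tv[OF a0(1)[rule_format] a1(1)[rule_format]] bracket_tv[OF a0(1)[rule_format] a2(1)[rule_format]] bracket_tv[OF a0(1)[rule_format] a3(1)[rule_format]] bracket_tv[OF a1(1)[rule_format] a2(1)[rule_format]] bracket_tv[OF a1(1)[rule_format] a3(1)[rule_format]] bracket_tv[OF a2(1)[rule_format] a3(1)[rule_format]]
      w lin d algebra_simps a0(1) a1(1) a2(1) a3(1) a0(3) a1(3) a2(3) a3(3)
      h(1)[where y=u1 and x="fd (\<lambda>z. a2 (p \<otimes> K z)) 0 u0" and z=u3]
      h(2)[where y=u1 and x="fd (\<lambda>z. a3 (p \<otimes> K z)) 0 u0" and z=u2]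
      h(1)[where y=u0 and x="fd (\<lambda>z. a2 (p \<otimes> K z)) 0 u1" and z=u3]
      h(2)[where y=u0 and x="fd (\<lambda>z. a3 (p \<otimes> K z)) 0 u1" and z=u2]
      h(1)[where y=u0 and x="fd (\<lambda>z. a1 (p \<otimes> K z)) 0 u2" and z=u3]
      h(2)[where y=u0 and x="fd (\<lambda>z. a3 (p \<otimes> K z)) 0 u2" and z=u1]
      h(1)[where y=u0 and x="fd (\<lambda>z. a1 (p \<otimes> K z)) 0 u3" and z=u2]
      h(2)[where y=u0 and x="fd (\<lambda>z. a2 (p \<otimes> K z)) 0 u3" and z=u1])
qed

lemma ext_deriv_4:
  assumes W: "altf 4 W" and \<omega>: "\<And>q us. length us = 4 \<Longrightarrow> \<omega> q (map (tv q) us) = W us"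
  shows "ext_deriv A \<omega> p [tv p u0, tv p u1, tv p u2, tv p u3, tv p u4] =
    - W [br u0 u1, u2, u3, u4] + W [br u0 u2, u1, u3, u4] - W [br u1 u2, u0, u3, u4] - W [br u0 u3, u1, u2, u4] + W [br u1 u3, u0, u2, u4] - W [br u2 u3, u0, u1, u4]
    + W [br u0 u4, u1, u2, u3] - W [br u1 u4, u0, u2, u3] + W [br u2 u4, u0, u1, u3] - W [br u3 u4, u0, u1, u2]"
proof -
  obtain a0 where a0: "\<forall>q. sm q a0" "extend A p (tv p u0) = (\<lambda>q. tv q (a0 q))" "a0 p = u0" using extend[of p u0] by blast
  obtain a1 where a1: "\<forall>q. sm q a1" "extend A p (tv p u1) = (\<lambda>q. tv q (a1 q))" "a1 p = u1" using extend[of p u1] by blast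
  obtain a2 where a2: "\<forall>q. sm q a2" "extend A p (tv p u2) = (\<lambda>q. tv q (a2 q))" "a2 p = u2" using extend[of p u2] by blast
  obtain a3 where a3: "\<forall>q. sm q a3" "extend A p (tv p u3) = (\<lambda>q. tv q (a3 q))" "a3 p = u3" using extend[of p u3] by blast
  obtain a4 where a4: "\<forall>q. sm q a4" "extend A p (tv p u4) = (\<lambda>q. tv q (a4 q))" "a4 p = u4" using extend[of p u4] by blast
  note sa = a0(1)[rule_format] a1(1)[rule_format] a2(1)[rule_format] a3(1)[rule_format] a4(1)[rule_format]
  note fe = a0(2) a1(2) a2(2) a3(2) a4(2)
  have W': "altf (Suc 3) W" using W by simp
  note lin = altf_linear_head[OF W']
  have d: "tv p v (\<lambda>q. \<omega> q [tv q (a q), tv q (b q), tv q (c q), tv q (e q)]) = W [dv p v a, b p, c p, e p] + W [a p, dv p v b, c p, e p] + W [a p, b p, dv p v c, e p] + W [a p, b p, c p, dv p v e]"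
    if "\<forall>q. sm q a" "\<forall>q. sm q b" "\<forall>q. sm q c" "\<forall>q. sm q e" for v a b c e
  proof -
    have "\<And>aa. aa \<in> set [a, b, c, e] \<Longrightarrow> \<forall>q. sm q aa" using that by auto
    from form_deriv[where \<omega>=\<omega> and as="[a, b, c, e]" and p=p and v=v, OF W \<omega> _ this] show ?thesis by (simp add: eval_nat_numeral)
  qed
  have w: "\<omega> p [tv p x, tv p y, tv p z, tv p t] = W [x, y, z, t]" for x y z t using \<omega>[of "[x, y, z, t]" p] by simp
  note h = altf_head4[OF W]
  show ?thesis
    unfolding ext_deriv_def ext_deriv_fields_def list.map fe
    by (simp add: lessThan_nat_numeral lessThan_Suc insert_commute[of _ 0] nths_compl bracket_tv[OF a0(1)[rule_format] a1(1)[rule_format]] bracket_tv[OF a0(1)[rule_format] a2(1)[rule_format]] bracket_tv[OF a0(1)[rule_format] a3(1)[rule_format]] bracket_tv[OF a0(1)[rule_format] a4(1)[rule_format]] bracket_tv[OF a1(1)[rule_format] a2(1)[rule_format]] bracket_tv[OF a1(1)[rule_format] a3(1)[rule_format]] bracket_tv[OF a1(1)[rule_format] a4(1)[rule_format]] bracket_tv[OF a2(1)[rule_format] a3(1)[rule_format]] bracket_tv[OF a2(1)[rule_format] a4(1)[rule_format]] bracket_tv[OF a3(1)[rule_format] a4(1)[rule_format]]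
      w lin d algebra_simps a0(1) a1(1) a2(1) a3(1) a4(1) a0(3) a1(3) a2(3) a3(3) a4(3)
      h(1)[where y=u1 and x="fd (\<lambda>z. a2 (p \<otimes> K z)) 0 u0" and z=u3 and w=u4]
      h(2)[where y=u1 and x="fd (\<lambda>z. a3 (p \<otimes> K z)) 0 u0" and z=u2 and w=u4]
      h(3)[where y=u1 and x="fd (\<lambda>z. a4 (p \<otimes> K z)) 0 u0" and z=u2 and w=u3]
      h(1)[where y=u0 and x="fd (\<lambda>z. a2 (p \<otimes> K z)) 0 u1" and z=u3 and w=u4]
      h(2)[where y=u0 and x="fd (\<lambda>z. a3 (p \<otimes> K z)) 0 u1" and z=u2 and w=u4]
      h(3)[where y=u0 and x="fd (\<lambda>z. a4 (p \<otimes> K z)) 0 u1" and z=u2 and w=u3]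
      h(1)[where y=u0 and x="fd (\<lambda>z. a1 (p \<otimes> K z)) 0 u2" and z=u3 and w=u4]
      h(2)[where y=u0 and x="fd (\<lambda>z. a3 (p \<otimes> K z)) 0 u2" and z=u1 and w=u4]
      h(3)[where y=u0 and x="fd (\<lambda>z. a4 (p \<otimes> K z)) 0 u2" and z=u1 and w=u3]
      h(1)[where y=u0 and x="fd (\<lambda>z. a1 (p \<otimes> K z)) 0 u3" and z=u2 and w=u4]
      h(2)[where y=u0 and x="fd (\<lambda>z. a2 (p \<otimes> K z)) 0 u3" and z=u1 and w=u4]
      h(3)[where y=u0 and x="fd (\<lambda>z. a4 (p \<otimes> K z)) 0 u3" and z=u1 and w=u2]
      h(1)[where y=u0 and x="fd (\<lambda>z. a1 (p \<otimes> K z)) 0 u4" and z=u2 and w=u3]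
      h(2)[where y=u0 and x="fd (\<lambda>z. a2 (p \<otimes> K z)) 0 u4" and z=u1 and w=u3]
      h(3)[where y=u0 and x="fd (\<lambda>z. a3 (p \<otimes> K z)) 0 u4" and z=u1 and w=u2])
qed

end

section \<open>Exterior algebra on the coordinate space and the standard three-form\<close>

abbreviation ax :: "'n \<Rightarrow> real ^ 'n::finite" where "ax i \<equiv> axis i 1"

lemma altf_transpose:
  fixes W :: "'v::real_vector list \<Rightarrow> real"
  assumes W: "altf n W" and len: "length us = n" and ij: "i < n" "j < n" "i \<noteq> j"
  shows "W (us[i := us ! j, j := us ! i]) = - W us"
proof -
  define f where "f x y = W (us[i := x, j := y])" for x y
  have lx: "linear (\<lambda>x. f x y)" for y
    using mlD[OF altf_ml[OF W], of "us[j := y]" i] len ij by (simp add: f_def list_update_swap)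
  have ly: "linear (f x)" for x
    using mlD[OF altf_ml[OF W], of "us[i := x]" j] len ij unfolding f_def[abs_def] by simp
  have z: "f x x = 0" for x
    using W len ij unfolding altf_def f_def by (auto simp: nth_list_update)
  have "f (us ! i + us ! j) (us ! i + us ! j) = f (us ! i) (us ! j) + f (us ! j) (us ! i)"
    unfolding linear_add[OF lx] linear_add[OF ly] by (simp add: z)
  then have "f (us ! i) (us ! j) + f (us ! j) (us ! i) = 0" by (simp only: z)
  then show ?thesis by (simp add: f_def)
qed

lemma altf_permute:
  fixes W :: "'v::real_vector list \<Rightarrow> real"
  assumes W: "altf n W" and len: "length us = n" and \<sigma>: "\<sigma> permutes {..<n}"
  shows "W (map (\<lambda>i. us ! \<sigma> i) [0..<n]) = of_int (sign \<sigma>) * W us"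
proof -
  have "\<forall>us. length us = n \<longrightarrow> W (map (\<lambda>i. us ! \<sigma> i) [0..<n]) = of_int (sign \<sigma>) * W us"
    using \<sigma> finite_lessThan
  proof (induction rule: permutes_induct)
    case id
    have "map (\<lambda>i. us ! id i) [0..<n] = us" if "length us = n" for us :: "'v list" using map_nth[of us] that by simp
    then show ?case by (simp add: sign_id)
  next
    case (swap a b p)
    show ?case
    proof (intro allI impI)
      fix us :: "'v list" assume len: "length us = n"
      define vs where "vs = us[a := us ! b, b := us ! a]"
      have v: "us ! Transposition.transpose a b k = vs ! k" if "k < n" for k
        using that swap.hyps len by (auto simp: vs_def nth_list_update Transposition.transpose_def)
      have pk: "p k < n" if "k < n" for k using permutes_in_image[OF swap.hyps(4), of k] that by simp
      have "W (map (\<lambda>i. us ! (Transposition.transpose a b \<circ> p) i) [0..<n]) = W (map (\<lambda>i. vs ! p i) [0..<n])"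
        by (intro arg_cong[of _ _ W] map_cong refl) (simp add: v pk)
      also have "\<dots> = of_int (sign p) * W vs" using swap.IH len by (simp add: vs_def)
      also have "W vs = - W us" unfolding vs_def by (rule altf_transpose[OF W len]) (use swap.hyps in auto)
      also have "of_int (sign p) * - W us = of_int (sign (Transposition.transpose a b \<circ> p)) * W us"
        using swap.hyps permutes_imp_permutation[OF finite_lessThan swap.hyps(4)]
        by (simp add: sign_compose permutation_swap_id sign_swap_id)
      finally show "W (map (\<lambda>i. us ! (Transposition.transpose a b \<circ> p) i) [0..<n]) = of_int (sign (Transposition.transpose a b \<circ> p)) * W us" .
    qed
  qed
  then show ?thesis using len by blast
qed

lemma altf_antisym:
  fixes T :: "'v::real_vector list \<Rightarrow> real"
  assumes T: "ml n T"
  shows "altf n (\<lambda>us. \<Sum>\<sigma> | \<sigma> permutes {..<n}. of_int (sign \<sigma>) * T (map (\<lambda>i. us ! \<sigma> i) [0..<n]))"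
  unfolding altf_def ml_def
proof (intro conjI allI impI)
  fix us :: "'v list" and i assume us: "length us = n" "i < n"
  show "linear (\<lambda>x. \<Sum>\<sigma> | \<sigma> permutes {..<n}. of_int (sign \<sigma>) * T (map (\<lambda>k. us[i := x] ! \<sigma> k) [0..<n]))"
  proof (rule linear_compose_sum, rule ballI)
    fix \<sigma> assume "\<sigma> \<in> {\<sigma>. \<sigma> permutes {..<n}}"
    then have s: "\<sigma> permutes {..<n}" by simp
    define l where "l = inv_into UNIV \<sigma> i"
    have l: "l < n" "\<sigma> l = i"
      using permutes_in_image[OF permutes_inv[OF s], of i] us permutes_inverses(1)[OF s] by (auto simp: l_def)
    have "map (\<lambda>k. us[i := x] ! \<sigma> k) [0..<n] = (map (\<lambda>k. us ! \<sigma> k) [0..<n])[l := x]" for x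
    proof (rule nth_equalityI)
      fix k assume "k < length (map (\<lambda>k. us[i := x] ! \<sigma> k) [0..<n])"
      then have k: "k < n" by simp
      have "\<sigma> k = i \<longleftrightarrow> k = l" using l permutes_inj[OF s] by (auto dest: injD)
      then show "map (\<lambda>k. us[i := x] ! \<sigma> k) [0..<n] ! k = (map (\<lambda>k. us ! \<sigma> k) [0..<n])[l := x] ! k"
        using k us by (auto simp: nth_list_update)
    qed simp
    then show "linear (\<lambda>x. of_int (sign \<sigma>) * T (map (\<lambda>k. us[i := x] ! \<sigma> k) [0..<n]))"
      using linear_compose_scale_right[OF mlD[OF T, of "map (\<lambda>k. us ! \<sigma> k) [0..<n]" l], of "of_int (sign \<sigma>)"] l(1) by simp
  qed
next
  fix us :: "'v list" and i j assume us: "length us = n" "i < n" "j < n" "i \<noteq> j" "us ! i = us ! j"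
  let ?t = "Transposition.transpose i j"
  let ?f = "\<lambda>\<sigma>. of_int (sign \<sigma>) * T (map (\<lambda>k. us ! \<sigma> k) [0..<n])"
  have t: "?t permutes {..<n}" using us by (intro permutes_swap_id) auto
  have "(\<Sum>\<sigma> | \<sigma> permutes {..<n}. ?f \<sigma>) = (\<Sum>\<sigma> | \<sigma> permutes {..<n}. ?f (?t \<circ> \<sigma>))"
    by (rule sum.reindex_bij_witness[of _ "\<lambda>\<sigma>. ?t \<circ> \<sigma>" "\<lambda>\<sigma>. ?t \<circ> \<sigma>"]) (auto simp: o_assoc permutes_compose[OF _ t])
  also have "\<dots> = (\<Sum>\<sigma> | \<sigma> permutes {..<n}. - ?f \<sigma>)"
  proof (rule sum.cong[OF refl])
    fix \<sigma> assume "\<sigma> \<in> {\<sigma>. \<sigma> permutes {..<n}}"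
    then have s: "\<sigma> permutes {..<n}" by simp
    have "us ! ?t m = us ! m" for m using us(5) by (auto simp: Transposition.transpose_def)
    then show "?f (?t \<circ> \<sigma>) = - ?f \<sigma>"
      using us(4) permutes_imp_permutation[OF finite_lessThan s] by (simp add: sign_compose permutation_swap_id sign_swap_id)
  qed
  finally show "(\<Sum>\<sigma> | \<sigma> permutes {..<n}. ?f \<sigma>) = 0" by (simp add: sum_negf)
qed

definition ew :: "'n list \<Rightarrow> (real ^ 'n) list \<Rightarrow> real" where
  "ew is vs = (\<Sum>\<sigma> | \<sigma> permutes {..<length is}. of_int (sign \<sigma>) * (\<Prod>a<length is. (vs ! \<sigma> a) $ (is ! a)))"

lemma altf_ew:
  fixes "is" :: "'n::finite list"
  assumes n: "length is = n" shows "altf n (ew is)"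
proof -
  define T :: "(real ^ 'n) list \<Rightarrow> real" where "T vs = (\<Prod>a<n. (vs ! a) $ (is ! a))" for vs
  have "ml n T" unfolding ml_def
  proof (intro allI impI)
    fix us :: "(real ^ 'n) list" and i assume us: "length us = n" "i < n"
    have "T (us[i := x]) = x $ (is ! i) * (\<Prod>a\<in>{..<n} - {i}. (us ! a) $ (is ! a))" for x
      unfolding T_def using us by (subst prod.remove[of _ i]) (auto intro!: prod.cong)
    then show "linear (\<lambda>x. T (us[i := x]))" by (simp add: linear_iff algebra_simps)
  qed
  from altf_antisym[OF this]
  show "altf n (ew is)"
  proof (rule arg_cong[of _ _ "altf n", THEN iffD1, rotated])
    show "(\<lambda>us. \<Sum>\<sigma> | \<sigma> permutes {..<n}. of_int (sign \<sigma>) * T (map (\<lambda>i. us ! \<sigma> i) [0..<n])) = ew is"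
      by (rule ext) (simp add: ew_def T_def n)
  qed
qed

lemma ew_axis:
  assumes "distinct is" shows "ew is (map ax is) = 1"
proof -
  let ?n = "length is"
  have z: "(\<Prod>a<?n. (map ax is ! \<sigma> a) $ (is ! a)) = (if \<sigma> = id then 1 else 0 :: real)" if s: "\<sigma> permutes {..<?n}" for \<sigma>
  proof (cases "\<sigma> = id")
    case False
    then obtain a where a: "\<sigma> a \<noteq> a" by (auto simp: fun_eq_iff)
    have an: "a < ?n" using a s by (meson lessThan_iff permutes_not_in)
    moreover have "\<sigma> a < ?n" using permutes_in_image[OF s, of a] an by simp
    ultimately have "(map ax is ! \<sigma> a) $ (is ! a) = (0 :: real)"
      using assms a by (auto simp: axis_def nth_eq_iff_index_eq)
    then show ?thesis using False an by (auto intro!: prod_zero)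
  qed simp
  have "ew is (map ax is) = (\<Sum>\<sigma> | \<sigma> permutes {..<?n}. of_int (sign \<sigma>) * (if \<sigma> = id then 1 else 0))"
    unfolding ew_def by (intro sum.cong refl) (simp add: z)
  also have "\<dots> = (\<Sum>\<sigma>\<in>{id :: nat \<Rightarrow> nat}. of_int (sign \<sigma>) * (if \<sigma> = id then 1 else 0))"
    by (rule sum.mono_neutral_right) (auto simp: finite_permutations permutes_id)
  finally show ?thesis by (simp add: sign_id)
qed

lemma ew_axis_zero:
  assumes "length js = length is" "i \<in> set is" "i \<notin> set js" shows "ew is (map ax js) = 0"
proof -
  obtain a where a: "a < length is" "is ! a = i" using assms(2) by (auto simp: in_set_conv_nth)
  have "(\<Prod>a<length is. (map ax js ! \<sigma> a) $ (is ! a)) = (0 :: real)" if s: "\<sigma> permutes {..<length is}" for \<sigma>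
  proof -
    have sa: "\<sigma> a < length js" using permutes_in_image[OF s, of a] a assms(1) by simp
    then have "js ! \<sigma> a \<noteq> i" using assms(3) nth_mem by metis
    then have "(map ax js ! \<sigma> a) $ (is ! a) = (0 :: real)" using sa a by (simp add: axis_def)
    then show ?thesis using a by (auto intro!: prod_zero)
  qed
  then show ?thesis unfolding ew_def by (simp add: sum.neutral)
qed

lemma ew_tri:
  assumes "distinct [a, b, c]" shows "ew [a, b, c] [ax i, ax j, ax k] = tri a b c i j k"
proof (cases "{i, j, k} = {a, b, c}")
  case False
  then have z: "ew [a, b, c] (map ax [i, j, k]) = 0"
  proof -
    have "\<exists>x. x \<in> set [a, b, c] \<and> x \<notin> set [i, j, k]"
    proof (rule ccontr)
      assume "\<not> ?thesis"
      then have sub: "{a, b, c} \<subseteq> {i, j, k}" by auto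
      moreover have "card {a, b, c} = 3" using assms by simp
      moreover have "card {i, j, k} \<le> 3" by (simp add: card_insert_if)
      ultimately have "{a, b, c} = {i, j, k}" by (intro card_seteq) auto
      with False show False by simp
    qed
    then show ?thesis by (metis ew_axis_zero length_Cons list.size(3))
  qed
  then show ?thesis using False by (auto simp: tri_def)
next
  case True
  have e: "ew [a, b, c] [ax a, ax b, ax c] = 1" using ew_axis[OF assms] by simp
  have W: "altf 3 (ew [a, b, c])" by (rule altf_ew) simp
  note s1 = altf_swap[OF W, of "[]" "[_]", simplified] and s2 = altf_swap[OF W, of "[_]" "[]", simplified]
  have v: "ew [a, b, c] [ax b, ax a, ax c] = -1" "ew [a, b, c] [ax a, ax c, ax b] = -1"
    using s1[of "ax b" "ax a" "ax c"] s2[of "ax a" "ax c" "ax b"] e by simp_all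
  have v2: "ew [a, b, c] [ax b, ax c, ax a] = 1" "ew [a, b, c] [ax c, ax a, ax b] = 1"
    using s2[of "ax b" "ax c" "ax a"] s1[of "ax c" "ax a" "ax b"] v by simp_all
  have v3: "ew [a, b, c] [ax c, ax b, ax a] = -1"
    using s1[of "ax c" "ax b" "ax a"] v2 by simp
  have "i \<in> {a, b, c}" "j \<in> {a, b, c}" "k \<in> {a, b, c}" "a \<in> {i, j, k}" "b \<in> {i, j, k}" "c \<in> {i, j, k}" using True by auto
  then have "i = a \<and> j = b \<and> k = c \<or> i = b \<and> j = c \<and> k = a \<or> i = c \<and> j = a \<and> k = b \<or> i = b \<and> j = a \<and> k = c \<or> i = a \<and> j = c \<and> k = b \<or> i = c \<and> j = b \<and> k = a"
    using assms by auto
  then show ?thesis using assms e v v2 v3 by (elim disjE) (auto simp: tri_def)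
qed

definition phi0 :: "(real ^ 7) list \<Rightarrow> real" where
  "phi0 vs = ew [1,2,3] vs + ew [1,4,5] vs + ew [1,6,7] vs + ew [2,4,6] vs - ew [2,5,7] vs - ew [3,4,7] vs - ew [3,5,6] vs"

lemma phi0_axis: "phi0 [ax i, ax j, ax k] = ph i j k"
  by (simp add: phi0_def ph_def ew_tri)

lemma altf_phi0: "altf 3 phi0"
proof -
  have e: "altf 3 (ew [a, b, c])" for a b c :: 7 by (rule altf_ew) simp
  have add: "altf k (\<lambda>us. f us + g us)" and diff: "altf k (\<lambda>us. f us - g us)" if "altf k f" "altf k g" for k and f g :: "(real ^ 7) list \<Rightarrow> real"
    using that unfolding altf_def ml_def by (auto intro: linear_compose_add linear_compose_sub)
  show ?thesis unfolding phi0_def[abs_def] by (intro add diff e)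
qed

abbreviation vol0 :: "(real ^ 7) list \<Rightarrow> real" where "vol0 \<equiv> ew [1,2,3,4,5,6,7]"

lemma altf_vol0: "altf 7 vol0" by (rule altf_ew) simp

lemma sort_7:
  assumes "distinct xs" "length xs = 7" shows "sort xs = [0, 1, 2, 3, 4, 5, 6 :: 7]"
proof (rule sorted_distinct_set_unique)
  have "card (set xs) = CARD(7)" using assms by (simp only: distinct_card) simp
  then have "set xs = UNIV" by (intro card_subset_eq) simp_all
  then show "set (sort xs) = set [0, 1, 2, 3, 4, 5, 6 :: 7]" unfolding UNIV_7 by simp
  show "sorted [0, 1, 2, 3, 4, 5, 6 :: 7]" by (simp add: less_7 le_less)
qed (use assms in simp_all)

lemma vol0_axis:
  assumes "distinct xs" "length xs = 7" shows "vol0 (map ax xs) = isgn xs"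
proof -
  have d: "distinct [1,2,3,4,5,6,0::7]" and l: "length [1,2,3,4,5,6,0::7] = 7" by simp_all
  have "vol0 (map ax [1,2,3,4,5,6,0]) = isgn [1,2,3,4,5,6,0::7] * vol0 (map ax [0,1,2,3,4,5,6])"
    using altf_sort[OF altf_vol0 l d, of ax] unfolding sort_7[OF d l] .
  \<comment> \<open>The numeral 7 is 0 and comes last in the volume form; bringing it to the front
    takes six swaps, so both orders give the same orientation.\<close>
  moreover have "inversions [1,2,3,4,5,6,0::7] = 6"
    unfolding inversions.simps filter.simps less_7 if_True if_False by simp
  moreover have "vol0 (map ax [1,2,3,4,5,6,0]) = 1"
  proof -
    have z: "(7 :: 7) = 0" by simp
    show ?thesis unfolding z by (rule ew_axis[OF d])
  qed
  ultimately have "vol0 (map ax [0,1,2,3,4,5,6]) = 1" by (simp only:) simp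
  with altf_sort[OF altf_vol0 assms(2,1), of ax] show ?thesis unfolding sort_7[OF assms] by simp
qed

lemma altf_move:
  fixes W :: "'v::real_vector list \<Rightarrow> real"
  assumes W: "altf n W" and "length pre + Suc (length xs + length ys) = n"
  shows "W (pre @ xs @ x # ys) = (-1) ^ length xs * W (pre @ x # xs @ ys)"
  using assms(2)
proof (induction xs arbitrary: pre)
  case (Cons y xs)
  have "W ((pre @ [y]) @ xs @ x # ys) = (-1) ^ length xs * W ((pre @ [y]) @ x # xs @ ys)" by (rule Cons.IH) (use Cons.prems in simp)
  then show ?case using altf_swap[OF W, of pre "xs @ ys" y x] Cons.prems by simp
qed simp

lemma hodge_axis:
  assumes W: "altf k W" and kl: "k + l = 7" and js: "length js = l" and L: "length L = k" and d: "distinct (L @ js)"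
  shows "(\<Sum>is\<in>tuples k UNIV. W (map ax is) * vol0 (map ax is @ map ax js)) = fact k * (W (map ax L) * isgn (L @ js))"
proof -
  have "card (set (L @ js)) = CARD(7)" using d L js kl by (simp only: distinct_card) simp
  then have "set (L @ js) = UNIV" by (intro card_subset_eq) auto
  moreover have "altf (k + l) vol0" using altf_vol0 kl by simp
  ultimately show ?thesis
    using hodge_complement[OF W _ js L d, of vol0 ax] vol0_axis[OF d] L js kl by simp
qed

text \<open>The Hodge dual of \<phi> before the division by 3!.\<close>

definition S4 :: "(real ^ 7) list \<Rightarrow> real" where
  "S4 us = (\<Sum>is\<in>tuples 3 UNIV. phi0 (map ax is) * vol0 (map ax is @ us))"

lemma hodge3: "distinct [x, y, z, a, b, c, d] \<Longrightarrow> S4 [ax a, ax b, ax c, ax d] = 6 * (ph x y z * isgn [x, y, z, a, b, c, d])"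
  using hodge_axis[OF altf_phi0, of 4 "[a, b, c, d]" "[x, y, z]"] by (simp add: S4_def phi0_axis fact_numeral del: inversions.simps)

text \<open>Each value is six times the component of \<phi> at the three complementary indices, with
  the sign of the concatenated list.\<close>

lemma star_sorted:
  "S4 [ax 0, ax 1, ax 2, ax 3] = 6 * ps 0 1 2 3"
  "S4 [ax 0, ax 1, ax 2, ax 4] = 6 * ps 0 1 2 4"
  "S4 [ax 0, ax 1, ax 2, ax 5] = 6 * ps 0 1 2 5"
  "S4 [ax 0, ax 1, ax 2, ax 6] = 6 * ps 0 1 2 6"
  "S4 [ax 0, ax 1, ax 3, ax 4] = 6 * ps 0 1 3 4"
  "S4 [ax 0, ax 1, ax 3, ax 5] = 6 * ps 0 1 3 5"
  "S4 [ax 0, ax 1, ax 3, ax 6] = 6 * ps 0 1 3 6"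
  "S4 [ax 0, ax 1, ax 4, ax 5] = 6 * ps 0 1 4 5"
  "S4 [ax 0, ax 1, ax 4, ax 6] = 6 * ps 0 1 4 6"
  "S4 [ax 0, ax 1, ax 5, ax 6] = 6 * ps 0 1 5 6"
  "S4 [ax 0, ax 2, ax 3, ax 4] = 6 * ps 0 2 3 4"
  "S4 [ax 0, ax 2, ax 3, ax 5] = 6 * ps 0 2 3 5"
  "S4 [ax 0, ax 2, ax 3, ax 6] = 6 * ps 0 2 3 6"
  "S4 [ax 0, ax 2, ax 4, ax 5] = 6 * ps 0 2 4 5"
  "S4 [ax 0, ax 2, ax 4, ax 6] = 6 * ps 0 2 4 6"
  "S4 [ax 0, ax 2, ax 5, ax 6] = 6 * ps 0 2 5 6"
  "S4 [ax 0, ax 3, ax 4, ax 5] = 6 * ps 0 3 4 5"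
  "S4 [ax 0, ax 3, ax 4, ax 6] = 6 * ps 0 3 4 6"
  "S4 [ax 0, ax 3, ax 5, ax 6] = 6 * ps 0 3 5 6"
  "S4 [ax 0, ax 4, ax 5, ax 6] = 6 * ps 0 4 5 6"
  "S4 [ax 1, ax 2, ax 3, ax 4] = 6 * ps 1 2 3 4"
  "S4 [ax 1, ax 2, ax 3, ax 5] = 6 * ps 1 2 3 5"
  "S4 [ax 1, ax 2, ax 3, ax 6] = 6 * ps 1 2 3 6"
  "S4 [ax 1, ax 2, ax 4, ax 5] = 6 * ps 1 2 4 5"
  "S4 [ax 1, ax 2, ax 4, ax 6] = 6 * ps 1 2 4 6"
  "S4 [ax 1, ax 2, ax 5, ax 6] = 6 * ps 1 2 5 6"
  "S4 [ax 1, ax 3, ax 4, ax 5] = 6 * ps 1 3 4 5"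
  "S4 [ax 1, ax 3, ax 4, ax 6] = 6 * ps 1 3 4 6"
  "S4 [ax 1, ax 3, ax 5, ax 6] = 6 * ps 1 3 5 6"
  "S4 [ax 1, ax 4, ax 5, ax 6] = 6 * ps 1 4 5 6"
  "S4 [ax 2, ax 3, ax 4, ax 5] = 6 * ps 2 3 4 5"
  "S4 [ax 2, ax 3, ax 4, ax 6] = 6 * ps 2 3 4 6"
  "S4 [ax 2, ax 3, ax 5, ax 6] = 6 * ps 2 3 5 6"
  "S4 [ax 2, ax 4, ax 5, ax 6] = 6 * ps 2 4 5 6"
  "S4 [ax 3, ax 4, ax 5, ax 6] = 6 * ps 3 4 5 6"
proof -
  note inv_7 = inversions.simps filter.simps less_7 if_True if_False
  show "S4 [ax 0, ax 1, ax 2, ax 3] = 6 * ps 0 1 2 3"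
    by (subst hodge3[of 4 5 6 0 1 2 3], simp, unfold inv_7, simp add: ph_rows ps_rows)
  show "S4 [ax 0, ax 1, ax 2, ax 4] = 6 * ps 0 1 2 4"
    by (subst hodge3[of 3 5 6 0 1 2 4], simp, unfold inv_7, simp add: ph_rows ps_rows)
  show "S4 [ax 0, ax 1, ax 2, ax 5] = 6 * ps 0 1 2 5"
    by (subst hodge3[of 3 4 6 0 1 2 5], simp, unfold inv_7, simp add: ph_rows ps_rows)
  show "S4 [ax 0, ax 1, ax 2, ax 6] = 6 * ps 0 1 2 6"
    by (subst hodge3[of 3 4 5 0 1 2 6], simp, unfold inv_7, simp add: ph_rows ps_rows)
  show "S4 [ax 0, ax 1, ax 3, ax 4] = 6 * ps 0 1 3 4"
    by (subst hodge3[of 2 5 6 0 1 3 4], simp, unfold inv_7, simp add: ph_rows ps_rows)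
  show "S4 [ax 0, ax 1, ax 3, ax 5] = 6 * ps 0 1 3 5"
    by (subst hodge3[of 2 4 6 0 1 3 5], simp, unfold inv_7, simp add: ph_rows ps_rows)
  show "S4 [ax 0, ax 1, ax 3, ax 6] = 6 * ps 0 1 3 6"
    by (subst hodge3[of 2 4 5 0 1 3 6], simp, unfold inv_7, simp add: ph_rows ps_rows)
  show "S4 [ax 0, ax 1, ax 4, ax 5] = 6 * ps 0 1 4 5"
    by (subst hodge3[of 2 3 6 0 1 4 5], simp, unfold inv_7, simp add: ph_rows ps_rows)
  show "S4 [ax 0, ax 1, ax 4, ax 6] = 6 * ps 0 1 4 6"
    by (subst hodge3[of 2 3 5 0 1 4 6], simp, unfold inv_7, simp add: ph_rows ps_rows)
  show "S4 [ax 0, ax 1, ax 5, ax 6] = 6 * ps 0 1 5 6"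
    by (subst hodge3[of 2 3 4 0 1 5 6], simp, unfold inv_7, simp add: ph_rows ps_rows)
  show "S4 [ax 0, ax 2, ax 3, ax 4] = 6 * ps 0 2 3 4"
    by (subst hodge3[of 1 5 6 0 2 3 4], simp, unfold inv_7, simp add: ph_rows ps_rows)
  show "S4 [ax 0, ax 2, ax 3, ax 5] = 6 * ps 0 2 3 5"
    by (subst hodge3[of 1 4 6 0 2 3 5], simp, unfold inv_7, simp add: ph_rows ps_rows)
  show "S4 [ax 0, ax 2, ax 3, ax 6] = 6 * ps 0 2 3 6"
    by (subst hodge3[of 1 4 5 0 2 3 6], simp, unfold inv_7, simp add: ph_rows ps_rows)
  show "S4 [ax 0, ax 2, ax 4, ax 5] = 6 * ps 0 2 4 5"
    by (subst hodge3[of 1 3 6 0 2 4 5], simp, unfold inv_7, simp add: ph_rows ps_rows)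
  show "S4 [ax 0, ax 2, ax 4, ax 6] = 6 * ps 0 2 4 6"
    by (subst hodge3[of 1 3 5 0 2 4 6], simp, unfold inv_7, simp add: ph_rows ps_rows)
  show "S4 [ax 0, ax 2, ax 5, ax 6] = 6 * ps 0 2 5 6"
    by (subst hodge3[of 1 3 4 0 2 5 6], simp, unfold inv_7, simp add: ph_rows ps_rows)
  show "S4 [ax 0, ax 3, ax 4, ax 5] = 6 * ps 0 3 4 5"
    by (subst hodge3[of 1 2 6 0 3 4 5], simp, unfold inv_7, simp add: ph_rows ps_rows)
  show "S4 [ax 0, ax 3, ax 4, ax 6] = 6 * ps 0 3 4 6"
    by (subst hodge3[of 1 2 5 0 3 4 6], simp, unfold inv_7, simp add: ph_rows ps_rows)
  show "S4 [ax 0, ax 3, ax 5, ax 6] = 6 * ps 0 3 5 6"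
    by (subst hodge3[of 1 2 4 0 3 5 6], simp, unfold inv_7, simp add: ph_rows ps_rows)
  show "S4 [ax 0, ax 4, ax 5, ax 6] = 6 * ps 0 4 5 6"
    by (subst hodge3[of 1 2 3 0 4 5 6], simp, unfold inv_7, simp add: ph_rows ps_rows)
  show "S4 [ax 1, ax 2, ax 3, ax 4] = 6 * ps 1 2 3 4"
    by (subst hodge3[of 0 5 6 1 2 3 4], simp, unfold inv_7, simp add: ph_rows ps_rows)
  show "S4 [ax 1, ax 2, ax 3, ax 5] = 6 * ps 1 2 3 5"
    by (subst hodge3[of 0 4 6 1 2 3 5], simp, unfold inv_7, simp add: ph_rows ps_rows)
  show "S4 [ax 1, ax 2, ax 3, ax 6] = 6 * ps 1 2 3 6"
    by (subst hodge3[of 0 4 5 1 2 3 6], simp, unfold inv_7, simp add: ph_rows ps_rows)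
  show "S4 [ax 1, ax 2, ax 4, ax 5] = 6 * ps 1 2 4 5"
    by (subst hodge3[of 0 3 6 1 2 4 5], simp, unfold inv_7, simp add: ph_rows ps_rows)
  show "S4 [ax 1, ax 2, ax 4, ax 6] = 6 * ps 1 2 4 6"
    by (subst hodge3[of 0 3 5 1 2 4 6], simp, unfold inv_7, simp add: ph_rows ps_rows)
  show "S4 [ax 1, ax 2, ax 5, ax 6] = 6 * ps 1 2 5 6"
    by (subst hodge3[of 0 3 4 1 2 5 6], simp, unfold inv_7, simp add: ph_rows ps_rows)
  show "S4 [ax 1, ax 3, ax 4, ax 5] = 6 * ps 1 3 4 5"
    by (subst hodge3[of 0 2 6 1 3 4 5], simp, unfold inv_7, simp add: ph_rows ps_rows)
  show "S4 [ax 1, ax 3, ax 4, ax 6] = 6 * ps 1 3 4 6"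
    by (subst hodge3[of 0 2 5 1 3 4 6], simp, unfold inv_7, simp add: ph_rows ps_rows)
  show "S4 [ax 1, ax 3, ax 5, ax 6] = 6 * ps 1 3 5 6"
    by (subst hodge3[of 0 2 4 1 3 5 6], simp, unfold inv_7, simp add: ph_rows ps_rows)
  show "S4 [ax 1, ax 4, ax 5, ax 6] = 6 * ps 1 4 5 6"
    by (subst hodge3[of 0 2 3 1 4 5 6], simp, unfold inv_7, simp add: ph_rows ps_rows)
  show "S4 [ax 2, ax 3, ax 4, ax 5] = 6 * ps 2 3 4 5"
    by (subst hodge3[of 0 1 6 2 3 4 5], simp, unfold inv_7, simp add: ph_rows ps_rows)
  show "S4 [ax 2, ax 3, ax 4, ax 6] = 6 * ps 2 3 4 6"
    by (subst hodge3[of 0 1 5 2 3 4 6], simp, unfold inv_7, simp add: ph_rows ps_rows)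
  show "S4 [ax 2, ax 3, ax 5, ax 6] = 6 * ps 2 3 5 6"
    by (subst hodge3[of 0 1 4 2 3 5 6], simp, unfold inv_7, simp add: ph_rows ps_rows)
  show "S4 [ax 2, ax 4, ax 5, ax 6] = 6 * ps 2 4 5 6"
    by (subst hodge3[of 0 1 3 2 4 5 6], simp, unfold inv_7, simp add: ph_rows ps_rows)
  show "S4 [ax 3, ax 4, ax 5, ax 6] = 6 * ps 3 4 5 6"
    by (subst hodge3[of 0 1 2 3 4 5 6], simp, unfold inv_7, simp add: ph_rows ps_rows)
qed

lemma altf_S4: "altf 4 S4"
  unfolding altf_def ml_def
proof (intro conjI allI impI)
  fix us :: "(real ^ 7) list" and i :: nat assume us: "length us = 4" "i < 4"
  have "linear (\<lambda>x. vol0 (map ax is @ us[i := x]))" if "is \<in> tuples 3 UNIV" for "is"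
    using mlD[OF altf_ml[OF altf_vol0], of "map ax is @ us" "3 + i"] us that by (simp add: tuples_def list_update_append)
  then show "linear (\<lambda>x. S4 (us[i := x]))"
    unfolding S4_def by (intro linear_compose_sum ballI) (simp add: linear_iff algebra_simps)
next
  fix us :: "(real ^ 7) list" and i j :: nat assume us: "length us = 4" "i < 4" "j < 4" "i \<noteq> j" "us ! i = us ! j"
  have "vol0 (map ax is @ us) = 0" if "is \<in> tuples 3 UNIV" for "is"
  proof (rule altf_zero[OF altf_vol0])
    have "\<not> distinct us" using us by (auto simp: distinct_conv_nth)
    then show "\<not> distinct (map ax is @ us)" by simp
  qed (use us that in \<open>simp add: tuples_def\<close>)
  then show "S4 us = 0" unfolding S4_def by (simp add: sum.neutral)
qed

lemma ps_not_distinct: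
  assumes "\<not> distinct [a, b, c, d]" shows "ps a b c d = 0"
proof -
  have 1: "ps x x y z = 0" for x y z using ps_swap12[of x x y z] by simp
  have 2: "ps x y y z = 0" for x y z using ps_swap23[of x y y z] by simp
  have 3: "ps x y z z = 0" for x y z using ps_swap34[of x y z z] by simp
  have 4: "ps x y x z = 0" for x y z using ps_swap23[of x y x z] ps_swap23[of x x y z] 1[of x y z] by simp
  have 5: "ps x y z y = 0" for x y z using ps_swap34[of x y z y] ps_swap34[of x y y z] 2[of x y z] by simp
  have 6: "ps x y z x = 0" for x y z using ps_swap34[of x y z x] ps_swap34[of x y x z] 4[of x y z] by simp
  show ?thesis using assms 1 2 3 4 5 6 by auto
qed

text \<open>Both sides change sign under adjacent swaps, so \<open>sort_sign\<close> reduces the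
  comparison to the 35 increasing quadruples.\<close>

lemma star_phi0: "S4 [ax a, ax b, ax c, ax d] = 6 * ps a b c d"
proof (cases "distinct [a, b, c, d]")
  case False
  have "S4 (map ax [a, b, c, d]) = 0"
    by (rule altf_zero[OF altf_S4]) (use False in \<open>simp_all add: axis_eq_axis\<close>)
  then show ?thesis using ps_not_distinct[OF False] by simp
next
  case True
  define F where "F xs = S4 (map ax xs) - 6 * ps (xs ! 0) (xs ! 1) (xs ! 2) (xs ! 3)" for xs
  have F12: "F [b, a, c, d] = - F [a, b, c, d]" for a b c d
    using altf_swap[OF altf_S4, of "[]" "[ax c, ax d]" "ax b" "ax a"] ps_swap12[of b a c d] by (simp add: F_def)
  have F23: "F [a, c, b, d] = - F [a, b, c, d]" for a b c d
    using altf_swap[OF altf_S4, of "[ax a]" "[ax d]" "ax c" "ax b"] ps_swap23[of a c b d] by (simp add: F_def)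
  have F34: "F [a, b, d, c] = - F [a, b, c, d]" for a b c d
    using altf_swap[OF altf_S4, of "[ax a, ax b]" "[]" "ax d" "ax c"] ps_swap34[of a b d c] by (simp add: F_def)
  have sw: "F (xs @ y # x # ys) = -1 * F (xs @ x # y # ys)" if l: "length xs + Suc (Suc (length ys)) = 4" for xs x y ys
  proof -
    have "length xs = 0 \<and> length ys = 2 \<or> length xs = 1 \<and> length ys = 1 \<or> length xs = 2 \<and> length ys = 0" using l by arith
    then show ?thesis
      by (elim disjE) (auto simp: length_Suc_conv numeral_2_eq_2 intro: F12 F23 F34)
  qed
  have F0: "F xs = 0" if s: "sorted xs" "distinct xs" and l: "length xs = 4" for xs
  proof -
    obtain a b c d where xs: "xs = [a, b, c, d]" using l by (auto simp: length_Suc_conv numeral_eq_Suc)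
    have "\<forall>a b. a < b \<longrightarrow> (\<forall>c. b < c \<longrightarrow> (\<forall>d. c < d \<longrightarrow> S4 [ax a, ax b, ax c, ax d] = 6 * ps a b c d))"
      unfolding forall_7 less_7 by (simp add: star_sorted)
    moreover have "a < b" "b < c" "c < d" using s xs by auto
    ultimately show ?thesis by (simp add: F_def xs)
  qed
  have "F (sort [a, b, c, d]) = 0"
    by (rule F0[OF sorted_sort]) (simp_all only: distinct_sort length_sort True, simp)
  moreover have "F ([] @ [a, b, c, d]) = (-1) ^ inversions [a, b, c, d] * F ([] @ sort [a, b, c, d])"
    by (rule sort_sign[where f = F and s = "-1" and k = 4, OF sw]) (use True in simp_all)
  ultimately have "F [a, b, c, d] = 0" by (simp only: append_Nil mult_zero_right)
  then show ?thesis by (simp add: F_def)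
qed

section \<open>The three-form determines the metric and the volume form\<close>

lemma ph_ph: "(\<Sum>c\<in>UNIV. \<Sum>d\<in>UNIV. ph m c d * ph j c d) = (if m = j then 6 else 0)"
  using exhaust_7[of m] exhaust_7[of j] by (elim disjE) (simp_all add: sum_7 ph_rows)

lemma delta2: "(\<Sum>c\<in>UNIV. \<Sum>d\<in>UNIV. of_bool (a = c \<and> b = d) * f c d) = (f (a :: 'a::finite) (b :: 'b::finite) :: real)"
proof -
  have "(\<Sum>d\<in>UNIV. of_bool (a = c \<and> b = d) * f c d) = (if a = c then f c b else 0)" for c
    by (cases "a = c") (simp_all add: of_bool_def mult_delta_left)
  then show ?thesis by simp
qed

text \<open>The product of two \<open>ph\<close> contributes 6 by \<open>ph_ph\<close>, and each of
  the two delta terms in \<open>ps\<close> takes away 1.\<close>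

lemma ps_ph: "(\<Sum>c\<in>UNIV. \<Sum>d\<in>UNIV. ps a b c d * ph j c d) = 4 * ph a b j"
proof -
  have "(\<Sum>c\<in>UNIV. \<Sum>d\<in>UNIV. ps a b c d * ph j c d) = (\<Sum>c\<in>UNIV. \<Sum>d\<in>UNIV. \<Sum>m\<in>UNIV. ph a b m * (ph m c d * ph j c d))
      - (\<Sum>c\<in>UNIV. \<Sum>d\<in>UNIV. of_bool (a = c \<and> b = d) * ph j c d) + (\<Sum>c\<in>UNIV. \<Sum>d\<in>UNIV. of_bool (a = d \<and> b = c) * ph j c d)"
    unfolding ps_def by (simp add: algebra_simps sum.distrib sum_subtractf sum_distrib_left sum_distrib_right)
  also have "(\<Sum>c\<in>UNIV. \<Sum>d\<in>UNIV. \<Sum>m\<in>UNIV. ph a b m * (ph m c d * ph j c d)) = (\<Sum>m\<in>UNIV. ph a b m * (\<Sum>c\<in>UNIV. \<Sum>d\<in>UNIV. ph m c d * ph j c d))"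
  proof -
    have "(\<Sum>c\<in>UNIV. \<Sum>d\<in>UNIV. \<Sum>m\<in>UNIV. ph a b m * (ph m c d * ph j c d)) = (\<Sum>c\<in>UNIV. \<Sum>m\<in>UNIV. \<Sum>d\<in>UNIV. ph a b m * (ph m c d * ph j c d))"
      by (intro sum.cong refl sum.swap)
    also have "\<dots> = (\<Sum>m\<in>UNIV. \<Sum>c\<in>UNIV. \<Sum>d\<in>UNIV. ph a b m * (ph m c d * ph j c d))" by (rule sum.swap)
    finally show ?thesis by (simp add: sum_distrib_left)
  qed
  also have "\<dots> = 6 * ph a b j" unfolding ph_ph by (simp add: if_distrib cong: if_cong)
  also have "(\<Sum>c\<in>UNIV. \<Sum>d\<in>UNIV. of_bool (a = c \<and> b = d) * ph j c d) = ph j a b"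
    by (rule delta2)
  also have "(\<Sum>c\<in>UNIV. \<Sum>d\<in>UNIV. of_bool (a = d \<and> b = c) * ph j c d) = ph j b a"
    unfolding conj_commute[of "a = _"] by (rule delta2)
  also have "ph j b a = - ph j a b" by (rule ph_swap23)
  also have "ph j a b = ph a b j" by (rule ph_cyc[symmetric])
  finally show ?thesis by simp
qed

text \<open>N is the transpose of M. In a full contraction it passes from one factor to the other
  slot by slot.\<close>

lemma ml_adjoint:
  fixes W W' :: "(real ^ 'n) list \<Rightarrow> real"
  assumes "ml k W" "ml k W'" and MN: "\<And>i j. M i $ j = N j $ i"
  shows "(\<Sum>is\<in>tuples k UNIV. W (map M is) * W' (map ax is)) = (\<Sum>is\<in>tuples k UNIV. W (map ax is) * W' (map N is))"
  using assms(1,2)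
proof (induction k arbitrary: W W')
  case 0
  then show ?case by (simp add: sum_tuples_0)
next
  case (Suc k)
  have "(\<Sum>is\<in>tuples (Suc k) UNIV. W (map M is) * W' (map ax is))
    = (\<Sum>i\<in>UNIV. \<Sum>is\<in>tuples k UNIV. W (M i # map M is) * W' (ax i # map ax is))"
    by (simp add: sum_tuples_Suc)
  also have "\<dots> = (\<Sum>i\<in>UNIV. \<Sum>is\<in>tuples k UNIV. W (M i # map ax is) * W' (ax i # map N is))"
    by (intro sum.cong refl Suc.IH ml_Cons Suc.prems)
  also have "\<dots> = (\<Sum>is\<in>tuples k UNIV. \<Sum>i\<in>UNIV. W (M i # map ax is) * W' (ax i # map N is))"
    by (rule sum.swap)
  also have "\<dots> = (\<Sum>is\<in>tuples k UNIV. \<Sum>j\<in>UNIV. W (ax j # map ax is) * W' (N j # map N is))"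
  proof (rule sum.cong[OF refl])
    fix "is" :: "'n list" assume "is \<in> tuples k UNIV"
    then have l: "length (map (ax :: 'n \<Rightarrow> _) is) = k" "length (map N is) = k" by (simp_all add: tuples_def)
    have "(\<Sum>i\<in>UNIV. W (M i # map ax is) * W' (ax i # map N is)) = (\<Sum>i\<in>UNIV. \<Sum>j\<in>UNIV. M i $ j * W (ax j # map ax is) * W' (ax i # map N is))"
      by (subst linear_axis_sum[OF ml_head[OF Suc.prems(1) l(1)], of "M _"]) (simp add: sum_distrib_right)
    also have "\<dots> = (\<Sum>j\<in>UNIV. \<Sum>i\<in>UNIV. M i $ j * W (ax j # map ax is) * W' (ax i # map N is))" by (rule sum.swap)
    also have "\<dots> = (\<Sum>j\<in>UNIV. W (ax j # map ax is) * W' (N j # map N is))"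
      by (subst linear_axis_sum[OF ml_head[OF Suc.prems(2) l(2)], of "N _"]) (simp add: sum_distrib_left MN mult_ac)
    finally show "(\<Sum>i\<in>UNIV. W (M i # map ax is) * W' (ax i # map N is)) = (\<Sum>j\<in>UNIV. W (ax j # map ax is) * W' (N j # map N is))" .
  qed
  also have "\<dots> = (\<Sum>j\<in>UNIV. \<Sum>is\<in>tuples k UNIV. W (ax j # map ax is) * W' (N j # map N is))"
    by (rule sum.swap)
  finally show ?case by (simp add: sum_tuples_Suc)
qed

lemma vol0_multiple:
  assumes W: "altf 7 W" and us: "length us = 7"
  shows "W us = W (map ax [0, 1, 2, 3, 4, 5, 6]) * vol0 us"
proof (rule altf_ext[OF W _ us])
  show "altf 7 (\<lambda>us. W (map ax [0, 1, 2, 3, 4, 5, 6]) * vol0 us)"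
    using altf_vol0 unfolding altf_def ml_def by (auto simp: linear_iff algebra_simps)
  fix "is" :: "7 list" assume i: "length is = 7" "sorted is" "distinct is"
  have "set is = UNIV" using i by (intro card_subset_eq) (auto simp: distinct_card)
  then have "set is = set [0, 1, 2, 3, 4, 5, 6]" using UNIV_7 by auto
  then have "is = [0, 1, 2, 3, 4, 5, 6]" by (intro sorted_distinct_set_unique i) (simp_all add: less_7 le_less)
  moreover have "vol0 (map ax [0, 1, 2, 3, 4, 5, 6]) = 1"
  proof -
    have "vol0 (map ax [0, 1, 2, 3, 4, 5, 6]) = isgn [0, 1, 2, 3, 4, 5, 6 :: 7]" by (rule vol0_axis) simp_all
    also have "inversions [0, 1, 2, 3, 4, 5, 6 :: 7] = 0" unfolding inversions.simps filter.simps less_7 if_True if_False by simp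
    finally show ?thesis by (simp only: power_0)
  qed
  ultimately show "W (map ax is) = W (map ax [0, 1, 2, 3, 4, 5, 6]) * vol0 (map ax is)" by (simp only: mult_1_right)
qed

lemma ew_scale:
  assumes "length us = length is" shows "ew is (map ((*\<^sub>R) r) us) = r ^ length is * ew is us"
  unfolding ew_def sum_distrib_left
proof (rule sum.cong[OF refl])
  fix \<sigma> assume "\<sigma> \<in> {\<sigma>. \<sigma> permutes {..<length is}}"
  then have "\<sigma> a < length is" if "a < length is" for a using permutes_in_image[of \<sigma> "{..<length is}" a] that by simp
  then have "(\<Prod>a<length is. (map ((*\<^sub>R) r) us ! \<sigma> a) $ (is ! a)) = (\<Prod>a<length is. r * (us ! \<sigma> a) $ (is ! a))"
    using assms by (intro prod.cong) auto
  also have "\<dots> = r ^ length is * (\<Prod>a<length is. (us ! \<sigma> a) $ (is ! a))" by (simp add: prod.distrib)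
  finally show "of_int (sign \<sigma>) * (\<Prod>a<length is. (map ((*\<^sub>R) r) us ! \<sigma> a) $ (is ! a))
    = r ^ length is * (of_int (sign \<sigma>) * (\<Prod>a<length is. (us ! \<sigma> a) $ (is ! a)))" by simp
qed

text \<open>The tensor product of the two interior products and \<phi>, not antisymmetrised: pairing
  with \<open>vol0\<close> does this. The pairing is therefore 2! 2! 3! = 24 times the coefficient 6
  \<langle>x, y\<rangle> of the wedge product, which explains the constant 144 in
  \<open>T7_vol0\<close>.\<close>

definition T7 :: "real ^ 7 \<Rightarrow> real ^ 7 \<Rightarrow> (real ^ 7) list \<Rightarrow> real" where
  "T7 x y us = phi0 [x, us ! 0, us ! 1] * phi0 [y, us ! 2, us ! 3] * phi0 [us ! 4, us ! 5, us ! 6]"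

lemma phi0_linear: "linear (\<lambda>z. phi0 [z, x, y])" "linear (\<lambda>z. phi0 [x, z, y])" "linear (\<lambda>z. phi0 [x, y, z])"
  using mlD[OF altf_ml[OF altf_phi0], of "[0, x, y]" 0] mlD[OF altf_ml[OF altf_phi0], of "[x, 0, y]" 1]
    mlD[OF altf_ml[OF altf_phi0], of "[x, y, 0]" 2] by (simp_all add: numeral_2_eq_2)

lemma ml_T7: "ml 7 (T7 x y)"
  unfolding ml_def
proof (intro allI impI)
  fix us :: "(real ^ 7) list" and i :: nat assume us: "length us = 7" "i < 7"
  have "i = 0 \<or> i = 1 \<or> i = 2 \<or> i = 3 \<or> i = 4 \<or> i = 5 \<or> i = 6" using us by arith
  then show "linear (\<lambda>z. T7 x y (us[i := z]))"
    using us by (elim disjE) (use phi0_linear in \<open>simp_all add: T7_def linear_iff algebra_simps\<close>)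
qed

text \<open>The metric is recovered from the three-form by \<open>(u \<lrcorner> \<phi>) \<and> (v \<lrcorner> \<phi>) \<and> \<phi> = 6 \<langle>u, v\<rangle> vol\<close>.\<close>

lemma T7_vol0: "(\<Sum>is\<in>tuples 7 UNIV. T7 u v (map ax is) * vol0 (map ax is)) = 144 * (u \<bullet> v)"
proof -
  \<comment> \<open>Moving three arguments past four is an even permutation.\<close>
  have sw: "vol0 ([a, b, c, d] @ [e, f, g]) = vol0 ([e, f, g] @ [a, b, c, d])" for a b c d e f g
    using altf_move[OF altf_vol0, of "[]" "[a, b, c, d]" "[f, g]" e] altf_move[OF altf_vol0, of "[e]" "[a, b, c, d]" "[g]" f]
      altf_move[OF altf_vol0, of "[e, f]" "[a, b, c, d]" "[]" g] by simp
  have e: "(\<Sum>js\<in>tuples 3 UNIV. T7 u v (map ax ([a, b, c, d] @ js)) * vol0 (map ax ([a, b, c, d] @ js)))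
      = phi0 [u, ax a, ax b] * phi0 [v, ax c, ax d] * (6 * ps a b c d)" for a b c d
  proof -
    have "T7 u v (map ax ([a, b, c, d] @ js)) * vol0 (map ax ([a, b, c, d] @ js)) =
      phi0 [u, ax a, ax b] * phi0 [v, ax c, ax d] * (phi0 (map ax js) * vol0 (map ax js @ [ax a, ax b, ax c, ax d]))"
      if "js \<in> tuples 3 UNIV" for js
    proof -
      have "length js = Suc (Suc (Suc 0))" using that by (simp add: tuples_def)
      then obtain x y z where js: "js = [x, y, z]" by (auto simp: length_Suc_conv)
      show ?thesis using sw[of "ax a" "ax b" "ax c" "ax d" "ax x" "ax y" "ax z"] by (simp add: js T7_def)
    qed
    then have "(\<Sum>js\<in>tuples 3 UNIV. T7 u v (map ax ([a, b, c, d] @ js)) * vol0 (map ax ([a, b, c, d] @ js)))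
      = phi0 [u, ax a, ax b] * phi0 [v, ax c, ax d] * S4 [ax a, ax b, ax c, ax d]"
      by (simp add: S4_def sum_distrib_left)
    then show ?thesis by (simp add: star_phi0)
  qed
  have p: "phi0 [u, ax a, ax b] = (\<Sum>i\<in>UNIV. u $ i * ph i a b)" for u a b
    using linear_axis_sum[OF phi0_linear(1)[of "ax a" "ax b"], of u] by (simp add: phi0_axis)
  have "(\<Sum>is\<in>tuples 7 UNIV. T7 u v (map ax is) * vol0 (map ax is)) =
    (\<Sum>is\<in>tuples 4 UNIV. \<Sum>js\<in>tuples 3 UNIV. T7 u v (map ax (is @ js)) * vol0 (map ax (is @ js)))"
    using sum_tuples_add[of "\<lambda>is. T7 u v (map ax is) * vol0 (map ax is)" 4 3 UNIV] by simp
  also have "\<dots> = (\<Sum>a\<in>UNIV. \<Sum>b\<in>UNIV. \<Sum>c\<in>UNIV. \<Sum>d\<in>UNIV. \<Sum>js\<in>tuples 3 UNIV. T7 u v (map ax ([a, b, c, d] @ js)) * vol0 (map ax ([a, b, c, d] @ js)))"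
  proof -
    have n: "(4::nat) = Suc (Suc (Suc (Suc 0)))" by simp
    show ?thesis unfolding n sum_tuples_Suc sum_tuples_0 ..
  qed
  also have "\<dots> = (\<Sum>a\<in>UNIV. \<Sum>b\<in>UNIV. phi0 [u, ax a, ax b] * (\<Sum>c\<in>UNIV. \<Sum>d\<in>UNIV. 6 * (ps a b c d * phi0 [v, ax c, ax d])))"
    unfolding e by (simp add: sum_distrib_left mult_ac)
  also have "\<dots> = (\<Sum>a\<in>UNIV. \<Sum>b\<in>UNIV. phi0 [u, ax a, ax b] * (24 * phi0 [v, ax a, ax b]))"
  proof (intro sum.cong refl arg_cong[of _ _ "\<lambda>x. _ * x"])
    fix a b
    have "(\<Sum>c\<in>UNIV. \<Sum>d\<in>UNIV. 6 * (ps a b c d * phi0 [v, ax c, ax d])) = (\<Sum>c\<in>UNIV. \<Sum>d\<in>UNIV. \<Sum>j\<in>UNIV. 6 * v $ j * (ps a b c d * ph j c d))"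
      unfolding p by (simp add: sum_distrib_left mult_ac)
    also have "\<dots> = (\<Sum>c\<in>UNIV. \<Sum>j\<in>UNIV. \<Sum>d\<in>UNIV. 6 * v $ j * (ps a b c d * ph j c d))"
      by (intro sum.cong refl sum.swap)
    also have "\<dots> = (\<Sum>j\<in>UNIV. \<Sum>c\<in>UNIV. \<Sum>d\<in>UNIV. 6 * v $ j * (ps a b c d * ph j c d))" by (rule sum.swap)
    also have "\<dots> = (\<Sum>j\<in>UNIV. 6 * v $ j * (4 * ph a b j))"
      unfolding ps_ph[symmetric] by (simp add: sum_distrib_left)
    also have "\<dots> = 24 * phi0 [v, ax a, ax b]"
      unfolding p by (simp add: sum_distrib_left mult_ac ph_cyc[of a b])
    finally show "(\<Sum>c\<in>UNIV. \<Sum>d\<in>UNIV. 6 * (ps a b c d * phi0 [v, ax c, ax d])) = 24 * phi0 [v, ax a, ax b]" .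
  qed
  also have "\<dots> = (\<Sum>a\<in>UNIV. \<Sum>b\<in>UNIV. \<Sum>i\<in>UNIV. \<Sum>j\<in>UNIV. 24 * u $ i * v $ j * (ph i a b * ph j a b))"
    unfolding p sum_distrib_left[of 24] sum_product by (simp only: mult_ac)
  also have "\<dots> = (\<Sum>i\<in>UNIV. \<Sum>j\<in>UNIV. \<Sum>a\<in>UNIV. \<Sum>b\<in>UNIV. 24 * u $ i * v $ j * (ph i a b * ph j a b))"
  proof -
    have "(\<Sum>a\<in>UNIV. \<Sum>b\<in>UNIV. \<Sum>i\<in>UNIV. \<Sum>j\<in>UNIV. 24 * u $ i * v $ j * (ph i a b * ph j a b))
      = (\<Sum>a\<in>UNIV. \<Sum>i\<in>UNIV. \<Sum>b\<in>UNIV. \<Sum>j\<in>UNIV. 24 * u $ i * v $ j * (ph i a b * ph j a b))"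
      by (rule sum.cong[OF refl], rule sum.swap)
    also have "\<dots> = (\<Sum>i\<in>UNIV. \<Sum>a\<in>UNIV. \<Sum>b\<in>UNIV. \<Sum>j\<in>UNIV. 24 * u $ i * v $ j * (ph i a b * ph j a b))" by (rule sum.swap)
    also have "\<dots> = (\<Sum>i\<in>UNIV. \<Sum>a\<in>UNIV. \<Sum>j\<in>UNIV. \<Sum>b\<in>UNIV. 24 * u $ i * v $ j * (ph i a b * ph j a b))"
      by (rule sum.cong[OF refl], rule sum.cong[OF refl], rule sum.swap)
    also have "\<dots> = (\<Sum>i\<in>UNIV. \<Sum>j\<in>UNIV. \<Sum>a\<in>UNIV. \<Sum>b\<in>UNIV. 24 * u $ i * v $ j * (ph i a b * ph j a b))"
      by (rule sum.cong[OF refl], rule sum.swap)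
    finally show ?thesis .
  qed
  also have "\<dots> = (\<Sum>i\<in>UNIV. \<Sum>j\<in>UNIV. 24 * u $ i * v $ j * (if i = j then 6 else 0))"
    unfolding ph_ph[symmetric] by (simp add: sum_distrib_left)
  also have "\<dots> = 144 * (u \<bullet> v)"
    by (simp add: inner_vec_def sum_distrib_left if_distrib mult_ac cong: if_cong)
  finally show ?thesis .
qed

text \<open>The adjoint N and M itself multiply \<open>vol0\<close> by factors d and d'; these
  determinants agree. As M preserves \<phi>, the expression of the metric through \<phi> shows that
  M scales the metric by 1/d, so d is positive and d N is the inverse of M. Taking volumes then
  leaves only d = 1.\<close>

theorem g2_invariant:
  fixes M :: "real ^ 7 \<Rightarrow> real ^ 7"
  assumes lin: "linear M" and inv: "\<And>us. length us = 3 \<Longrightarrow> phi0 (map M us) = phi0 us"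
  shows "M u \<bullet> M v = u \<bullet> v" and "length us = 7 \<Longrightarrow> vol0 (map M us) = vol0 us"
proof -
  define N where "N = (\<lambda>x. \<chi> i. M (ax i) \<bullet> x)"
  have adj: "M x \<bullet> y = x \<bullet> N y" for x y
  proof -
    have "linear (\<lambda>x. M x \<bullet> y)" using lin by (auto simp: linear_iff inner_add_left)
    from linear_axis_sum[OF this, of x] show ?thesis by (simp add: inner_vec_def[of x] N_def)
  qed
  have linN: "linear N" by (auto simp: linear_iff N_def vec_eq_iff inner_add_right)
  have MN: "M (ax i) $ j = N (ax j) $ i" for i j by (simp add: N_def inner_axis)
  have comp: "altf 7 (\<lambda>us. vol0 (map f us))" if "linear f" for f :: "real ^ 7 \<Rightarrow> real ^ 7"
    unfolding altf_def ml_def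
  proof (intro conjI allI impI)
    fix us :: "(real ^ 7) list" and i :: nat assume us: "length us = 7" "i < 7"
    have "linear ((\<lambda>x. vol0 ((map f us)[i := x])) \<circ> f)"
      by (rule linear_compose[OF that mlD[OF altf_ml[OF altf_vol0]]]) (use us in auto)
    then show "linear (\<lambda>x. vol0 (map f (us[i := x])))" by (simp add: comp_def map_update)
  next
    fix us :: "(real ^ 7) list" and i j :: nat assume us: "length us = 7" "i < 7" "j < 7" "i \<noteq> j" "us ! i = us ! j"
    then show "vol0 (map f us) = 0" using altf_vol0 unfolding altf_def by simp
  qed
  let ?L = "map ax [0, 1, 2, 3, 4, 5, 6] :: (real ^ 7) list"
  define d where "d = vol0 (map N ?L)"
  define d' where "d' = vol0 (map M ?L)"
  have dN: "vol0 (map N us) = d * vol0 us" and dM: "vol0 (map M us) = d' * vol0 us" if "length us = 7" for us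
    unfolding d_def d'_def by (rule vol0_multiple[OF comp[OF linN] that], rule vol0_multiple[OF comp[OF lin] that])
  \<comment> \<open>The arguments of \<phi> are replaced by their images under M, and
    \<open>ml_adjoint\<close> moves M to the volume form, where it appears as N and produces the
    factor d.\<close>
  have key: "u \<bullet> v = d * (M u \<bullet> M v)" for u v
  proof -
    have "144 * (u \<bullet> v) = (\<Sum>is\<in>tuples 7 UNIV. T7 (M u) (M v) (map (\<lambda>i. M (ax i)) is) * vol0 (map ax is))"
      unfolding T7_vol0[symmetric]
    proof (intro sum.cong refl arg_cong[of _ _ "\<lambda>x. x * _"])
      fix "is" :: "7 list" assume "is \<in> tuples 7 UNIV"
      then have l: "length is = 7" by (simp add: tuples_def)
      show "T7 u v (map ax is) = T7 (M u) (M v) (map (\<lambda>i. M (ax i)) is)"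
        using inv[of "[u, ax (is ! 0), ax (is ! 1)]"] inv[of "[v, ax (is ! 2), ax (is ! 3)]"] inv[of "[ax (is ! 4), ax (is ! 5), ax (is ! 6)]"]
        by (simp add: T7_def l)
    qed
    also have "\<dots> = (\<Sum>is\<in>tuples 7 UNIV. T7 (M u) (M v) (map ax is) * vol0 (map (\<lambda>i. N (ax i)) is))"
      by (rule ml_adjoint[OF ml_T7 altf_ml[OF altf_vol0] MN])
    also have "\<dots> = (\<Sum>is\<in>tuples 7 UNIV. d * (T7 (M u) (M v) (map ax is) * vol0 (map ax is)))"
    proof (intro sum.cong refl)
      fix "is" :: "7 list" assume "is \<in> tuples 7 UNIV"
      then have "length (map (ax :: 7 \<Rightarrow> _) is) = 7" by (simp add: tuples_def)
      from dN[OF this] show "T7 (M u) (M v) (map ax is) * vol0 (map (\<lambda>i. N (ax i)) is) = d * (T7 (M u) (M v) (map ax is) * vol0 (map ax is))"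
        by (simp add: comp_def)
    qed
    also have "\<dots> = d * (144 * (M u \<bullet> M v))" unfolding sum_distrib_left[symmetric] T7_vol0 ..
    finally show ?thesis by simp
  qed
  have dd: "d = d'"
  proof -
    let ?V = "\<Sum>is\<in>tuples 7 UNIV. vol0 (map ax is) * vol0 (map ax is)"
    have c: "(\<Sum>is\<in>tuples 7 UNIV. f is) = (\<Sum>is\<in>tuples 7 UNIV. g is)" if "\<And>is. length is = 7 \<Longrightarrow> f is = g is" for f g :: "7 list \<Rightarrow> real"
      by (rule sum.cong) (use that in \<open>auto simp: tuples_def\<close>)
    have "(\<Sum>is\<in>tuples 7 UNIV. vol0 (map (\<lambda>i. M (ax i)) is) * vol0 (map ax is)) = d' * ?V"
      unfolding sum_distrib_left by (rule c) (use dM[of "map ax _"] in \<open>simp add: comp_def\<close>)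
    moreover have "(\<Sum>is\<in>tuples 7 UNIV. vol0 (map ax is) * vol0 (map (\<lambda>i. N (ax i)) is)) = d * ?V"
      unfolding sum_distrib_left by (rule c) (use dN[of "map ax _"] in \<open>simp add: comp_def\<close>)
    moreover have "(\<Sum>is\<in>tuples 7 UNIV. vol0 (map (\<lambda>i. M (ax i)) is) * vol0 (map ax is)) = (\<Sum>is\<in>tuples 7 UNIV. vol0 (map ax is) * vol0 (map (\<lambda>i. N (ax i)) is))"
      by (rule ml_adjoint[OF altf_ml[OF altf_vol0] altf_ml[OF altf_vol0] MN])
    moreover have "?V > 0"
    proof (rule sum_pos2[of _ "[1,2,3,4,5,6,7]"])
      have "vol0 (map ax [1,2,3,4,5,6,7]) = 1" by (rule ew_axis) simp
      then show "0 < vol0 (map ax [1,2,3,4,5,6,7]) * vol0 (map ax [1,2,3,4,5,6,7])" by simp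
    qed (simp add: finite_tuples, simp add: tuples_def, simp)
    ultimately show ?thesis by simp
  qed
  have pos: "d > 0"
  proof -
    have "1 = d * (M (ax 0) \<bullet> M (ax 0))" using key[of "ax 0" "ax 0"] by (simp add: inner_axis_axis)
    moreover have "0 \<le> M (ax 0) \<bullet> M (ax 0)" by simp
    ultimately show ?thesis by (metis mult_nonpos_nonneg not_le not_one_le_zero)
  qed
  have NM: "d *\<^sub>R N (M v) = v" for v
    by (rule vector_eq_ldot[THEN iffD1], rule allI) (simp only: inner_scaleR_right adj[symmetric] key[of _ v, symmetric])
  \<comment> \<open>The volume of d N M = id in dimension 7: seven factors d from the scaling, one
    from N and one from M.\<close>
  have "d ^ 9 = 1"
  proof -
    define us0 :: "(real ^ 7) list" where "us0 = map ax [1,2,3,4,5,6,7]"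
    have l: "length us0 = 7" by (simp add: us0_def)
    have "map ((*\<^sub>R) d) (map N (map M us0)) = us0" by (rule nth_equalityI) (simp_all add: NM)
    then have "vol0 us0 = vol0 (map ((*\<^sub>R) d) (map N (map M us0)))" by simp
    also have "\<dots> = d ^ 7 * vol0 (map N (map M us0))"
    proof -
      have l7: "length [1,2,3,4,5,6,7::7] = 7" by simp
      show ?thesis using ew_scale[of "map N (map M us0)" "[1,2,3,4,5,6,7]" d] unfolding l7 length_map by (simp only: l)
    qed
    also have "vol0 (map N (map M us0)) = d * vol0 (map M us0)" by (rule dN) (simp add: l)
    also have "vol0 (map M us0) = d * vol0 us0" unfolding dd by (rule dM) (rule l)
    also have "vol0 us0 = 1" unfolding us0_def by (rule ew_axis) simp
    finally have "1 = d ^ 7 * (d * (d * 1))" .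
    also have "\<dots> = d ^ 9" by (simp add: eval_nat_numeral)
    finally show ?thesis by simp
  qed
  then have "d = 1" using power_eq_imp_eq_base[of d 9 1] pos by simp
  then show "M u \<bullet> M v = u \<bullet> v" and "length us = 7 \<Longrightarrow> vol0 (map M us) = vol0 us"
    using key[of u v] dM[of us] unfolding dd[symmetric] by auto
qed

section \<open>The Hodge operator and the wedge product on the coordinate space\<close>

definition star :: "nat \<Rightarrow> ((real ^ 7) list \<Rightarrow> real) \<Rightarrow> (real ^ 7) list \<Rightarrow> real" where
  "star k W us = (\<Sum>is\<in>tuples k UNIV. W (map ax is) * vol0 (map ax is @ us)) / fact k"

lemma altf_star:
  assumes kl: "k + l = 7" shows "altf l (star k W)"
  unfolding altf_def ml_def
proof (intro conjI allI impI)
  fix us :: "(real ^ 7) list" and i :: nat assume us: "length us = l" "i < l"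
  have "linear (\<lambda>x. W (map ax is) * vol0 (map ax is @ us[i := x]))" if "is \<in> tuples k UNIV" for "is"
    using mlD[OF altf_ml[OF altf_vol0], of "map ax is @ us" "k + i"] us that kl
    by (simp add: tuples_def list_update_append linear_iff algebra_simps)
  then have "linear (\<lambda>x. \<Sum>is\<in>tuples k UNIV. W (map ax is) * vol0 (map ax is @ us[i := x]))"
    by (intro linear_compose_sum ballI)
  then show "linear (\<lambda>x. star k W (us[i := x]))"
    unfolding star_def by (simp add: linear_iff add_divide_distrib)
next
  fix us :: "(real ^ 7) list" and i j :: nat assume us: "length us = l" "i < l" "j < l" "i \<noteq> j" "us ! i = us ! j"
  have "vol0 (map ax is @ us) = 0" if "is \<in> tuples k UNIV" for "is"
  proof (rule altf_zero[OF altf_vol0])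
    have "\<not> distinct us" using us by (auto simp: distinct_conv_nth)
    then show "\<not> distinct (map ax is @ us)" by simp
  qed (use us that kl in \<open>simp add: tuples_def\<close>)
  then show "star k W us = 0" unfolding star_def by (simp add: sum.neutral)
qed

lemma star_axis:
  assumes W: "altf k W" and "k + l = 7" "length js = l" "length L = k" "distinct (L @ js)"
  shows "star k W (map ax js) = isgn (L @ js) * W (map ax L)"
  unfolding star_def hodge_axis[OF assms] by (simp del: inversions.simps)

abbreviation psi0 :: "(real ^ 7) list \<Rightarrow> real" where "psi0 \<equiv> star 3 phi0"

lemma psi0_axis: "psi0 [ax a, ax b, ax c, ax d] = ps a b c d"
  using star_phi0[of a b c d] by (simp add: star_def S4_def fact_numeral)

lemma altf_psi0: "altf 4 psi0" by (rule altf_star) simp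

definition asym :: "nat \<Rightarrow> ('v list \<Rightarrow> real) \<Rightarrow> 'v list \<Rightarrow> real" where
  "asym n T us = (\<Sum>\<sigma> | \<sigma> permutes {..<n}. of_int (sign \<sigma>) * T (map (\<lambda>i. us ! \<sigma> i) [0..<n]))"

lemma altf_asym: "ml n T \<Longrightarrow> altf n (asym n T)"
  unfolding asym_def[abs_def] by (rule altf_antisym)

text \<open>Reindexing by \<sigma> changes V by the sign of \<sigma>, which cancels the sign in the
  antisymmetrisation. All n! terms become equal.\<close>

lemma asym_pairing:
  fixes V :: "'v::real_vector list \<Rightarrow> real" and e :: "'i::finite \<Rightarrow> 'v"
  assumes V: "altf n V"
  shows "(\<Sum>is\<in>tuples n UNIV. asym n T (map e is) * V (map e is)) = fact n * (\<Sum>is\<in>tuples n UNIV. T (map e is) * V (map e is))"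
proof -
  define perm where "perm = (\<lambda>\<sigma> (is :: 'i list). map (\<lambda>i. is ! \<sigma> i) [0..<n])"
  have me: "map (\<lambda>i. map e is ! \<sigma> i) [0..<n] = map e (perm \<sigma> is)" if s: "\<sigma> permutes {..<n}" and l: "length is = n" for \<sigma> "is"
    using permutes_in_image[OF s] l by (auto simp: perm_def)
  have inv: "perm (inv_into UNIV \<sigma>) (perm \<sigma> is) = is" "perm \<sigma> (perm (inv_into UNIV \<sigma>) is) = is" if s: "\<sigma> permutes {..<n}" and l: "length is = n" for \<sigma> "is"
    using permutes_in_image[OF s] permutes_in_image[OF permutes_inv[OF s]] permutes_inverses[OF s] l
    by (auto simp: perm_def intro!: nth_equalityI)
  have "(\<Sum>is\<in>tuples n UNIV. asym n T (map e is) * V (map e is))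
    = (\<Sum>is\<in>tuples n UNIV. \<Sum>\<sigma> | \<sigma> permutes {..<n}. of_int (sign \<sigma>) * T (map (\<lambda>i. map e is ! \<sigma> i) [0..<n]) * V (map e is))"
    by (simp add: asym_def sum_distrib_right)
  also have "\<dots> = (\<Sum>\<sigma> | \<sigma> permutes {..<n}. \<Sum>is\<in>tuples n UNIV. of_int (sign \<sigma>) * T (map (\<lambda>i. map e is ! \<sigma> i) [0..<n]) * V (map e is))"
    by (rule sum.swap)
  also have "\<dots> = (\<Sum>\<sigma> | \<sigma> permutes {..<n}. \<Sum>is\<in>tuples n UNIV. T (map e is) * V (map e is))"
  proof (rule sum.cong[OF refl])
    fix \<sigma> assume "\<sigma> \<in> {\<sigma>. \<sigma> permutes {..<n}}"
    then have s: "\<sigma> permutes {..<n}" by simp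
    have "(\<Sum>is\<in>tuples n UNIV. of_int (sign \<sigma>) * T (map (\<lambda>i. map e is ! \<sigma> i) [0..<n]) * V (map e is))
      = (\<Sum>is\<in>tuples n UNIV. T (map e (perm \<sigma> is)) * V (map e (perm \<sigma> is)))"
    proof (rule sum.cong[OF refl])
      fix "is" :: "'i list" assume "is \<in> tuples n UNIV"
      then have l: "length is = n" by (simp add: tuples_def)
      have "V (map e (perm \<sigma> is)) = of_int (sign \<sigma>) * V (map e is)"
        using altf_permute[OF V _ s, of "map e is"] l by (simp only: me[OF s l] length_map)
      then show "of_int (sign \<sigma>) * T (map (\<lambda>i. map e is ! \<sigma> i) [0..<n]) * V (map e is) = T (map e (perm \<sigma> is)) * V (map e (perm \<sigma> is))"
        unfolding me[OF s l] by simp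
    qed
    also have "\<dots> = (\<Sum>is\<in>tuples n UNIV. T (map e is) * V (map e is))"
      by (rule sum.reindex_bij_witness[of _ "perm (inv_into UNIV \<sigma>)" "perm \<sigma>"])
        (use inv[OF s] in \<open>auto simp: tuples_def perm_def\<close>)
    finally show "(\<Sum>is\<in>tuples n UNIV. of_int (sign \<sigma>) * T (map (\<lambda>i. map e is ! \<sigma> i) [0..<n]) * V (map e is)) = (\<Sum>is\<in>tuples n UNIV. T (map e is) * V (map e is))" .
  qed
  also have "\<dots> = fact n * (\<Sum>is\<in>tuples n UNIV. T (map e is) * V (map e is))"
    by (simp add: card_permutations)
  finally show ?thesis .
qed

definition wdg :: "nat \<Rightarrow> nat \<Rightarrow> ('v list \<Rightarrow> real) \<Rightarrow> ('v list \<Rightarrow> real) \<Rightarrow> 'v list \<Rightarrow> real" where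
  "wdg k l W W' us = asym (k + l) (\<lambda>us. W (take k us) * W' (drop k us)) us / (fact k * fact l)"

lemma altf_wdg:
  fixes W W' :: "'v::real_vector list \<Rightarrow> real"
  assumes "ml k W" "ml l W'" shows "altf (k + l) (wdg k l W W')"
proof -
  have "ml (k + l) (\<lambda>us. W (take k us) * W' (drop k us))" unfolding ml_def
  proof (intro allI impI)
    fix us :: "'v list" and i assume us: "length us = k + l" "i < k + l"
    show "linear (\<lambda>x. W (take k (us[i := x])) * W' (drop k (us[i := x])))"
    proof (cases "i < k")
      case True
      have "linear (\<lambda>x. W ((take k us)[i := x]))" by (rule mlD[OF assms(1)]) (use us True in auto)
      then show ?thesis using True by (simp add: take_update_swap drop_update_cancel linear_iff algebra_simps)
    next
      case False
      have "linear (\<lambda>x. W' ((drop k us)[i - k := x]))" by (rule mlD[OF assms(2)]) (use us False in auto)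
      then show ?thesis using False by (simp add: take_update_cancel drop_update_swap linear_iff algebra_simps)
    qed
  qed
  from altf_asym[OF this] show ?thesis
    unfolding altf_def ml_def wdg_def by (simp add: linear_iff add_divide_distrib)
qed

lemma wedge_wdg:
  assumes \<alpha>: "\<And>us. length us = k \<Longrightarrow> \<alpha> p (map t us) = W us" and \<beta>: "\<And>us. length us = l \<Longrightarrow> \<beta> p (map t us) = W' us"
    and us: "length us = k + l"
  shows "wedge k l \<alpha> \<beta> p (map t us) = wdg k l W W' us"
proof -
  have key: "of_int (sign \<sigma>) * \<alpha> p (map (\<lambda>i. map t us ! \<sigma> i) [0..<k]) * \<beta> p (map (\<lambda>i. map t us ! \<sigma> i) [k..<k + l])
     = of_int (sign \<sigma>) * (W (take k (map (\<lambda>i. us ! \<sigma> i) [0..<k + l])) * W' (drop k (map (\<lambda>i. us ! \<sigma> i) [0..<k + l])))"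
    if s: "\<sigma> permutes {..<k + l}" for \<sigma>
  proof -
    have n: "\<sigma> i < length us" if "i < k + l" for i using permutes_in_image[OF s, of i] that us by simp
    have "map (\<lambda>i. map t us ! \<sigma> i) [0..<k] = map t (map (\<lambda>i. us ! \<sigma> i) [0..<k])"
      "map (\<lambda>i. map t us ! \<sigma> i) [k..<k + l] = map t (map (\<lambda>i. us ! \<sigma> i) [k..<k + l])"
      using n by auto
    then show ?thesis
      using \<alpha>[of "map (\<lambda>i. us ! \<sigma> i) [0..<k]"] \<beta>[of "map (\<lambda>i. us ! \<sigma> i) [k..<k + l]"]
      by (simp only: length_map length_upt take_map drop_map take_upt drop_upt) (simp add: mult.assoc)
  qed
  show ?thesis unfolding wedge_def wdg_def asym_def
    by (rule arg_cong2[of _ _ _ _ "(/)"], rule sum.cong[OF refl], rule key, simp, rule refl)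
qed

lemma altf_permute_drop:
  fixes W :: "'v::real_vector list \<Rightarrow> real"
  assumes W: "altf n W" and len: "length us = Suc n" and \<sigma>: "\<sigma> permutes {1..<Suc n}"
  shows "W (map (\<lambda>i. us ! \<sigma> i) [1..<Suc n]) = of_int (sign \<sigma>) * W (tl us)"
proof -
  have "\<forall>us. length us = Suc n \<longrightarrow> W (map (\<lambda>i. us ! \<sigma> i) [1..<Suc n]) = of_int (sign \<sigma>) * W (tl us)"
    using \<sigma> finite_atLeastLessThan
  proof (induction rule: permutes_induct)
    case id
    have "map (\<lambda>i. us ! id i) [1..<Suc n] = tl us" if "length us = Suc n" for us :: "'v list"
      using that by (intro nth_equalityI) (auto simp: nth_tl simp del: upt_Suc)
    then show ?case by (simp add: sign_id)
  next
    case (swap a b p)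
    show ?case
    proof (intro allI impI)
      fix us :: "'v list" assume len: "length us = Suc n"
      define vs where "vs = us[a := us ! b, b := us ! a]"
      obtain x xs where us: "us = x # xs" using len by (cases us) auto
      have v: "us ! Transposition.transpose a b k = vs ! k" if "k < Suc n" for k
        using that swap.hyps len by (auto simp: vs_def nth_list_update Transposition.transpose_def)
      have pk: "p k < Suc n" if "k \<in> {1..<Suc n}" for k using permutes_in_image[OF swap.hyps(4), of k] that by simp
      have "W (map (\<lambda>i. us ! (Transposition.transpose a b \<circ> p) i) [1..<Suc n]) = W (map (\<lambda>i. vs ! p i) [1..<Suc n])"
        by (rule arg_cong[of _ _ W], rule map_cong[OF refl]) (simp only: set_upt comp_apply v pk)
      also have "\<dots> = of_int (sign p) * W (tl vs)" using swap.IH len by (simp add: vs_def)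
      also have "tl vs = xs[a - 1 := xs ! (b - 1), b - 1 := xs ! (a - 1)]"
        using swap.hyps by (cases a; cases b) (auto simp: vs_def us)
      also have "W \<dots> = - W xs" by (rule altf_transpose[OF W]) (use swap.hyps len us in auto)
      also have "of_int (sign p) * - W xs = of_int (sign (Transposition.transpose a b \<circ> p)) * W (tl us)"
        using swap.hyps permutes_imp_permutation[OF finite_atLeastLessThan swap.hyps(4)] us
        by (simp add: sign_compose permutation_swap_id sign_swap_id)
      finally show "W (map (\<lambda>i. us ! (Transposition.transpose a b \<circ> p) i) [1..<Suc n]) = of_int (sign (Transposition.transpose a b \<circ> p)) * W (tl us)" .
    qed
  qed
  then show ?thesis using len by blast
qed

text \<open>Every permutation is uniquely the transposition of 0 and b after a permutation q fixing
  0. W' absorbs the sign of q, and the sum over q gives the factor n! that the normalisation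
  removes.\<close>

lemma wdg_1:
  fixes W W' :: "'v::real_vector list \<Rightarrow> real"
  assumes W': "altf n W'" and us: "length us = Suc n"
  shows "wdg 1 n W W' us = (\<Sum>b<Suc n. (if b = 0 then 1 else -1) * (W [us ! b] * W' (tl (map (\<lambda>i. us ! Transposition.transpose 0 b i) [0..<Suc n]))))"
proof -
  define S where "S = {1..<Suc n}"
  have S: "{..<1 + n} = insert 0 S" "0 \<notin> S" "finite S" by (auto simp: S_def)
  define T where "T = (\<lambda>us :: 'v list. W (take 1 us) * W' (drop 1 us))"
  have u: "[0..<1 + n] = 0 # [1..<Suc n]" by (simp add: upt_rec)
  have t: "of_int (sign (Transposition.transpose 0 b \<circ> q)) * T (map (\<lambda>i. us ! (Transposition.transpose 0 b \<circ> q) i) [0..<1 + n])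
     = (if b = 0 then 1 else -1) * (W [us ! b] * W' (tl (map (\<lambda>i. us ! Transposition.transpose 0 b i) [0..<Suc n])))"
    if b: "b \<in> insert 0 S" and q: "q permutes S" for b q
  proof -
    define vs where "vs = map (\<lambda>i. us ! Transposition.transpose 0 b i) [0..<Suc n]"
    have q0: "q 0 = 0" by (rule permutes_not_in[OF q S(2)])
    have qk: "q k < Suc n" if "k \<in> {1..<Suc n}" for k using permutes_in_image[OF q, of k] that by (simp add: S_def)
    have m: "map (\<lambda>i. us ! (Transposition.transpose 0 b \<circ> q) i) [1..<Suc n] = map (\<lambda>i. vs ! q i) [1..<Suc n]"
      by (rule map_cong[OF refl]) (use qk in \<open>simp add: vs_def del: upt_Suc\<close>)
    have "T (map (\<lambda>i. us ! (Transposition.transpose 0 b \<circ> q) i) [0..<1 + n]) = W [us ! b] * W' (map (\<lambda>i. vs ! q i) [1..<Suc n])"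
      unfolding u T_def list.map m by (simp add: q0 del: upt_Suc)
    also have "W' (map (\<lambda>i. vs ! q i) [1..<Suc n]) = of_int (sign q) * W' (tl vs)"
      by (rule altf_permute_drop[OF W']) (use q in \<open>simp_all add: vs_def S_def del: upt_Suc\<close>)
    finally have "T (map (\<lambda>i. us ! (Transposition.transpose 0 b \<circ> q) i) [0..<1 + n]) = W [us ! b] * (of_int (sign q) * W' (tl vs))" .
    moreover have "sign (Transposition.transpose 0 b \<circ> q) = (if b = 0 then 1 else -1) * sign q"
      using permutes_imp_permutation[OF S(3) q] by (simp add: sign_compose permutation_swap_id sign_swap_id)
    moreover have "of_int (sign q) * of_int (sign q) = (1::real)" by (simp add: sign_def)
    ultimately show ?thesis unfolding vs_def[symmetric] by simp
  qed
  have "asym (1 + n) T us = (\<Sum>b\<in>insert 0 S. \<Sum>q | q permutes S. of_int (sign (Transposition.transpose 0 b \<circ> q)) *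
      T (map (\<lambda>i. us ! (Transposition.transpose 0 b \<circ> q) i) [0..<1 + n]))"
    unfolding asym_def S(1) by (rule sum_over_permutations_insert[OF S(3,2)])
  also have "\<dots> = (\<Sum>b\<in>insert 0 S. \<Sum>q | q permutes S. (if b = 0 then 1 else -1) * (W [us ! b] * W' (tl (map (\<lambda>i. us ! Transposition.transpose 0 b i) [0..<Suc n]))))"
    by (intro sum.cong refl t) auto
  also have "\<dots> = fact n * (\<Sum>b\<in>insert 0 S. (if b = 0 then 1 else -1) * (W [us ! b] * W' (tl (map (\<lambda>i. us ! Transposition.transpose 0 b i) [0..<Suc n]))))"
  proof -
    have cS: "card S = n" by (simp add: S_def)
    show ?thesis by (simp only: sum_constant card_permutations[OF cS S(3)] sum_distrib_left of_nat_fact)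
  qed
  also have "insert 0 S = {..<Suc n}" using S(1) by simp
  finally show ?thesis unfolding wdg_def T_def by simp
qed

lemma wdg_1_3:
  assumes "altf 3 W'"
  shows "wdg 1 3 W W' [u0, u1, u2, u3] = W [u0] * W' [u1, u2, u3] - W [u1] * W' [u0, u2, u3] + W [u2] * W' [u0, u1, u3] - W [u3] * W' [u0, u1, u2]"
  using altf_head3(1)[OF assms, of u1 u0 u3] altf_head3(2)[OF assms, of u1 u2 u0]
  by (subst wdg_1[OF assms], simp) (simp add: lessThan_Suc numeral_3_eq_3 Transposition.transpose_def)

lemma wdg_1_4:
  assumes "altf 4 W'"
  shows "wdg 1 4 W W' [u0, u1, u2, u3, u4] = W [u0] * W' [u1, u2, u3, u4] - W [u1] * W' [u0, u2, u3, u4] + W [u2] * W' [u0, u1, u3, u4]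
    - W [u3] * W' [u0, u1, u2, u4] + W [u4] * W' [u0, u1, u2, u3]"
  using altf_head4(1)[OF assms, of u1 u0 u3 u4] altf_head4(2)[OF assms, of u1 u2 u0 u4] altf_head4(3)[OF assms, of u1 u2 u3 u0]
  by (subst wdg_1[OF assms], simp) (simp add: lessThan_Suc numeral_eq_Suc Transposition.transpose_def)

text \<open>This is the identity between \<star>(W \<and> \<phi>) and the inner product of \<star>W
  with \<phi>, where 1/6 passes from ordered to increasing triples. It expresses the scalar in the
  torsion form by components of \<star>d\<phi>.\<close>

lemma star_wdg_4_3:
  assumes "altf 4 W"
  shows "star 7 (wdg 4 3 W phi0) [] = (\<Sum>i\<in>UNIV. \<Sum>j\<in>UNIV. \<Sum>k\<in>UNIV. ph i j k * star 4 W [ax i, ax j, ax k]) / 6"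
proof -
  have f: "fact 4 * fact 3 = (144::real)" by (simp add: fact_numeral)
  have "star 7 (wdg 4 3 W phi0) [] = (\<Sum>is\<in>tuples 7 UNIV. asym 7 (\<lambda>us. W (take 4 us) * phi0 (drop 4 us)) (map ax is) * vol0 (map ax is)) / 144 / fact 7"
    unfolding star_def wdg_def f by (simp add: sum_divide_distrib)
  also have "\<dots> = (\<Sum>is\<in>tuples 7 UNIV. W (take 4 (map ax is)) * phi0 (drop 4 (map ax is)) * vol0 (map ax is)) / 144"
    unfolding asym_pairing[OF altf_vol0] by simp
  also have "(\<Sum>is\<in>tuples 7 UNIV. W (take 4 (map ax is)) * phi0 (drop 4 (map ax is)) * vol0 (map ax is))
    = (\<Sum>is\<in>tuples 4 UNIV. \<Sum>js\<in>tuples 3 UNIV. W (map ax is) * phi0 (map ax js) * vol0 (map ax is @ map ax js))"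
    using sum_tuples_add[of "\<lambda>is. W (take 4 (map ax is)) * phi0 (drop 4 (map ax is)) * vol0 (map ax is)" 4 3 UNIV]
    by (auto simp: tuples_def intro!: sum.cong)
  also have "\<dots> = (\<Sum>js\<in>tuples 3 UNIV. \<Sum>is\<in>tuples 4 UNIV. W (map ax is) * phi0 (map ax js) * vol0 (map ax is @ map ax js))"
    by (rule sum.swap)
  also have "\<dots> = (\<Sum>js\<in>tuples 3 UNIV. 24 * (phi0 (map ax js) * star 4 W (map ax js)))"
    by (simp add: star_def sum_distrib_left sum_divide_distrib mult_ac fact_numeral)
  also have "\<dots> = (\<Sum>i\<in>UNIV. \<Sum>j\<in>UNIV. \<Sum>k\<in>UNIV. 24 * (ph i j k * star 4 W [ax i, ax j, ax k]))"
    unfolding numeral_3_eq_3 sum_tuples_Suc sum_tuples_0 by (simp add: phi0_axis)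
  finally show ?thesis by (simp add: sum_distrib_left[symmetric])
qed

section \<open>Closedness and the Jacobi identity contracted with the dual four-form\<close>

lemma ps_perm: "ps j k i l = ps i j k l" "ps i l j k = ps i j k l" "ps j l i k = - ps i j k l" "ps k l i j = ps i j k l"
  using ps_swap23[of j k i l] ps_swap12[of j i k l] ps_swap23[of i l j k] ps_swap34[of i j l k] ps_swap23[of j l i k] ps_swap12[of j i l k]
    ps_swap23[of k l i j] ps_swap12[of k i l j] ps_swap34[of i k l j] ps_swap23[of i k j l] by linarith+

text \<open>The sign of each of the six terms of the exterior derivative is opposite to that of the
  permutation that restores the order of indices in \<open>ps\<close>, so all six contribute the
  same to the contraction.\<close>

lemma closed_contract:
  fixes c t :: "7 \<Rightarrow> 7 \<Rightarrow> 7 \<Rightarrow> real"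
  assumes d: "\<And>i j k l. (\<Sum>m\<in>UNIV. - (c i j m * t m k l) + c i k m * t m j l - c j k m * t m i l
    - c i l m * t m j k + c j l m * t m i k - c k l m * t m i j) = 0"
  shows "(\<Sum>(i,j,k,l,m)\<in>UNIV. c i j m * t m k l * ps i j k l) = 0"
proof -
  define Q where "Q = (\<lambda>i j k l. \<Sum>m\<in>UNIV. c i j m * t m k l)"
  define P where "P = (\<lambda>(i,j,k,l). ps i j k l * Q i j k l)"
  let ?p = "\<Sum>x\<in>UNIV. P x"
  have 1: "(\<Sum>(i,j,k,l)\<in>UNIV. P (i,k,j,l)) = ?p"
    by (rule sum.reindex_bij_witness[of _ "\<lambda>(i,j,k,l). (i,k,j,l)" "\<lambda>(i,j,k,l). (i,k,j,l)"]) auto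
  have 2: "(\<Sum>(i,j,k,l)\<in>UNIV. P (j,k,i,l)) = ?p"
    by (rule sum.reindex_bij_witness[of _ "\<lambda>(j,k,i,l). (i,j,k,l)" "\<lambda>(i,j,k,l). (j,k,i,l)"]) auto
  have 3: "(\<Sum>(i,j,k,l)\<in>UNIV. P (i,l,j,k)) = ?p"
    by (rule sum.reindex_bij_witness[of _ "\<lambda>(i,l,j,k). (i,j,k,l)" "\<lambda>(i,j,k,l). (i,l,j,k)"]) auto
  have 4: "(\<Sum>(i,j,k,l)\<in>UNIV. P (j,l,i,k)) = ?p"
    by (rule sum.reindex_bij_witness[of _ "\<lambda>(j,l,i,k). (i,j,k,l)" "\<lambda>(i,j,k,l). (j,l,i,k)"]) auto
  have 5: "(\<Sum>(i,j,k,l)\<in>UNIV. P (k,l,i,j)) = ?p"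
    by (rule sum.reindex_bij_witness[of _ "\<lambda>(k,l,i,j). (i,j,k,l)" "\<lambda>(i,j,k,l). (k,l,i,j)"]) auto
  have z: "- Q i j k l + Q i k j l - Q j k i l - Q i l j k + Q j l i k - Q k l i j = 0" for i j k l
    using d[of i j k l] unfolding Q_def by (simp add: sum.distrib sum_subtractf sum_negf)
  have "- P (i,j,k,l) - P (i,k,j,l) - P (j,k,i,l) - P (i,l,j,k) - P (j,l,i,k) - P (k,l,i,j) = 0" for i j k l
  proof -
    have "- P (i,j,k,l) - P (i,k,j,l) - P (j,k,i,l) - P (i,l,j,k) - P (j,l,i,k) - P (k,l,i,j)
      = ps i j k l * (- Q i j k l + Q i k j l - Q j k i l - Q i l j k + Q j l i k - Q k l i j)"
      unfolding P_def prod.case ps_perm[of j k i l] ps_perm(2)[of i l j k] ps_perm(3)[of j l i k] ps_perm(4)[of k l i j] ps_swap23[of i k j l]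
      by (simp add: algebra_simps)
    then show ?thesis unfolding z by simp
  qed
  then have "(\<Sum>(i,j,k,l)\<in>UNIV. - P (i,j,k,l) - P (i,k,j,l) - P (j,k,i,l) - P (i,l,j,k) - P (j,l,i,k) - P (k,l,i,j)) = 0"
    by (simp add: case_prod_beta')
  then have "?p = 0" using 1 2 3 4 5 by (simp add: case_prod_beta' sum_subtractf sum_negf)
  moreover have "(\<Sum>(i,j,k,l,m)\<in>UNIV. c i j m * t m k l * ps i j k l) = (\<Sum>(i,j,k,l)\<in>UNIV. P (i,j,k,l))"
    unfolding nested5 nested4 by (simp add: P_def Q_def sum_distrib_left mult_ac)
  ultimately show ?thesis by (simp add: case_prod_beta')
qed

text \<open>Cyclic permutations of the first three slots leave \<open>ps\<close> unchanged, so the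
  three terms of the Jacobi identity contribute the same.\<close>

lemma jacobi_contract:
  fixes c :: "7 \<Rightarrow> 7 \<Rightarrow> 7 \<Rightarrow> real"
  assumes J: "\<And>i j l n. (\<Sum>m\<in>UNIV. c i j m * c m l n + c j l m * c m i n + c l i m * c m j n) = 0"
  shows "(\<Sum>(i,j,k,l,m)\<in>UNIV. c i j m * c m k l * ps i j k l) = 0"
proof -
  define Q where "Q = (\<lambda>i j k l. \<Sum>m\<in>UNIV. c i j m * c m k l)"
  define P where "P = (\<lambda>(i,j,k,l). ps i j k l * Q i j k l)"
  let ?p = "\<Sum>x\<in>UNIV. P x"
  have 1: "(\<Sum>(i,j,k,l)\<in>UNIV. P (j,k,i,l)) = ?p"
    by (rule sum.reindex_bij_witness[of _ "\<lambda>(j,k,i,l). (i,j,k,l)" "\<lambda>(i,j,k,l). (j,k,i,l)"]) auto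
  have 2: "(\<Sum>(i,j,k,l)\<in>UNIV. P (k,i,j,l)) = ?p"
    by (rule sum.reindex_bij_witness[of _ "\<lambda>(k,i,j,l). (i,j,k,l)" "\<lambda>(i,j,k,l). (k,i,j,l)"]) auto
  have "P (i,j,k,l) + P (j,k,i,l) + P (k,i,j,l) = 0" for i j k l
  proof -
    have "P (i,j,k,l) + P (j,k,i,l) + P (k,i,j,l) = ps i j k l * (Q i j k l + Q j k i l + Q k i j l)"
      unfolding P_def prod.case ps_perm(1)[of j k i l] ps_perm(1)[of i j k l, symmetric] ps_perm(1)[of k i j l] by (simp add: algebra_simps)
    then show ?thesis using J[of i j k l] by (simp add: Q_def sum.distrib)
  qed
  then have "(\<Sum>(i,j,k,l)\<in>UNIV. P (i,j,k,l) + P (j,k,i,l) + P (k,i,j,l)) = 0" by (simp add: case_prod_beta')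
  then have "?p = 0" using 1 2 by (simp add: case_prod_beta' sum.distrib)
  moreover have "(\<Sum>(i,j,k,l,m)\<in>UNIV. c i j m * c m k l * ps i j k l) = (\<Sum>(i,j,k,l)\<in>UNIV. P (i,j,k,l))"
    unfolding nested5 nested4 by (simp add: P_def Q_def sum_distrib_left mult_ac)
  ultimately show ?thesis by (simp add: case_prod_beta')
qed

text \<open>The Chevalley-Eilenberg differential of a 3-form.\<close>

definition DD :: "(real ^ 7 \<Rightarrow> real ^ 7 \<Rightarrow> real ^ 7) \<Rightarrow> ((real ^ 7) list \<Rightarrow> real) \<Rightarrow> (real ^ 7) list \<Rightarrow> real" where
  "DD br W us = (let u0 = us ! 0; u1 = us ! 1; u2 = us ! 2; u3 = us ! 3 in
    - W [br u0 u1, u2, u3] + W [br u0 u2, u1, u3] - W [br u1 u2, u0, u3] - W [br u0 u3, u1, u2] + W [br u1 u3, u0, u2] - W [br u2 u3, u0, u1])"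

lemma altf_DD:
  assumes br: "bilinear br" and sk: "\<And>u v. br v u = - br u v" and W: "altf 3 W"
  shows "altf 4 (DD br W)"
proof -
  have l1: "linear (\<lambda>z. W [z, x, y])" and l2: "linear (\<lambda>z. W [x, z, y])" and l3: "linear (\<lambda>z. W [x, y, z])" for x y
    using mlD[OF altf_ml[OF W], of "[0, x, y]" 0] mlD[OF altf_ml[OF W], of "[x, 0, y]" 1]
      mlD[OF altf_ml[OF W], of "[x, y, 0]" 2] by (simp_all add: numeral_2_eq_2)
  note lin = linear_add[OF l1] linear_add[OF l2] linear_add[OF l3] linear_scale[OF l1] linear_scale[OF l2] linear_scale[OF l3]
    bilinear_ladd[OF br] bilinear_radd[OF br] bilinear_lmul[OF br] bilinear_rmul[OF br]
  have b0: "br u u = 0" for u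
  proof -
    have "br u u + br u u = 0" by (rule sk[of u u, unfolded eq_neg_iff_add_eq_0])
    then have "2 *\<^sub>R br u u = 0" by (simp only: scaleR_2)
    then show ?thesis by simp
  qed
  have w0: "W [0, x, y] = 0" for x y by (rule linear_0[OF l1])
  have wr: "W [x, y, y] = 0" for x y by (rule altf_zero[OF W]) auto
  have ws: "W [x, z, y] = - W [x, y, z]" for x y z using altf_swap[OF W, of "[x]" "[]" z y] by simp
  have wn: "W [- x, y, z] = - W [x, y, z]" for x y z using linear_neg[OF l1] .
  show ?thesis unfolding altf_def ml_def
  proof (intro conjI allI impI)
    fix us :: "(real ^ 7) list" and i :: nat assume us: "length us = 4" "i < 4"
    then have "i = 0 \<or> i = 1 \<or> i = 2 \<or> i = 3" by arith
    then show "linear (\<lambda>x. DD br W (us[i := x]))"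
      using us by (elim disjE) (rule linearI; simp add: DD_def Let_def lin algebra_simps)+
  next
    fix us :: "(real ^ 7) list" and i j :: nat assume us: "length us = 4" "i < 4" "j < 4" "i \<noteq> j" "us ! i = us ! j"
    define u0 u1 u2 u3 where "u0 = us ! 0" and "u1 = us ! 1" and "u2 = us ! 2" and "u3 = us ! 3"
    have D: "DD br W us = - W [br u0 u1, u2, u3] + W [br u0 u2, u1, u3] - W [br u1 u2, u0, u3] - W [br u0 u3, u1, u2] + W [br u1 u3, u0, u2] - W [br u2 u3, u0, u1]"
      unfolding DD_def Let_def u0_def u1_def u2_def u3_def by (rule refl)
    have "(i = 0 \<or> i = 1 \<or> i = 2 \<or> i = 3) \<and> (j = 0 \<or> j = 1 \<or> j = 2 \<or> j = 3)" using us by arith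
    then have "u0 = u1 \<or> u0 = u2 \<or> u0 = u3 \<or> u1 = u2 \<or> u1 = u3 \<or> u2 = u3"
      using us(4,5) unfolding u0_def u1_def u2_def u3_def by (elim conjE disjE) simp_all
    then consider "u0 = u1" | "u0 = u2" | "u0 = u3" | "u1 = u2" | "u1 = u3" | "u2 = u3" by blast
    then show "DD br W us = 0"
    proof cases
      case 1 show ?thesis unfolding D 1 by (simp add: b0 w0 wr)
    next
      case 2 show ?thesis unfolding D 2 using sk[of u1 u2] ws[of "br u2 u3" u2 u1] by (simp add: b0 w0 wr wn)
    next
      case 3 show ?thesis unfolding D 3 using sk[of u1 u3] sk[of u2 u3] ws[of "br u1 u3" u3 u2] ws[of "br u2 u3" u3 u1] by (simp add: b0 w0 wr wn)
    next
      case 4 show ?thesis unfolding D 4 by (simp add: b0 w0 wr)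
    next
      case 5 show ?thesis unfolding D 5 using sk[of u2 u3] ws[of "br u0 u3" u3 u2] by (simp add: b0 w0 wr wn)
    next
      case 6 show ?thesis unfolding D 6 by (simp add: b0 w0 wr)
    qed
  qed
qed

section \<open>Left-invariant $G_2$-structures\<close>

lemma ewedge_ew:
  assumes "length us = length is" and e: "\<And>i u. e i (t u) = M u $ i"
  shows "ewedge e is (map t us) = ew is (map M us)"
  unfolding ewedge_def ew_def
proof (intro sum.cong refl arg_cong2[of _ _ _ _ "(*)"] prod.cong)
  fix \<sigma> a assume s: "\<sigma> \<in> {\<sigma>. \<sigma> permutes {..<length is}}" and a: "a \<in> {..<length is}"
  then have "\<sigma> a < length us" using permutes_in_image[of \<sigma> "{..<length is}" a] assms(1) by simp
  then show "e (is ! a) (map t us ! \<sigma> a) = (map M us ! \<sigma> a) $ (is ! a)" by (simp add: e)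
qed

lemma length_4E: "length us = 4 \<Longrightarrow> (\<And>x y z t. us = [x, y, z, t] \<Longrightarrow> P) \<Longrightarrow> P"
  and length_5E: "length us = 5 \<Longrightarrow> (\<And>x y z t s. us = [x, y, z, t, s] \<Longrightarrow> P) \<Longrightarrow> P"
proof -
  have n: "(4::nat) = Suc (Suc (Suc (Suc 0)))" "(5::nat) = Suc (Suc (Suc (Suc (Suc 0))))" by simp_all
  show "length us = 4 \<Longrightarrow> (\<And>x y z t. us = [x, y, z, t] \<Longrightarrow> P) \<Longrightarrow> P" unfolding n length_Suc_conv length_0_conv by blast
  show "length us = 5 \<Longrightarrow> (\<And>x y z t s. us = [x, y, z, t, s] \<Longrightarrow> P) \<Longrightarrow> P" unfolding n length_Suc_conv length_0_conv by blast
qed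

lemma ps_rot: "ps m k l p = - ps k l p m"
  using ps_swap12[of m k l p] ps_swap23[of k m l p] ps_swap34[of k l m p] by simp

text \<open>Left invariance, together with coordinates adapted to \<phi> at the identity, gives
  \<phi> the same standard coefficients at every point. Such coordinates are supplied by
  \<open>adapted_coordinates\<close>.\<close>

locale lie_g2 = lie_param G A U c B
  for G :: "'g::{t2_space,second_countable_topology} monoid" (structure)
    and A :: "('g, 7) atlas" and U c B +
  fixes \<phi> :: "'g form"
  assumes phi_tv: "length us = 3 \<Longrightarrow> \<phi> p (map (tv p) us) = phi0 us"
    and coframe_ex: "\<exists>e. g2_coframe A \<phi> p e"
begin

text \<open>The coframe chosen at p differs from the coordinate one by a linear map M that preserves
  \<open>phi0\<close>, and by \<open>g2_invariant\<close> such a map preserves the inner product and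
  the volume.\<close>

lemma metric_vol:
  shows "g2_metric A \<phi> p (tv p u) (tv p v) = u \<bullet> v"
    and "length us = 7 \<Longrightarrow> g2_vol A \<phi> p (map (tv p) us) = vol0 us"
proof -
  define e where "e = some_g2_coframe A \<phi> p"
  have e: "g2_coframe A \<phi> p e" unfolding e_def some_g2_coframe_def by (rule someI_ex[OF coframe_ex])
  then have co: "coframe A p e" by (simp add: g2_coframe_def)
  have el: "e i (lincomb a (tv p u) b (tv p v)) = a * e i (tv p u) + b * e i (tv p v)" for i a b u v
    using co unfolding coframe_def tangent_space_eq by blast
  define M where "M u = (\<chi> i. e i (tv p u))" for u
  have eM: "e i (tv p u) = M u $ i" for i u by (simp add: M_def)
  have lin: "linear M"
  proof (rule linearI)
    show "M (u + v) = M u + M v" for u v using el[of _ 1 u 1 v] by (simp add: M_def tv_lincomb vec_eq_iff)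
    show "M (r *\<^sub>R u) = r *\<^sub>R M u" for r u using el[of _ r u 0 u] by (simp add: M_def tv_lincomb vec_eq_iff)
  qed
  have inv: "phi0 (map M us) = phi0 us" if l: "length us = 3" for us
  proof -
    have "map (tv p) us \<in> tuples 3 (tangent_space A p)" using l by (auto simp: tuples_def tangent_space_eq)
    then have "\<phi> p (map (tv p) us) = ewedge e [1,2,3] (map (tv p) us) + ewedge e [1,4,5] (map (tv p) us) + ewedge e [1,6,7] (map (tv p) us)
               + ewedge e [2,4,6] (map (tv p) us) - ewedge e [2,5,7] (map (tv p) us)
               - ewedge e [3,4,7] (map (tv p) us) - ewedge e [3,5,6] (map (tv p) us)"
      using e unfolding g2_coframe_def by blast
    moreover have "ewedge e [a, b, c] (map (tv p) us) = ew [a, b, c] (map M us)" for a b c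
      by (rule ewedge_ew[where e = e and t = "tv p" and M = M, OF _ eM]) (simp add: l)
    ultimately show ?thesis using phi_tv[OF l, of p] by (simp add: phi0_def)
  qed
  show "g2_metric A \<phi> p (tv p u) (tv p v) = u \<bullet> v"
    using g2_invariant(1)[OF lin inv, of u v] unfolding g2_metric_def e_def[symmetric] eM by (simp add: inner_vec_def)
  show "length us = 7 \<Longrightarrow> g2_vol A \<phi> p (map (tv p) us) = vol0 us"
    using g2_invariant(2)[OF lin inv, of us] unfolding g2_vol_def e_def[symmetric]
    by (subst ewedge_ew[where e = e and t = "tv p" and M = M, OF _ eM]) simp_all
qed

sublocale lie_metric G A U c B "g2_metric A \<phi>"
  by unfold_locales (rule metric_vol(1))

lemma star_tv:
  assumes W: "altf k W" and \<omega>: "\<And>us. length us = k \<Longrightarrow> \<omega> p (map (tv p) us) = W us" and l: "k + length us = 7"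
  shows "g2_star A \<phi> k \<omega> p (map (tv p) us) = star k W us"
proof -
  obtain F where F: "\<And>i. some_frame A (g2_metric A \<phi>) p i = tv p (F i)" "\<And>i j. F i \<bullet> F j = (if i = j then 1 else 0)"
    using some_frame_tv[of p] by blast
  have ml: "ml k (\<lambda>xs. vol0 (xs @ us))" unfolding ml_def
  proof (intro allI impI)
    fix xs :: "(real ^ 7) list" and i assume xs: "length xs = k" "i < k"
    have "linear (\<lambda>x. vol0 ((xs @ us)[i := x]))" by (rule mlD[OF altf_ml[OF altf_vol0]]) (use xs l in auto)
    then show "linear (\<lambda>x. vol0 (xs[i := x] @ us))" using xs by (simp add: list_update_append1)
  qed
  have "\<omega> p (map (some_frame A (g2_metric A \<phi>) p) is) * g2_vol A \<phi> p (map (some_frame A (g2_metric A \<phi>) p) is @ map (tv p) us)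
     = W (map F is) * vol0 (map F is @ us)" if "is \<in> tuples k UNIV" for "is"
  proof -
    have li: "length is = k" using that by (simp add: tuples_def)
    have m: "map (some_frame A (g2_metric A \<phi>) p) is = map (tv p) (map F is)" by (simp add: F(1))
    show ?thesis unfolding m map_append[symmetric] using \<omega>[of "map F is"] metric_vol(2)[of "map F is @ us" p] li l by (simp only: length_map length_append)
  qed
  then have "g2_star A \<phi> k \<omega> p (map (tv p) us) = (\<Sum>is\<in>tuples k UNIV. W (map F is) * vol0 (map F is @ us)) / fact k"
    unfolding g2_star_def hodge_def by simp
  also have "(\<Sum>is\<in>tuples k UNIV. W (map F is) * vol0 (map F is @ us)) = (\<Sum>is\<in>tuples k UNIV. W (map ax is) * vol0 (map ax is @ us))"
    by (rule frame_independent[OF altf_ml[OF W] ml]) (rule frame_trace[OF _ F(2)])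
  finally show ?thesis by (simp add: star_def)
qed

definition cc :: "7 \<Rightarrow> 7 \<Rightarrow> 7 \<Rightarrow> real" where "cc i j k = br (ax i) (ax j) $ k"

lemma cc_skew: "cc j i k = - cc i j k" unfolding cc_def by (simp only: br_skew[of "ax j" "ax i"] vector_uminus_component)

lemma br_axis:
  assumes "linear L" shows "L (br (ax i) (ax j)) = (\<Sum>m\<in>UNIV. cc i j m * L (ax m) :: real)"
  unfolding cc_def by (rule linear_axis_sum[OF assms])

lemma ext_deriv_DD:
  assumes W: "altf 3 W" and \<omega>: "\<And>q us. length us = 3 \<Longrightarrow> \<omega> q (map (tv q) us) = W us" and us: "length us = 4"
  shows "ext_deriv A \<omega> p (map (tv p) us) = DD br W us"
  using us by (rule length_4E) (simp add: ext_deriv_3[OF W \<omega>] DD_def)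

lemma DD_axis:
  assumes W: "altf 3 W"
  shows "DD br W [ax i, ax j, ax k, ax l] = (\<Sum>m\<in>UNIV. - (cc i j m * W [ax m, ax k, ax l]) + cc i k m * W [ax m, ax j, ax l] - cc j k m * W [ax m, ax i, ax l]
    - cc i l m * W [ax m, ax j, ax k] + cc j l m * W [ax m, ax i, ax k] - cc k l m * W [ax m, ax i, ax j])"
proof -
  have "linear (\<lambda>z. W [z, x, y])" for x y using mlD[OF altf_ml[OF W], of "[0, x, y]" 0] by simp
  note b = br_axis[OF this]
  show ?thesis unfolding DD_def Let_def by (simp add: b sum.distrib sum_subtractf sum_negf)
qed

lemma DD_phi0: "DD br phi0 [ax i, ax j, ax k, ax l] = d3 cc i j k l"
  unfolding DD_axis[OF altf_phi0] d3_def phi0_axis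
  by (simp only: ph_cyc[of k l] ph_cyc[of j l] ph_cyc[of i l] ph_cyc[of j k] ph_cyc[of i k] ph_cyc[of i j])

lemma altf_Dphi: "altf 4 (DD br phi0)"
  by (rule altf_DD[OF bilinear_br br_skew altf_phi0])

lemma dphi: "length us = 4 \<Longrightarrow> ext_deriv A \<phi> p (map (tv p) us) = DD br phi0 us"
  by (rule ext_deriv_DD[OF altf_phi0 phi_tv])

lemma psi_tv: "length us = 4 \<Longrightarrow> g2_star A \<phi> 3 \<phi> p (map (tv p) us) = psi0 us"
  by (rule star_tv[OF altf_phi0 phi_tv]) simp_all

lemma dpsi: "ext_deriv A (g2_star A \<phi> 3 \<phi>) p (map (tv p) [ax i, ax j, ax k, ax l, ax n]) = d4 cc i j k l n"
proof -
  have "linear (\<lambda>z. psi0 [z, x, y, w])" for x y w using mlD[OF altf_ml[OF altf_psi0], of "[0, x, y, w]" 0] by simp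
  note b = br_axis[OF this]
  have e: "ext_deriv A (g2_star A \<phi> 3 \<phi>) p [tv p u0, tv p u1, tv p u2, tv p u3, tv p u4] =
    - psi0 [br u0 u1, u2, u3, u4] + psi0 [br u0 u2, u1, u3, u4] - psi0 [br u1 u2, u0, u3, u4] - psi0 [br u0 u3, u1, u2, u4] + psi0 [br u1 u3, u0, u2, u4] - psi0 [br u2 u3, u0, u1, u4]
    + psi0 [br u0 u4, u1, u2, u3] - psi0 [br u1 u4, u0, u2, u3] + psi0 [br u2 u4, u0, u1, u3] - psi0 [br u3 u4, u0, u1, u2]" for u0 u1 u2 u3 u4
    by (rule ext_deriv_4[OF altf_psi0 psi_tv])
  show ?thesis
    unfolding list.map e b psi0_axis d4_def ps_rot[of _ k l n] ps_rot[of _ j l n] ps_rot[of _ i l n]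
      ps_rot[of _ j k n] ps_rot[of _ i k n] ps_rot[of _ i j n] ps_rot[of _ j k l] ps_rot[of _ i k l] ps_rot[of _ i j l] ps_rot[of _ i j k]
    by (simp add: sum.distrib sum_subtractf sum_negf)
qed

end

section \<open>Left-invariant strong structures on unimodular groups\<close>

locale lie_strong = lie_g2 G A U c B \<phi>
  for G :: "'g::{t2_space,second_countable_topology} monoid" (structure)
    and A :: "('g, 7) atlas" and U c B \<phi> +
  fixes \<theta> :: "'g form"
  assumes lee: "lee_form A \<phi> \<theta>" and closed: "form_eq A 4 (ext_deriv A (torsion_form A \<phi> \<theta>)) (\<lambda>p vs. 0)"
    and unim: "unimodular_group G A"
begin

lemma tuples_tv: "length us = k \<Longrightarrow> map (tv p) us \<in> tuples k (tangent_space A p)"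
  by (auto simp: tuples_def tangent_space_eq)

definition th :: "'g \<Rightarrow> 7 \<Rightarrow> real" where "th p i = \<theta> p [tv p (ax i)]"

lemma theta_linear: "linear (\<lambda>u. \<theta> p [tv p u])"
proof -
  have "alternating_on (tangent_space A p) 1 (\<theta> p)" using lee by (simp add: lee_form_def diff_form_def)
  then have a: "\<theta> p ([tv p u][0 := lincomb a (tv p u) b (tv p v)]) = a * \<theta> p ([tv p u][0 := tv p u]) + b * \<theta> p ([tv p u][0 := tv p v])" for a b u v
    using tuples_tv[of "[u]" 1 p] unfolding alternating_on_def tangent_space_eq by auto
  show ?thesis
  proof (rule linearI)
    show "\<theta> p [tv p (u + v)] = \<theta> p [tv p u] + \<theta> p [tv p v]" for u v using a[of u 1 1 v] by (simp add: tv_lincomb)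
    show "\<theta> p [tv p (r *\<^sub>R u)] = r *\<^sub>R \<theta> p [tv p u]" for r u using a[of u r 0 u] by (simp add: tv_lincomb)
  qed
qed

lemma lee_wdg:
  assumes us: "length us = 5"
  shows "ext_deriv A (g2_star A \<phi> 3 \<phi>) p (map (tv p) us) = wdg 1 4 (\<lambda>us. \<theta> p (map (tv p) us)) psi0 us"
proof -
  have "ext_deriv A (g2_star A \<phi> 3 \<phi>) p (map (tv p) us) = wedge 1 4 \<theta> (g2_star A \<phi> 3 \<phi>) p (map (tv p) us)"
    using lee tuples_tv[OF us, of p] unfolding lee_form_def form_eq_def by blast
  also have "\<dots> = wdg 1 4 (\<lambda>us. \<theta> p (map (tv p) us)) psi0 us"
    by (rule wedge_wdg[where \<alpha> = \<theta> and \<beta> = "g2_star A \<phi> 3 \<phi>" and t = "tv p"]) (simp_all add: us psi_tv)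
  finally show ?thesis .
qed

lemma lee_axis:
  "d4 cc i j k l n = th p i * ps j k l n - th p j * ps i k l n + th p k * ps i j l n - th p l * ps i j k n + th p n * ps i j k l"
proof -
  have "d4 cc i j k l n = wdg 1 4 (\<lambda>us. \<theta> p (map (tv p) us)) psi0 [ax i, ax j, ax k, ax l, ax n]"
    unfolding dpsi[of p, symmetric] by (rule lee_wdg) simp
  then show ?thesis unfolding wdg_1_4[OF altf_psi0] psi0_axis by (simp add: th_def)
qed

text \<open>In \<open>lee_axis\<close> the component of \<theta> at an index is multiplied by
  \<open>ps\<close> at the other four. Two missing indices lie on exactly one Fano line, so a single
  component survives; the seven tuples are chosen to reach all of them.\<close>

lemma th_const: "th p i = th q i"
  using exhaust_7[of i]
    lee_axis[of 1 2 3 4 5 p] lee_axis[of 1 2 3 4 5 q] lee_axis[of 1 2 3 4 6 p] lee_axis[of 1 2 3 4 6 q]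
    lee_axis[of 1 2 3 4 0 p] lee_axis[of 1 2 3 4 0 q] lee_axis[of 1 2 4 5 6 p] lee_axis[of 1 2 4 5 6 q]
    lee_axis[of 1 2 4 5 0 p] lee_axis[of 1 2 4 5 0 q] lee_axis[of 1 2 4 6 0 p] lee_axis[of 1 2 4 6 0 q]
    lee_axis[of 1 2 5 6 0 p] lee_axis[of 1 2 5 6 0 q]
  by (elim disjE) (simp_all add: ps_rows)

definition Th :: "(real ^ 7) list \<Rightarrow> real" where "Th us = (\<Sum>i\<in>UNIV. hd us $ i * th \<one> i)"

lemma theta_tv: "length us = 1 \<Longrightarrow> \<theta> p (map (tv p) us) = Th us"
proof -
  assume "length us = 1"
  then obtain u where us: "us = [u]" by (auto simp: length_Suc_conv)
  show ?thesis using linear_axis_sum[OF theta_linear, of p u] th_const[of p _ \<one>] by (simp add: us Th_def th_def)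
qed

lemma ml_Th: "ml 1 Th"
  unfolding ml_def
proof (intro allI impI)
  fix us :: "(real ^ 7) list" and i :: nat assume "length us = 1" "i < 1"
  then obtain u where us: "us = [u]" and i: "i = 0" by (auto simp: length_Suc_conv)
  show "linear (\<lambda>x. Th (us[i := x]))"
    by (simp add: us i Th_def linear_iff algebra_simps sum.distrib sum_distrib_left)
qed

definition s where "s = star 7 (wdg 4 3 (DD br phi0) phi0) []"

definition TW :: "(real ^ 7) list \<Rightarrow> real" where
  "TW us = 1 / 6 * s * phi0 us - star 4 (DD br phi0) us + star 4 (wdg 1 3 Th phi0) us"

lemma altf_sh: "altf 4 (wdg 1 3 Th phi0)"
  using altf_wdg[OF ml_Th altf_ml[OF altf_phi0]] by simp

lemma torsion_tv:
  assumes us: "length us = 3" shows "torsion_form A \<phi> \<theta> p (map (tv p) us) = TW us"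
proof -
  have "altf 7 (wdg 4 3 (DD br phi0) phi0)"
    using altf_wdg[OF altf_ml[OF altf_Dphi] altf_ml[OF altf_phi0]] by simp
  moreover have "wedge 4 3 (ext_deriv A \<phi>) \<phi> p (map (tv p) us) = wdg 4 3 (DD br phi0) phi0 us" if "length us = 7" for us
    by (rule wedge_wdg[where \<alpha> = "ext_deriv A \<phi>" and \<beta> = \<phi> and t = "tv p"]) (simp_all add: dphi phi_tv that)
  ultimately have "g2_star A \<phi> 7 (wedge 4 3 (ext_deriv A \<phi>) \<phi>) p (map (tv p) []) = star 7 (wdg 4 3 (DD br phi0) phi0) []"
    by (rule star_tv) simp_all
  then have "g2_star A \<phi> 7 (wedge 4 3 (ext_deriv A \<phi>) \<phi>) p [] = s" by (simp add: s_def)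
  moreover have "g2_star A \<phi> 4 (ext_deriv A \<phi>) p (map (tv p) us) = star 4 (DD br phi0) us"
    by (rule star_tv[OF altf_Dphi dphi]) (simp_all add: us)
  moreover have "g2_star A \<phi> 4 (wedge 1 3 \<theta> \<phi>) p (map (tv p) us) = star 4 (wdg 1 3 Th phi0) us"
  proof (rule star_tv[OF altf_sh])
    show "wedge 1 3 \<theta> \<phi> p (map (tv p) us) = wdg 1 3 Th phi0 us" if "length us = 4" for us
      by (rule wedge_wdg[where \<alpha> = \<theta> and \<beta> = \<phi> and t = "tv p"]) (simp_all add: theta_tv phi_tv that)
  qed (simp add: us)
  ultimately show ?thesis unfolding torsion_form_def TW_def phi_tv[OF us] by simp
qed

lemma altf_TW: "altf 3 TW"
proof -
  have W: "altf 3 (star 4 (DD br phi0))" "altf 3 (star 4 (wdg 1 3 Th phi0))" by (rule altf_star, simp)+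
  have add: "altf k (\<lambda>us. f us + g us)" and diff: "altf k (\<lambda>us. f us - g us)" if "altf k f" "altf k g" for k and f g :: "(real ^ 7) list \<Rightarrow> real"
    using that unfolding altf_def ml_def by (auto intro: linear_compose_add linear_compose_sub)
  have scale: "altf k (\<lambda>us. r * f us)" if "altf k f" for k r and f :: "(real ^ 7) list \<Rightarrow> real"
    using that unfolding altf_def ml_def by (auto simp: linear_iff algebra_simps)
  show ?thesis unfolding TW_def[abs_def] by (intro add diff scale altf_phi0 W)
qed

definition t :: "7 \<Rightarrow> 7 \<Rightarrow> 7 \<Rightarrow> real" where "t i j k = TW [ax i, ax j, ax k]"

lemma t_skew: "t j i k = - t i j k" "t i k j = - t i j k"
  unfolding t_def using altf_swap[OF altf_TW, of "[]" "[ax k]" "ax j" "ax i"] altf_swap[OF altf_TW, of "[ax i]" "[]" "ax k" "ax j"] by simp_all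

lemma dT: "(\<Sum>(i,j,k,l,m)\<in>UNIV. cc i j m * t m k l * ps i j k l) = 0"
proof (rule closed_contract)
  fix i j k l
  have "ext_deriv A (torsion_form A \<phi> \<theta>) \<one> (map (tv \<one>) [ax i, ax j, ax k, ax l]) = 0"
    using closed tuples_tv[of "[ax i, ax j, ax k, ax l]" 4 \<one>] unfolding form_eq_def by (simp del: list.map)
  moreover have "ext_deriv A (torsion_form A \<phi> \<theta>) \<one> (map (tv \<one>) [ax i, ax j, ax k, ax l]) = DD br TW [ax i, ax j, ax k, ax l]"
    by (rule ext_deriv_DD[OF altf_TW torsion_tv]) simp_all
  ultimately show "(\<Sum>m\<in>UNIV. - (cc i j m * t m k l) + cc i k m * t m j l - cc j k m * t m i l
    - cc i l m * t m j k + cc j l m * t m i k - cc k l m * t m i j) = 0"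
    unfolding DD_axis[OF altf_TW] t_def by simp
qed

lemma jac: "(\<Sum>m\<in>UNIV. cc i j m * cc m l n + cc j l m * cc m i n + cc l i m * cc m j n) = 0"
proof -
  have b: "br (br (ax i) (ax j)) (ax l) $ n = (\<Sum>m\<in>UNIV. cc i j m * cc m l n)" for i j l
  proof -
    have "linear (\<lambda>u. br u (ax l) $ n)" by (auto simp: linear_iff bilinear_ladd[OF bilinear_br] bilinear_lmul[OF bilinear_br])
    from br_axis[OF this] show ?thesis by (simp add: cc_def)
  qed
  have "br (ax l) (br (ax i) (ax j)) + br (ax i) (br (ax j) (ax l)) + br (ax j) (br (ax l) (ax i)) = 0" by (rule Jacobi)
  then have "br (br (ax i) (ax j)) (ax l) + br (br (ax j) (ax l)) (ax i) + br (br (ax l) (ax i)) (ax j) = 0"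
    unfolding br_skew[of "ax l" "br (ax i) (ax j)"] br_skew[of "ax i" "br (ax j) (ax l)"] br_skew[of "ax j" "br (ax l) (ax i)"]
    by (simp add: algebra_simps neg_eq_iff_add_eq_0 minus_add_distrib[symmetric] del: minus_add_distrib)
  then have "(br (br (ax i) (ax j)) (ax l) + br (br (ax j) (ax l)) (ax i) + br (br (ax l) (ax i)) (ax j)) $ n = 0" by simp
  then show ?thesis by (simp add: b sum.distrib)
qed

definition Gc :: "7 \<Rightarrow> 7 \<Rightarrow> 7 \<Rightarrow> real" where "Gc i j k = (cc i j k - cc j k i + cc k i j) / 2"

lemma nab_axis: "nab (ax i) (ax j) $ k = Gc i j k"
  by (simp add: nab_def Gc_def cc_def inner_axis)

definition AA :: "7 \<Rightarrow> 7 \<Rightarrow> 7 \<Rightarrow> real" where "AA i j k = (cc i j k - cc j k i + cc k i j) / 2 + t i j k / 2"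

lemma trace0: "(\<Sum>i\<in>UNIV. cc j i i) = 0"
  unfolding cc_def by (rule unimodular_trace[OF unim])

lemma AA_g2: "is_g2 (AA i)"
proof (rule characteristic_g2[where c = cc and T = t and s = s and \<theta> = "th \<one>"
      and st = "\<lambda>i j k. star 4 (DD br phi0) [ax i, ax j, ax k]" and sh = "\<lambda>i j k. star 4 (wdg 1 3 Th phi0) [ax i, ax j, ax k]"])
  let ?st = "\<lambda>i j k. star 4 (DD br phi0) [ax i, ax j, ax k]"
  show "cc j i k = - cc i j k" for i j k by (rule cc_skew)
  show "t i j k = s / 6 * ph i j k - ?st i j k + star 4 (wdg 1 3 Th phi0) [ax i, ax j, ax k]" for i j k
    by (simp add: t_def TW_def phi0_axis)
  show "s = ?st 0 1 6 - ?st 0 2 5 - ?st 0 3 4 + ?st 1 2 3 + ?st 1 4 5 + ?st 2 4 6 - ?st 3 5 6"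
  proof -
    have W: "altf 3 (star 4 (DD br phi0))" by (rule altf_star) simp
    define f where "f = ?st"
    have f: "f b a c = - f a b c" "f a c b = - f a b c" for a b c
      unfolding f_def using altf_swap[OF W, of "[]" "[ax c]" "ax b" "ax a"] altf_swap[OF W, of "[ax a]" "[]" "ax c" "ax b"] by simp_all
    have p: "f b a c = - f a b c" "f a c b = - f a b c" "f b c a = f a b c" "f c a b = f a b c" "f c b a = - f a b c" for a b c
      using f(1)[of b a c] f(2)[of a c b] f(2)[of b c a] f(1)[of c a b] f(1)[of c b a] by linarith+
    have "s = (\<Sum>i\<in>UNIV. \<Sum>j\<in>UNIV. \<Sum>k\<in>UNIV. ph i j k * f i j k) / 6"
      unfolding s_def f_def by (rule star_wdg_4_3[OF altf_Dphi])
    also have "\<dots> = f 0 1 6 - f 0 2 5 - f 0 3 4 + f 1 2 3 + f 1 4 5 + f 2 4 6 - f 3 5 6"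
      by (simp add: sum_7 ph_rows, insert p[of 0 1 6] p[of 0 2 5] p[of 0 3 4] p[of 1 2 3] p[of 1 4 5] p[of 2 4 6] p[of 3 5 6], linarith)
    finally show ?thesis by (simp add: f_def)
  qed
  show "?st i j k = isgn [a,b,x,d,i,j,k] * d3 cc a b x d" if "distinct [a,b,x,d,i,j,k]" for a b x d i j k
    using star_axis[OF altf_Dphi, of 3 "[i, j, k]" "[a, b, x, d]"] that by (simp add: DD_phi0 del: inversions.simps)
  show "star 4 (wdg 1 3 Th phi0) [ax i, ax j, ax k] = isgn [a,b,x,d,i,j,k] *
       (th \<one> a * ph b x d - th \<one> b * ph a x d + th \<one> x * ph a b d - th \<one> d * ph a b x)" if "distinct [a,b,x,d,i,j,k]" for a b x d i j k
  proof -
    have "Th [ax i] = th \<one> i" for i using theta_tv[of "[ax i]" \<one>] by (simp add: th_def)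
    then show ?thesis
      using star_axis[OF altf_sh, of 3 "[i, j, k]" "[a, b, x, d]"] that unfolding list.map wdg_1_3[OF altf_phi0] phi0_axis
      by (simp del: inversions.simps)
  qed
  show "t j i k = - t i j k" "t i k j = - t i j k" for i j k by (rule t_skew)+
  show "d4 cc i j k l p = th \<one> i * ps j k l p - th \<one> j * ps i k l p + th \<one> k * ps i j l p - th \<one> l * ps i j k p + th \<one> p * ps i j k l" for i j k l p
    by (rule lee_axis)
qed (rule AA_def)

lemma t_diag: "t i i j = 0" using t_skew(1)[of i i j] by simp

text \<open>With a repeated index the Koszul terms collapse to c_jii, whose sum is the trace of ad
  e_j, and the skew torsion contributes nothing.\<close>

lemma AA_trace: "(\<Sum>i\<in>UNIV. AA i i j) = 0"
proof -
  have "AA i i j = cc j i i" for i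
    using cc_skew[of i i j] cc_skew[of i j i] by (simp add: AA_def t_diag)
  then show ?thesis using trace0[of j] by simp
qed

sublocale g2_skew AA
  by unfold_locales (rule AA_g2, rule AA_trace)

lemma cc_AA: "cc i j k = AA i j k - AA j i k - t i j k"
  using cc_skew[of j i k] cc_skew[of i k j] cc_skew[of k j i] t_skew(1)[of j i k] by (simp add: AA_def field_simps)

lemma Gc_AA: "Gc i j k = AA i j k - t i j k / 2" by (simp add: Gc_def AA_def)

lemma Gc_skew: "Gc i k j = - Gc i j k"
  using cc_skew[of i k j] cc_skew[of j k i] cc_skew[of j i k] by (simp add: Gc_def field_simps)

lemma Gc_trace: "(\<Sum>i\<in>UNIV. Gc i j i) = 0"
proof -
  have "Gc i j i = - AA i i j" for i using Gc_skew[of i i j] Gc_AA[of i i j] by (simp add: t_diag)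
  then show ?thesis using AA_trace[of j] by (simp add: sum_negf)
qed

text \<open>The contracted curvature has three terms. The one containing the trace of
  \<open>Gc\<close> vanishes by unimodularity, the other two are the sums on the right.\<close>

lemma scal_Gc:
  "scalar_curvature A (g2_metric A \<phi>) p = (\<Sum>(i,j,k)\<in>UNIV. Gc i j k * Gc j i k) - (\<Sum>(i,j,k)\<in>UNIV. cc i j k * Gc k j i)"
proof -
  have n1: "nab (ax i) v $ k = (\<Sum>m\<in>UNIV. v $ m * Gc i m k)" for i v k
  proof -
    have "linear (\<lambda>v. nab (ax i) v $ k)" by (auto simp: linear_iff bilinear_radd[OF bilinear_nab] bilinear_rmul[OF bilinear_nab])
    from linear_axis_sum[OF this, of v] show ?thesis by (simp add: nab_axis)
  qed
  have n2: "nab v (ax j) $ k = (\<Sum>m\<in>UNIV. v $ m * Gc m j k)" for j v k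
  proof -
    have "linear (\<lambda>v. nab v (ax j) $ k)" by (auto simp: linear_iff bilinear_ladd[OF bilinear_nab] bilinear_lmul[OF bilinear_nab])
    from linear_axis_sum[OF this, of v] show ?thesis by (simp add: nab_axis)
  qed
  have "R0 (ax i) (ax j) (ax j) \<bullet> ax i = (\<Sum>m\<in>UNIV. Gc j j m * Gc i m i) + (\<Sum>m\<in>UNIV. Gc i j m * Gc j i m) - (\<Sum>m\<in>UNIV. cc i j m * Gc m j i)" for i j
  proof -
    have "(\<Sum>m\<in>UNIV. Gc i j m * Gc j i m) = - (\<Sum>m\<in>UNIV. Gc i j m * Gc j m i)"
      unfolding sum_negf[symmetric] by (rule sum.cong[OF refl]) (simp only: Gc_skew[of j i] mult_minus_right minus_minus)
    then show ?thesis by (simp add: R0_def inner_axis n1[of i "nab (ax j) (ax j)"] n1[of j "nab (ax i) (ax j)"] n2[of "br (ax i) (ax j)"] nab_axis cc_def)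
  qed
  then have "scalar_curvature A (g2_metric A \<phi>) p = (\<Sum>i\<in>UNIV. \<Sum>j\<in>UNIV. \<Sum>m\<in>UNIV. Gc j j m * Gc i m i)
     + (\<Sum>i\<in>UNIV. \<Sum>j\<in>UNIV. \<Sum>m\<in>UNIV. Gc i j m * Gc j i m) - (\<Sum>i\<in>UNIV. \<Sum>j\<in>UNIV. \<Sum>m\<in>UNIV. cc i j m * Gc m j i)"
    by (simp add: scalar_curvature_eq sum.distrib sum_subtractf)
  also have "(\<Sum>i\<in>UNIV. \<Sum>j\<in>UNIV. \<Sum>m\<in>UNIV. Gc j j m * Gc i m i) = (\<Sum>j\<in>UNIV. \<Sum>m\<in>UNIV. Gc j j m * (\<Sum>i\<in>UNIV. Gc i m i))"
  proof -
    have "(\<Sum>i\<in>UNIV. \<Sum>j\<in>UNIV. \<Sum>m\<in>UNIV. Gc j j m * Gc i m i) = (\<Sum>j\<in>UNIV. \<Sum>i\<in>UNIV. \<Sum>m\<in>UNIV. Gc j j m * Gc i m i)" by (rule sum.swap)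
    also have "\<dots> = (\<Sum>j\<in>UNIV. \<Sum>m\<in>UNIV. \<Sum>i\<in>UNIV. Gc j j m * Gc i m i)" by (rule sum.cong[OF refl], rule sum.swap)
    finally show ?thesis by (simp add: sum_distrib_left)
  qed
  also have "\<dots> = 0" by (simp add: Gc_trace)
  finally show ?thesis by (simp add: nested3)
qed

text \<open>The two sums containing A in \<open>scal_formula\<close> cancel by
  \<open>jac_contract\<close>, and only the torsion term is left.\<close>

lemma scal_torsion: "scalar_curvature A (g2_metric A \<phi>) p = (\<Sum>(i,j,k)\<in>UNIV. (t i j k)\<^sup>2) / 4"
  using scal_formula[of AA t cc Gc, OF A_skew t_skew cc_AA Gc_AA] jac_contract[of t cc, OF t_skew cc_AA dT jacobi_contract[OF jac]]
  unfolding scal_Gc UU_def by linarith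

lemma scal_nonneg: "0 \<le> scalar_curvature A (g2_metric A \<phi>) p"
  unfolding scal_torsion by (intro divide_nonneg_pos sum_nonneg) auto

lemma torsion_free:
  assumes "scalar_curvature A (g2_metric A \<phi>) p \<le> 0" shows "t i j k = 0"
proof -
  have "(\<Sum>(i,j,k)\<in>UNIV. (t i j k)\<^sup>2) = 0" using assms scal_nonneg[of p] unfolding scal_torsion by simp
  then have "\<forall>x\<in>UNIV. (case x of (i,j,k) \<Rightarrow> (t i j k)\<^sup>2) = 0" by (subst (asm) sum_nonneg_eq_0_iff) auto
  then have "(case (i,j,k) of (i,j,k) \<Rightarrow> (t i j k)\<^sup>2) = 0" by blast
  then show ?thesis by simp
qed

lemma solvable_torsion_free:
  assumes "solvable G" shows "t i j k = 0"
proof (rule torsion_free)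
  have b: "(\<Sum>x\<in>Basis. f x) = (\<Sum>i\<in>UNIV. f (ax i))" for f :: "real ^ 7 \<Rightarrow> real"
  proof -
    have "(Basis :: (real ^ 7) set) = ax ` UNIV" by (auto simp: Basis_vec_def)
    then have "(\<Sum>x\<in>Basis. f x) = (\<Sum>x\<in>ax ` UNIV. f x)" by (rule arg_cong)
    also have "\<dots> = (\<Sum>i\<in>UNIV. f (ax i))" by (rule sum.reindex_cong[OF _ refl refl]) (auto simp: inj_def axis_eq_axis)
    finally show ?thesis .
  qed
  have "0 \<le> (\<Sum>(i,j,k)\<in>UNIV. (cc i j k)\<^sup>2) / 4 + (\<Sum>(i,j,k)\<in>UNIV. cc i j k * cc i k j) / 2"
    using solvable_br[OF assms] unfolding b nested3 by (simp add: cc_def inner_axis)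
  then show "scalar_curvature A (g2_metric A \<phi>) \<one> \<le> 0"
    unfolding scal_Gc scal_structure[of cc Gc, OF cc_skew Gc_def] by simp
qed

context
  assumes t0: "\<And>i j k. t i j k = 0"
begin

lemma parallel: "g2_parallel AA cc"
  by unfold_locales (simp add: cc_AA t0, rule jac)

lemma torsion_free_flat: "flat A (g2_metric A \<phi>)"
proof -
  interpret P: g2_parallel AA cc by (rule parallel)
  have n: "nab (ax i) w = P.G i *v w" for i w
  proof -
    have "linear (\<lambda>v. nab (ax i) v $ k)" for k by (auto simp: linear_iff bilinear_radd[OF bilinear_nab] bilinear_rmul[OF bilinear_nab])
    from linear_axis_sum[OF this, of w] show ?thesis
      by (simp add: vec_eq_iff matrix_vector_mult_def P.G_def nab_axis Gc_AA t0 mult.commute)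
  qed
  have lw: "linear (\<lambda>M :: real ^ 7 ^ 7. M *v w)" for w
    by (auto simp: linear_iff matrix_vector_mult_add_rdistrib scaleR_matrix_vector_assoc)
  have e: "R0 (ax i) (ax j) w = 0" for i j w
  proof -
    have "nab (br (ax i) (ax j)) w = (\<Sum>m\<in>UNIV. cc i j m *\<^sub>R nab (ax m) w)"
      using linear_vec_sum[of "\<lambda>u. nab u w" "br (ax i) (ax j)"] bilinear_nab by (simp add: bilinear_def cc_def)
    then have "R0 (ax i) (ax j) w = P.R i j *v w"
      unfolding R0_def P.R_def linear_diff[OF lw] linear_sum[OF lw] linear_scale[OF lw] n matrix_vector_mul_assoc by simp
    then show ?thesis using P.flat by simp
  qed
  have l1: "linear (\<lambda>u. R0 u v w)" and l2: "linear (\<lambda>v. R0 u v w)" for u v w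
    unfolding R0_def linear_iff
    by (simp_all add: bilinear_ladd[OF bilinear_nab] bilinear_radd[OF bilinear_nab] bilinear_lmul[OF bilinear_nab] bilinear_rmul[OF bilinear_nab]
       bilinear_ladd[OF bilinear_br] bilinear_radd[OF bilinear_br] bilinear_lmul[OF bilinear_br] bilinear_rmul[OF bilinear_br] algebra_simps)
  have "R0 u v w = 0" for u v w
  proof -
    have "R0 (ax i) v w = 0" for i
    proof -
      have "R0 (ax i) v w = (\<Sum>j\<in>UNIV. v $ j *\<^sub>R R0 (ax i) (ax j) w)" by (rule linear_vec_sum[OF l2])
      then show ?thesis by (simp add: e)
    qed
    moreover have "R0 u v w = (\<Sum>i\<in>UNIV. u $ i *\<^sub>R R0 (ax i) v w)" by (rule linear_vec_sum[OF l1])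
    ultimately show ?thesis by simp
  qed
  then show ?thesis by (simp add: flat_iff)
qed

text \<open>Closedness of \<phi> is \<open>d_ph\<close>, extended by multilinearity. For
  \<star>\<phi>, the vanishing of \<open>d4\<close> forces every component of \<theta> to be zero,
  and the Lee equation then gives closedness on arbitrary vectors.\<close>

lemma torsion_free_parallel: "parallel_g2 A \<phi>"
  unfolding parallel_g2_def form_eq_def
proof (intro conjI allI ballI)
  interpret P: g2_parallel AA cc by (rule parallel)
  fix p
  have tup: "\<exists>us. length us = k \<and> vs = map (tv p) us" if "vs \<in> tuples k (tangent_space A p)" for vs k
  proof -
    have "set vs \<subseteq> range (tv p)" using that by (simp add: tuples_def tangent_space_eq)
    then have "vs \<in> lists (range (tv p))" by auto
    then have "vs \<in> map (tv p) ` lists UNIV" unfolding lists_image[symmetric] by simp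
    then show ?thesis using that by (auto simp: tuples_def)
  qed
  fix vs assume "vs \<in> tuples 4 (tangent_space A p)"
  then obtain us where us: "length us = 4" "vs = map (tv p) us" using tup by blast
  have "DD br phi0 us = (\<lambda>us. 0) us"
  proof (rule ml_ext[OF altf_ml[OF altf_Dphi] _ us(1)])
    show "ml 4 (\<lambda>us. 0)" by (simp add: ml_def linear_zero)
    fix "is" :: "7 list" assume "length is = 4"
    then show "DD br phi0 (map ax is) = 0"
      by (rule length_4E) (use P.d_ph in \<open>simp add: DD_axis[OF altf_phi0] phi0_axis\<close>)
  qed
  then show "ext_deriv A \<phi> p vs = 0" unfolding us(2) dphi[OF us(1)] .
next
  interpret P: g2_parallel AA cc by (rule parallel)
  fix p
  have d: "d4 cc i j k l n = 0" for i j k l n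
    using P.d_ps[of i j k l n] unfolding d4_def ps_rot[of _ k l n] ps_rot[of _ j l n] ps_rot[of _ i l n]
      ps_rot[of _ j k n] ps_rot[of _ i k n] ps_rot[of _ i j n] ps_rot[of _ j k l] ps_rot[of _ i k l] ps_rot[of _ i j l] ps_rot[of _ i j k]
    by simp
  have th: "th q i = 0" for q i
    using exhaust_7[of i] lee_axis[of 1 2 3 4 5 q] lee_axis[of 1 2 3 4 6 q] lee_axis[of 1 2 3 4 0 q] lee_axis[of 1 2 4 5 6 q]
      lee_axis[of 1 2 4 5 0 q] lee_axis[of 1 2 4 6 0 q] lee_axis[of 1 2 5 6 0 q]
    unfolding d by (elim disjE) (simp_all add: ps_rows)
  have th0: "\<theta> p [tv p u] = 0" for u
    using linear_axis_sum[OF theta_linear, of p u] th[of p] by (simp add: th_def)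
  fix vs assume v: "vs \<in> tuples 5 (tangent_space A p)"
  have "ext_deriv A (g2_star A \<phi> 3 \<phi>) p (map (tv p) us) = 0" if "length us = 5" for us
    using that unfolding lee_wdg[OF that] by (rule length_5E) (simp add: wdg_1_4[OF altf_psi0, unfolded One_nat_def] th0)
  moreover have "\<exists>us. length us = 5 \<and> vs = map (tv p) us"
  proof -
    have "set vs \<subseteq> range (tv p)" using v by (simp add: tuples_def tangent_space_eq)
    then have "vs \<in> lists (range (tv p))" by auto
    then have "vs \<in> map (tv p) ` lists UNIV" unfolding lists_image[symmetric] by simp
    then show ?thesis using v by (auto simp: tuples_def)
  qed
  ultimately show "ext_deriv A (g2_star A \<phi> 3 \<phi>) p vs = 0" by blast
qed

end

text \<open>Flatness makes the scalar curvature zero, so the parallel conclusion follows from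
  flatness alone, whatever its cause.\<close>

lemma flat_torsion_free:
  assumes "flat A (g2_metric A \<phi>)" shows "t i j k = 0"
proof (rule torsion_free)
  show "scalar_curvature A (g2_metric A \<phi>) \<one> \<le> 0"
    using assms unfolding flat_iff scalar_curvature_eq by simp
qed

lemma conclusion:
  "(\<forall>p. 0 \<le> scalar_curvature A (g2_metric A \<phi>) p) \<and>
    (solvable G \<or> (\<forall>p. scalar_curvature A (g2_metric A \<phi>) p = 0) \<longrightarrow> flat A (g2_metric A \<phi>)) \<and>
    (flat A (g2_metric A \<phi>) \<longrightarrow> parallel_g2 A \<phi>)"
proof (intro conjI allI impI)
  show "0 \<le> scalar_curvature A (g2_metric A \<phi>) p" for p by (rule scal_nonneg)
  assume "solvable G \<or> (\<forall>p. scalar_curvature A (g2_metric A \<phi>) p = 0)"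
  then have "t i j k = 0" for i j k
    using solvable_torsion_free torsion_free[of \<one>] by auto
  then show "flat A (g2_metric A \<phi>)" by (rule torsion_free_flat)
next
  assume "flat A (g2_metric A \<phi>)"
  then show "parallel_g2 A \<phi>" by (intro torsion_free_parallel flat_torsion_free)
qed

end

text \<open>At the identity the coordinates are chosen such that the given coframe becomes the standard one.\<close>

lemma adapted_coordinates:
  fixes G :: "'g::{t2_space,second_countable_topology} monoid" and A :: "('g, 7) atlas"
  assumes G: "lie_group G A" and li: "left_invariant G A 3 \<phi>" and g2: "g2_structure A \<phi>"
  shows "\<exists>U c B. lie_g2 G A U c B \<phi>"
proof -
  interpret lie G A by unfold_locales (rule G)
  obtain U c where ch: "(U, c) \<in> A" "\<one>\<^bsub>G\<^esub> \<in> U" using chart_ex by blast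
  \<comment> \<open>Provisional coordinates with the identity matrix, in which the given coframe at
    the identity becomes a linear isomorphism E. The final B is the matrix of its inverse F.\<close>
  interpret L0: lie_param G A U c "mat 1" by unfold_locales (use ch in \<open>auto simp: invertible_def\<close>)
  obtain e where e: "g2_coframe A \<phi> \<one>\<^bsub>G\<^esub> e" using g2 unfolding g2_structure_def by blast
  then have co: "coframe A \<one>\<^bsub>G\<^esub> e" by (simp add: g2_coframe_def)
  have el: "e i (lincomb a (L0.tv \<one>\<^bsub>G\<^esub> u) b (L0.tv \<one>\<^bsub>G\<^esub> v)) = a * e i (L0.tv \<one>\<^bsub>G\<^esub> u) + b * e i (L0.tv \<one>\<^bsub>G\<^esub> v)" for i a b u v
    using co unfolding coframe_def L0.tangent_space_eq by blast
  define E where "E u = (\<chi> i. e i (L0.tv \<one>\<^bsub>G\<^esub> u))" for u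
  have lin: "linear E"
  proof (rule linearI)
    show "E (u + v) = E u + E v" for u v using el[of _ 1 u 1 v] by (simp add: E_def L0.tv_lincomb vec_eq_iff)
    show "E (r *\<^sub>R u) = r *\<^sub>R E u" for r u using el[of _ r u 0 u] by (simp add: E_def L0.tv_lincomb vec_eq_iff)
  qed
  have "bij E"
  proof -
    have "bij_betw (L0.tv \<one>\<^bsub>G\<^esub>) UNIV (tangent_space A \<one>\<^bsub>G\<^esub>)"
      by (simp add: bij_betw_def inj_on_def L0.tv_inj L0.tangent_space_eq)
    from bij_betw_trans[OF this] co have "bij_betw ((\<lambda>v. \<chi> i. e i v) \<circ> L0.tv \<one>\<^bsub>G\<^esub>) UNIV UNIV" unfolding coframe_def by blast
    then show ?thesis by (simp add: comp_def E_def[abs_def])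
  qed
  define F where "F = inv_into UNIV E"
  have FE: "E (F u) = u" "F (E u) = u" for u using \<open>bij E\<close> by (simp_all add: F_def bij_is_surj surj_f_inv_f bij_is_inj)
  have linF: "linear F"
  proof (rule linearI)
    show "F (u + v) = F u + F v" for u v using FE(2)[of "F u + F v"] by (simp add: linear_add[OF lin] FE(1))
    show "F (r *\<^sub>R u) = r *\<^sub>R F u" for r u using FE(2)[of "r *\<^sub>R F u"] by (simp add: linear_scale[OF lin] FE(1))
  qed
  define B where "B = matrix F"
  have B: "B *v u = F u" and E: "matrix E *v u = E u" for u
    unfolding B_def using fun_cong[OF matrix_vector_mul(2)[OF linF], of u] fun_cong[OF matrix_vector_mul(2)[OF lin], of u] by simp_all
  have "invertible B"
    unfolding invertible_def
  proof (intro exI[of _ "matrix E"] conjI)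
    show "B ** matrix E = mat 1" "matrix E ** B = mat 1"
      by (simp_all add: matrix_eq matrix_vector_mul_assoc[symmetric] B E FE)
  qed
  interpret L: lie_param G A U c B by unfold_locales (use ch \<open>invertible B\<close> in auto)
  have K: "L.K z = L0.K (B *v z)" for z by (simp add: L.K_def L0.K_def)
  \<comment> \<open>Replacing the identity matrix by B reparametrises the chart linearly, so by the
    chain rule the coefficient vectors change by F.\<close>
  have tv: "L.tv p u = L0.tv p (F u)" for p u
  proof (rule ext)
    fix f
    show "L.tv p u f = L0.tv p (F u) f"
    proof (cases "smooth_at A p f")
      case True
      then have s: "smooth_near (\<lambda>z. f (p \<otimes>\<^bsub>G\<^esub> L.K z)) 0" "smooth_near (\<lambda>z. f (p \<otimes>\<^bsub>G\<^esub> L0.K z)) 0"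
        using L.smooth_at_iff L0.smooth_at_iff by blast+
      have "((\<lambda>z. B *v z) has_derivative (\<lambda>z. B *v z)) (at 0)"
        by (rule bounded_linear_imp_has_derivative) (rule matrix_vector_mul_bounded_linear)
      from fd_eqI[OF has_derivative_compose[OF this, of "\<lambda>z. f (p \<otimes>\<^bsub>G\<^esub> L0.K z)"]]
      have "fd (\<lambda>z. f (p \<otimes>\<^bsub>G\<^esub> L0.K (B *v z))) 0 u = fd (\<lambda>z. f (p \<otimes>\<^bsub>G\<^esub> L0.K z)) 0 (B *v u)"
        using differentiable_fd[OF smooth_near_differentiable[OF s(2)]] by simp
      then show ?thesis using s by (simp add: L.tv_def L0.tv_def K B)
    next
      case False
      then show ?thesis using L.smooth_at_iff[of p f] L0.smooth_at_iff[of p f] by (simp add: L.tv_def L0.tv_def)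
    qed
  qed
  have e1: "e i (L.tv \<one>\<^bsub>G\<^esub> u) = id u $ i" for i u
    using FE(1)[of u] unfolding tv E_def by (simp add: vec_eq_iff)
  have phi1: "\<phi> \<one>\<^bsub>G\<^esub> (map (L.tv \<one>\<^bsub>G\<^esub>) us) = phi0 us" if l: "length us = 3" for us
  proof -
    let ?v = "map (L.tv \<one>\<^bsub>G\<^esub>) us"
    have "?v \<in> tuples 3 (tangent_space A \<one>\<^bsub>G\<^esub>)" using l by (auto simp: tuples_def L.tangent_space_eq)
    then have "\<phi> \<one>\<^bsub>G\<^esub> ?v = ewedge e [1,2,3] ?v + ewedge e [1,4,5] ?v + ewedge e [1,6,7] ?v
               + ewedge e [2,4,6] ?v - ewedge e [2,5,7] ?v - ewedge e [3,4,7] ?v - ewedge e [3,5,6] ?v"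
      using e unfolding g2_coframe_def by blast
    moreover have "ewedge e [a, b, d] ?v = ew [a, b, d] us" for a b d
      using ewedge_ew[of us "[a, b, d]" e "L.tv \<one>\<^bsub>G\<^esub>" id, OF _ e1] l by simp
    ultimately show ?thesis by (simp add: phi0_def)
  qed
  have "lie_g2 G A U c B \<phi>"
  proof unfold_locales
    show "\<exists>e. g2_coframe A \<phi> p e" for p using g2 unfolding g2_structure_def by blast
    fix us :: "(real ^ 7) list" and p assume l: "length us = 3"
    have "map (L.tv \<one>\<^bsub>G\<^esub>) us \<in> tuples 3 (tangent_space A \<one>\<^bsub>G\<^esub>)" using l by (auto simp: tuples_def L.tangent_space_eq)
    then have h: "\<phi> (p \<otimes>\<^bsub>G\<^esub> \<one>\<^bsub>G\<^esub>) (map (push (\<lambda>y. p \<otimes>\<^bsub>G\<^esub> y)) (map (L.tv \<one>\<^bsub>G\<^esub>) us)) = \<phi> \<one>\<^bsub>G\<^esub> (map (L.tv \<one>\<^bsub>G\<^esub>) us)"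
      using li unfolding left_invariant_def form_eq_def by blast
    have m: "map (push (\<lambda>y. p \<otimes>\<^bsub>G\<^esub> y)) (map (L.tv \<one>\<^bsub>G\<^esub>) us) = map (L.tv p) us" by (simp add: L.push_tv)
    show "\<phi> p (map (L.tv p) us) = phi0 us" using h unfolding m phi1[OF l] by simp
  qed
  then show ?thesis by blast
qed

theorem corollary3p2:
  fixes G :: "'g::{t2_space,second_countable_topology} monoid"
    and A :: "('g, 7) atlas"
    and \<phi> :: "'g form"
  assumes "lie_group G A" and "unimodular_group G A"
    and "left_invariant G A 3 \<phi>" and "strong_g2t_structure A \<phi>"
  shows "(\<forall>p. 0 \<le> scalar_curvature A (g2_metric A \<phi>) p) \<and>
    (solvable G \<or> (\<forall>p. scalar_curvature A (g2_metric A \<phi>) p = 0) \<longrightarrow>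
       flat A (g2_metric A \<phi>)) \<and>
    (flat A (g2_metric A \<phi>) \<longrightarrow> parallel_g2 A \<phi>)"
proof -
  have "g2_structure A \<phi>" using assms(4) by (simp add: strong_g2t_structure_def g2t_structure_def)
  then obtain U c B where L: "lie_g2 G A U c B \<phi>" using adapted_coordinates assms(1,3) by blast
  obtain \<theta> where \<theta>: "lee_form A \<phi> \<theta>" using assms(4) by (auto simp: strong_g2t_structure_def g2t_structure_def)
  then have "form_eq A 4 (ext_deriv A (torsion_form A \<phi> \<theta>)) (\<lambda>p vs. 0)"
    using assms(4) by (simp add: strong_g2t_structure_def)
  with L \<theta> assms(2) have "lie_strong G A U c B \<phi> \<theta>" by (simp add: lie_strong_def lie_strong_axioms_def)
  then show ?thesis by (rule lie_strong.conclusion)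
qed

end
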